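(* Let $1\le d<n$, let $A$ be a real $d\times n$ matrix of rank $d$, and let $\mathbf b\in\mathbb R^d$, $\mathbf c\in\mathbb R^n$ be generic (the $d+n$ coordinates are algebraically independent over $\mathbb Q(A)$) such that the linear program of maximizing $\mathbf c^T\mathbf x$ subject to $A\mathbf x=\mathbf b$, $\mathbf x\ge 0$ is bounded and both it and its dual are strictly feasible. Let $\mathcal C\subset\mathbb C^n$ be its primal central curve. Then: (a) the degree of $\mathcal C$ equals the Möbius number $|\mu(A,\mathbf c)|$, and hence is at most $\binom{n-1}{d}$; (b) the prime ideal in $K[x_1,\dots,x_n]$ of all polynomials that vanish on the primal central path is generated by the $d$ linear polynomials given by the entries of $A\mathbf x-\mathbf b$ together with the circuit polynomials $$\sum_{i\in\mathrm{supp}(v)} v_i\prod_{j\in\mathrm{supp}(v)\setminus\{i\}}x_j ,$$ where $v$ runs over the non-zero vectors $v\in K^n$ of minimal support such that the linear form $\sum_i v_ix_i$ vanishes on $\mathcal L_{A,\mathbf c}$.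
   Context: $\mathbb Q(A)\subset\mathbb R$ is the field generated by the entries of $A$, and $K=\mathbb Q(A)(\mathbf b,\mathbf c)\subset\mathbb R$ is the field generated over it by the coordinates of $\mathbf b,\mathbf c$. The dual program is: minimize $\mathbf b^T\mathbf y$ subject to $A^T\mathbf y-\mathbf s=\mathbf c$, $\mathbf s\ge0$. Strictly feasible means there are $\mathbf x>0$ with $A\mathbf x=\mathbf b$, and $\mathbf y$ with $A^T\mathbf y-\mathbf c>0$. Primal central path: $\{\mathbf x^*(\lambda):\lambda>0\}$, where $\mathbf x^*(\lambda)$ is the unique maximizer of $\mathbf c^T\mathbf x+\lambda\sum_{i=1}^n\log x_i$ over $\{\mathbf x>0: A\mathbf x=\mathbf b\}$. The primal central curve $\mathcal C$ is the Zariski closure of the primal central path in $\mathbb C^n$; its degree is the degree of its closure in $\mathbb P^n$. $\mathcal L_{A,\mathbf c}\subset K^n$ is the $(d+1)$-dimensional linear span of the rows of $A$ and $\mathbf c$. $M_{A,\mathbf c}$ is the rank $d+1$ matroid on $[n]$ in which $I$ is independent iff the coordinate functions $\{x_i:i\in I\}$ are linearly independent on $\mathcal L_{A,\mathbf c}$ (equivalently, the columns of $\binom{A}{\mathbf c}$ indexed by $I$ are linearly independent). Möbius number of a rank $r$ matroid $M$ on $[n]$: a broken circuit is a set $C\setminus\{\min C\}$ with $C$ a circuit; the broken circuit complex $\mathrm{Br}(M)$ is the simplicial complex of subsets of $[n]$ containing no broken circuit. Then $|\mu(M)|$ is the number of $(r-1)$-dimensional faces (those with $r$ elements) of $\mathrm{Br}(M)$;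 equivalently $|\mu(M)|=T_M(1,0)$ for the Tutte polynomial $T_M$, equivalently the sum of the entries of the h-vector of $\mathrm{Br}(M)$. Write $|\mu(A,\mathbf c)|=|\mu(M_{A,\mathbf c})|$. *)

theory Defs
  imports
    "HOL-Analysis.Analysis"
    "HOL-Library.Poly_Mapping"
    "HOL-Computational_Algebra.Polynomial"
    "HOL-Algebra.Ideal"
    "HOL-Algebra.Generated_Fields"
    "HOL-Algebra.Algebraic_Closure_Type"
begin

text \<open>A polynomial with variables indexed by \<open>'i\<close> maps exponent vectors to coefficients;
  multiplication is the convolution product on finitely supported maps.\<close>

type_synonym ('i, 'a) mpoly = "('i \<Rightarrow>\<^sub>0 nat) \<Rightarrow>\<^sub>0 'a"

definition Const :: "'a::zero \<Rightarrow> ('i, 'a) mpoly"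
  where "Const a = Poly_Mapping.single 0 a"

definition Var :: "'i \<Rightarrow> ('i, 'a::zero_neq_one) mpoly"
  where "Var i = Poly_Mapping.single (Poly_Mapping.single i 1) 1"

definition mpoly_eval :: "('i, 'a::comm_semiring_1) mpoly \<Rightarrow> ('i \<Rightarrow> 'a) \<Rightarrow> 'a"
  where "mpoly_eval p z =
    (\<Sum>m\<in>Poly_Mapping.keys p.
       Poly_Mapping.lookup p m * (\<Prod>i\<in>Poly_Mapping.keys m. z i ^ Poly_Mapping.lookup m i))"

definition mpoly_carrier :: "'a::zero set \<Rightarrow> ('i, 'a) mpoly set"
  where "mpoly_carrier K = {p. \<forall>m. Poly_Mapping.lookup p m \<in> K}"

definition mpoly_ring :: "'a::comm_ring_1 set \<Rightarrow> ('i, 'a) mpoly ring"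
  where "mpoly_ring K = ring_of_type_algebra\<lparr>carrier := mpoly_carrier K\<rparr>"

text \<open>The zero polynomial is homogeneous of every degree.\<close>

definition homogeneous :: "nat \<Rightarrow> ('i, 'a::zero) mpoly \<Rightarrow> bool"
  where "homogeneous m p \<longleftrightarrow>
    (\<forall>k\<in>Poly_Mapping.keys p. (\<Sum>i\<in>Poly_Mapping.keys k. Poly_Mapping.lookup k i) = m)"

definition algebraically_independent_over :: "'a::comm_ring_1 set \<Rightarrow> ('i \<Rightarrow> 'a) \<Rightarrow> bool"
  where "algebraically_independent_over F z \<longleftrightarrow>
    (\<forall>p\<in>mpoly_carrier F. mpoly_eval p z = 0 \<longrightarrow> p = 0)"

definition zariski_closure :: "(complex^'n::finite) set \<Rightarrow> (complex^'n) set"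
  where "zariski_closure S =
    {z. \<forall>p. (\<forall>x\<in>S. mpoly_eval p (($) x) = 0) \<longrightarrow> mpoly_eval p (($) z) = 0}"

text \<open>Points of projective space are represented by all their non-zero vectors of homogeneous
  coordinates; the index \<open>None\<close> is the homogenizing coordinate.\<close>

definition homogenize :: "complex^'n::finite \<Rightarrow> complex^('n option)"
  where "homogenize x = (\<chi> j. case j of None \<Rightarrow> 1 | Some i \<Rightarrow> x $ i)"

definition projective_closure :: "(complex^'n::finite) set \<Rightarrow> (complex^('n option)) set"
  where "projective_closure S =
    {z. z \<noteq> 0 \<and>
        (\<forall>m F. homogeneous m F \<and> (\<forall>x\<in>S. mpoly_eval F (($) (homogenize x)) = 0) \<longrightarrow>
           mpoly_eval F (($) z) = 0)}"

global_interpretation mpoly_vs: vector_space "\<lambda>(a::'a::field) (p::('i, 'a) mpoly). Const a * p"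
  defines mpoly_dim = mpoly_vs.dim
  by unfold_locales (simp_all add: Const_def algebra_simps single_add mult_single single_one
      flip: mult.assoc)

definition hilbert_function :: "(complex^'i::finite) set \<Rightarrow> nat \<Rightarrow> nat"
  where "hilbert_function Z m =
    mpoly_dim {F :: ('i, complex) mpoly. homogeneous m F} -
    mpoly_dim {F :: ('i, complex) mpoly. homogeneous m F \<and> (\<forall>z\<in>Z. mpoly_eval F (($) z) = 0)}"

text \<open>\<open>hilbert_function Z m\<close> is the dimension of the degree \<open>m\<close> part of the homogeneous coordinate
  ring of \<open>Z\<close>.\<close>

definition hilbert_polynomial :: "(complex^'i::finite) set \<Rightarrow> rat poly"
  where "hilbert_polynomial Z =
    (THE P. \<forall>\<^sub>F m in sequentially. of_nat (hilbert_function Z m) = Polynomial.poly P (of_nat m))"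

definition projective_degree :: "(complex^'i::finite) set \<Rightarrow> rat"
  where "projective_degree Z =
    fact (Polynomial.degree (hilbert_polynomial Z)) * Polynomial.lead_coeff (hilbert_polynomial Z)"

definition affine_degree :: "(complex^'n::finite) set \<Rightarrow> rat"
  where "affine_degree S = projective_degree (projective_closure S)"

text \<open>A matroid on the ground set \<open>UNIV\<close> is given by its independence predicate. The linear order on
  \<open>'n\<close> is used only for the minima of circuits and plays the role of the usual order on \<open>[n]\<close>.\<close>

definition matroid_rank :: "('n::finite set \<Rightarrow> bool) \<Rightarrow> nat"
  where "matroid_rank indep = Max {card I | I. indep I}"

definition matroid_circuit :: "('n set \<Rightarrow> bool) \<Rightarrow> 'n set \<Rightarrow> bool"
  where "matroid_circuit indep C \<longleftrightarrow> \<not> indep C \<and> (\<forall>D. D \<subset> C \<longrightarrow> indep D)"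

definition broken_circuits :: "('n::{finite,linorder} set \<Rightarrow> bool) \<Rightarrow> 'n set set"
  where "broken_circuits indep = {C - {Min C} | C. matroid_circuit indep C}"

definition broken_circuit_complex :: "('n::{finite,linorder} set \<Rightarrow> bool) \<Rightarrow> 'n set set"
  where "broken_circuit_complex indep = {S. \<forall>B\<in>broken_circuits indep. \<not> B \<subseteq> S}"

definition moebius_number :: "('n::{finite,linorder} set \<Rightarrow> bool) \<Rightarrow> nat"
  where "moebius_number indep = card {S\<in>broken_circuit_complex indep. card S = matroid_rank indep}"

definition entry_field :: "real^'n^'d \<Rightarrow> real set"
  where "entry_field A = generate_field ring_of_type_algebra (range (\<lambda>(k, i). A $ k $ i))"

definition lp_field :: "real^'n^'d \<Rightarrow> real^'d \<Rightarrow> real^'n \<Rightarrow> real set"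
  where "lp_field A b c = generate_field ring_of_type_algebra
    (entry_field A \<union> range (($) b) \<union> range (($) c))"

text \<open>The \<open>d + n\<close> coordinates of \<open>b\<close> and \<open>c\<close> are algebraically independent as one family.\<close>

definition lp_generic :: "real^'n::finite^'d::finite \<Rightarrow> real^'d \<Rightarrow> real^'n \<Rightarrow> bool"
  where "lp_generic A b c \<longleftrightarrow>
    algebraically_independent_over (entry_field A) (case_sum (($) b) (($) c))"

definition primal_feasible :: "real^'n::finite^'d::finite \<Rightarrow> real^'d \<Rightarrow> (real^'n) set"
  where "primal_feasible A b = {x. A *v x = b \<and> (\<forall>i. 0 \<le> x $ i)}"

definition strictly_primal_feasible :: "real^'n::finite^'d::finite \<Rightarrow> real^'d \<Rightarrow> (real^'n) set"
  where "strictly_primal_feasible A b = {x. A *v x = b \<and> (\<forall>i. 0 < x $ i)}"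

definition strictly_dual_feasible :: "real^'n::finite^'d::finite \<Rightarrow> real^'n \<Rightarrow> (real^'d) set"
  where "strictly_dual_feasible A c = {y. \<forall>i. 0 < (transpose A *v y - c) $ i}"

definition lp_bounded :: "real^'n::finite^'d::finite \<Rightarrow> real^'d \<Rightarrow> real^'n \<Rightarrow> bool"
  where "lp_bounded A b c \<longleftrightarrow> bdd_above ((\<lambda>x. c \<bullet> x) ` primal_feasible A b)"

definition barrier :: "real^'n::finite \<Rightarrow> real \<Rightarrow> real^'n \<Rightarrow> real"
  where "barrier c l x = c \<bullet> x + l * (\<Sum>i\<in>UNIV. ln (x $ i))"

definition central_point ::
    "real^'n::finite^'d::finite \<Rightarrow> real^'d \<Rightarrow> real^'n \<Rightarrow> real \<Rightarrow> real^'n \<Rightarrow> bool"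
  where "central_point A b c l x \<longleftrightarrow>
    x \<in> strictly_primal_feasible A b \<and>
    (\<forall>y\<in>strictly_primal_feasible A b. y \<noteq> x \<longrightarrow> barrier c l y < barrier c l x)"

definition primal_central_path ::
    "real^'n::finite^'d::finite \<Rightarrow> real^'d \<Rightarrow> real^'n \<Rightarrow> (real^'n) set"
  where "primal_central_path A b c = {x. \<exists>l>0. central_point A b c l x}"

definition primal_central_curve ::
    "real^'n::finite^'d::finite \<Rightarrow> real^'d \<Rightarrow> real^'n \<Rightarrow> (complex^'n) set"
  where "primal_central_curve A b c =
    zariski_closure ((\<lambda>x. \<chi> i. complex_of_real (x $ i)) ` primal_central_path A b c)"

definition row_space :: "real set \<Rightarrow> real^'n::finite^'d::finite \<Rightarrow> real^'n \<Rightarrow> (real^'n) set"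
  where "row_space K A c =
    {(\<Sum>k\<in>UNIV. y k *\<^sub>R row k A) + t *\<^sub>R c | y t. (\<forall>k. y k \<in> K) \<and> t \<in> K}"

definition coord_indep :: "real set \<Rightarrow> (real^'n::finite) set \<Rightarrow> 'n set \<Rightarrow> bool"
  where "coord_indep K L I \<longleftrightarrow>
    (\<forall>w. (\<forall>i\<in>I. w i \<in> K) \<and> (\<forall>x\<in>L. (\<Sum>i\<in>I. w i * x $ i) = 0) \<longrightarrow> (\<forall>i\<in>I. w i = 0))"

definition lp_moebius ::
    "real^'n::{finite,linorder}^'d::finite \<Rightarrow> real^'d \<Rightarrow>
    real^'n::{finite,linorder} \<Rightarrow> nat"
  where "lp_moebius A b c =
    moebius_number (let K = lp_field A b c in coord_indep K (row_space K A c))"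

definition support :: "'a::zero^'n \<Rightarrow> 'n set"
  where "support v = {i. v $ i \<noteq> 0}"

definition vanishing_forms :: "real set \<Rightarrow> (real^'n::finite) set \<Rightarrow> (real^'n) set"
  where "vanishing_forms K L = {v. (\<forall>i. v $ i \<in> K) \<and> (\<forall>x\<in>L. (\<Sum>i\<in>UNIV. v $ i * x $ i) = 0)}"

definition circuit_vectors :: "real set \<Rightarrow> (real^'n::finite) set \<Rightarrow> (real^'n) set"
  where "circuit_vectors K L =
    {v \<in> vanishing_forms K L. v \<noteq> 0 \<and>
       \<not> (\<exists>w\<in>vanishing_forms K L. w \<noteq> 0 \<and> support w \<subset> support v)}"

definition circuit_polynomial :: "real^'n::finite \<Rightarrow> ('n, real) mpoly"
  where "circuit_polynomial v =
    (\<Sum>i\<in>support v. Const (v $ i) * (\<Prod>j\<in>support v - {i}. Var j))"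

definition constraint_polynomial ::
    "real^'n::finite^'d::finite \<Rightarrow> real^'d \<Rightarrow> 'd \<Rightarrow> ('n, real) mpoly"
  where "constraint_polynomial A b k = (\<Sum>i\<in>UNIV. Const (A $ k $ i) * Var i) - Const (b $ k)"

definition central_generators ::
    "real^'n::finite^'d::finite \<Rightarrow> real^'d \<Rightarrow> real^'n \<Rightarrow> ('n, real) mpoly set"
  where "central_generators A b c =
    range (constraint_polynomial A b) \<union>
    circuit_polynomial ` (let K = lp_field A b c in circuit_vectors K (row_space K A c))"

definition central_ideal ::
    "real^'n::finite^'d::finite \<Rightarrow> real^'d \<Rightarrow> real^'n \<Rightarrow> ('n, real) mpoly set"
  where "central_ideal A b c =
    {p \<in> mpoly_carrier (lp_field A b c). \<forall>x\<in>primal_central_path A b c. mpoly_eval p (($) x) = 0}"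

end

theory Submission
  imports Defs
begin

text \<open>Let \<open>k\<close> be the field generated by the entries of \<open>A\<close> and \<open>c\<close>, and \<open>K = k(b)\<close>. At a vertex of
  the arrangement of coordinate hyperplanes in \<open>A x = b\<close>, the central curve has a smooth branch
  parametrized by power series over \<open>K\<close>; let \<open>psi\<close> be evaluation of polynomials at it. The path has
  infinitely many points with distinct costs on the same curve, so \<open>psi\<close> has the same kernel as
  restriction to the path.

  The circuit polynomials cut out the reciprocals of the vectors in the row space of \<open>A\<close> and \<open>c\<close>, and
  modulo them the monomials without broken circuits form a basis. The number of these monomials of
  bounded degree grows like \<open>|\<mu>|\<close> copies of a polynomial ring in the linear forms given by \<open>A\<close> and
  \<open>c\<close>. As \<open>b\<close> is generic, these forms stay independent on the branch in the sense that no relation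
  with coefficients in \<open>k\<close> holds; a polynomial over \<open>k\<close> killed by \<open>psi\<close> but not in the circuit ideal
  would therefore generate too many independent functions. Clearing denominators in \<open>b\<close> extends this
  to \<open>K\<close>, which gives the ideal.

  For the degree, the coordinate functions on the branch are integral over the cost \<open>c x\<close>, so the
  Hilbert function is eventually linear; comparing again with the count of monomials without broken
  circuits, its slope is \<open>|\<mu>|\<close>. A facet of the broken circuit complex contains the smallest
  element, whence the binomial bound.\<close>

no_notation var (\<open>X\<index>\<close>)
no_notation fps_nth (infixl \<open>$\<close> 75)

section \<open>Linear algebra over a subfield\<close>

text \<open>The branch solves \<open>x i * y i = fps_X\<close> with \<open>A x = b\<close> and
  \<open>y\<close> a vector of dual slacks, so the series variable plays the role of the barrier
  parameter. The branch stays formal: it is compared with the path only through polynomials. Power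
  series form an integral domain, hence the kernel of \<open>psi\<close> is prime by construction.
  The small field contains \<open>c\<close> but not \<open>b\<close> because the circuit ideal
  depends on \<open>A\<close> and \<open>c\<close> alone. Over it the coordinates of
  \<open>b\<close> behave like variables, so the constraint forms count as independent functions
  although their values on the branch are constants. Ideal membership thus becomes a comparison of
  growth rates, with multiplicities read off as leading coefficients of counts in the degree. The
  ideal lives over the reals and the degree over the complex numbers; the branch is therefore built
  for an arbitrary embedding of the reals into a field of characteristic 0 and used twice.\<close>

locale field_subset =
  fixes F :: "'a::field set"
  assumes zero_mem [simp, intro]: "0 \<in> F"
    and one_mem [simp, intro]: "1 \<in> F"
    and add_mem [intro]: "x \<in> F \<Longrightarrow> y \<in> F \<Longrightarrow> x + y \<in> F"
    and mult_mem [intro]: "x \<in> F \<Longrightarrow> y \<in> F \<Longrightarrow> x * y \<in> F"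
    and uminus_mem [intro]: "x \<in> F \<Longrightarrow> - x \<in> F"
    and inverse_mem [intro]: "x \<in> F \<Longrightarrow> inverse x \<in> F"
begin

lemma diff_mem [intro]: "x \<in> F \<Longrightarrow> y \<in> F \<Longrightarrow> x - y \<in> F"
  using add_mem[of x "- y"] uminus_mem by simp

lemma divide_mem [intro]: "x \<in> F \<Longrightarrow> y \<in> F \<Longrightarrow> x / y \<in> F"
  by (simp add: divide_inverse inverse_mem mult_mem)

lemma sum_mem [intro]: "(\<And>x. x \<in> X \<Longrightarrow> f x \<in> F) \<Longrightarrow> sum f X \<in> F"
  by (induction X rule: infinite_finite_induct) auto

lemma prod_mem [intro]: "(\<And>x. x \<in> X \<Longrightarrow> f x \<in> F) \<Longrightarrow> prod f X \<in> F"
  by (induction X rule: infinite_finite_induct) auto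

lemma power_mem [intro]: "x \<in> F \<Longrightarrow> x ^ n \<in> F"
  by (induction n) auto

lemma of_nat_mem [simp, intro]: "of_nat n \<in> F"
  by (induction n) auto

text \<open>Gaussian elimination inside the subfield: each equation uses up one unknown, so with
  more unknowns than equations one stays free. The later counting arguments rest on it.\<close>

lemma homogeneous_system_solution:
  assumes "finite Y" "finite X" "card Y < card X"
    and "\<And>x y. x \<in> X \<Longrightarrow> y \<in> Y \<Longrightarrow> M x y \<in> F"
  obtains w where "\<And>x. w x \<in> F" "\<exists>x\<in>X. w x \<noteq> 0" "\<And>y. y \<in> Y \<Longrightarrow> (\<Sum>x\<in>X. w x * M x y) = 0"
proof -
  have "\<exists>w. (\<forall>x. w x \<in> F) \<and> (\<exists>x\<in>X. w x \<noteq> 0) \<and> (\<forall>y\<in>Y. (\<Sum>x\<in>X. w x * M x y) = 0)"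
    using assms
  proof (induction Y arbitrary: X M rule: finite_induct)
    case empty
    then have "X \<noteq> {}" by auto
    then show ?case by (intro exI[of _ "\<lambda>_. 1"]) auto
  next
    case (insert y Y)
    show ?case
    proof (cases "\<forall>x\<in>X. M x y = 0")
      case True
      from insert.IH[of X M] insert.prems insert.hyps obtain w where
        "\<forall>x. w x \<in> F" "\<exists>x\<in>X. w x \<noteq> 0" "\<forall>y\<in>Y. (\<Sum>x\<in>X. w x * M x y) = 0"
        by auto
      with True show ?thesis by (intro exI[of _ w]) auto
    next
      case False
      then obtain p where p: "p \<in> X" "M p y \<noteq> 0" by auto
      \<comment> \<open>The equations of \<open>Y\<close> after the pivot unknown \<open>p\<close>
        has been solved for by means of equation \<open>y\<close>.\<close>
      define M' where "M' x z = M x z - M x y / M p y * M p z" for x z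
      have card: "card Y < card (X - {p})"
        using insert.prems insert.hyps p by simp
      have mem: "M' x z \<in> F" if "x \<in> X - {p}" "z \<in> Y" for x z
        unfolding M'_def using insert.prems(3)[of x z] insert.prems(3)[of x y]
          insert.prems(3)[of p y] insert.prems(3)[of p z] that p by blast
      from insert.IH[of "X - {p}" M', OF _ card mem] insert.prems obtain w where
        w: "\<forall>x. w x \<in> F" "\<exists>x\<in>X - {p}. w x \<noteq> 0"
          "\<forall>z\<in>Y. (\<Sum>x\<in>X - {p}. w x * M' x z) = 0"
        by auto
      define s where "s = - (\<Sum>x\<in>X - {p}. w x * M x y) / M p y"
      define w' where "w' = w(p := s)"
      have s: "s \<in> F"
        unfolding s_def using w(1) insert.prems(3)[of _ y] p
        by (intro divide_mem uminus_mem sum_mem mult_mem) auto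
      have split: "(\<Sum>x\<in>X. w' x * M x z) = s * M p z + (\<Sum>x\<in>X - {p}. w x * M x z)" for z
      proof -
        have "(\<Sum>x\<in>X. w' x * M x z) = w' p * M p z + (\<Sum>x\<in>X - {p}. w' x * M x z)"
          using p insert.prems(1) by (simp add: sum.remove)
        also have "(\<Sum>x\<in>X - {p}. w' x * M x z) = (\<Sum>x\<in>X - {p}. w x * M x z)"
          by (rule sum.cong) (auto simp: w'_def)
        finally show ?thesis by (simp add: w'_def)
      qed
      have y: "(\<Sum>x\<in>X. w' x * M x y) = 0"
        unfolding split s_def using p by simp
      have "(\<Sum>x\<in>X. w' x * M x z) = 0" if "z \<in> Y" for z
      proof -
        have "0 = (\<Sum>x\<in>X - {p}. w x * M' x z)" using w(3) that by simp
        also have "\<dots> = (\<Sum>x\<in>X - {p}. w x * M x z) - (\<Sum>x\<in>X - {p}. w x * M x y) / M p y * M p z"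
          unfolding M'_def by (simp add: algebra_simps sum_subtractf sum_divide_distrib sum_distrib_left)
        also have "\<dots> = (\<Sum>x\<in>X. w' x * M x z)"
          unfolding split s_def by simp
        finally show ?thesis by simp
      qed
      moreover have "\<exists>x\<in>X. w' x \<noteq> 0" using w(2) by (auto simp: w'_def)
      moreover have "\<forall>x. w' x \<in> F" using w(1) s by (auto simp: w'_def)
      ultimately show ?thesis using y by blast
    qed
  qed
  then show thesis using that by blast
qed

text \<open>Fredholm alternative over a subfield, with both outcomes rational over \<open>F\<close>.
  It supplies rational circuit vectors, column bases and, over the reals, Lagrange
  multipliers.\<close>

lemma span_or_separating_functional:
  fixes a :: "'s \<Rightarrow> 'l::finite \<Rightarrow> 'a"
  assumes "finite S" "\<And>j l. j \<in> S \<Longrightarrow> a j l \<in> F" "\<And>l. v l \<in> F"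
  shows "(\<exists>\<beta>. (\<forall>j. \<beta> j \<in> F) \<and> (\<forall>l. v l = (\<Sum>j\<in>S. \<beta> j * a j l))) \<or>
    (\<exists>\<eta>. (\<forall>l. \<eta> l \<in> F) \<and> (\<forall>j\<in>S. (\<Sum>l\<in>UNIV. \<eta> l * a j l) = 0) \<and> (\<Sum>l\<in>UNIV. \<eta> l * v l) = 1)"
    (is "?span S v \<or> ?sep S v")
  using assms
proof (induction S arbitrary: v rule: finite_induct)
  case empty
  show ?case
  proof (cases "\<forall>l. v l = 0")
    case True
    then show ?thesis by (intro disjI1 exI[of _ "\<lambda>_. 0"]) auto
  next
    case False
    then obtain l where l: "v l \<noteq> 0" by auto
    have "(\<Sum>l'\<in>UNIV. (if l' = l then inverse (v l) else 0) * v l') =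
      (\<Sum>l'\<in>UNIV. if l' = l then inverse (v l) * v l else 0)"
      by (rule sum.cong) auto
    also have "\<dots> = 1" using l by simp
    finally show ?thesis using empty
      by (intro disjI2 exI[of _ "\<lambda>l'. if l' = l then inverse (v l) else 0"]) auto
  qed
next
  case (insert j S)
  have spanI: "?span (insert j S) u" if "\<beta>0 \<in> F" "?span S (\<lambda>l. u l - \<beta>0 * a j l)" for \<beta>0 u
  proof -
    from that(2) obtain \<beta> where \<beta>: "\<forall>j. \<beta> j \<in> F" "\<forall>l. u l - \<beta>0 * a j l = (\<Sum>j\<in>S. \<beta> j * a j l)"
      by blast
    have "u l = (\<Sum>i\<in>insert j S. (\<beta>(j := \<beta>0)) i * a i l)" for l
    proof -
      have "(\<Sum>i\<in>S. (\<beta>(j := \<beta>0)) i * a i l) = (\<Sum>j\<in>S. \<beta> j * a j l)"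
        using insert.hyps by (intro sum.cong) auto
      then show ?thesis using \<beta>(2) insert.hyps by (simp add: algebra_simps)
    qed
    then show ?thesis using \<beta>(1) that(1) by (intro exI[of _ "\<beta>(j := \<beta>0)"]) auto
  qed
  have aS: "\<And>i l. i \<in> S \<Longrightarrow> a i l \<in> F" and aj: "\<And>l. a j l \<in> F" using insert.prems by auto
  from insert.IH[OF aS aj] show ?case
  proof
    assume "?span S (a j)"
    then obtain \<beta> where \<beta>: "\<forall>i. \<beta> i \<in> F" "\<forall>l. a j l = (\<Sum>i\<in>S. \<beta> i * a i l)" by blast
    from insert.IH[OF aS insert.prems(2)] show ?thesis
    proof
      assume "?span S v"
      then show ?thesis using spanI[of 0 v] by simp
    next
      assume "?sep S v"
      then obtain \<eta> where \<eta>: "\<forall>l. \<eta> l \<in> F" "\<forall>j\<in>S. (\<Sum>l\<in>UNIV. \<eta> l * a j l) = 0"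
        "(\<Sum>l\<in>UNIV. \<eta> l * v l) = 1" by blast
      have "(\<Sum>l\<in>UNIV. \<eta> l * a j l) = (\<Sum>l\<in>UNIV. \<Sum>i\<in>S. \<beta> i * (\<eta> l * a i l))"
        using \<beta>(2) by (intro sum.cong) (auto simp: sum_distrib_left mult_ac)
      also have "\<dots> = (\<Sum>i\<in>S. \<beta> i * (\<Sum>l\<in>UNIV. \<eta> l * a i l))"
        by (subst sum.swap) (simp add: sum_distrib_left)
      also have "\<dots> = 0" using \<eta>(2) by simp
      finally show ?thesis using \<eta> by blast
    qed
  next
    assume "?sep S (a j)"
    then obtain \<eta>0 where \<eta>0: "\<forall>l. \<eta>0 l \<in> F" "\<forall>j\<in>S. (\<Sum>l\<in>UNIV. \<eta>0 l * a j l) = 0"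
        "(\<Sum>l\<in>UNIV. \<eta>0 l * a j l) = 1" by blast
    define t where "t = (\<Sum>l\<in>UNIV. \<eta>0 l * v l)"
    have t: "t \<in> F" unfolding t_def using \<eta>0(1) insert.prems(2) by blast
    have v': "v l - t * a j l \<in> F" for l using t insert.prems by blast
    from insert.IH[OF aS v'] show ?thesis
    proof
      assume "?span S (\<lambda>l. v l - t * a j l)"
      then show ?thesis using spanI[OF t] by blast
    next
      assume "?sep S (\<lambda>l. v l - t * a j l)"
      then obtain \<eta> where \<eta>: "\<forall>l. \<eta> l \<in> F" "\<forall>j\<in>S. (\<Sum>l\<in>UNIV. \<eta> l * a j l) = 0"
        "(\<Sum>l\<in>UNIV. \<eta> l * (v l - t * a j l)) = 1" by blast
      \<comment> \<open>The functional \<open>\<eta>0\<close> is 1 on \<open>a j\<close> and 0 on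
        the vectors of \<open>S\<close>; subtracting \<open>u\<close> times it kills
        \<open>a j\<close> as well. The value on \<open>v\<close> stays 1 because \<open>v\<close>
        was reduced by \<open>t * a j\<close> beforehand.\<close>
      define u where "u = (\<Sum>l\<in>UNIV. \<eta> l * a j l)"
      have u: "u \<in> F" unfolding u_def using \<eta>(1) aj by blast
      have ev: "(\<Sum>l\<in>UNIV. (\<eta> l - u * \<eta>0 l) * z l) =
        (\<Sum>l\<in>UNIV. \<eta> l * z l) - u * (\<Sum>l\<in>UNIV. \<eta>0 l * z l)" for z
        by (simp add: algebra_simps sum_subtractf sum_distrib_left)
      have "(\<Sum>l\<in>UNIV. \<eta> l * v l) - t * u = 1"
        using \<eta>(3) unfolding u_def by (simp add: algebra_simps sum_subtractf sum_distrib_left)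
      then have "(\<Sum>l\<in>UNIV. (\<eta> l - u * \<eta>0 l) * v l) = 1"
        unfolding ev t_def by (simp add: mult.commute)
      moreover have "\<forall>i\<in>insert j S. (\<Sum>l\<in>UNIV. (\<eta> l - u * \<eta>0 l) * a i l) = 0"
        unfolding ev using \<eta>(2) \<eta>0(2,3) by (auto simp: u_def)
      moreover have "\<forall>l. \<eta> l - u * \<eta>0 l \<in> F" using \<eta>(1) \<eta>0(1) u by blast
      ultimately show ?thesis
        apply -
        apply (rule disjI2, rule exI[of _ "\<lambda>l. \<eta> l - u * \<eta>0 l"])
        apply (intro conjI; assumption)
        done
    qed
  qed
qed

text \<open>Values outside the \<open>F\<close>-span of the earlier ones are collected in
  \<open>R\<close>, which makes \<open>R\<close> independent over \<open>F\<close>. Coordinates in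
  \<open>R\<close> split a relation over the large field into relations over
  \<open>F\<close>.\<close>

lemma finite_family_coordinates:
  fixes z :: "'x \<Rightarrow> 'a"
  assumes "finite X"
  obtains R w where "finite R" "\<And>x r. w x r \<in> F" "\<And>x. x \<in> X \<Longrightarrow> z x = (\<Sum>r\<in>R. w x r * r)"
    "\<And>u. (\<And>r. r \<in> R \<Longrightarrow> u r \<in> F) \<Longrightarrow> (\<Sum>r\<in>R. u r * r) = 0 \<Longrightarrow> \<forall>r\<in>R. u r = 0"
proof -
  have "\<exists>R w. finite R \<and> (\<forall>x r. w x r \<in> F) \<and> (\<forall>x\<in>X. z x = (\<Sum>r\<in>R. w x r * r)) \<and>
    (\<forall>u. (\<forall>r\<in>R. u r \<in> F) \<and> (\<Sum>r\<in>R. u r * r) = 0 \<longrightarrow> (\<forall>r\<in>R. u r = 0))"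
    using assms
  proof (induction X rule: finite_induct)
    case empty
    show ?case by (intro exI[of _ "{}"] exI[of _ "\<lambda>_ _. 0"]) auto
  next
    case (insert y X)
    then obtain R w where R: "finite R" "\<forall>x r. w x r \<in> F" "\<forall>x\<in>X. z x = (\<Sum>r\<in>R. w x r * r)"
      and ind: "\<And>u. (\<forall>r\<in>R. u r \<in> F) \<Longrightarrow> (\<Sum>r\<in>R. u r * r) = 0 \<Longrightarrow> (\<forall>r\<in>R. u r = 0)"
      by auto
    show ?case
    proof (cases "\<exists>v. (\<forall>r. v r \<in> F) \<and> z y = (\<Sum>r\<in>R. v r * r)")
      case True
      then obtain v where v: "\<forall>r. v r \<in> F" "z y = (\<Sum>r\<in>R. v r * r)" by blast
      show ?thesis using R ind v insert.hyps
        by (intro exI[of _ R] exI[of _ "w(y := v)"]) auto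
    next
      case False
      then have nospan: "z y \<noteq> (\<Sum>r\<in>R. v r * r)" if "\<And>r. v r \<in> F" for v
        using that by auto
      have notin: "z y \<notin> R"
      proof -
        have "z y = (\<Sum>r\<in>R. (if r = z y then 1 else 0) * r)" if "z y \<in> R"
        proof -
          have "(\<Sum>r\<in>R. (if r = z y then 1 else 0) * r) = (\<Sum>r\<in>R. if r = z y then z y else 0)"
            by (rule sum.cong) auto
          then show ?thesis using that R by simp
        qed
        then show ?thesis using nospan[of "\<lambda>r. if r = z y then 1 else 0"] by auto
      qed
      define w' where "w' x r = (if x = y then (if r = z y then 1 else 0) else if r = z y then 0 else w x r)" for x r
      have "\<forall>x\<in>insert y X. z x = (\<Sum>r\<in>insert (z y) R. w' x r * r)"
      proof
        fix x assume x: "x \<in> insert y X"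
        show "z x = (\<Sum>r\<in>insert (z y) R. w' x r * r)"
        proof (cases "x = y")
        case True
        have "(\<Sum>r\<in>R. w' x r * r) = 0"
          using True notin by (intro sum.neutral) (auto simp: w'_def)
        then show ?thesis using True notin R by (simp add: w'_def)
      next
        case False
        have "(\<Sum>r\<in>R. w' x r * r) = (\<Sum>r\<in>R. w x r * r)"
          using False notin by (intro sum.cong) (auto simp: w'_def)
        then show ?thesis using False notin R x by (simp add: w'_def)
        qed
      qed
      moreover have "\<forall>u. (\<forall>r\<in>insert (z y) R. u r \<in> F) \<and> (\<Sum>r\<in>insert (z y) R. u r * r) = 0
        \<longrightarrow> (\<forall>r\<in>insert (z y) R. u r = 0)"
      proof (intro allI impI, elim conjE)
        fix u assume u: "\<forall>r\<in>insert (z y) R. u r \<in> F" "(\<Sum>r\<in>insert (z y) R. u r * r) = 0"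
        have eq: "u (z y) * z y + (\<Sum>r\<in>R. u r * r) = 0"
          using u(2) R notin by simp
        have "u (z y) = 0"
        proof (rule ccontr)
          assume nz: "u (z y) \<noteq> 0"
          have "z y = (\<Sum>r\<in>R. (if r \<in> R then - u r / u (z y) else 0) * r)"
          proof -
            have "(\<Sum>r\<in>R. (if r \<in> R then - u r / u (z y) else 0) * r) = (\<Sum>r\<in>R. - (u r * r) / u (z y))"
              by (rule sum.cong) auto
            also have "\<dots> = - (\<Sum>r\<in>R. u r * r) / u (z y)"
              by (simp add: sum_divide_distrib sum_negf)
            also have "\<dots> = z y"
              using nz eq_neg_iff_add_eq_0[THEN iffD2, OF eq] by (simp add: field_simps)
            finally show ?thesis by simp
          qed
          moreover have "(if r \<in> R then - u r / u (z y) else 0) \<in> F" for r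
            using u(1) by auto
          ultimately show False
            using nospan[of "\<lambda>r. if r \<in> R then - u r / u (z y) else 0"] by simp
        qed
        moreover have "\<forall>r\<in>R. u r = 0"
        proof (rule ind)
          show "\<forall>r\<in>R. u r \<in> F" using u(1) by blast
          show "(\<Sum>r\<in>R. u r * r) = 0" using eq \<open>u (z y) = 0\<close> by simp
        qed
        ultimately show "\<forall>r\<in>insert (z y) R. u r = 0" by blast
      qed
      moreover have "\<forall>x r. w' x r \<in> F" using R(2) by (simp add: w'_def)
      moreover have "finite (insert (z y) R)" using R(1) by simp
      ultimately show ?thesis
        apply -
        apply (rule exI[of _ "insert (z y) R"], rule exI[of _ w'])
        apply (intro conjI; assumption)
        done
    qed
  qed
  then obtain R w where 1: "finite R" and 2: "\<forall>x r. w x r \<in> F"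
    and 3: "\<forall>x\<in>X. z x = (\<Sum>r\<in>R. w x r * r)"
    and 4: "\<forall>u. (\<forall>r\<in>R. u r \<in> F) \<and> (\<Sum>r\<in>R. u r * r) = 0 \<longrightarrow> (\<forall>r\<in>R. u r = 0)"
    by (elim exE conjE)
  show thesis
  proof (rule that[OF 1 2[rule_format] 3[rule_format]])
    fix u assume "\<And>r. r \<in> R \<Longrightarrow> u r \<in> F" "(\<Sum>r\<in>R. u r * r) = 0"
    then show "\<forall>r\<in>R. u r = 0" using 4[THEN spec[of _ u]] by blast
  qed
qed

end

section \<open>Counting monomials\<close>

definition exp_degree :: "('i::finite \<Rightarrow>\<^sub>0 nat) \<Rightarrow> nat"
  where "exp_degree a = (\<Sum>i\<in>UNIV. Poly_Mapping.lookup a i)"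

lemma exp_degree_zero [simp]: "exp_degree 0 = 0"
  and exp_degree_add: "exp_degree (a + a') = exp_degree a + exp_degree a'"
  and exp_degree_single [simp]: "exp_degree (Poly_Mapping.single i k) = k"
  by (simp_all add: exp_degree_def lookup_add sum.distrib lookup_single when_def)

lemma exp_degree_eq_0_iff [simp]: "exp_degree a = 0 \<longleftrightarrow> a = 0"
  by (auto simp: exp_degree_def intro: poly_mapping_eqI)

lemma lookup_le_exp_degree: "Poly_Mapping.lookup a i \<le> exp_degree a"
  unfolding exp_degree_def by (rule member_le_sum) auto

lemma in_keys_iff_pos: "i \<in> Poly_Mapping.keys a \<longleftrightarrow> 0 < Poly_Mapping.lookup (a :: 'i \<Rightarrow>\<^sub>0 nat) i"
  by (simp add: in_keys_iff)

definition exps_le :: "'i::finite set \<Rightarrow> nat \<Rightarrow> ('i \<Rightarrow>\<^sub>0 nat) set"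
  where "exps_le S m = {a. Poly_Mapping.keys a \<subseteq> S \<and> exp_degree a \<le> m}"

lemma single_plus_image:
  "((+) (Poly_Mapping.single i 1)) ` exps_le (insert i S) m =
    {a \<in> exps_le (insert i S) (Suc m). i \<in> Poly_Mapping.keys a}"
proof (intro equalityI subsetI)
  fix a assume "a \<in> ((+) (Poly_Mapping.single i 1)) ` exps_le (insert i S) m"
  then obtain a' where a': "a = Poly_Mapping.single i 1 + a'" "a' \<in> exps_le (insert i S) m" by auto
  have "Poly_Mapping.keys a = insert i (Poly_Mapping.keys a')"
    unfolding a'(1) set_eq_iff by (auto simp: in_keys_iff lookup_add lookup_single when_def)
  then show "a \<in> {a \<in> exps_le (insert i S) (Suc m). i \<in> Poly_Mapping.keys a}"
    using a' by (auto simp: exps_le_def exp_degree_add)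
next
  fix a assume a: "a \<in> {a \<in> exps_le (insert i S) (Suc m). i \<in> Poly_Mapping.keys a}"
  define a' where "a' = a - Poly_Mapping.single i 1"
  have eq: "a = Poly_Mapping.single i 1 + a'"
    using a by (intro poly_mapping_eqI) (auto simp: a'_def lookup_add lookup_minus lookup_single when_def in_keys_iff_pos)
  have "exp_degree a = Suc (exp_degree a')" by (subst eq) (simp add: exp_degree_add)
  moreover have "Poly_Mapping.keys a' \<subseteq> Poly_Mapping.keys a"
    by (auto simp: a'_def lookup_minus in_keys_iff_pos)
  ultimately have "a' \<in> exps_le (insert i S) m" using a by (auto simp: exps_le_def)
  then show "a \<in> ((+) (Poly_Mapping.single i 1)) ` exps_le (insert i S) m" using eq by blast
qed

text \<open>Pascal's rule: a monomial in the variables \<open>insert i S\<close> either avoids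
  \<open>i\<close> or is \<open>i\<close> times a monomial of smaller degree.\<close>

lemma finite_exps_le_card:
  "finite (exps_le S m) \<and> card (exps_le S m) = (m + card S) choose card S"
proof (induction S arbitrary: m rule: finite_induct[OF finite])
  case 1
  have "exps_le ({} :: 'a set) m = {0}" by (auto simp: exps_le_def)
  then show ?case by (simp only: finite.emptyI finite_insert card_1_singleton_iff) simp
next
  case (2 i S)
  show ?case
  proof (induction m)
    case 0
    have "exps_le (insert i S) 0 = {0}" by (auto simp: exps_le_def)
    then show ?case using 2 by simp
  next
    case (Suc m)
    have eq: "exps_le (insert i S) (Suc m) = exps_le S (Suc m) \<union>
      ((+) (Poly_Mapping.single i 1)) ` exps_le (insert i S) m"
      unfolding single_plus_image by (auto simp: exps_le_def)
    have disj: "exps_le S (Suc m) \<inter> ((+) (Poly_Mapping.single i 1)) ` exps_le (insert i S) m = {}"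
      unfolding single_plus_image using 2 by (auto simp: exps_le_def)
    have inj: "inj_on ((+) (Poly_Mapping.single i 1)) (exps_le (insert i S) m)" by simp
    show ?case unfolding eq using Suc 2 disj
      by (simp add: card_Un_disjoint card_image add.commute)
  qed
qed

lemmas finite_exps_le [simp] = finite_exps_le_card[THEN conjunct1]
lemmas card_exps_le = finite_exps_le_card[THEN conjunct2]

text \<open>Pascal's rule applied \<open>e\<close> times, each lower term being bounded by the
  largest one.\<close>

lemma binomial_shift_le: "((m + e) choose Suc r) \<le> (m choose Suc r) + e * ((m + e) choose r)"
proof (induction e)
  case (Suc e)
  have "((m + Suc e) choose Suc r) = ((m + e) choose r) + ((m + e) choose Suc r)" by simp
  also have "\<dots> \<le> ((m + e) choose r) + ((m choose Suc r) + e * ((m + e) choose r))" using Suc by simp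
  also have "\<dots> = (m choose Suc r) + Suc e * ((m + e) choose r)" by simp
  also have "\<dots> \<le> (m choose Suc r) + Suc e * ((m + Suc e) choose r)"
    by (intro add_left_mono mult_le_mono2 binomial_right_mono) simp
  finally show ?case .
qed simp

text \<open>Both sides grow like polynomials of degree \<open>Suc r\<close> in \<open>m\<close>;
  neither the shift by \<open>e\<close> nor the term with \<open>choose r\<close> affects the
  leading coefficient. Ranks are compared through this.\<close>

lemma binomial_growth:
  assumes "\<And>m. m \<ge> m0 \<Longrightarrow> x * ((m + Suc r) choose Suc r) \<le>
    y * ((m + e + Suc r) choose Suc r) + w * ((m + e + Suc r) choose r)"
  shows "x \<le> y"
proof (rule ccontr)
  assume "\<not> x \<le> y"
  then have xy: "y + 1 \<le> x" by simp
  define W where "W = y * e + w"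
  have le: "((m + Suc r) choose Suc r) \<le> W * ((m + e + Suc r) choose r)" if "m \<ge> m0" for m
  proof -
    have "(y + 1) * ((m + Suc r) choose Suc r) \<le> x * ((m + Suc r) choose Suc r)"
      by (rule mult_le_mono1[OF xy])
    also have "\<dots> \<le> y * ((m + e + Suc r) choose Suc r) + w * ((m + e + Suc r) choose r)"
      using assms that by blast
    also have "\<dots> \<le> y * (((m + Suc r) choose Suc r) + e * ((m + e + Suc r) choose r)) + w * ((m + e + Suc r) choose r)"
      using binomial_shift_le[of "m + Suc r" e r] by (intro add_mono mult_le_mono2) (simp_all add: add_ac)
    finally show ?thesis by (simp add: W_def algebra_simps)
  qed
  \<comment> \<open>Large enough for \<open>M + e \<le> 2 * M\<close> and for a contradiction: the
    bounds on the two binomials force \<open>M \<le> W * 2 ^ r * Suc r ^ Suc r\<close>.\<close>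
  define m where "m = m0 + e + W * 2 ^ r * Suc r ^ Suc r"
  define M where "M = m + Suc r"
  have "real M ^ Suc r / real (Suc r) ^ Suc r \<le> real (M choose Suc r)"
    using binomial_ge_n_over_k_pow_k[of "Suc r" M, where 'a = real] unfolding M_def
    by (simp add: power_divide)
  also have "\<dots> \<le> real (W * ((M + e) choose r))"
    using le[of m] unfolding M_def by (intro of_nat_mono) (simp add: m_def add_ac)
  also have "\<dots> \<le> real (W * (2 * M) ^ r)"
  proof -
    have "((M + e) choose r) \<le> (M + e) ^ r"
    proof (cases "r \<le> M + e")
      case True then show ?thesis by (rule binomial_le_pow)
    next
      case False then show ?thesis by (simp add: binomial_eq_0)
    qed
    also have "\<dots> \<le> (2 * M) ^ r" by (rule power_mono) (auto simp: M_def m_def)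
    finally show ?thesis by (intro of_nat_mono mult_le_mono2)
  qed
  finally have "real M ^ Suc r \<le> real (W * (2 * M) ^ r) * real (Suc r) ^ Suc r"
    by (simp add: divide_le_eq mult.commute)
  then have "real M * real M ^ r \<le> real (W * 2 ^ r * Suc r ^ Suc r) * real M ^ r"
    by (simp only: power_mult_distrib of_nat_mult of_nat_power power_Suc mult_ac of_nat_numeral)
  moreover have "real M ^ r > 0" by (simp add: M_def)
  ultimately have "real M \<le> real (W * 2 ^ r * Suc r ^ Suc r)" by (simp only: mult_le_cancel_right_pos)
  then have "M \<le> W * 2 ^ r * Suc r ^ Suc r" by (simp only: of_nat_le_iff)
  then show False unfolding M_def m_def by simp
qed

section \<open>Evaluation of polynomials\<close>

definition mono_val :: "('i::finite \<Rightarrow> 'b::comm_semiring_1) \<Rightarrow> ('i \<Rightarrow>\<^sub>0 nat) \<Rightarrow> 'b"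
  where "mono_val z a = (\<Prod>i\<in>UNIV. z i ^ Poly_Mapping.lookup a i)"

lemma mono_val_0 [simp]: "mono_val z 0 = 1"
  and mono_val_add: "mono_val z (a + a') = mono_val z a * mono_val z a'"
  by (simp_all add: mono_val_def lookup_add power_add prod.distrib)

lemma mono_val_single [simp]: "mono_val z (Poly_Mapping.single i k) = z i ^ k"
proof -
  have "mono_val z (Poly_Mapping.single i k) = (\<Prod>j\<in>UNIV. if j = i then z i ^ k else 1)"
    unfolding mono_val_def by (rule prod.cong) (auto simp: lookup_single when_def)
  then show ?thesis by simp
qed

lemma mono_val_keys: "mono_val z a = (\<Prod>i\<in>Poly_Mapping.keys a. z i ^ Poly_Mapping.lookup a i)"
  unfolding mono_val_def by (rule prod.mono_neutral_right) (auto simp: in_keys_iff)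

text \<open>The coefficient map \<open>h\<close> lets one definition serve for numerical evaluation,
  for evaluation at power series (\<open>fps_const\<close>) and for substitution of polynomials
  (\<open>Const\<close>).\<close>

definition meval :: "('a::zero \<Rightarrow> 'b::comm_semiring_1) \<Rightarrow> ('i::finite, 'a) mpoly \<Rightarrow> ('i \<Rightarrow> 'b) \<Rightarrow> 'b"
  where "meval h p z = (\<Sum>a\<in>Poly_Mapping.keys p. h (Poly_Mapping.lookup p a) * mono_val z a)"

lemma mpoly_eval_eq_meval: "mpoly_eval p z = meval (\<lambda>x. x) p z"
  unfolding mpoly_eval_def meval_def mono_val_keys ..

lemma poly_mapping_sum_single:
  "p = (\<Sum>a\<in>Poly_Mapping.keys p. Poly_Mapping.single a (Poly_Mapping.lookup p a))"
proof (rule poly_mapping_eqI)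
  fix a
  have "Poly_Mapping.lookup (\<Sum>a\<in>Poly_Mapping.keys p. Poly_Mapping.single a (Poly_Mapping.lookup p a)) a =
    (\<Sum>a'\<in>Poly_Mapping.keys p. if a' = a then Poly_Mapping.lookup p a else 0)"
    unfolding lookup_sum by (rule sum.cong) (auto simp: lookup_single when_def)
  then show "Poly_Mapping.lookup p a =
    Poly_Mapping.lookup (\<Sum>a\<in>Poly_Mapping.keys p. Poly_Mapping.single a (Poly_Mapping.lookup p a)) a"
    by (simp add: in_keys_iff)
qed

lemma mult_eq_sum_single:
  fixes p q :: "('i, 'a::comm_ring_1) mpoly"
  shows "p * q = (\<Sum>a\<in>Poly_Mapping.keys p. \<Sum>b\<in>Poly_Mapping.keys q.
      Poly_Mapping.single (a + b) (Poly_Mapping.lookup p a * Poly_Mapping.lookup q b))"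
proof -
  have "p * q = (\<Sum>a\<in>Poly_Mapping.keys p. Poly_Mapping.single a (Poly_Mapping.lookup p a)) *
      (\<Sum>a\<in>Poly_Mapping.keys q. Poly_Mapping.single a (Poly_Mapping.lookup q a))"
    by (rule arg_cong2[where f = "(*)"]; rule poly_mapping_sum_single)
  then show ?thesis by (simp only: sum_product mult_single)
qed

locale coeff_hom =
  fixes h :: "'a::comm_ring_1 \<Rightarrow> 'b::comm_ring_1"
  assumes hom_1: "h 1 = 1"
    and hom_add: "h (x + y) = h x + h y"
    and hom_mult: "h (x * y) = h x * h y"
begin

lemma hom_0: "h 0 = 0"
  using hom_add[of 0 0] by simp

lemma hom_uminus: "h (- x) = - h x"
  using hom_add[of x "- x"] by (simp add: hom_0 eq_neg_iff_add_eq_0 add.commute)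

lemma hom_diff: "h (x - y) = h x - h y"
  using hom_add[of x "- y"] by (simp add: hom_uminus)

lemma hom_sum: "h (sum f A) = (\<Sum>x\<in>A. h (f x))"
  by (induction A rule: infinite_finite_induct) (simp_all add: hom_0 hom_add)

lemma hom_prod: "h (prod f A) = (\<Prod>x\<in>A. h (f x))"
  by (induction A rule: infinite_finite_induct) (simp_all add: hom_1 hom_mult)

lemma hom_power: "h (x ^ n) = h x ^ n"
  by (induction n) (simp_all add: hom_1 hom_mult)

lemma meval_superset:
  assumes "finite S" "Poly_Mapping.keys p \<subseteq> S"
  shows "meval h p z = (\<Sum>a\<in>S. h (Poly_Mapping.lookup p a) * mono_val z a)"
  unfolding meval_def using assms by (intro sum.mono_neutral_left) (auto simp: in_keys_iff hom_0)

lemma meval_zero [simp]: "meval h 0 z = 0"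
  by (simp add: meval_def)

lemma meval_single [simp]: "meval h (Poly_Mapping.single a c) z = h c * mono_val z a"
  by (simp add: meval_def hom_0)

lemma meval_add: "meval h (p + q) z = meval h p z + meval h q z"
proof -
  let ?S = "Poly_Mapping.keys p \<union> Poly_Mapping.keys q"
  have "Poly_Mapping.keys (p + q) \<subseteq> ?S" by (rule Poly_Mapping.keys_add)
  then show ?thesis
    by (simp add: meval_superset[of ?S] lookup_add hom_add distrib_right sum.distrib)
qed

lemma meval_sum: "meval h (sum f A) z = (\<Sum>x\<in>A. meval h (f x) z)"
  by (induction A rule: infinite_finite_induct) (simp_all add: meval_add)

lemma meval_mult: "meval h (p * q) z = meval h p z * meval h q z"
proof -
  have "p * q = (\<Sum>a\<in>Poly_Mapping.keys p. \<Sum>b\<in>Poly_Mapping.keys q.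
      Poly_Mapping.single (a + b) (Poly_Mapping.lookup p a * Poly_Mapping.lookup q b))"
    by (rule mult_eq_sum_single)
  then have "meval h (p * q) z = (\<Sum>a\<in>Poly_Mapping.keys p. \<Sum>b\<in>Poly_Mapping.keys q.
      (h (Poly_Mapping.lookup p a) * mono_val z a) * (h (Poly_Mapping.lookup q b) * mono_val z b))"
    by (simp add: meval_sum hom_mult mono_val_add mult_ac)
  then show ?thesis by (simp add: meval_def sum_product)
qed

lemma meval_Const [simp]: "meval h (Const c) z = h c"
  by (simp add: Const_def)

lemma meval_Var [simp]: "meval h (Var i) z = z i"
  by (simp add: Var_def hom_1)

lemma meval_one [simp]: "meval h 1 z = 1"
  using meval_single[of 0 1] by (simp add: hom_1)

lemma meval_uminus: "meval h (- p) z = - meval h p z"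
  using meval_add[of p "- p" z] by (simp add: eq_neg_iff_add_eq_0 add.commute)

lemma meval_diff: "meval h (p - q) z = meval h p z - meval h q z"
  using meval_add[of p "- q" z] by (simp add: meval_uminus)

lemma meval_prod: "meval h (prod f A) z = (\<Prod>x\<in>A. meval h (f x) z)"
  by (induction A rule: infinite_finite_induct) (simp_all add: meval_mult)

lemma meval_power: "meval h (p ^ n) z = meval h p z ^ n"
  by (induction n) (simp_all add: meval_mult)

lemma meval_mono_val: "meval h (mono_val \<sigma> a) z = mono_val (\<lambda>j. meval h (\<sigma> j) z) a"
  by (simp add: mono_val_def meval_prod meval_power)

lemma meval_substitute:
  "meval h (meval Const q \<sigma>) z = meval h q (\<lambda>j. meval h (\<sigma> j) z)"
  by (simp add: meval_def[of Const] meval_sum meval_mult meval_mono_val) (simp add: meval_def)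

lemmas meval_simps = meval_add meval_sum meval_mult meval_uminus meval_diff meval_prod meval_power

end

lemma coeff_hom_id: "coeff_hom (\<lambda>x. x)"
  by unfold_locales simp_all

lemma coeff_hom_Const: "coeff_hom (Const :: 'a::comm_ring_1 \<Rightarrow> ('i, 'a) mpoly)"
  by unfold_locales (simp_all add: Const_def single_add mult_single)

lemma coeff_hom_fps_const: "coeff_hom (fps_const :: 'a::comm_ring_1 \<Rightarrow> 'a fps)"
  by unfold_locales simp_all

interpretation eval_id: coeff_hom "\<lambda>x::'a::comm_ring_1. x" by (rule coeff_hom_id)
interpretation eval_Const: coeff_hom "Const :: 'a::comm_ring_1 \<Rightarrow> ('i, 'a) mpoly" by (rule coeff_hom_Const)
interpretation eval_fps: coeff_hom "fps_const :: 'a::comm_ring_1 \<Rightarrow> 'a fps" by (rule coeff_hom_fps_const)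

lemma mono_val_Var: "mono_val Var a = (Poly_Mapping.single a 1 :: ('i::finite, 'a::comm_ring_1) mpoly)"
proof -
  have power: "Var i ^ k = (Poly_Mapping.single (Poly_Mapping.single i k) 1 :: ('i, 'a) mpoly)" for i :: 'i and k
  proof (induction k)
    case 0
    show ?case by (simp only: power_0 single_zero single_one)
  next
    case (Suc k)
    have "Var i ^ Suc k = (Var i * Poly_Mapping.single (Poly_Mapping.single i k) 1 :: ('i, 'a) mpoly)"
      by (simp only: power_Suc Suc)
    also have "\<dots> = Poly_Mapping.single (Poly_Mapping.single i 1 + Poly_Mapping.single i k) 1"
      by (simp only: Var_def mult_single mult_1_left)
    also have "Poly_Mapping.single i 1 + Poly_Mapping.single i k = (Poly_Mapping.single i (Suc k) :: 'i \<Rightarrow>\<^sub>0 nat)"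
      using single_add[of i "1 :: nat" k] by (simp only: plus_1_eq_Suc)
    finally show ?case .
  qed
  have prod: "(\<Prod>i\<in>S. Poly_Mapping.single (f i) 1) = (Poly_Mapping.single (\<Sum>i\<in>S. f i) 1 :: ('i, 'a) mpoly)"
    if "finite S" for S :: "'i set" and f
    using that
  proof (induction S rule: finite_induct)
    case empty
    show ?case by (simp only: prod.empty sum.empty single_one)
  next
    case (insert i S)
    show ?case
      by (simp only: prod.insert[OF insert.hyps] sum.insert[OF insert.hyps] insert.IH mult_single mult_1_left)
  qed
  have "(\<Sum>i\<in>UNIV. Poly_Mapping.single i (Poly_Mapping.lookup a i)) = a"
  proof (rule poly_mapping_eqI)
    fix j
    have "Poly_Mapping.lookup (\<Sum>i\<in>UNIV. Poly_Mapping.single i (Poly_Mapping.lookup a i)) j =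
      (\<Sum>i\<in>UNIV. if i = j then Poly_Mapping.lookup a j else 0)"
      unfolding lookup_sum by (rule sum.cong) (auto simp: lookup_single when_def)
    then show "Poly_Mapping.lookup (\<Sum>i\<in>UNIV. Poly_Mapping.single i (Poly_Mapping.lookup a i)) j =
      Poly_Mapping.lookup a j" by simp
  qed
  then show ?thesis by (simp add: mono_val_def power prod)
qed

lemma single_eq_Const_mono_val:
  "Poly_Mapping.single a c = Const c * (mono_val Var a :: ('i::finite, 'a::comm_ring_1) mpoly)"
  by (simp add: mono_val_Var Const_def mult_single)

section \<open>Polynomials over a subfield\<close>

context field_subset
begin

lemma carrier_add: "p \<in> mpoly_carrier F \<Longrightarrow> q \<in> mpoly_carrier F \<Longrightarrow> p + q \<in> mpoly_carrier F"
  and carrier_uminus: "p \<in> mpoly_carrier F \<Longrightarrow> - p \<in> mpoly_carrier F"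
  and carrier_diff: "p \<in> mpoly_carrier F \<Longrightarrow> q \<in> mpoly_carrier F \<Longrightarrow> p - q \<in> mpoly_carrier F"
  by (auto simp: mpoly_carrier_def lookup_add lookup_minus)

lemma carrier_single: "c \<in> F \<Longrightarrow> Poly_Mapping.single a c \<in> mpoly_carrier F"
  by (auto simp: mpoly_carrier_def lookup_single when_def)

lemma carrier_Const: "c \<in> F \<Longrightarrow> Const c \<in> mpoly_carrier F"
  and carrier_Var: "Var i \<in> mpoly_carrier F"
  and carrier_zero: "0 \<in> mpoly_carrier F"
  and carrier_one: "1 \<in> mpoly_carrier F"
  using carrier_single[of c 0] carrier_single[of 1 "Poly_Mapping.single i 1"] carrier_single[of 1 0]
  by (simp_all add: Const_def Var_def) (simp add: mpoly_carrier_def)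

lemma carrier_sum: "(\<And>x. x \<in> X \<Longrightarrow> f x \<in> mpoly_carrier F) \<Longrightarrow> sum f X \<in> mpoly_carrier F"
  by (induction X rule: infinite_finite_induct) (auto intro: carrier_add carrier_zero)

lemma carrier_mult:
  assumes "p \<in> mpoly_carrier F" "q \<in> mpoly_carrier F"
  shows "p * q \<in> mpoly_carrier F"
proof -
  have "p * q = (\<Sum>a\<in>Poly_Mapping.keys p. \<Sum>b\<in>Poly_Mapping.keys q.
      Poly_Mapping.single (a + b) (Poly_Mapping.lookup p a * Poly_Mapping.lookup q b))"
    by (rule mult_eq_sum_single)
  also have "\<dots> \<in> mpoly_carrier F"
    using assms by (intro carrier_sum carrier_single mult_mem) (auto simp: mpoly_carrier_def)
  finally show ?thesis .
qed

lemma carrier_prod: "(\<And>x. x \<in> X \<Longrightarrow> f x \<in> mpoly_carrier F) \<Longrightarrow> prod f X \<in> mpoly_carrier F"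
  by (induction X rule: infinite_finite_induct) (auto intro: carrier_mult carrier_one)

lemma carrier_power: "p \<in> mpoly_carrier F \<Longrightarrow> p ^ n \<in> mpoly_carrier F"
  by (induction n) (auto intro: carrier_mult carrier_one)

lemma carrier_mono_val: "(\<And>i. z i \<in> mpoly_carrier F) \<Longrightarrow> mono_val z a \<in> mpoly_carrier F"
  unfolding mono_val_def by (intro carrier_prod carrier_power)

lemma carrier_substitute:
  assumes "q \<in> mpoly_carrier F" "\<And>j. \<sigma> j \<in> mpoly_carrier F"
  shows "meval Const q \<sigma> \<in> mpoly_carrier F"
  unfolding meval_def using assms
  by (intro carrier_sum carrier_mult carrier_Const carrier_mono_val) (auto simp: mpoly_carrier_def)

lemmas carrier_intros = carrier_add carrier_uminus carrier_diff carrier_Const carrier_Var carrier_zero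
  carrier_one carrier_sum carrier_mult carrier_prod carrier_power carrier_mono_val carrier_substitute

lemma mono_val_mem: "(\<And>i. z i \<in> F) \<Longrightarrow> mono_val z a \<in> F"
  unfolding mono_val_def by (intro prod_mem power_mem)

lemma meval_mem: "p \<in> mpoly_carrier F \<Longrightarrow> (\<And>i. z i \<in> F) \<Longrightarrow> meval (\<lambda>x. x) p z \<in> F"
  unfolding meval_def by (intro sum_mem mult_mem mono_val_mem) (auto simp: mpoly_carrier_def)

end

definition degree_le :: "nat \<Rightarrow> ('i::finite, 'a::zero) mpoly \<Rightarrow> bool"
  where "degree_le m p \<longleftrightarrow> (\<forall>a\<in>Poly_Mapping.keys p. exp_degree a \<le> m)"

lemma degree_le_mono: "degree_le m p \<Longrightarrow> m \<le> m' \<Longrightarrow> degree_le m' p"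
  by (force simp: degree_le_def)

lemma degree_le_0 [simp]: "degree_le m 0"
  by (simp add: degree_le_def)

lemma degree_le_single: "exp_degree a \<le> m \<Longrightarrow> degree_le m (Poly_Mapping.single a c)"
  by (simp add: degree_le_def)

lemma degree_le_Const: "degree_le m (Const c)"
  by (simp add: Const_def degree_le_single)

lemma degree_le_Var: "degree_le 1 (Var i)"
  by (simp add: Var_def degree_le_single)

lemma degree_le_1 [simp]: "degree_le m (1 :: ('i::finite, 'a::comm_ring_1) mpoly)"
  by (simp add: degree_le_def)

lemma degree_le_add: "degree_le m p \<Longrightarrow> degree_le m q \<Longrightarrow> degree_le m (p + q)"
  using Poly_Mapping.keys_add[of p q] by (auto simp: degree_le_def)

lemma degree_le_sum: "(\<And>x. x \<in> A \<Longrightarrow> degree_le m (f x)) \<Longrightarrow> degree_le m (sum f A)"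
  by (induction A rule: infinite_finite_induct) (auto intro: degree_le_add)

lemma degree_le_mult:
  fixes p q :: "('i::finite, 'a::comm_ring_1) mpoly"
  assumes "degree_le m p" "degree_le m' q"
  shows "degree_le (m + m') (p * q)"
  unfolding degree_le_def
proof
  fix c assume "c \<in> Poly_Mapping.keys (p * q)"
  then have "c \<in> {a + b |a b. a \<in> Poly_Mapping.keys p \<and> b \<in> Poly_Mapping.keys q}"
    by (rule subsetD[OF Poly_Mapping.keys_mult])
  then obtain a b where "a \<in> Poly_Mapping.keys p" "b \<in> Poly_Mapping.keys q" "c = a + b"
    by auto
  with assms show "exp_degree c \<le> m + m'"
    by (auto simp: degree_le_def exp_degree_add intro: add_mono)
qed

lemma degree_le_power:
  fixes p :: "('i::finite, 'a::comm_ring_1) mpoly"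
  assumes "degree_le m p"
  shows "degree_le (m * k) (p ^ k)"
proof (induction k)
  case 0
  show ?case by simp
next
  case (Suc k)
  then show ?case using degree_le_mult[OF assms Suc] by simp
qed

lemma degree_le_prod:
  fixes f :: "'x \<Rightarrow> ('i::finite, 'a::comm_ring_1) mpoly"
  assumes "finite A" "\<And>x. x \<in> A \<Longrightarrow> degree_le (m x) (f x)"
  shows "degree_le (\<Sum>x\<in>A. m x) (prod f A)"
  using assms
proof (induction A rule: finite_induct)
  case empty
  show ?case by simp
next
  case (insert x A)
  then show ?case by (simp add: degree_le_mult)
qed

lemma degree_le_mono_val:
  fixes \<sigma> :: "'j::finite \<Rightarrow> ('i::finite, 'a::comm_ring_1) mpoly"
  assumes "\<And>j. degree_le 1 (\<sigma> j)"
  shows "degree_le (exp_degree a) (mono_val \<sigma> a)"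
  unfolding mono_val_def exp_degree_def
  by (intro degree_le_prod) (use degree_le_power[OF assms] in simp_all)

lemma degree_le_ex: "\<exists>m. degree_le m p"
proof -
  have "exp_degree a \<le> (\<Sum>a\<in>Poly_Mapping.keys p. exp_degree a)" if "a \<in> Poly_Mapping.keys p" for a
    using that by (intro member_le_sum) auto
  then show ?thesis unfolding degree_le_def by blast
qed

lemma keys_subset_exps_le: "degree_le m p \<Longrightarrow> Poly_Mapping.keys p \<subseteq> exps_le UNIV m"
  by (auto simp: degree_le_def exps_le_def)

definition coeff_poly :: "('i \<Rightarrow>\<^sub>0 nat) set \<Rightarrow> (('i \<Rightarrow>\<^sub>0 nat) \<Rightarrow> 'a::comm_monoid_add) \<Rightarrow> ('i, 'a) mpoly"
  where "coeff_poly E w = (\<Sum>a\<in>E. Poly_Mapping.single a (w a))"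

lemma lookup_coeff_poly:
  assumes "finite E"
  shows "Poly_Mapping.lookup (coeff_poly E w) a = (if a \<in> E then w a else 0)"
proof -
  have "Poly_Mapping.lookup (coeff_poly E w) a = (\<Sum>a'\<in>E. if a' = a then w a else 0)"
    unfolding coeff_poly_def lookup_sum by (rule sum.cong) (auto simp: lookup_single when_def)
  then show ?thesis using assms by simp
qed

lemma (in coeff_hom) meval_coeff_poly:
  "meval h (coeff_poly E w) z = (\<Sum>a\<in>E. h (w a) * mono_val z a)"
  by (simp add: coeff_poly_def meval_sum)

lemma (in field_subset) carrier_coeff_poly:
  "(\<And>a. a \<in> E \<Longrightarrow> w a \<in> F) \<Longrightarrow> coeff_poly E w \<in> mpoly_carrier F"
  unfolding coeff_poly_def by (intro carrier_sum carrier_single)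

section \<open>Ideals generated over a subfield\<close>

text \<open>Multipliers have coefficients in \<open>F\<close> only, so ideals over several subfields
  can be compared inside one polynomial type. The induction adds one multiple of a generator at a
  time.\<close>

inductive_set ideal_gen :: "'a::comm_ring_1 set \<Rightarrow> ('i, 'a) mpoly set \<Rightarrow> ('i, 'a) mpoly set"
  for F G where
    ideal_gen_zero: "0 \<in> ideal_gen F G"
  | ideal_gen_step: "q \<in> ideal_gen F G \<Longrightarrow> p \<in> mpoly_carrier F \<Longrightarrow> g \<in> G \<Longrightarrow> q + p * g \<in> ideal_gen F G"

lemma ideal_gen_mult_gen: "p \<in> mpoly_carrier F \<Longrightarrow> g \<in> G \<Longrightarrow> p * g \<in> ideal_gen F G"
  using ideal_gen_step[OF ideal_gen_zero] by fastforce

lemma ideal_gen_add: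
  assumes "p \<in> ideal_gen F G" "q \<in> ideal_gen F G"
  shows "p + q \<in> ideal_gen F G"
  using assms(2)
proof induction
  case ideal_gen_zero
  then show ?case using assms(1) by simp
next
  case (ideal_gen_step q p' g)
  then show ?case using ideal_gen.ideal_gen_step[of "p + q" F G p' g] by (simp add: add.assoc)
qed

lemma ideal_gen_sum: "(\<And>x. x \<in> A \<Longrightarrow> f x \<in> ideal_gen F G) \<Longrightarrow> sum f A \<in> ideal_gen F G"
  by (induction A rule: infinite_finite_induct) (auto intro: ideal_gen_zero ideal_gen_add)

lemma (in field_subset) ideal_gen_mult:
  assumes "q \<in> ideal_gen F G" "p \<in> mpoly_carrier F"
  shows "p * q \<in> ideal_gen F G"
  using assms(1)
proof induction
  case ideal_gen_zero
  then show ?case by (simp add: ideal_gen.ideal_gen_zero)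
next
  case (ideal_gen_step q p' g)
  then show ?case
    using ideal_gen.ideal_gen_step[OF ideal_gen_step.IH carrier_mult[OF assms(2)], of p' g]
    by (simp add: distrib_left mult.assoc)
qed

lemma (in field_subset) ideal_gen_diff:
  assumes "p \<in> ideal_gen F G" "q \<in> ideal_gen F G"
  shows "p - q \<in> ideal_gen F G"
proof -
  have "(- 1) * q \<in> ideal_gen F G" by (intro ideal_gen_mult assms carrier_uminus carrier_one)
  then show ?thesis using ideal_gen_add[OF assms(1)] by fastforce
qed

lemma ideal_gen_mono:
  assumes "F \<subseteq> F'" "G \<subseteq> G'"
  shows "ideal_gen F G \<subseteq> ideal_gen F' G'"
proof
  fix p assume "p \<in> ideal_gen F G"
  then show "p \<in> ideal_gen F' G'"
  proof induction
    case (ideal_gen_step q p g)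
    moreover have "p \<in> mpoly_carrier F'"
      using ideal_gen_step.hyps assms by (auto simp: mpoly_carrier_def)
    ultimately show ?case using assms by (auto intro: ideal_gen.ideal_gen_step)
  qed (rule ideal_gen_zero)
qed

lemma (in coeff_hom) meval_ideal_gen:
  assumes "p \<in> ideal_gen F G" "\<And>g. g \<in> G \<Longrightarrow> meval h g z = 0"
  shows "meval h p z = 0"
  using assms by induction (simp_all add: meval_add meval_mult)

lemma (in field_subset) ideal_gen_carrier:
  assumes "p \<in> ideal_gen F G" "G \<subseteq> mpoly_carrier F"
  shows "p \<in> mpoly_carrier F"
  using assms by induction (auto intro: carrier_intros)

text \<open>Telescoping: one factor at a time is changed from \<open>P i\<close> to
  \<open>Q i\<close>. Later this exchanges the constants \<open>b j\<close> for linear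
  forms.\<close>

lemma mono_val_substitution_diff:
  fixes P Q :: "'i::finite \<Rightarrow> ('j::finite, 'a::field) mpoly"
  assumes "field_subset F" "\<And>i. P i \<in> mpoly_carrier F" "\<And>i. Q i \<in> mpoly_carrier F"
    "\<And>i. P i - Q i \<in> ideal_gen F G"
  shows "mono_val P a - mono_val Q a \<in> ideal_gen F G"
proof -
  interpret field_subset F by fact
  have power: "P i ^ k - Q i ^ k \<in> ideal_gen F G" for i k
  proof (induction k)
    case (Suc k)
    have "P i ^ Suc k - Q i ^ Suc k = P i ^ k * (P i - Q i) + Q i * (P i ^ k - Q i ^ k)"
      by (simp add: algebra_simps)
    then show ?case using Suc assms by (auto intro!: ideal_gen_add ideal_gen_mult carrier_power)
  qed (simp add: ideal_gen_zero)
  have "(\<Prod>i\<in>S. P i ^ Poly_Mapping.lookup a i) - (\<Prod>i\<in>S. Q i ^ Poly_Mapping.lookup a i) \<in> ideal_gen F G"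
    if "finite S" for S
    using that
  proof (induction S rule: finite_induct)
    case (insert i S)
    let ?p = "\<lambda>i. P i ^ Poly_Mapping.lookup a i" and ?q = "\<lambda>i. Q i ^ Poly_Mapping.lookup a i"
    have "prod ?p (insert i S) - prod ?q (insert i S) =
      prod ?p S * (?p i - ?q i) + ?q i * (prod ?p S - prod ?q S)"
      using insert.hyps by (simp add: algebra_simps)
    then show ?case using insert power assms
      by (auto intro!: ideal_gen_add ideal_gen_mult carrier_power carrier_prod)
  qed (simp add: ideal_gen_zero)
  then show ?thesis unfolding mono_val_def by simp
qed

section \<open>Linear independence of the monomials without broken circuits\<close>

text \<open>The product of \<open>f\<close> with all the \<open>q i\<close> vanishes everywhere,
  hence is zero. This plays the part of a density argument over any field of characteristic
  0.\<close>

lemma poly_eq_0_off_roots: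
  fixes f :: "'a::field_char_0 Polynomial.poly"
  assumes "finite I" "\<And>i. i \<in> I \<Longrightarrow> q i \<noteq> 0"
    and "\<And>x. (\<And>i. i \<in> I \<Longrightarrow> Polynomial.poly (q i) x \<noteq> 0) \<Longrightarrow> Polynomial.poly f x = 0"
  shows "f = 0"
proof -
  have "Polynomial.poly (f * (\<Prod>i\<in>I. q i)) x = 0" for x
  proof (cases "\<exists>i\<in>I. Polynomial.poly (q i) x = 0")
    case True
    then have "(\<Prod>i\<in>I. Polynomial.poly (q i) x) = 0" using assms(1) by (intro prod_zero) auto
    then show ?thesis by (simp add: poly_prod)
  next
    case False
    then have "Polynomial.poly f x = 0" using assms(3) by blast
    then show ?thesis by simp
  qed
  then have "f * (\<Prod>i\<in>I. q i) = 0" using poly_all_0_iff_0 by blast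
  moreover have "(\<Prod>i\<in>I. q i) \<noteq> 0" using assms(1,2) by simp
  ultimately show ?thesis by simp
qed

definition linear_subspace :: "('n \<Rightarrow> 'a::field) set \<Rightarrow> bool"
  where "linear_subspace L \<longleftrightarrow> (\<lambda>_. 0) \<in> L \<and>
    (\<forall>s\<in>L. \<forall>u\<in>L. \<forall>x. (\<lambda>i. s i + x * u i) \<in> L)"

lemma linear_subspace_axpy:
  "linear_subspace L \<Longrightarrow> s \<in> L \<Longrightarrow> u \<in> L \<Longrightarrow> (\<lambda>i. s i + x * u i) \<in> L"
  unfolding linear_subspace_def by simp

lemma linear_subspace_zero: "linear_subspace L \<Longrightarrow> (\<lambda>_. 0) \<in> L"
  unfolding linear_subspace_def by simp

definition form_vanishes_on :: "('n::finite \<Rightarrow> 'a::field) set \<Rightarrow> ('n \<Rightarrow> 'a) \<Rightarrow> bool"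
  where "form_vanishes_on L v \<longleftrightarrow> (\<forall>s\<in>L. (\<Sum>i\<in>UNIV. v i * s i) = 0)"

definition form_support :: "('n \<Rightarrow> 'a::zero) \<Rightarrow> 'n set"
  where "form_support v = {i. v i \<noteq> 0}"

text \<open>In this form, quantifying over all relations instead of the circuits, absence of broken
  circuits is visibly inherited by restrictions and contractions.\<close>

definition no_broken_relation ::
    "('n::{finite,linorder} \<Rightarrow> 'a::field) set \<Rightarrow> 'n set \<Rightarrow> 'n set \<Rightarrow> bool"
  where "no_broken_relation L E S \<longleftrightarrow> (\<forall>v. form_vanishes_on L v \<and> form_support v \<noteq> {} \<and>
    form_support v \<subseteq> E \<longrightarrow> \<not> form_support v - {Min (form_support v)} \<subseteq> S)"

text \<open>A relation on the hyperplane \<open>s k = 0\<close> of \<open>L\<close> becomes one on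
  \<open>L\<close> after a suitable coefficient is put at \<open>k\<close>. As \<open>k\<close>
  exceeds all of \<open>E\<close>, the minimum of the support is unchanged, so the broken part grows
  at most by \<open>k\<close>.\<close>

lemma no_broken_relation_contract:
  fixes L :: "('n::{finite,linorder} \<Rightarrow> 'a::field) set"
  assumes L: "linear_subspace L" and u: "u \<in> L" "u k = 1" and E: "\<And>i. i \<in> E \<Longrightarrow> i < k"
    and nb: "no_broken_relation L (insert k E) S" and S: "S \<subseteq> insert k S'"
    and k: "k \<in> S"
  shows "no_broken_relation {s \<in> L. s k = 0} E (S - {k})"
  unfolding no_broken_relation_def
proof (intro allI impI notI)
  fix v
  assume v: "form_vanishes_on {s \<in> L. s k = 0} v \<and> form_support v \<noteq> {} \<and> form_support v \<subseteq> E"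
    and sub: "form_support v - {Min (form_support v)} \<subseteq> S - {k}"
  \<comment> \<open>The vector \<open>s - s k * u\<close> lies in the hyperplane, so
    \<open>v\<close> takes the value \<open>s k * x\<close> at \<open>s\<close>; the coefficient
    \<open>- x\<close> at \<open>k\<close> cancels it.\<close>
  define x where "x = (\<Sum>i\<in>UNIV. v i * u i)"
  define v' where "v' = v(k := - x)"
  have vk: "v k = 0" using v E by (auto simp: form_support_def)
  have "(\<Sum>i\<in>UNIV. v' i * s i) = 0" if s: "s \<in> L" for s
  proof -
    have "(\<lambda>i. s i + (- s k) * u i) \<in> {s \<in> L. s k = 0}"
      using linear_subspace_axpy[OF L s u(1), of "- s k"] u(2) by simp
    then have "(\<Sum>i\<in>UNIV. v i * (s i + (- s k) * u i)) = 0"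
      using v[THEN conjunct1, unfolded form_vanishes_on_def, THEN bspec] by simp
    then have "(\<Sum>i\<in>UNIV. v i * s i) = s k * x"
      by (simp add: x_def algebra_simps sum_subtractf sum_distrib_left)
    moreover have "(\<Sum>i\<in>UNIV. v' i * s i) = (\<Sum>i\<in>UNIV. v i * s i + (if i = k then - x * s k else 0))"
      by (rule sum.cong) (auto simp: v'_def vk)
    ultimately show ?thesis by (simp add: sum.distrib)
  qed
  then have van: "form_vanishes_on L v'" by (simp add: form_vanishes_on_def)
  have supp: "form_support v \<subseteq> form_support v'" "form_support v' \<subseteq> insert k (form_support v)"
    using vk by (auto simp: form_support_def v'_def)
  let ?m = "Min (form_support v)"
  have m: "?m \<in> form_support v" using v by (intro Min_in) auto
  have "Min (form_support v') = ?m"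
  proof (rule Min_eqI)
    fix y assume "y \<in> form_support v'"
    then have "y = k \<or> y \<in> form_support v" using supp(2) by blast
    moreover have "?m < k" using m v E by blast
    ultimately show "?m \<le> y" by auto
  qed (use m supp in auto)
  then have "form_support v' - {Min (form_support v')} \<subseteq> S"
    using supp(2) sub k by auto
  moreover have "form_support v' \<noteq> {}" "form_support v' \<subseteq> insert k E" using supp v by auto
  ultimately show False using nb[unfolded no_broken_relation_def, rule_format, of v'] van by simp
qed

lemma no_broken_relation_subset:
  "no_broken_relation L E S \<Longrightarrow> E' \<subseteq> E \<Longrightarrow> no_broken_relation L E' S"
  unfolding no_broken_relation_def by blast

text \<open>A loop \<open>k\<close> would give a relation with support \<open>{k}\<close>, whose
  broken part is empty and so contained in every \<open>S\<close>.\<close>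

lemma no_broken_relation_not_loop:
  assumes "no_broken_relation L E S" "linear_subspace L" "k \<in> E"
  obtains u where "u \<in> L" "u k = 1"
proof -
  have "\<exists>s\<in>L. s k \<noteq> 0"
  proof (rule ccontr)
    assume "\<not> (\<exists>s\<in>L. s k \<noteq> 0)"
    then have "form_vanishes_on L (\<lambda>i. if i = k then 1 else 0)"
      unfolding form_vanishes_on_def by (auto intro!: sum.neutral)
    moreover have "form_support (\<lambda>i. if i = k then 1 else 0 :: 'b) = {k}"
      by (auto simp: form_support_def)
    moreover have "form_support (\<lambda>i. if i = k then 1 else 0 :: 'b) -
        {Min (form_support (\<lambda>i. if i = k then 1 else 0 :: 'b))} = {}"
      unfolding calculation(2) by simp
    ultimately show False
      using assms(1)[unfolded no_broken_relation_def, rule_format, of "\<lambda>i. if i = k then 1 else 0"]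
        assms(3) by simp
  qed
  then obtain s where s: "s \<in> L" "s k \<noteq> 0" by blast
  have "(\<lambda>i. 0 + inverse (s k) * s i) \<in> L"
    by (rule linear_subspace_axpy[OF assms(2) linear_subspace_zero[OF assms(2)] s(1)])
  then show thesis using s(2) by (intro that[of "\<lambda>i. 0 + inverse (s k) * s i"]) simp_all
qed

lemma prod_split_at:
  fixes f :: "'n::finite \<Rightarrow> 'a::comm_monoid_mult"
  shows "(\<Prod>i\<in>UNIV. f i) = f k * (\<Prod>i\<in>UNIV - {k}. f i)"
  by (rule prod.remove) auto

text \<open>Multiplying a relation by the highest pole along \<open>s k = 0\<close> extends it to that hyperplane.\<close>

lemma extend_relation_over_hyperplane:
  fixes L :: "('n::{finite,linorder} \<Rightarrow> 'a::field_char_0) set"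
  assumes L: "linear_subspace L" and u: "u \<in> L" "u k = 1" and fin: "finite T"
    and keys: "\<And>a. a \<in> T \<Longrightarrow> Poly_Mapping.keys a \<subseteq> insert k E"
    and e: "\<And>a. a \<in> T \<Longrightarrow> Poly_Mapping.lookup a k \<le> e"
    and rel: "\<And>s. s \<in> L \<Longrightarrow> (\<And>i. i \<in> insert k E \<Longrightarrow> s i \<noteq> 0) \<Longrightarrow>
      (\<Sum>a\<in>T. w a * mono_val (\<lambda>i. inverse (s i)) a) = 0"
    and s: "s \<in> L" "\<And>i. i \<in> E \<Longrightarrow> s i \<noteq> 0" and k: "k \<notin> E"
  shows "(\<Sum>a\<in>T. w a * (s k ^ (e - Poly_Mapping.lookup a k) *
    (\<Prod>i\<in>UNIV - {k}. inverse (s i) ^ Poly_Mapping.lookup a i))) = 0"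
proof -
  \<comment> \<open>A common bound for all exponents: multiplication by \<open>t i ^ D\<close> for
    \<open>i\<close> in \<open>E\<close> clears every pole other than the one along
    \<open>t k = 0\<close>.\<close>
  define D where "D = (\<Sum>a\<in>T. exp_degree a)"
  have D: "Poly_Mapping.lookup a i \<le> D" if "a \<in> T" for a i
    using lookup_le_exp_degree[of a i] member_le_sum[OF that _ fin, of exp_degree] by (simp add: D_def)
  \<comment> \<open>The line through \<open>s\<close> in direction \<open>u\<close> lies in none of
    the hyperplanes concerned. The relation holds at all but finitely many of its points, hence as a
    polynomial identity in the parameter, and so at \<open>s\<close> itself.\<close>
  define l where "l i = [:s i, u i:]" for i
  define g where "g t a = t k ^ (e - Poly_Mapping.lookup a k) * (\<Prod>i\<in>E. t i ^ (D - Poly_Mapping.lookup a i))"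
    for t :: "'n \<Rightarrow> 'b::comm_ring_1" and a
  define f where "f = (\<Sum>a\<in>T. Polynomial.smult (w a)
    (l k ^ (e - Poly_Mapping.lookup a k) * (\<Prod>i\<in>E. l i ^ (D - Poly_Mapping.lookup a i))))"
  have ev: "Polynomial.poly f x = (\<Sum>a\<in>T. w a * ((s k + x * u k) ^ (e - Poly_Mapping.lookup a k) *
      (\<Prod>i\<in>E. (s i + x * u i) ^ (D - Poly_Mapping.lookup a i))))" for x
    unfolding f_def l_def by (simp add: poly_sum poly_prod poly_power)
  have prodE: "(\<Prod>i\<in>E. t i ^ (D - Poly_Mapping.lookup a i)) =
      (\<Prod>i\<in>E. t i ^ D) * (\<Prod>i\<in>UNIV - {k}. inverse (t i) ^ Poly_Mapping.lookup a i)"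
    if "a \<in> T" "\<And>i. i \<in> E \<Longrightarrow> t i \<noteq> 0" for a and t :: "'n \<Rightarrow> 'a"
  proof -
    have "Poly_Mapping.lookup a i = 0" if "i \<notin> E" "i \<noteq> k" for i
      using keys[OF \<open>a \<in> T\<close>] that
      by (meson insert_iff not_in_keys_iff_lookup_eq_zero subsetD)
    then have "(\<Prod>i\<in>UNIV - {k}. inverse (t i) ^ Poly_Mapping.lookup a i) =
        (\<Prod>i\<in>E. inverse (t i) ^ Poly_Mapping.lookup a i)"
      using k by (intro prod.mono_neutral_right) auto
    moreover have "(\<Prod>i\<in>E. t i ^ (D - Poly_Mapping.lookup a i)) =
        (\<Prod>i\<in>E. t i ^ D * inverse (t i) ^ Poly_Mapping.lookup a i)"
      using that D by (intro prod.cong) (auto simp: power_diff divide_inverse power_inverse)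
    ultimately show ?thesis by (simp add: prod.distrib)
  qed
  have "f = 0"
  proof (rule poly_eq_0_off_roots[of "insert k E" l])
    show "finite (insert k E)" by (rule finite)
    show "l i \<noteq> 0" if "i \<in> insert k E" for i using that s(2) u by (auto simp: l_def)
    fix x assume nz: "\<And>i. i \<in> insert k E \<Longrightarrow> Polynomial.poly (l i) x \<noteq> 0"
    define t where "t i = s i + x * u i" for i
    have t: "t i \<noteq> 0" if "i \<in> insert k E" for i using nz[OF that] by (simp add: t_def l_def)
    have tL: "t \<in> L" unfolding t_def by (rule linear_subspace_axpy[OF L s(1) u(1)])
    have "Polynomial.poly f x = (\<Sum>a\<in>T. w a * (t k ^ (e - Poly_Mapping.lookup a k) *
        (\<Prod>i\<in>E. t i ^ (D - Poly_Mapping.lookup a i))))"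
      unfolding ev t_def ..
    also have "\<dots> = (\<Sum>a\<in>T. t k ^ e * (\<Prod>i\<in>E. t i ^ D) * (w a * mono_val (\<lambda>i. inverse (t i)) a))"
    proof (rule sum.cong)
      fix a assume a: "a \<in> T"
      have "t k ^ (e - Poly_Mapping.lookup a k) = t k ^ e * inverse (t k) ^ Poly_Mapping.lookup a k"
        using t e[OF a] by (simp add: power_diff divide_inverse power_inverse)
      then show "w a * (t k ^ (e - Poly_Mapping.lookup a k) *
          (\<Prod>i\<in>E. t i ^ (D - Poly_Mapping.lookup a i))) =
          t k ^ e * (\<Prod>i\<in>E. t i ^ D) * (w a * mono_val (\<lambda>i. inverse (t i)) a)"
        using prodE[OF a, of t] t unfolding mono_val_def
        by (subst prod_split_at[of _ k]) (simp add: mult_ac)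
    qed simp
    also have "\<dots> = t k ^ e * (\<Prod>i\<in>E. t i ^ D) * (\<Sum>a\<in>T. w a * mono_val (\<lambda>i. inverse (t i)) a)"
      by (simp add: sum_distrib_left)
    also have "\<dots> = 0" using rel[OF tL t] by simp
    finally show "Polynomial.poly f x = 0" .
  qed
  then have "(\<Sum>a\<in>T. w a * (s k ^ (e - Poly_Mapping.lookup a k) *
      (\<Prod>i\<in>E. s i ^ (D - Poly_Mapping.lookup a i)))) = 0"
    using ev[of 0] by simp
  also have "(\<Sum>a\<in>T. w a * (s k ^ (e - Poly_Mapping.lookup a k) *
      (\<Prod>i\<in>E. s i ^ (D - Poly_Mapping.lookup a i)))) =
      (\<Prod>i\<in>E. s i ^ D) * (\<Sum>a\<in>T. w a * (s k ^ (e - Poly_Mapping.lookup a k) *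
      (\<Prod>i\<in>UNIV - {k}. inverse (s i) ^ Poly_Mapping.lookup a i)))"
    unfolding sum_distrib_left using prodE[of _ s] s(2) by (intro sum.cong) (auto simp: mult_ac)
  finally show ?thesis using s(2) by simp
qed

text \<open>Deletion and contraction at the largest index \<open>k\<close>: the terms with the
  highest pole along \<open>s k = 0\<close> form a relation with fewer variables, on that hyperplane
  or, if \<open>k\<close> does not occur, on \<open>L\<close> itself. Their coefficients vanish by
  induction, and fewer terms remain.\<close>

theorem inverse_monomials_independent:
  fixes L :: "('n::{finite,linorder} \<Rightarrow> 'a::field_char_0) set"
  assumes "linear_subspace L" "finite T"
    and "\<And>a. a \<in> T \<Longrightarrow> Poly_Mapping.keys a \<subseteq> E \<and> no_broken_relation L E (Poly_Mapping.keys a)"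
    and "\<And>s. s \<in> L \<Longrightarrow> (\<And>i. i \<in> E \<Longrightarrow> s i \<noteq> 0) \<Longrightarrow>
      (\<Sum>a\<in>T. w a * mono_val (\<lambda>i. inverse (s i)) a) = 0"
  shows "\<forall>a\<in>T. w a = 0"
proof -
  have "finite E" by simp
  then show ?thesis using assms
  proof (induction E arbitrary: L T w rule: finite_linorder_max_induct)
    case empty
    then have "T \<subseteq> {0}" by auto
    then consider "T = {}" | "T = {0}" by blast
    then show ?case
    proof cases
      case 2
      have "(\<lambda>_. 0) \<in> L" using empty by (simp add: linear_subspace_def)
      from empty(4)[OF this] 2 show ?thesis by simp
    qed simp
  next
    case (insert k E)
    have k: "k \<notin> E" using insert.hyps by blast
    show ?case using insert.prems(2-4)
    proof (induction T rule: finite_psubset_induct)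
      case (psubset T)
      show ?case
      proof (cases "T = {}")
        case False
        then obtain a0 where a0: "a0 \<in> T" by blast
        then obtain u where u: "u \<in> L" "u k = 1"
          using no_broken_relation_not_loop[of L "insert k E" "Poly_Mapping.keys a0" k]
            psubset.prems(1) insert.prems(1) by blast
        define e where "e = Max ((\<lambda>a. Poly_Mapping.lookup a k) ` T)"
        have e: "Poly_Mapping.lookup a k \<le> e" if "a \<in> T" for a
          unfolding e_def using that psubset.hyps by (intro Max_ge) auto
        define T' where "T' = {a \<in> T. Poly_Mapping.lookup a k = e}"
        have T': "T' \<noteq> {}" "T' \<subseteq> T" "finite T'"
        proof -
          have "e \<in> (\<lambda>a. Poly_Mapping.lookup a k) ` T"
            unfolding e_def using False psubset.hyps by (intro Max_in) auto
          then show "T' \<noteq> {}" by (auto simp: T'_def)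
        qed (use psubset.hyps in \<open>auto simp: T'_def\<close>)
        \<comment> \<open>For \<open>e = 0\<close> no term involves \<open>k\<close>, which is
          deleted; otherwise the arrangement is restricted to the hyperplane, which contracts the
          matroid by \<open>k\<close>.\<close>
        define L' where "L' = (if e = 0 then L else {s \<in> L. s k = 0})"
        have L': "linear_subspace L'"
          using insert.prems(1) by (auto simp: L'_def linear_subspace_def)
        define r where "r a = a - Poly_Mapping.single k e" for a :: "'n \<Rightarrow>\<^sub>0 nat"
        have r: "a = r a + Poly_Mapping.single k e" if "a \<in> T'" for a
          using that by (intro poly_mapping_eqI)
            (auto simp: r_def T'_def lookup_add lookup_minus lookup_single when_def)
        then have inj: "inj_on r T'" by (metis inj_onI)
        have lr: "Poly_Mapping.lookup (r a) i = (if i = k then 0 else Poly_Mapping.lookup a i)"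
          if "a \<in> T'" for a i
          using that by (auto simp: r_def T'_def lookup_minus lookup_single when_def)
        have keys_r: "Poly_Mapping.keys (r a) = Poly_Mapping.keys a - {k}" if "a \<in> T'" for a
          using lr[OF that] by (auto simp: in_keys_iff split: if_splits)
        have "\<forall>a\<in>r ` T'. w (a + Poly_Mapping.single k e) = 0"
        proof (rule insert.IH[OF L'])
          show "finite (r ` T')" using T' by simp
        next
          fix a' assume "a' \<in> r ` T'"
          then obtain a where a: "a' = r a" "a \<in> T'" by blast
          have keys_a: "Poly_Mapping.keys a \<subseteq> insert k E"
            and nb: "no_broken_relation L (insert k E) (Poly_Mapping.keys a)"
            using psubset.prems(1) a(2) T'(2) by blast+
          have "no_broken_relation L' E (Poly_Mapping.keys a - {k})"
          proof (cases "e = 0")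
            case True
            then have "k \<notin> Poly_Mapping.keys a" using a by (simp add: T'_def in_keys_iff)
            then show ?thesis
              using True no_broken_relation_subset[OF nb, of E] by (auto simp: L'_def)
          next
            case False
            then have "k \<in> Poly_Mapping.keys a" using a by (simp add: T'_def in_keys_iff)
            then show ?thesis
              using no_broken_relation_contract[OF insert.prems(1) u _ nb, of "Poly_Mapping.keys a"]
                insert.hyps False by (auto simp: L'_def)
          qed
          then show "Poly_Mapping.keys a' \<subseteq> E \<and> no_broken_relation L' E (Poly_Mapping.keys a')"
            using keys_a keys_r[OF a(2)] a(1) by auto
        next
          fix s assume s: "s \<in> L'" "\<And>i. i \<in> E \<Longrightarrow> s i \<noteq> 0"
          then have sL: "s \<in> L" by (auto simp: L'_def split: if_splits)
          have zero: "(\<Sum>a\<in>T. w a * (s k ^ (e - Poly_Mapping.lookup a k) *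
              (\<Prod>i\<in>UNIV - {k}. inverse (s i) ^ Poly_Mapping.lookup a i))) = 0"
            by (rule extend_relation_over_hyperplane[OF insert.prems(1) u psubset.hyps _ e
                psubset.prems(2) sL s(2) k]) (use psubset.prems(1) in blast)
          have "(\<Sum>a\<in>T. w a * (s k ^ (e - Poly_Mapping.lookup a k) *
              (\<Prod>i\<in>UNIV - {k}. inverse (s i) ^ Poly_Mapping.lookup a i))) =
              (\<Sum>a\<in>T'. w a * (s k ^ (e - Poly_Mapping.lookup a k) *
              (\<Prod>i\<in>UNIV - {k}. inverse (s i) ^ Poly_Mapping.lookup a i)))"
          proof (rule sum.mono_neutral_right)
            show "\<forall>a\<in>T - T'. w a * (s k ^ (e - Poly_Mapping.lookup a k) *
              (\<Prod>i\<in>UNIV - {k}. inverse (s i) ^ Poly_Mapping.lookup a i)) = 0"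
            proof
              \<comment> \<open>Terms of lower pole order keep a positive power of
                \<open>s k\<close>, which is zero on \<open>L'\<close>.\<close>
              fix a assume a: "a \<in> T - T'"
              then have lt: "Poly_Mapping.lookup a k < e" using e[of a] by (auto simp: T'_def)
              then have "s k = 0" using s(1) by (auto simp: L'_def split: if_splits)
              then show "w a * (s k ^ (e - Poly_Mapping.lookup a k) *
                (\<Prod>i\<in>UNIV - {k}. inverse (s i) ^ Poly_Mapping.lookup a i)) = 0"
                using lt by simp
            qed
          qed (use T' psubset.hyps in auto)
          also have "\<dots> = (\<Sum>a\<in>T'. w (r a + Poly_Mapping.single k e) * mono_val (\<lambda>i. inverse (s i)) (r a))"
          proof (rule sum.cong)
            fix a assume a: "a \<in> T'"
            have "mono_val (\<lambda>i. inverse (s i)) (r a) =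
              (\<Prod>i\<in>UNIV - {k}. inverse (s i) ^ Poly_Mapping.lookup a i)"
              unfolding mono_val_def using lr[OF a] by (subst prod_split_at[of _ k]) simp
            then show "w a * (s k ^ (e - Poly_Mapping.lookup a k) *
                (\<Prod>i\<in>UNIV - {k}. inverse (s i) ^ Poly_Mapping.lookup a i)) =
                w (r a + Poly_Mapping.single k e) * mono_val (\<lambda>i. inverse (s i)) (r a)"
              using a r[OF a] by (simp add: T'_def)
          qed simp
          also have "\<dots> = (\<Sum>a\<in>r ` T'. w (a + Poly_Mapping.single k e) * mono_val (\<lambda>i. inverse (s i)) a)"
            by (simp add: sum.reindex[OF inj])
          finally show "(\<Sum>a\<in>r ` T'. w (a + Poly_Mapping.single k e) *
            mono_val (\<lambda>i. inverse (s i)) a) = 0" using zero by simp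
        qed
        then have wT': "\<forall>a\<in>T'. w a = 0" using r by auto
        have "\<forall>a\<in>T - T'. w a = 0"
        proof (rule psubset.IH)
          show "T - T' \<subset> T" using T' by blast
          show "Poly_Mapping.keys a \<subseteq> insert k E \<and> no_broken_relation L (insert k E) (Poly_Mapping.keys a)"
            if "a \<in> T - T'" for a
            using psubset.prems(1) that by blast
          fix s assume s: "s \<in> L" "\<And>i. i \<in> insert k E \<Longrightarrow> s i \<noteq> 0"
          have "(\<Sum>a\<in>T - T'. w a * mono_val (\<lambda>i. inverse (s i)) a) =
              (\<Sum>a\<in>T. w a * mono_val (\<lambda>i. inverse (s i)) a)"
            using wT' psubset.hyps by (intro sum.mono_neutral_left) auto
          also have "\<dots> = 0" using psubset.prems(2)[OF s] .
          finally show "(\<Sum>a\<in>T - T'. w a * mono_val (\<lambda>i. inverse (s i)) a) = 0" .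
        qed
        with wT' show ?thesis by blast
      qed simp
    qed
  qed
qed

section \<open>The matroid of a row space\<close>

lemma lookup_Const_mult:
  "Poly_Mapping.lookup (Const x * p) b = x * Poly_Mapping.lookup (p :: ('i, 'a::comm_ring_1) mpoly) b"
  unfolding Const_def mult_map_scale_conv_mult[symmetric]
  by (simp add: Poly_Mapping.map.rep_eq when_def)

definition column_relation :: "('l::finite \<Rightarrow> 'n::finite \<Rightarrow> 'a::field) \<Rightarrow> ('n \<Rightarrow> 'a) \<Rightarrow> bool"
  where "column_relation A v \<longleftrightarrow> (\<forall>l. (\<Sum>i\<in>UNIV. v i * A l i) = 0)"

definition column_indep :: "('l::finite \<Rightarrow> 'n::finite \<Rightarrow> 'a::field) \<Rightarrow> 'n set \<Rightarrow> bool"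
  where "column_indep A I \<longleftrightarrow>
    (\<forall>v. column_relation A v \<and> form_support v \<subseteq> I \<longrightarrow> form_support v = {})"

definition row_span :: "('l::finite \<Rightarrow> 'n \<Rightarrow> 'a::field) \<Rightarrow> ('n \<Rightarrow> 'a) set"
  where "row_span A = {s. \<exists>y. s = (\<lambda>i. \<Sum>l\<in>UNIV. y l * A l i)}"

definition cpoly :: "('n::finite \<Rightarrow> 'a::comm_ring_1) \<Rightarrow> ('n, 'a) mpoly"
  where "cpoly v = (\<Sum>i\<in>form_support v. Const (v i) * (\<Prod>j\<in>form_support v - {i}. Var j))"

definition cpolys :: "'a::field set \<Rightarrow> ('l::finite \<Rightarrow> 'n::finite \<Rightarrow> 'a) \<Rightarrow> ('n, 'a) mpoly set"
  where "cpolys F A = {cpoly v |v. (\<forall>i. v i \<in> F) \<and> column_relation A v \<and>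
    matroid_circuit (column_indep A) (form_support v)}"

lemma column_relation_axpy:
  "column_relation A v \<Longrightarrow> column_relation A w \<Longrightarrow> column_relation A (\<lambda>i. v i + x * w i)"
  unfolding column_relation_def
  by (simp add: distrib_right sum.distrib mult.assoc flip: sum_distrib_left)

lemma form_support_empty_iff: "form_support v = {} \<longleftrightarrow> (\<forall>i. v i = 0)"
  by (auto simp: form_support_def)

text \<open>Among the relations inside the support that involve \<open>m\<close>, one of least
  support is a circuit: a smaller relation avoiding \<open>m\<close> could be used to eliminate
  another coordinate while keeping \<open>m\<close>.\<close>

lemma circuit_through:
  assumes "column_relation A v" "m \<in> form_support v"
  obtains C where "matroid_circuit (column_indep A) C" "m \<in> C" "C \<subseteq> form_support v"
proof -
  let ?P = "\<lambda>w. column_relation A w \<and> m \<in> form_support w \<and> form_support w \<subseteq> form_support v"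
  obtain w where w: "?P w" and min: "\<And>u. ?P u \<Longrightarrow> card (form_support w) \<le> card (form_support u)"
    using assms ex_has_least_nat[of ?P v "\<lambda>w. card (form_support w)"] by blast
  have "matroid_circuit (column_indep A) (form_support w)"
    unfolding matroid_circuit_def
  proof (intro conjI allI impI)
    show "\<not> column_indep A (form_support w)" using w unfolding column_indep_def by blast
  next
    fix D assume D: "D \<subset> form_support w"
    show "column_indep A D"
    proof (rule ccontr)
      assume "\<not> column_indep A D"
      then obtain u where u: "column_relation A u" "form_support u \<subseteq> D" "form_support u \<noteq> {}"
        unfolding column_indep_def by blast
      have psub: "form_support u \<subset> form_support w" using u D by blast
      show False
      proof (cases "m \<in> form_support u")
        case True
        then have "?P u" using u psub w by blast
        from min[OF this] psubset_card_mono[OF _ psub] show False by simp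
      next
        case False
        from u obtain j where j: "j \<in> form_support u" by blast
        define w' where "w' = (\<lambda>i. w i + (- (w j / u j)) * u i)"
        have rel: "column_relation A w'"
          unfolding w'_def using w u by (intro column_relation_axpy) auto
        have "w' j = 0" using j by (simp add: w'_def form_support_def)
        moreover have "m \<in> form_support w'" using False w by (simp add: w'_def form_support_def)
        moreover have "form_support w' \<subseteq> form_support w"
          using psub by (auto simp: w'_def form_support_def)
        moreover have "j \<in> form_support w" using j psub by blast
        ultimately have "form_support w' \<subset> form_support w" "?P w'"
          using rel w by (auto simp: form_support_def)
        from min[OF this(2)] psubset_card_mono[OF _ this(1)] show False by simp
      qed
    qed
  qed
  then show thesis using that w by blast
qed

lemma dependent_imp_circuit:
  assumes "\<not> column_indep A I"
  obtains C where "matroid_circuit (column_indep A) C" "C \<subseteq> I"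
proof -
  from assms obtain v where v: "column_relation A v" "form_support v \<subseteq> I" "form_support v \<noteq> {}"
    unfolding column_indep_def by blast
  then obtain m where "m \<in> form_support v" by blast
  then obtain C where C: "matroid_circuit (column_indep A) C" "C \<subseteq> form_support v"
    by (rule circuit_through[OF v(1)])
  show thesis using that[OF C(1)] C(2) v(2) by blast
qed

lemma linear_subspace_row_span: "linear_subspace (row_span A)"
  unfolding linear_subspace_def
proof (intro conjI ballI allI)
  show "(\<lambda>_. 0) \<in> row_span A"
    unfolding row_span_def by (intro CollectI exI[of _ "\<lambda>_. 0"]) simp
  fix s u x assume "s \<in> row_span A" "u \<in> row_span A"
  then obtain y z where "s = (\<lambda>i. \<Sum>l\<in>UNIV. y l * A l i)" "u = (\<lambda>i. \<Sum>l\<in>UNIV. z l * A l i)"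
    unfolding row_span_def by blast
  then show "(\<lambda>i. s i + x * u i) \<in> row_span A"
    unfolding row_span_def
    by (intro CollectI exI[of _ "\<lambda>l. y l + x * z l"])
      (simp add: distrib_right sum.distrib sum_distrib_left mult.assoc)
qed

lemma row_mem_row_span: "A l \<in> row_span A"
proof -
  have "(\<Sum>l'\<in>UNIV. (if l' = l then 1 else 0) * A l' i) = (\<Sum>l'\<in>UNIV. if l' = l then A l i else 0)" for i
    by (rule sum.cong) auto
  then show ?thesis
    unfolding row_span_def by (intro CollectI exI[of _ "\<lambda>l'. if l' = l then 1 else 0"]) simp
qed

lemma form_vanishes_on_row_span: "form_vanishes_on (row_span A) v \<Longrightarrow> column_relation A v"
  unfolding form_vanishes_on_def column_relation_def using row_mem_row_span by blast

lemma column_relation_row_span: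
  assumes "column_relation A v" "s \<in> row_span A"
  shows "(\<Sum>i\<in>UNIV. v i * s i) = 0"
proof -
  from assms(2) obtain y where s: "s = (\<lambda>i. \<Sum>l\<in>UNIV. y l * A l i)" unfolding row_span_def by blast
  have "(\<Sum>i\<in>UNIV. v i * s i) = (\<Sum>l\<in>UNIV. y l * (\<Sum>i\<in>UNIV. v i * A l i))"
    unfolding s sum_distrib_left by (subst sum.swap) (simp add: mult_ac)
  then show ?thesis using assms(1) by (simp add: column_relation_def)
qed

text \<open>A circuit through the minimum of the support of a relation has the same minimum, so its
  broken circuit lies in the broken part of the relation.\<close>

lemma broken_circuit_complex_no_broken_relation:
  fixes A :: "'l::finite \<Rightarrow> 'n::{finite,linorder} \<Rightarrow> 'a::field"
  assumes "S \<in> broken_circuit_complex (column_indep A)"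
  shows "no_broken_relation (row_span A) UNIV S"
  unfolding no_broken_relation_def
proof (intro allI impI notI, elim conjE)
  fix v assume v: "form_vanishes_on (row_span A) v" "form_support v \<noteq> {}"
    and sub: "form_support v - {Min (form_support v)} \<subseteq> S"
  let ?m = "Min (form_support v)"
  have m: "?m \<in> form_support v" using v(2) by (intro Min_in) auto
  obtain C where C: "matroid_circuit (column_indep A) C" "?m \<in> C" "C \<subseteq> form_support v"
    using circuit_through[OF form_vanishes_on_row_span[OF v(1)] m] .
  have "Min C = ?m" using C by (intro Min_eqI) auto
  then have "C - {Min C} \<subseteq> S" using C sub by auto
  moreover have "C - {Min C} \<in> broken_circuits (column_indep A)"
    using C(1) unfolding broken_circuits_def by blast
  ultimately show False using assms unfolding broken_circuit_complex_def by blast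
qed

lemma broken_circuit_complex_indep:
  fixes A :: "'l::finite \<Rightarrow> 'n::{finite,linorder} \<Rightarrow> 'a::field"
  assumes "S \<in> broken_circuit_complex (column_indep A)"
  shows "column_indep A S"
proof (rule ccontr)
  assume "\<not> column_indep A S"
  then obtain C where C: "matroid_circuit (column_indep A) C" "C \<subseteq> S"
    by (rule dependent_imp_circuit)
  have "C - {Min C} \<in> broken_circuits (column_indep A)"
    using C(1) unfolding broken_circuits_def by blast
  moreover have "C - {Min C} \<subseteq> S" using C(2) by blast
  ultimately show False using assms unfolding broken_circuit_complex_def by blast
qed

text \<open>The exponents of the standard monomials of bounded degree: those that survive in the
  Stanley-Reisner ring of the broken circuit complex.\<close>

definition nbc_exps :: "('n::{finite,linorder} set \<Rightarrow> bool) \<Rightarrow> nat \<Rightarrow> ('n \<Rightarrow>\<^sub>0 nat) set"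
  where "nbc_exps I m = {e. Poly_Mapping.keys e \<in> broken_circuit_complex I \<and> exp_degree e \<le> m}"

lemma finite_nbc_exps [simp]: "finite (nbc_exps I m)"
  by (rule finite_subset[OF _ finite_exps_le[of UNIV m]]) (auto simp: nbc_exps_def exps_le_def)

lemma nbc_exps_mono: "m \<le> m' \<Longrightarrow> nbc_exps I m \<subseteq> nbc_exps I m'"
  by (auto simp: nbc_exps_def)

lemma binomial_add_mono: "s \<le> q \<Longrightarrow> ((m + s) choose s) \<le> ((m + q) choose q)"
  using binomial_right_mono[of "m + s" "m + q" m]
  by (metis add_left_mono binomial_symmetric diff_add_inverse le_add1 add.commute)

text \<open>The monomials are covered by the faces containing their supports; faces with fewer than
  \<open>Suc q\<close> elements contribute only lower order in \<open>m\<close>.\<close>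

lemma card_nbc_exps_le:
  fixes I :: "'n::{finite,linorder} set \<Rightarrow> bool"
  assumes "\<And>S. S \<in> broken_circuit_complex I \<Longrightarrow> card S \<le> Suc q"
  shows "card (nbc_exps I m) \<le>
    card {S \<in> broken_circuit_complex I. card S = Suc q} * ((m + Suc q) choose Suc q) +
    card (UNIV :: 'n set set) * ((m + Suc q) choose q)"
proof -
  let ?B = "broken_circuit_complex I" and ?T = "{S \<in> broken_circuit_complex I. card S = Suc q}"
  have "nbc_exps I m \<subseteq> (\<Union>S\<in>?B. exps_le S m)"
    by (auto simp: nbc_exps_def exps_le_def)
  then have "card (nbc_exps I m) \<le> card (\<Union>S\<in>?B. exps_le S m)"
    by (intro card_mono) auto
  also have "\<dots> \<le> (\<Sum>S\<in>?B. card (exps_le S m))" by (rule card_UN_le) simp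
  also have "\<dots> = (\<Sum>S\<in>?T. card (exps_le S m)) + (\<Sum>S\<in>?B - ?T. card (exps_le S m))"
    by (subst sum.subset_diff[of ?T]) auto
  also have "\<dots> \<le> card ?T * ((m + Suc q) choose Suc q) + card (?B - ?T) * ((m + Suc q) choose q)"
  proof (rule add_mono)
    show "(\<Sum>S\<in>?T. card (exps_le S m)) \<le> card ?T * ((m + Suc q) choose Suc q)"
      by (simp add: card_exps_le)
    have "card (exps_le S m) \<le> ((m + Suc q) choose q)" if "S \<in> ?B - ?T" for S
    proof -
      have "card S \<noteq> Suc q" "card S \<le> Suc q" using that assms by auto
      then have "card S \<le> q" by simp
      then have "card (exps_le S m) \<le> ((m + q) choose q)"
        unfolding card_exps_le by (rule binomial_add_mono)
      also have "\<dots> \<le> ((m + Suc q) choose q)" by (rule binomial_right_mono) simp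
      finally show ?thesis .
    qed
    then show "(\<Sum>S\<in>?B - ?T. card (exps_le S m)) \<le> card (?B - ?T) * ((m + Suc q) choose q)"
      using sum_bounded_above[of "?B - ?T" "\<lambda>S. card (exps_le S m)"] by simp
  qed
  also have "\<dots> \<le> card ?T * ((m + Suc q) choose Suc q) + card (UNIV :: 'n set set) * ((m + Suc q) choose q)"
    by (intro add_left_mono mult_le_mono1 card_mono[OF _ subset_UNIV]) (rule finite)
  finally show ?thesis .
qed

text \<open>Only monomials whose support is a whole face of size \<open>r\<close> are counted, so
  that the face can be recovered from the monomial. Full support is forced by the factor
  \<open>one S\<close>, which shifts the degree by \<open>r\<close>.\<close>

lemma card_nbc_exps_ge:
  "card {S \<in> broken_circuit_complex I. card S = r} * ((m + r) choose r) \<le> card (nbc_exps I (m + r))"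
proof -
  let ?T = "{S \<in> broken_circuit_complex I. card S = r}"
  define one where "one S = (\<Sum>i\<in>S. Poly_Mapping.single i (1::nat))" for S :: "'a set"
  have lookup_one: "Poly_Mapping.lookup (one S) i = (if i \<in> S then 1 else 0)" for S i
  proof -
    have "Poly_Mapping.lookup (one S) i = (\<Sum>j\<in>S. if j = i then 1 else 0)"
      unfolding one_def lookup_sum by (rule sum.cong) (auto simp: lookup_single when_def)
    then show ?thesis by simp
  qed
  have deg: "exp_degree (one S) = card S" for S
    by (simp add: exp_degree_def lookup_one sum.If_cases)
  have keys: "Poly_Mapping.keys (one S + e) = S" if "e \<in> exps_le S m" for S e
  proof -
    have "Poly_Mapping.lookup e i = 0" if "i \<notin> S" for i
    proof -
      have "i \<notin> Poly_Mapping.keys e" using that \<open>e \<in> exps_le S m\<close> by (auto simp: exps_le_def)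
      then show ?thesis by (simp add: in_keys_iff)
    qed
    then have "i \<in> Poly_Mapping.keys (one S + e) \<longleftrightarrow> i \<in> S" for i
      by (cases "i \<in> S") (simp_all add: in_keys_iff lookup_add lookup_one)
    then show ?thesis by blast
  qed
  define f where "f = (\<lambda>(S, e). one S + e)"
  have "card (Sigma ?T (\<lambda>S. exps_le S m)) \<le> card (nbc_exps I (m + r))"
  proof (rule card_inj_on_le[of f])
    show "inj_on f (Sigma ?T (\<lambda>S. exps_le S m))"
    proof (rule inj_onI, clarsimp simp: f_def)
      fix S e S' e'
      assume "e \<in> exps_le S m" "e' \<in> exps_le S' m" "one S + e = one S' + e'"
      moreover have "S = S'"
        using keys[OF \<open>e \<in> exps_le S m\<close>] keys[OF \<open>e' \<in> exps_le S' m\<close>] \<open>one S + e = one S' + e'\<close>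
        by simp
      ultimately show "S = S' \<and> e = e'" by simp
    qed
    show "f ` Sigma ?T (\<lambda>S. exps_le S m) \<subseteq> nbc_exps I (m + r)"
      using keys deg by (auto simp: f_def nbc_exps_def exp_degree_add) (auto simp: exps_le_def)
  qed simp
  also have "card (Sigma ?T (\<lambda>S. exps_le S m)) = (\<Sum>S\<in>?T. card (exps_le S m))"
    by (subst card_SigmaI) auto
  also have "\<dots> = card ?T * ((m + r) choose r)" by (simp add: card_exps_le)
  finally show ?thesis .
qed

locale arrangement = field_subset F
  for F :: "'a::field_char_0 set" +
  fixes A :: "'l::finite \<Rightarrow> 'n::{finite,linorder} \<Rightarrow> 'a"
  assumes row_mem: "A l i \<in> F"
begin

text \<open>Circuits refer to coefficients from the whole type, yet carry a vector over
  \<open>F\<close>: if no column of \<open>C\<close> were an \<open>F\<close>-combination of the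
  others, separating functionals would make \<open>C\<close> independent over the whole
  type.\<close>

lemma circuit_vector:
  assumes C: "matroid_circuit (column_indep A) C"
  obtains v where "\<And>i. v i \<in> F" "column_relation A v" "form_support v = C"
proof -
  define spanned where "spanned j \<longleftrightarrow> (\<exists>\<beta>. (\<forall>i. \<beta> i \<in> F) \<and> (\<forall>l. A l j = (\<Sum>i\<in>C - {j}. \<beta> i * A l i)))" for j
  have "\<exists>j\<in>C. spanned j"
  proof (rule ccontr)
    assume neg: "\<not> ?thesis"
    have "column_indep A C"
      unfolding column_indep_def
    proof (intro allI impI, elim conjE)
      fix v assume v: "column_relation A v" "form_support v \<subseteq> C"
      have "v j = 0" for j
      proof (cases "j \<in> C")
        case False
        then show ?thesis using v(2) by (auto simp: form_support_def)
      next
        case True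
        have "spanned j \<or> (\<exists>\<eta>. (\<forall>l. \<eta> l \<in> F) \<and> (\<forall>i\<in>C - {j}. (\<Sum>l\<in>UNIV. \<eta> l * A l i) = 0) \<and>
            (\<Sum>l\<in>UNIV. \<eta> l * A l j) = 1)"
          unfolding spanned_def by (rule span_or_separating_functional) (auto simp: row_mem)
        then obtain \<eta> where \<eta>: "\<forall>i\<in>C - {j}. (\<Sum>l\<in>UNIV. \<eta> l * A l i) = 0"
          "(\<Sum>l\<in>UNIV. \<eta> l * A l j) = 1"
          using neg True by blast
        have "0 = (\<Sum>l\<in>UNIV. \<eta> l * (\<Sum>i\<in>UNIV. v i * A l i))"
          using v(1) by (simp add: column_relation_def)
        also have "\<dots> = (\<Sum>i\<in>UNIV. v i * (\<Sum>l\<in>UNIV. \<eta> l * A l i))"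
          unfolding sum_distrib_left by (subst sum.swap) (simp add: mult_ac)
        also have "\<dots> = (\<Sum>i\<in>UNIV. if i = j then v j else 0)"
        proof (rule sum.cong)
          fix i
          have "v i = 0" if "i \<notin> C" using that v(2) by (auto simp: form_support_def)
          then show "v i * (\<Sum>l\<in>UNIV. \<eta> l * A l i) = (if i = j then v j else 0)"
            using \<eta> by (cases "i \<in> C") auto
        qed simp
        finally show ?thesis by simp
      qed
      then show "form_support v = {}" by (simp add: form_support_empty_iff)
    qed
    then show False using C by (simp add: matroid_circuit_def)
  qed
  then obtain j \<beta> where j: "j \<in> C" and \<beta>: "\<forall>i. \<beta> i \<in> F"
    "\<forall>l. A l j = (\<Sum>i\<in>C - {j}. \<beta> i * A l i)"
    unfolding spanned_def by (elim bexE exE conjE)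
  define v where "v i = (if i = j then - 1 else if i \<in> C then \<beta> i else 0)" for i
  have rel: "column_relation A v"
    unfolding column_relation_def
  proof
    fix l
    have "(\<Sum>i\<in>UNIV. v i * A l i) = (\<Sum>i\<in>C. v i * A l i)"
      by (rule sum.mono_neutral_right) (use j in \<open>auto simp: v_def\<close>)
    also have "\<dots> = - A l j + (\<Sum>i\<in>C - {j}. v i * A l i)"
      using j by (subst sum.remove[of _ j]) (auto simp: v_def)
    also have "(\<Sum>i\<in>C - {j}. v i * A l i) = (\<Sum>i\<in>C - {j}. \<beta> i * A l i)"
      by (rule sum.cong) (auto simp: v_def)
    finally show "(\<Sum>i\<in>UNIV. v i * A l i) = 0" using \<beta>(2) by simp
  qed
  have sub: "form_support v \<subseteq> C" using j by (auto simp: form_support_def v_def)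
  have "form_support v \<noteq> {}" by (auto simp: form_support_def v_def)
  then have "\<not> column_indep A (form_support v)"
    using rel unfolding column_indep_def by blast
  then have "form_support v = C" using C sub unfolding matroid_circuit_def by blast
  moreover have "v i \<in> F" for i using \<beta>(1) by (auto simp: v_def)
  ultimately show thesis using that rel by blast
qed

lemma column_indep_card:
  assumes "column_indep A I"
  shows "card I \<le> CARD('l)"
proof (rule ccontr)
  assume "\<not> card I \<le> CARD('l)"
  then have card: "card (UNIV :: 'l set) < card I" by simp
  obtain w where "\<And>i. w i \<in> F" and w: "\<exists>i\<in>I. w i \<noteq> 0"
      "\<And>l. l \<in> UNIV \<Longrightarrow> (\<Sum>i\<in>I. w i * A l i) = 0"
    by (rule homogeneous_system_solution[OF _ _ card, of "\<lambda>i l. A l i"]) (auto simp: row_mem)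
  define v where "v i = (if i \<in> I then w i else 0)" for i
  have "(\<Sum>i\<in>UNIV. v i * A l i) = (\<Sum>i\<in>I. w i * A l i)" for l
    by (rule sum.mono_neutral_cong_right) (auto simp: v_def)
  then have "column_relation A v" using w(2) by (simp add: column_relation_def)
  moreover have "form_support v \<subseteq> I" "form_support v \<noteq> {}"
    using w(1) by (auto simp: form_support_def v_def)
  ultimately show False using assms unfolding column_indep_def by blast
qed

abbreviation "Br \<equiv> broken_circuit_complex (column_indep A)"
abbreviation "J \<equiv> ideal_gen F (cpolys F A)"

lemma cpolys_carrier: "cpolys F A \<subseteq> mpoly_carrier F"
  by (auto simp: cpolys_def cpoly_def intro!: carrier_sum carrier_mult carrier_Const carrier_prod carrier_Var)

text \<open>Straightening: the circuit polynomial rewrites a monomial divisible by a broken circuit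
  into monomials of the same degree in which the missing minimum \<open>m\<close> takes the place of
  some larger \<open>i\<close>.\<close>

lemma nbc_normal_form_monomial:
  "\<exists>w. (\<forall>b. w b \<in> F) \<and>
    Poly_Mapping.single e 1 - coeff_poly (nbc_exps (column_indep A) (exp_degree e)) w \<in> J"
proof -
  \<comment> \<open>Weights each variable by its position in the order. Trading \<open>i\<close> for
    the smaller \<open>m\<close> lowers the weight, which makes the rewriting stop.\<close>
  define ht where "ht e = (\<Sum>i\<in>UNIV. Poly_Mapping.lookup e i * card {j. j < i})" for e :: "'n \<Rightarrow>\<^sub>0 nat"
  have ht_add: "ht (e + e') = ht e + ht e'" for e e'
    by (simp add: ht_def lookup_add distrib_right sum.distrib)
  have ht_single: "ht (Poly_Mapping.single i 1) = card {j. j < i}" for i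
  proof -
    have "ht (Poly_Mapping.single i 1) = (\<Sum>i'\<in>UNIV. if i' = i then card {j. j < i} else 0)"
      unfolding ht_def by (rule sum.cong) (auto simp: lookup_single when_def)
    then show ?thesis by simp
  qed
  show ?thesis
  proof (induction e rule: measure_induct_rule[of ht])
    case (less e)
    let ?N = "nbc_exps (column_indep A) (exp_degree e)"
    show ?case
    proof (cases "Poly_Mapping.keys e \<in> Br")
      case True
      have e: "e \<in> ?N" using True by (simp add: nbc_exps_def)
      have "coeff_poly ?N (\<lambda>b. if b = e then 1 else 0 :: 'a) = Poly_Mapping.single e 1"
        by (rule poly_mapping_eqI) (use e in \<open>auto simp: lookup_coeff_poly lookup_single when_def\<close>)
      then show ?thesis
        by (intro exI[of _ "\<lambda>b. if b = e then 1 else 0 :: 'a"]) (simp add: ideal_gen_zero)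
    next
      case False
      then obtain C where C: "matroid_circuit (column_indep A) C"
        and sub: "C - {Min C} \<subseteq> Poly_Mapping.keys e"
        unfolding broken_circuit_complex_def broken_circuits_def by blast
      obtain v where v: "\<And>i. v i \<in> F" "column_relation A v" "form_support v = C"
        using circuit_vector[OF C] by blast
      define m where "m = Min C"
      have "C \<noteq> {}" using C by (auto simp: matroid_circuit_def column_indep_def)
      then have mC: "m \<in> C" unfolding m_def by (intro Min_in) auto
      define one where "one S = (\<Sum>i\<in>S. Poly_Mapping.single i (1::nat))" for S :: "'n set"
      have lookup_one: "Poly_Mapping.lookup (one S) i = (if i \<in> S then 1 else 0)" for S i
      proof -
        have "Poly_Mapping.lookup (one S) i = (\<Sum>j\<in>S. if j = i then 1 else 0)"
          unfolding one_def lookup_sum by (rule sum.cong) (auto simp: lookup_single when_def)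
        then show ?thesis by simp
      qed
      define e' where "e' = e - one (C - {m})"
      have e: "e = e' + one (C - {m})"
      proof (rule poly_mapping_eqI)
        fix i
        have "Poly_Mapping.lookup e i > 0" if "i \<in> C - {m}"
          using that sub by (auto simp: m_def in_keys_iff)
        then show "Poly_Mapping.lookup e i = Poly_Mapping.lookup (e' + one (C - {m})) i"
          by (auto simp: e'_def lookup_add lookup_minus lookup_one)
      qed
      have onei: "one (C - {i}) + Poly_Mapping.single i 1 = one (C - {m}) + Poly_Mapping.single m 1"
        if "i \<in> C" for i
        using that mC by (intro poly_mapping_eqI) (auto simp: lookup_add lookup_one lookup_single when_def)
      have deg: "exp_degree (e' + one (C - {i})) = exp_degree e" if "i \<in> C" for i
      proof -
        have "exp_degree (e' + one (C - {i}) + Poly_Mapping.single i 1) =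
          exp_degree (e' + one (C - {m}) + Poly_Mapping.single m 1)"
          using onei[OF that] by (simp add: add.assoc)
        then show ?thesis unfolding e by (simp add: exp_degree_add)
      qed
      have ht_less: "ht (e' + one (C - {i})) < ht e" if i: "i \<in> C - {m}" for i
      proof -
        have "m \<le> i" unfolding m_def using i by (intro Min_le) auto
        then have "m < i" using i by auto
        then have "{j. j < m} \<subset> {j. j < i}" by auto
        then have c: "card {j. j < m} < card {j. j < i}" by (intro psubset_card_mono) auto
        have "ht (e' + one (C - {i}) + Poly_Mapping.single i 1) =
          ht (e' + one (C - {m}) + Poly_Mapping.single m 1)"
          using onei[of i] i by (simp add: add.assoc)
        then show ?thesis using c unfolding e ht_add ht_single by linarith
      qed
      have "\<forall>i\<in>C - {m}. \<exists>w. (\<forall>b. w b \<in> F) \<and>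
          Poly_Mapping.single (e' + one (C - {i})) 1 - coeff_poly ?N w \<in> J"
      proof
        fix i assume i: "i \<in> C - {m}"
        from less.IH[OF ht_less[OF i]] deg[of i] i show "\<exists>w. (\<forall>b. w b \<in> F) \<and>
          Poly_Mapping.single (e' + one (C - {i})) 1 - coeff_poly ?N w \<in> J" by simp
      qed
      from bchoice[OF this] obtain W where W: "\<forall>i\<in>C - {m}. (\<forall>b. W i b \<in> F) \<and>
        Poly_Mapping.single (e' + one (C - {i})) 1 - coeff_poly ?N (W i) \<in> J" by (elim exE)
      define w where "w b = (\<Sum>i\<in>C - {m}. - (v i / v m) * W i b)" for b
      have vm: "v m \<noteq> 0" using mC v(3) by (auto simp: form_support_def)
      have prod_Var: "(\<Prod>j\<in>S. Var j) = (Poly_Mapping.single (one S) 1 :: ('n, 'a) mpoly)" for S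
      proof (induction S rule: infinite_finite_induct)
        case (insert x S)
        then show ?case by (simp add: one_def Var_def mult_single)
      qed (simp_all add: one_def)
      have cp: "Poly_Mapping.single e' (inverse (v m)) * cpoly v =
        (\<Sum>i\<in>C. Poly_Mapping.single (e' + one (C - {i})) (v i / v m))"
        unfolding cpoly_def v(3) prod_Var
        by (simp add: sum_distrib_left Const_def mult_single divide_inverse mult_ac)
      have "cpoly v \<in> cpolys F A" using v C unfolding cpolys_def by blast
      then have inJ: "Poly_Mapping.single e' (inverse (v m)) * cpoly v \<in> J"
        by (intro ideal_gen_mult_gen carrier_single inverse_mem v(1))
      have cpw: "coeff_poly ?N w = (\<Sum>i\<in>C - {m}. Const (- (v i / v m)) * coeff_poly ?N (W i))"
      proof (rule poly_mapping_eqI)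
        fix b
        show "Poly_Mapping.lookup (coeff_poly ?N w) b =
            Poly_Mapping.lookup (\<Sum>i\<in>C - {m}. Const (- (v i / v m)) * coeff_poly ?N (W i)) b"
          by (simp add: lookup_sum lookup_coeff_poly lookup_Const_mult w_def)
      qed
      have "Poly_Mapping.single e 1 - coeff_poly ?N w =
        Poly_Mapping.single e' (inverse (v m)) * cpoly v -
        (\<Sum>i\<in>C - {m}. Const (v i / v m) *
          (Poly_Mapping.single (e' + one (C - {i})) 1 - coeff_poly ?N (W i)))"
      proof -
        have "(\<Sum>i\<in>C. Poly_Mapping.single (e' + one (C - {i})) (v i / v m)) =
          Poly_Mapping.single e 1 + (\<Sum>i\<in>C - {m}. Poly_Mapping.single (e' + one (C - {i})) (v i / v m))"
          using vm e by (subst sum.remove[OF _ mC]) simp_all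
        moreover have "Const x * (Poly_Mapping.single d 1 - p) = Poly_Mapping.single d x - Const x * p"
          for x d and p :: "('n, 'a) mpoly"
          by (simp add: right_diff_distrib Const_def mult_single)
        moreover have "Const (- x) * p = - (Const x * p)" for x and p :: "('n, 'a) mpoly"
          by (simp add: Const_def single_uminus)
        ultimately show ?thesis
          unfolding cp cpw by (simp add: sum_subtractf sum_negf)
      qed
      also have "\<dots> \<in> J"
      proof (intro ideal_gen_diff inJ ideal_gen_sum)
        fix i assume "i \<in> C - {m}"
        then show "Const (v i / v m) *
          (Poly_Mapping.single (e' + one (C - {i})) 1 - coeff_poly ?N (W i)) \<in> J"
          using W by (intro ideal_gen_mult carrier_Const divide_mem v(1)) blast
      qed
      finally have "Poly_Mapping.single e 1 - coeff_poly ?N w \<in> J" .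
      moreover have "\<forall>b. w b \<in> F"
        unfolding w_def using W v(1) by (intro allI sum_mem mult_mem uminus_mem divide_mem) auto
      ultimately show ?thesis by (intro exI[of _ w] conjI)
    qed
  qed
qed

lemma nbc_normal_form:
  assumes p: "p \<in> mpoly_carrier F" "degree_le m p"
  obtains w where "\<And>b. w b \<in> F" "p - coeff_poly (nbc_exps (column_indep A) m) w \<in> J"
proof -
  let ?N = "nbc_exps (column_indep A)"
  obtain W where W: "\<And>e b. W e b \<in> F"
    "\<And>e. Poly_Mapping.single e 1 - coeff_poly (?N (exp_degree e)) (W e) \<in> J"
    using nbc_normal_form_monomial by metis
  define w where "w b = (\<Sum>e\<in>Poly_Mapping.keys p. Poly_Mapping.lookup p e *
    (if b \<in> ?N (exp_degree e) then W e b else 0))" for b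
  have cpw: "coeff_poly (?N m) w =
    (\<Sum>e\<in>Poly_Mapping.keys p. Const (Poly_Mapping.lookup p e) * coeff_poly (?N (exp_degree e)) (W e))"
  proof (rule poly_mapping_eqI)
    fix b
    have "b \<in> ?N m" if "e \<in> Poly_Mapping.keys p" "b \<in> ?N (exp_degree e)" for e
      using that p(2) nbc_exps_mono[of "exp_degree e" m] by (auto simp: degree_le_def)
    then have "w b = 0" if "b \<notin> ?N m"
      unfolding w_def using that by (intro sum.neutral) auto
    then have "Poly_Mapping.lookup (coeff_poly (?N m) w) b = w b"
      by (simp add: lookup_coeff_poly)
    then show "Poly_Mapping.lookup (coeff_poly (?N m) w) b = Poly_Mapping.lookup
      (\<Sum>e\<in>Poly_Mapping.keys p. Const (Poly_Mapping.lookup p e) * coeff_poly (?N (exp_degree e)) (W e)) b"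
      by (simp add: lookup_sum lookup_coeff_poly lookup_Const_mult w_def)
  qed
  have pe: "p = (\<Sum>e\<in>Poly_Mapping.keys p. Const (Poly_Mapping.lookup p e) * Poly_Mapping.single e 1)"
    by (rule trans[OF poly_mapping_sum_single]) (simp add: Const_def mult_single)
  have "p - coeff_poly (?N m) w = (\<Sum>e\<in>Poly_Mapping.keys p. Const (Poly_Mapping.lookup p e) *
      (Poly_Mapping.single e 1 - coeff_poly (?N (exp_degree e)) (W e)))"
    unfolding cpw right_diff_distrib sum_subtractf by (rule arg_cong2[where f = "(-)", OF pe refl])
  also have "\<dots> \<in> J"
    using p(1) by (intro ideal_gen_sum ideal_gen_mult W carrier_Const) (simp add: mpoly_carrier_def)
  finally have inJ: "p - coeff_poly (?N m) w \<in> J" .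
  show thesis
  proof (rule that[OF _ inJ])
    fix b
    have "(if b \<in> ?N (exp_degree e) then W e b else 0) \<in> F" for e using W(1) by simp
    then show "w b \<in> F"
      unfolding w_def using p(1) by (intro sum_mem mult_mem) (simp_all add: mpoly_carrier_def)
  qed
qed

text \<open>Multiplication by the \<open>s i\<close> turns the circuit polynomial into the linear
  relation times a power of \<open>t\<close>. The factor is kept in the conclusion because
  \<open>s\<close> may consist of non-invertible series: \<open>t = 1\<close> serves for points,
  \<open>t = fps_X\<close> for the branch.\<close>

lemma cpoly_vanishes:
  fixes h :: "'a \<Rightarrow> 'b::comm_ring_1" and z s :: "'n \<Rightarrow> 'b"
  assumes h: "coeff_hom h" and g: "g \<in> cpolys F A" and zs: "\<And>i. z i * s i = t"
    and s: "\<And>v. column_relation A v \<Longrightarrow> (\<Sum>i\<in>UNIV. h (v i) * s i) = 0"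
  shows "(\<Prod>i\<in>UNIV. s i) * meval h g z = 0"
proof -
  interpret coeff_hom h by fact
  from g obtain v where v: "g = cpoly v" "column_relation A v" unfolding cpolys_def by blast
  let ?C = "form_support v"
  have "(\<Prod>i\<in>?C. s i) * meval h g z =
    (\<Sum>i\<in>?C. h (v i) * ((\<Prod>j\<in>?C. s j) * (\<Prod>j\<in>?C - {i}. z j)))"
    by (simp add: v(1) cpoly_def meval_simps sum_distrib_left mult_ac)
  also have "\<dots> = (\<Sum>i\<in>?C. h (v i) * s i * t ^ (card ?C - 1))"
  proof (rule sum.cong)
    fix i assume i: "i \<in> ?C"
    have "(\<Prod>j\<in>?C. s j) * (\<Prod>j\<in>?C - {i}. z j) = s i * (\<Prod>j\<in>?C - {i}. z j * s j)"
      using i by (simp add: prod.remove[of ?C i] prod.distrib mult_ac)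
    also have "(\<Prod>j\<in>?C - {i}. z j * s j) = t ^ (card ?C - 1)"
      using i by (simp add: zs)
    finally show "h (v i) * ((\<Prod>j\<in>?C. s j) * (\<Prod>j\<in>?C - {i}. z j)) = h (v i) * s i * t ^ (card ?C - 1)"
      by (simp add: mult_ac)
  qed simp
  also have "\<dots> = (\<Sum>i\<in>?C. h (v i) * s i) * t ^ (card ?C - 1)"
    by (simp add: sum_distrib_right)
  also have "(\<Sum>i\<in>?C. h (v i) * s i) = (\<Sum>i\<in>UNIV. h (v i) * s i)"
    by (rule sum.mono_neutral_left) (auto simp: form_support_def hom_0)
  finally have "(\<Prod>i\<in>?C. s i) * meval h g z = 0" using s[OF v(2)] by simp
  moreover have "(\<Prod>i\<in>UNIV. s i) = (\<Prod>i\<in>UNIV - ?C. s i) * (\<Prod>i\<in>?C. s i)"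
    by (rule prod.subset_diff) auto
  ultimately show ?thesis by (simp add: mult.assoc)
qed

text \<open>Vanishing on the reciprocal linear space, tested at the coordinatewise inverses of
  vectors of the row span; the span is taken over the whole type, not over \<open>F\<close>.\<close>

definition vanishes :: "('n, 'a) mpoly \<Rightarrow> bool"
  where "vanishes p \<longleftrightarrow> (\<forall>s\<in>row_span A. (\<forall>i. s i \<noteq> 0) \<longrightarrow> meval (\<lambda>x. x) p (\<lambda>i. inverse (s i)) = 0)"

lemma J_vanishes:
  assumes "p \<in> J" shows "vanishes p"
  unfolding vanishes_def
proof (intro ballI impI)
  fix s assume s: "s \<in> row_span A" "\<forall>i. s i \<noteq> 0"
  show "meval (\<lambda>x. x) p (\<lambda>i. inverse (s i)) = 0"
  proof (rule eval_id.meval_ideal_gen[OF assms])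
    fix g assume "g \<in> cpolys F A"
    then have "(\<Prod>i\<in>UNIV. s i) * meval (\<lambda>x. x) g (\<lambda>i. inverse (s i)) = 0"
      by (rule cpoly_vanishes[OF coeff_hom_id, where t = 1])
        (use s column_relation_row_span in auto)
    then show "meval (\<lambda>x. x) g (\<lambda>i. inverse (s i)) = 0" using s(2) by simp
  qed
qed

text \<open>The normal form of \<open>p\<close> is a vanishing combination of inverse monomials
  without broken circuits, hence zero. Together with \<open>J_vanishes\<close> this identifies the
  circuit ideal with a vanishing ideal.\<close>

lemma vanishes_imp_J:
  assumes p: "p \<in> mpoly_carrier F" and van: "vanishes p"
  shows "p \<in> J"
proof -
  let ?N = "nbc_exps (column_indep A)"
  obtain m where m: "degree_le m p" using degree_le_ex by blast
  obtain w where w: "\<And>b. w b \<in> F" "p - coeff_poly (?N m) w \<in> J"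
    using nbc_normal_form[OF p m] by blast
  have "\<forall>b\<in>?N m. w b = 0"
  proof (rule inverse_monomials_independent[OF linear_subspace_row_span[of A], where E = UNIV])
    fix s assume s: "s \<in> row_span A" "\<And>i. i \<in> UNIV \<Longrightarrow> s i \<noteq> 0"
    have "meval (\<lambda>x. x) (p - (p - coeff_poly (?N m) w)) (\<lambda>i. inverse (s i)) = 0"
      using J_vanishes[OF w(2)] van s by (simp add: vanishes_def eval_id.meval_diff)
    then show "(\<Sum>a\<in>?N m. w a * mono_val (\<lambda>i. inverse (s i)) a) = 0"
      by (simp add: eval_id.meval_coeff_poly)
  next
    fix a assume "a \<in> ?N m"
    then show "Poly_Mapping.keys a \<subseteq> UNIV \<and> no_broken_relation (row_span A) UNIV (Poly_Mapping.keys a)"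
      by (simp add: nbc_exps_def broken_circuit_complex_no_broken_relation)
  qed simp
  then have "coeff_poly (?N m) w = 0"
    by (intro poly_mapping_eqI) (simp add: lookup_coeff_poly)
  then show ?thesis using w(2) by simp
qed

text \<open>Irreducibility of the reciprocal linear space: two vectors of the row span are joined by
  a line, and on it, after clearing denominators, \<open>p\<close> and \<open>q\<close> become
  univariate polynomials with product zero.\<close>

lemma vanishes_mult:
  assumes "vanishes (p * q)" "\<not> vanishes p"
  shows "vanishes q"
  unfolding vanishes_def
proof (intro ballI impI, rule ccontr)
  let ?ev = "meval (\<lambda>x. x)"
  from assms(2) obtain s where s: "s \<in> row_span A" "\<And>i. s i \<noteq> 0" "?ev p (\<lambda>i. inverse (s i)) \<noteq> 0"
    unfolding vanishes_def by blast
  fix t assume t: "t \<in> row_span A" "\<forall>i. t i \<noteq> 0" "?ev q (\<lambda>i. inverse (t i)) \<noteq> 0"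
  \<comment> \<open>The line \<open>s + x * u\<close> passes through \<open>s\<close> at
    \<open>x = 0\<close>, where \<open>p\<close> does not vanish, and through \<open>t\<close> at
    \<open>x = 1\<close>, where \<open>q\<close> does not.\<close>
  define u where "u i = t i + (- 1) * s i" for i
  have u: "u \<in> row_span A"
    unfolding u_def by (rule linear_subspace_axpy[OF linear_subspace_row_span t(1) s(1)])
  define l where "l i = [:s i, u i:]" for i
  have clear: "\<exists>f D. \<forall>x. (\<forall>i. Polynomial.poly (l i) x \<noteq> 0) \<longrightarrow> Polynomial.poly f x =
      (\<Prod>i\<in>UNIV. Polynomial.poly (l i) x) ^ D * ?ev r (\<lambda>i. inverse (Polynomial.poly (l i) x))" for r
  proof -
    obtain D where D: "degree_le D r" using degree_le_ex by blast
    define f where "f = (\<Sum>a\<in>Poly_Mapping.keys r. Polynomial.smult (Poly_Mapping.lookup r a)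
      (\<Prod>i\<in>UNIV. l i ^ (D - Poly_Mapping.lookup a i)))"
    have "Polynomial.poly f x =
        (\<Prod>i\<in>UNIV. Polynomial.poly (l i) x) ^ D * ?ev r (\<lambda>i. inverse (Polynomial.poly (l i) x))"
      if x: "\<forall>i. Polynomial.poly (l i) x \<noteq> 0" for x
    proof -
      let ?y = "\<lambda>i. Polynomial.poly (l i) x"
      have "(\<Prod>i\<in>UNIV. ?y i ^ (D - Poly_Mapping.lookup a i)) =
          (\<Prod>i\<in>UNIV. ?y i) ^ D * mono_val (\<lambda>i. inverse (?y i)) a" if a: "a \<in> Poly_Mapping.keys r" for a
      proof -
        have "Poly_Mapping.lookup a i \<le> D" for i
          using lookup_le_exp_degree[of a i] D a by (force simp: degree_le_def)
        then have "?y i ^ (D - Poly_Mapping.lookup a i) = ?y i ^ D * inverse (?y i) ^ Poly_Mapping.lookup a i" for i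
          using x by (simp add: power_diff divide_inverse power_inverse)
        then show ?thesis by (simp add: mono_val_def prod.distrib prod_power_distrib)
      qed
      then show ?thesis
        by (simp add: f_def poly_sum poly_prod poly_power meval_def sum_distrib_left mult_ac)
    qed
    then show ?thesis by blast
  qed
  obtain f D where f: "\<And>x. (\<forall>i. Polynomial.poly (l i) x \<noteq> 0) \<Longrightarrow> Polynomial.poly f x =
      (\<Prod>i\<in>UNIV. Polynomial.poly (l i) x) ^ D * ?ev p (\<lambda>i. inverse (Polynomial.poly (l i) x))"
    using clear[of p] by blast
  obtain g D' where g: "\<And>x. (\<forall>i. Polynomial.poly (l i) x \<noteq> 0) \<Longrightarrow> Polynomial.poly g x =
      (\<Prod>i\<in>UNIV. Polynomial.poly (l i) x) ^ D' * ?ev q (\<lambda>i. inverse (Polynomial.poly (l i) x))"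
    using clear[of q] by blast
  have "f * g = 0"
  proof (rule poly_eq_0_off_roots[of UNIV l])
    show "l i \<noteq> 0" for i using s(2) by (simp add: l_def)
    fix x assume "\<And>i. i \<in> UNIV \<Longrightarrow> Polynomial.poly (l i) x \<noteq> 0"
    then have x: "\<forall>i. Polynomial.poly (l i) x \<noteq> 0" by simp
    have "(\<lambda>i. s i + x * u i) \<in> row_span A"
      by (rule linear_subspace_axpy[OF linear_subspace_row_span s(1) u])
    then have "(\<lambda>i. Polynomial.poly (l i) x) \<in> row_span A" by (simp add: l_def)
    then have "?ev (p * q) (\<lambda>i. inverse (Polynomial.poly (l i) x)) = 0"
      by (rule assms(1)[unfolded vanishes_def, rule_format]) (use x in simp)
    then have "?ev p (\<lambda>i. inverse (Polynomial.poly (l i) x)) = 0 \<or>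
        ?ev q (\<lambda>i. inverse (Polynomial.poly (l i) x)) = 0"
      by (simp only: eval_id.meval_mult mult_eq_0_iff)
    then show "Polynomial.poly (f * g) x = 0"
      unfolding poly_mult f[OF x] g[OF x] by (elim disjE) simp_all
  qed simp
  moreover have "Polynomial.poly f 0 \<noteq> 0" using f[of 0] s by (simp add: l_def)
  moreover have "Polynomial.poly g 1 \<noteq> 0" using g[of 1] t by (simp add: l_def u_def)
  ultimately show False by auto
qed

end

section \<open>A power series branch of the central curve\<close>

text \<open>Differentiating a relation and dividing by \<open>fps_deriv \<tau>\<close> lowers its
  degree; the factors \<open>Suc i\<close> that appear are invertible in characteristic 0.\<close>

lemma transcendental_powers_independent:
  fixes \<tau> :: "'a::field_char_0 fps"
  assumes "fps_deriv \<tau> \<noteq> 0" "(\<Sum>i\<le>N. fps_const (w i) * \<tau> ^ i) = 0"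
  shows "\<forall>i\<le>N. w i = 0"
  using assms(2)
proof (induction N arbitrary: w)
  case 0
  then show ?case by simp
next
  case (Suc N)
  have "0 = fps_deriv (\<Sum>i\<le>Suc N. fps_const (w i) * \<tau> ^ i)" using Suc.prems by simp
  also have "\<dots> = (\<Sum>i\<le>Suc N. fps_const (w i) * (of_nat i * fps_deriv \<tau> * \<tau> ^ (i - 1)))"
    unfolding fps_deriv_sum by (rule sum.cong) (simp_all add: fps_deriv_power fps_of_nat)
  also have "\<dots> = (\<Sum>i\<le>N. fps_const (w (Suc i)) * (of_nat (Suc i) * fps_deriv \<tau> * \<tau> ^ i))"
    unfolding sum.atMost_Suc_shift by simp
  also have "\<dots> = fps_deriv \<tau> * (\<Sum>i\<le>N. fps_const (w (Suc i) * of_nat (Suc i)) * \<tau> ^ i)"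
    unfolding sum_distrib_left
    by (rule sum.cong) (simp_all only: fps_const_mult[symmetric] fps_of_nat mult_ac)
  finally have "(\<Sum>i\<le>N. fps_const (w (Suc i) * of_nat (Suc i)) * \<tau> ^ i) = 0"
    using assms(1) by simp
  from Suc.IH[OF this] have S: "w (Suc i) = 0" if "i \<le> N" for i
    using that by (simp del: of_nat_Suc)
  moreover have "w 0 = 0"
  proof -
    have "(\<Sum>i\<le>Suc N. fps_const (w i) * \<tau> ^ i) = fps_const (w 0)"
      unfolding sum.atMost_Suc_shift using S by simp
    then show ?thesis using Suc.prems by simp
  qed
  ultimately show ?case by (metis Suc_le_mono not0_implies_Suc)
qed

section \<open>Power series with coefficients in a subfield\<close>

definition fps_over :: "'a::zero set \<Rightarrow> 'a fps set"
  where "fps_over K = {f. \<forall>n. fps_nth f n \<in> K}"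

context field_subset
begin

lemma fps_over_const: "x \<in> F \<Longrightarrow> fps_const x \<in> fps_over F"
  and fps_over_zero: "0 \<in> fps_over F"
  and fps_over_one: "1 \<in> fps_over F"
  and fps_over_add: "f \<in> fps_over F \<Longrightarrow> g \<in> fps_over F \<Longrightarrow> f + g \<in> fps_over F"
  and fps_over_mult: "f \<in> fps_over F \<Longrightarrow> g \<in> fps_over F \<Longrightarrow> f * g \<in> fps_over F"
  by (auto simp: fps_over_def fps_mult_nth intro!: sum_mem)

lemma fps_over_sum: "(\<And>x. x \<in> I \<Longrightarrow> f x \<in> fps_over F) \<Longrightarrow> sum f I \<in> fps_over F"
  by (induction I rule: infinite_finite_induct) (auto intro: fps_over_zero fps_over_add)

lemma fps_over_prod: "(\<And>x. x \<in> I \<Longrightarrow> f x \<in> fps_over F) \<Longrightarrow> prod f I \<in> fps_over F"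
  by (induction I rule: infinite_finite_induct) (auto intro: fps_over_one fps_over_mult)

lemma fps_over_power: "f \<in> fps_over F \<Longrightarrow> f ^ n \<in> fps_over F"
  by (induction n) (auto intro: fps_over_one fps_over_mult)

lemma fps_over_mono_val: "(\<And>i. z i \<in> fps_over F) \<Longrightarrow> mono_val z a \<in> fps_over F"
  unfolding mono_val_def by (intro fps_over_prod fps_over_power)

text \<open>With the scalars written in elements independent over \<open>F\<close>, the identity
  splits at every power of the series variable. Linear dependence thus descends from the whole type
  to \<open>F\<close>.\<close>

lemma fps_relation_coordinates:
  fixes f :: "'x \<Rightarrow> 'a fps" and w :: "'x \<Rightarrow> 'a"
  assumes "finite I" and f: "\<And>x. x \<in> I \<Longrightarrow> f x \<in> fps_over F"
    and rel: "(\<Sum>x\<in>I. fps_const (w x) * f x) = 0"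
  obtains R u where "finite R" "\<And>x r. u x r \<in> F" "\<And>x. x \<in> I \<Longrightarrow> w x = (\<Sum>r\<in>R. u x r * r)"
    "\<And>r. r \<in> R \<Longrightarrow> (\<Sum>x\<in>I. fps_const (u x r) * f x) = 0"
proof (rule finite_family_coordinates[OF assms(1), of w])
  fix R u assume R: "finite R" and u: "\<And>x r. u x r \<in> F"
    and w: "\<And>x. x \<in> I \<Longrightarrow> w x = (\<Sum>r\<in>R. u x r * r)"
    and ind: "\<And>u. (\<And>r. r \<in> R \<Longrightarrow> u r \<in> F) \<Longrightarrow> (\<Sum>r\<in>R. u r * r) = 0 \<Longrightarrow> \<forall>r\<in>R. u r = 0"
  have "\<forall>r\<in>R. (\<Sum>x\<in>I. u x r * fps_nth (f x) n) = 0" for n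
  proof (rule ind)
    show "(\<Sum>x\<in>I. u x r * fps_nth (f x) n) \<in> F" for r
      using u f by (intro sum_mem mult_mem) (auto simp: fps_over_def)
    have "0 = fps_nth (\<Sum>x\<in>I. fps_const (w x) * f x) n" using rel by simp
    also have "\<dots> = (\<Sum>x\<in>I. (\<Sum>r\<in>R. u x r * r) * fps_nth (f x) n)"
      using w by (simp add: fps_sum_nth)
    also have "\<dots> = (\<Sum>r\<in>R. (\<Sum>x\<in>I. u x r * fps_nth (f x) n) * r)"
      unfolding sum_distrib_right by (subst sum.swap) (simp add: mult_ac)
    finally show "(\<Sum>r\<in>R. (\<Sum>x\<in>I. u x r * fps_nth (f x) n) * r) = 0" by simp
  qed
  then have zero: "(\<Sum>x\<in>I. fps_const (u x r) * f x) = 0" if "r \<in> R" for r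
    using that by (intro fps_ext) (simp add: fps_sum_nth)
  show thesis by (rule that[OF R u w zero])
qed

end

lemma (in coeff_hom) mono_val_hom: "mono_val (\<lambda>j. h (z j)) a = h (mono_val z a)"
  by (simp add: mono_val_def hom_prod hom_power)

lemma (in coeff_hom) meval_hom_point: "meval h q (\<lambda>j. h (z j)) = h (meval (\<lambda>t. t) q z)"
  by (simp add: meval_def hom_sum hom_mult mono_val_hom)

lemma card_option: "CARD('d::finite option) = Suc CARD('d)"
  by (simp add: card_UNIV_option)

fun all_rows :: "('d \<Rightarrow> 'n \<Rightarrow> 'a) \<Rightarrow> ('n \<Rightarrow> 'a) \<Rightarrow> 'd option \<Rightarrow> 'n \<Rightarrow> 'a"
  where "all_rows A c None = c" | "all_rows A c (Some j) = A j"

definition linear_form :: "('n::finite \<Rightarrow> 'a::comm_ring_1) \<Rightarrow> ('n, 'a) mpoly"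
  where "linear_form v = (\<Sum>i\<in>UNIV. Const (v i) * Var i)"

lemma (in coeff_hom) meval_linear_form: "meval h (linear_form v) z = (\<Sum>i\<in>UNIV. h (v i) * z i)"
  by (simp add: linear_form_def meval_simps)

lemma degree_le_linear_form: "degree_le 1 (linear_form v)"
  unfolding linear_form_def
proof (rule degree_le_sum)
  fix i
  show "degree_le 1 (Const (v i) * Var i)"
    using degree_le_mult[OF degree_le_Const degree_le_Var, of 0 "v i" i] by simp
qed

lemma (in field_subset) carrier_linear_form: "(\<And>i. v i \<in> F) \<Longrightarrow> linear_form v \<in> mpoly_carrier F"
  unfolding linear_form_def by (intro carrier_intros) auto

definition central_gens :: "'a::field set \<Rightarrow> ('d::finite \<Rightarrow> 'n::finite \<Rightarrow> 'a) \<Rightarrow> ('n \<Rightarrow> 'a) \<Rightarrow>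
    ('d \<Rightarrow> 'a) \<Rightarrow> ('n, 'a) mpoly set"
  where "central_gens K A c b =
    range (\<lambda>j. linear_form (A j) - Const (b j)) \<union> cpolys K (all_rows A c)"

lemma (in field_subset) fractions_common_denominator:
  assumes "finite I" and fr: "\<And>j. j \<in> I \<Longrightarrow> \<exists>p q. p \<in> mpoly_carrier F \<and> q \<in> mpoly_carrier F \<and>
      meval (\<lambda>t. t) q b \<noteq> 0 \<and> z j = meval (\<lambda>t. t) p b / meval (\<lambda>t. t) q b"
  obtains D P where "D \<in> mpoly_carrier F" "meval (\<lambda>t. t) D b \<noteq> 0" "\<And>j. P j \<in> mpoly_carrier F"
    "\<And>j. j \<in> I \<Longrightarrow> meval (\<lambda>t. t) D b * z j = meval (\<lambda>t. t) (P j) b"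
proof -
  have "\<exists>p q. p \<in> mpoly_carrier F \<and> q \<in> mpoly_carrier F \<and> meval (\<lambda>t. t) q b \<noteq> 0 \<and>
      (j \<in> I \<longrightarrow> z j = meval (\<lambda>t. t) p b / meval (\<lambda>t. t) q b)" for j
  proof (cases "j \<in> I")
    case True
    from fr[OF True] show ?thesis by auto
  next
    case False
    then show ?thesis
      by (intro exI[of _ 0] exI[of _ 1]) (simp add: carrier_zero carrier_one)
  qed
  then obtain p q where pq: "\<And>j. p j \<in> mpoly_carrier F" "\<And>j. q j \<in> mpoly_carrier F"
    "\<And>j. meval (\<lambda>t. t) (q j) b \<noteq> 0"
    "\<And>j. j \<in> I \<Longrightarrow> z j = meval (\<lambda>t. t) (p j) b / meval (\<lambda>t. t) (q j) b"
    by metis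
  define D where "D = (\<Prod>j\<in>I. q j)"
  define P where "P j = p j * (\<Prod>i\<in>I - {j}. q i)" for j
  show thesis
  proof (rule that)
    show "D \<in> mpoly_carrier F" unfolding D_def by (intro carrier_prod pq)
    show "meval (\<lambda>t. t) D b \<noteq> 0" unfolding D_def using pq(3) assms(1) by (simp add: eval_id.meval_prod)
    show "P j \<in> mpoly_carrier F" for j unfolding P_def by (intro carrier_mult carrier_prod pq)
    show "meval (\<lambda>t. t) D b * z j = meval (\<lambda>t. t) (P j) b" if "j \<in> I" for j
      using pq(3)[of j] that assms(1)
      by (simp add: D_def P_def pq(4) eval_id.meval_mult eval_id.meval_prod prod.remove[of I j])
  qed
qed

text \<open>The field \<open>k\<close> contains the entries of \<open>A\<close> and
  \<open>c\<close>, and \<open>K\<close> consists of fractions in \<open>b\<close> over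
  \<open>k\<close>. The series \<open>y\<close> are the slacks, placed in the row space by
  \<open>y_rel\<close>; \<open>xy\<close> is the complementarity condition with \<open>fps_X\<close>
  as barrier parameter. \<open>b_indep\<close> expresses genericity of \<open>b\<close>, and
  \<open>cx\<close> says that the cost varies along the branch.\<close>

locale central_branch =
  arr: arrangement k "all_rows A c" + K: field_subset K
  for k K :: "'a::field_char_0 set"
    and A :: "'d::finite \<Rightarrow> 'n::{finite,linorder} \<Rightarrow> 'a" and c :: "'n \<Rightarrow> 'a" +
  fixes b :: "'d \<Rightarrow> 'a" and x y :: "'n \<Rightarrow> 'a fps"
  assumes k_subset: "k \<subseteq> K"
    and b_mem: "b j \<in> K"
    and b_indep: "q \<in> mpoly_carrier k \<Longrightarrow> meval (\<lambda>t. t) q b = 0 \<Longrightarrow> q = 0"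
    and K_fraction: "z \<in> K \<Longrightarrow> \<exists>p q. p \<in> mpoly_carrier k \<and> q \<in> mpoly_carrier k \<and>
      meval (\<lambda>t. t) q b \<noteq> 0 \<and> z = meval (\<lambda>t. t) p b / meval (\<lambda>t. t) q b"
    and x_over: "x i \<in> fps_over K"
    and y_nonzero: "y i \<noteq> 0"
    and xy: "x i * y i = fps_X"
    and y_rel: "column_relation (all_rows A c) v \<Longrightarrow> (\<Sum>i\<in>UNIV. fps_const (v i) * y i) = 0"
    and Ax: "(\<Sum>i\<in>UNIV. fps_const (A j i) * x i) = fps_const (b j)"
    and cx: "fps_deriv (\<Sum>i\<in>UNIV. fps_const (c i) * x i) \<noteq> 0"
begin

abbreviation "R \<equiv> all_rows A c"
abbreviation "ind \<equiv> column_indep R"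

definition psi :: "('n, 'a) mpoly \<Rightarrow> 'a fps"
  where "psi p = meval fps_const p x"

definition theta :: "'d option \<Rightarrow> ('n, 'a) mpoly"
  where "theta l = linear_form (R l)"

definition tau :: "'a fps"
  where "tau = (\<Sum>i\<in>UNIV. fps_const (c i) * x i)"

definition tt :: "'d option \<Rightarrow> 'a fps"
  where "tt l = (case l of None \<Rightarrow> tau | Some j \<Rightarrow> fps_const (b j))"

text \<open>Counts the faces with \<open>d + 1\<close> elements. As soon as it is positive the
  matroid has rank \<open>d + 1\<close>, and it is the Moebius number.\<close>

definition mu :: nat
  where "mu = card {S \<in> arr.Br. card S = CARD('d option)}"

lemma psi_simps:
  "psi (p + q) = psi p + psi q" "psi (p * q) = psi p * psi q" "psi (p - q) = psi p - psi q"
  "psi (Const t) = fps_const t" "psi (Var i) = x i" "psi (p ^ n) = psi p ^ n" "psi 0 = 0" "psi 1 = 1"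
  "psi (sum f I) = (\<Sum>j\<in>I. psi (f j))" "psi (Poly_Mapping.single a t) = fps_const t * mono_val x a"
  "psi (coeff_poly E w) = (\<Sum>a\<in>E. fps_const (w a) * mono_val x a)"
  by (simp_all add: psi_def eval_fps.meval_simps eval_fps.meval_coeff_poly)

lemma theta_carrier: "theta l \<in> mpoly_carrier k"
  unfolding theta_def by (intro arr.carrier_linear_form arr.row_mem)

lemma degree_theta: "degree_le 1 (theta l)"
  unfolding theta_def by (rule degree_le_linear_form)

lemma psi_theta: "psi (theta l) = tt l"
  by (cases l) (simp_all add: psi_def theta_def eval_fps.meval_linear_form tt_def tau_def Ax)

lemma psi_substitute: "psi (meval Const q theta) = meval fps_const q tt"
  unfolding psi_def eval_fps.meval_substitute by (simp flip: psi_def add: psi_theta)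

lemma psi_J:
  assumes "p \<in> arr.J" shows "psi p = 0"
  unfolding psi_def
proof (rule eval_fps.meval_ideal_gen[OF assms])
  fix g assume "g \<in> cpolys k R"
  then have "(\<Prod>i\<in>UNIV. y i) * meval fps_const g x = 0"
    by (rule arr.cpoly_vanishes[OF coeff_hom_fps_const _ xy y_rel])
  then show "meval fps_const g x = 0" using y_nonzero by simp
qed

lemma tau_over: "tau \<in> fps_over K"
  unfolding tau_def using k_subset arr.row_mem[of None]
  by (intro K.fps_over_sum K.fps_over_mult K.fps_over_const x_over) auto

definition dehom :: "('d option \<Rightarrow>\<^sub>0 nat) \<Rightarrow> ('d \<Rightarrow>\<^sub>0 nat)"
  where "dehom e = (\<Sum>j\<in>UNIV. Poly_Mapping.single j (Poly_Mapping.lookup e (Some j)))"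

lemma lookup_dehom: "Poly_Mapping.lookup (dehom e) j = Poly_Mapping.lookup e (Some j)"
proof -
  have "Poly_Mapping.lookup (dehom e) j = (\<Sum>j'\<in>UNIV. if j' = j then Poly_Mapping.lookup e (Some j) else 0)"
    unfolding dehom_def lookup_sum by (rule sum.cong) (auto simp: lookup_single when_def)
  then show ?thesis by simp
qed

lemma dehom_inj:
  assumes "dehom e = dehom e'" "Poly_Mapping.lookup e None = Poly_Mapping.lookup e' None"
  shows "e = e'"
proof (rule poly_mapping_eqI)
  fix l
  show "Poly_Mapping.lookup e l = Poly_Mapping.lookup e' l"
    using assms(2) arg_cong[OF assms(1), of "\<lambda>e. Poly_Mapping.lookup e j" for j]
    by (cases l) (auto simp: lookup_dehom)
qed

lemma mono_val_tt: "mono_val tt e = fps_const (mono_val b (dehom e)) * tau ^ Poly_Mapping.lookup e None"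
proof -
  have "(\<Prod>l\<in>UNIV. tt l ^ Poly_Mapping.lookup e l) =
      tt None ^ Poly_Mapping.lookup e None * (\<Prod>l\<in>range Some. tt l ^ Poly_Mapping.lookup e l)"
    by (simp add: UNIV_option_conv)
  also have "(\<Prod>l\<in>range Some. tt l ^ Poly_Mapping.lookup e l) =
      (\<Prod>j\<in>UNIV. tt (Some j) ^ Poly_Mapping.lookup e (Some j))"
    by (subst prod.reindex) simp_all
  also have "\<dots> = mono_val (\<lambda>j. fps_const (b j)) (dehom e)"
    by (simp add: mono_val_def tt_def lookup_dehom)
  also have "\<dots> = fps_const (mono_val b (dehom e))" by (rule eval_fps.mono_val_hom)
  finally show ?thesis by (simp add: mono_val_def tt_def mult.commute)
qed

text \<open>With \<open>q\<close> read as a polynomial in the cost variable \<open>None\<close>,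
  this is the coefficient of its \<open>n\<close>-th power, a polynomial in the variables that stand
  for \<open>b\<close>.\<close>

definition tcoeff :: "('d option, 'a) mpoly \<Rightarrow> nat \<Rightarrow> ('d, 'a) mpoly"
  where "tcoeff q n = (\<Sum>e | e \<in> Poly_Mapping.keys q \<and> Poly_Mapping.lookup e None = n.
    Poly_Mapping.single (dehom e) (Poly_Mapping.lookup q e))"

lemma meval_tt:
  assumes "degree_le M q"
  shows "meval fps_const q tt = (\<Sum>n\<le>M. fps_const (meval (\<lambda>t. t) (tcoeff q n) b) * tau ^ n)"
proof -
  have *: "Poly_Mapping.lookup e None \<le> M" if "e \<in> Poly_Mapping.keys q" for e
    using that assms lookup_le_exp_degree[of e None] by (force simp: degree_le_def)
  have "meval fps_const q tt = (\<Sum>e\<in>Poly_Mapping.keys q.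
      fps_const (Poly_Mapping.lookup q e * mono_val b (dehom e)) * tau ^ Poly_Mapping.lookup e None)"
    by (simp add: meval_def mono_val_tt mult.assoc flip: fps_const_mult)
  also have "\<dots> = (\<Sum>n\<le>M. \<Sum>e | e \<in> Poly_Mapping.keys q \<and> Poly_Mapping.lookup e None = n.
      fps_const (Poly_Mapping.lookup q e * mono_val b (dehom e)) * tau ^ Poly_Mapping.lookup e None)"
    using * by (subst sum.group) auto
  also have "\<dots> = (\<Sum>n\<le>M. fps_const (meval (\<lambda>t. t) (tcoeff q n) b) * tau ^ n)"
  proof (rule sum.cong)
    fix n
    have "(\<Sum>e | e \<in> Poly_Mapping.keys q \<and> Poly_Mapping.lookup e None = n.
        fps_const (Poly_Mapping.lookup q e * mono_val b (dehom e)) * tau ^ Poly_Mapping.lookup e None) =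
      (\<Sum>e | e \<in> Poly_Mapping.keys q \<and> Poly_Mapping.lookup e None = n.
        fps_const (Poly_Mapping.lookup q e * mono_val b (dehom e))) * tau ^ n"
      unfolding sum_distrib_right by (rule sum.cong) auto
    then show "(\<Sum>e | e \<in> Poly_Mapping.keys q \<and> Poly_Mapping.lookup e None = n.
        fps_const (Poly_Mapping.lookup q e * mono_val b (dehom e)) * tau ^ Poly_Mapping.lookup e None) =
      fps_const (meval (\<lambda>t. t) (tcoeff q n) b) * tau ^ n"
      by (simp add: tcoeff_def eval_id.meval_sum eval_fps.hom_sum)
  qed simp
  finally show ?thesis .
qed

lemma tcoeff_carrier: "q \<in> mpoly_carrier k \<Longrightarrow> tcoeff q n \<in> mpoly_carrier k"
  unfolding tcoeff_def by (intro arr.carrier_sum arr.carrier_single) (auto simp: mpoly_carrier_def)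

lemma tau_powers_independent: "(\<Sum>i\<le>N. fps_const (w i) * tau ^ i) = 0 \<Longrightarrow> \<forall>i\<le>N. w i = 0"
  using transcendental_powers_independent[where \<tau> = tau and N = N and w = w] cx unfolding tau_def by blast

text \<open>Powers of \<open>tau\<close> are independent over the constants, so each coefficient of
  a relation is a polynomial over \<open>k\<close> vanishing at \<open>b\<close>, and genericity of
  \<open>b\<close> applies. Coefficients in \<open>k\<close> are essential, since all
  \<open>tt l\<close> except \<open>tau\<close> are constants.\<close>

lemma tt_indep:
  assumes q: "q \<in> mpoly_carrier k" "meval fps_const q tt = 0"
  shows "q = 0"
proof (rule ccontr)
  assume "q \<noteq> 0"
  then obtain e where e: "e \<in> Poly_Mapping.keys q" by (metis keys_eq_empty ex_in_conv)
  obtain M where M: "degree_le M q" using degree_le_ex by blast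
  define n where "n = Poly_Mapping.lookup e None"
  have "n \<le> M" using e M lookup_le_exp_degree[of e None] by (force simp: degree_le_def n_def)
  then have "meval (\<lambda>t. t) (tcoeff q n) b = 0"
    using tau_powers_independent[OF q(2)[unfolded meval_tt[OF M]]] by blast
  then have "tcoeff q n = 0" using b_indep tcoeff_carrier q(1) by blast
  moreover have "Poly_Mapping.lookup (tcoeff q n) (dehom e) = Poly_Mapping.lookup q e"
  proof -
    let ?E = "{e. e \<in> Poly_Mapping.keys q \<and> Poly_Mapping.lookup e None = n}"
    have "finite ?E" by simp
    have "Poly_Mapping.lookup (tcoeff q n) (dehom e) =
        (\<Sum>e'\<in>?E. if e' = e then Poly_Mapping.lookup q e else 0)"
      unfolding tcoeff_def lookup_sum
    proof (rule sum.cong)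
      fix e' assume "e' \<in> ?E"
      then show "Poly_Mapping.lookup (Poly_Mapping.single (dehom e') (Poly_Mapping.lookup q e')) (dehom e) =
          (if e' = e then Poly_Mapping.lookup q e else 0)"
        using dehom_inj[of e' e] by (auto simp: lookup_single when_def n_def)
    qed simp
    then show ?thesis using e \<open>finite ?E\<close> by (simp add: n_def)
  qed
  ultimately show False using e by (simp add: in_keys_iff)
qed

lemma card_Br_le: "S \<in> arr.Br \<Longrightarrow> card S \<le> Suc CARD('d)"
  using arr.column_indep_card[OF broken_circuit_complex_indep[of S R]] by simp

text \<open>Polynomials of bounded degree outnumber the monomials without broken circuits as soon as
  they contain more than \<open>mu\<close> copies of the polynomial ring in the \<open>theta l\<close>.\<close>

lemma too_many_copies:
  fixes P :: "'x \<Rightarrow> ('n, 'a) mpoly"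
  assumes fin: "finite I" and card: "mu < card I"
    and P: "\<And>i. i \<in> I \<Longrightarrow> P i \<in> mpoly_carrier k" "\<And>i. i \<in> I \<Longrightarrow> degree_le D (P i)"
  obtains q where "\<And>i. q i \<in> mpoly_carrier k" "\<exists>i\<in>I. q i \<noteq> 0"
    "(\<Sum>i\<in>I. meval Const (q i) theta * P i) \<in> arr.J"
proof -
  let ?E = "\<lambda>m. exps_le (UNIV :: 'd option set) m" and ?N = "nbc_exps ind"
  \<comment> \<open>As \<open>m\<close> grows, the left side behaves at most like \<open>mu\<close>
    times, the right side like \<open>card I\<close> times the same binomial coefficient.\<close>
  have "\<exists>m. card (?N (m + D)) < card (I \<times> ?E m)"
  proof (rule ccontr)
    assume "\<not> ?thesis"
    then have le: "card (I \<times> ?E m) \<le> card (?N (m + D))" for m by (simp add: not_less)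
    have "card I \<le> mu"
    proof (rule binomial_growth[of 0 _ "CARD('d)" _ D "card (UNIV :: 'n set set)"])
      fix m :: nat
      have "card I * ((m + Suc CARD('d)) choose Suc CARD('d)) = card (I \<times> ?E m)"
        by (simp only: card_cartesian_product card_exps_le card_option)
      also note le
      also have "card (?N (m + D)) \<le> mu * ((m + D + Suc CARD('d)) choose Suc CARD('d)) +
          card (UNIV :: 'n set set) * ((m + D + Suc CARD('d)) choose CARD('d))"
        using card_nbc_exps_le[of ind "CARD('d)" "m + D"] card_Br_le
        unfolding mu_def card_option by simp
      finally show "card I * ((m + Suc CARD('d)) choose Suc CARD('d)) \<le>
          mu * ((m + D + Suc CARD('d)) choose Suc CARD('d)) +
          card (UNIV :: 'n set set) * ((m + D + Suc CARD('d)) choose CARD('d))" .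
    qed
    then show False using card by simp
  qed
  then obtain m where m: "card (?N (m + D)) < card (I \<times> ?E m)" by blast
  define Q where "Q = (\<lambda>(i, a). mono_val theta a * P i)"
  have Qc: "Q ia \<in> mpoly_carrier k" "degree_le (m + D) (Q ia)" if ia: "ia \<in> I \<times> ?E m" for ia
  proof -
    obtain i a where ia': "ia = (i, a)" "i \<in> I" "a \<in> ?E m" using ia by blast
    show "Q ia \<in> mpoly_carrier k"
      unfolding Q_def ia'(1) using P(1)[OF ia'(2)]
      by (auto intro: arr.carrier_mult arr.carrier_mono_val theta_carrier)
    have "degree_le (exp_degree a + D) (mono_val theta a * P i)"
      by (intro degree_le_mult degree_le_mono_val degree_theta P(2) ia'(2))
    then show "degree_le (m + D) (Q ia)"
      unfolding Q_def ia'(1) using ia'(3) by (auto simp: exps_le_def elim: degree_le_mono)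
  qed
  have "\<exists>w. (\<forall>e. w e \<in> k) \<and> (ia \<in> I \<times> ?E m \<longrightarrow> Q ia - coeff_poly (?N (m + D)) w \<in> arr.J)" for ia
  proof (cases "ia \<in> I \<times> ?E m")
    case True
    show ?thesis
    proof (rule arr.nbc_normal_form[OF Qc[OF True]])
      fix w assume "\<And>e. w e \<in> k" "Q ia - coeff_poly (?N (m + D)) w \<in> arr.J"
      then show ?thesis by (intro exI[of _ w]) simp
    qed
  next
    case False
    then show ?thesis by (intro exI[of _ "\<lambda>_. 0"]) auto
  qed
  then obtain W where W: "\<And>ia e. W ia e \<in> k"
    "\<And>ia. ia \<in> I \<times> ?E m \<Longrightarrow> Q ia - coeff_poly (?N (m + D)) (W ia) \<in> arr.J"
    by metis
  \<comment> \<open>The unknowns belong to the products of a monomial in the \<open>theta l\<close>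
    with some \<open>P i\<close>; the equations say that their normal forms cancel.\<close>
  obtain w where w: "\<And>ia. w ia \<in> k" "\<exists>ia\<in>I \<times> ?E m. w ia \<noteq> 0"
    "\<And>e. e \<in> ?N (m + D) \<Longrightarrow> (\<Sum>ia\<in>I \<times> ?E m. w ia * W ia e) = 0"
    by (rule arr.homogeneous_system_solution[OF _ _ m, of W]) (use W fin in auto)
  define q where "q i = coeff_poly (?E m) (\<lambda>a. w (i, a))" for i
  have qc: "q i \<in> mpoly_carrier k" for i
    unfolding q_def by (intro arr.carrier_coeff_poly w(1))
  have qnz: "\<exists>i\<in>I. q i \<noteq> 0"
  proof -
    obtain i a where ia: "i \<in> I" "a \<in> ?E m" "w (i, a) \<noteq> 0" using w(2) by blast
    then have "Poly_Mapping.lookup (q i) a \<noteq> 0" by (simp add: q_def lookup_coeff_poly)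
    then have "q i \<noteq> 0" by auto
    then show ?thesis using ia(1) by blast
  qed
  have "(\<Sum>ia\<in>I \<times> ?E m. Const (w ia) * coeff_poly (?N (m + D)) (W ia)) = 0"
  proof (rule poly_mapping_eqI)
    fix e
    show "Poly_Mapping.lookup (\<Sum>ia\<in>I \<times> ?E m. Const (w ia) * coeff_poly (?N (m + D)) (W ia)) e =
        Poly_Mapping.lookup 0 e"
      using w(3)[of e]
      by (cases "e \<in> ?N (m + D)") (simp_all add: lookup_sum lookup_Const_mult lookup_coeff_poly)
  qed
  then have "(\<Sum>ia\<in>I \<times> ?E m. Const (w ia) * Q ia) =
      (\<Sum>ia\<in>I \<times> ?E m. Const (w ia) * (Q ia - coeff_poly (?N (m + D)) (W ia)))"
    by (simp add: right_diff_distrib sum_subtractf)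
  also have "\<dots> \<in> arr.J"
    by (intro ideal_gen_sum arr.ideal_gen_mult arr.carrier_Const w(1) W(2))
  also have "(\<Sum>ia\<in>I \<times> ?E m. Const (w ia) * Q ia) = (\<Sum>i\<in>I. meval Const (q i) theta * P i)"
    by (simp add: sum.cartesian_product Q_def q_def eval_Const.meval_coeff_poly
        sum_distrib_right mult.assoc case_prod_unfold)
  finally show thesis by (rule that[OF qc qnz])
qed

text \<open>The powers of \<open>p\<close> from exponent 0 to \<open>mu\<close> would carry one copy
  too many of the polynomial ring in the \<open>theta l\<close>, which forces a relation modulo
  \<open>J\<close>. As \<open>J\<close> is prime and misses \<open>p\<close>, the lowest power of
  \<open>p\<close> cancels; \<open>psi\<close> then leaves a relation among the \<open>tt l\<close>
  alone.\<close>

lemma psi_zero_imp_J: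
  assumes p: "p \<in> mpoly_carrier k" "psi p = 0"
  shows "p \<in> arr.J"
proof (rule ccontr)
  assume "p \<notin> arr.J"
  then have nv: "\<not> arr.vanishes p" using arr.vanishes_imp_J p(1) by blast
  obtain D where D: "degree_le D p" using degree_le_ex by blast
  have Pc: "p ^ i \<in> mpoly_carrier k" for i using p(1) by (rule arr.carrier_power)
  have Pd: "degree_le (D * mu) (p ^ i)" if "i \<in> {..mu}" for i
    using degree_le_power[OF D, of i] that by (elim degree_le_mono) simp
  have card: "mu < card {..mu}" by simp
  obtain q where q: "\<And>i. q i \<in> mpoly_carrier k" "\<exists>i\<in>{..mu}. q i \<noteq> 0"
    and inJ: "(\<Sum>i\<in>{..mu}. meval Const (q i) theta * p ^ i) \<in> arr.J"
    by (rule too_many_copies[OF _ card, of "\<lambda>i. p ^ i"]) (use Pc Pd in auto)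
  define i0 where "i0 = (LEAST i. i \<le> mu \<and> q i \<noteq> 0)"
  have i0: "i0 \<le> mu" "q i0 \<noteq> 0"
    using q(2) LeastI_ex[of "\<lambda>i. i \<le> mu \<and> q i \<noteq> 0"] unfolding i0_def by auto
  have below: "q i = 0" if "i < i0" for i
    using not_less_Least[of i "\<lambda>i. i \<le> mu \<and> q i \<noteq> 0"] that i0 unfolding i0_def by auto
  define Q where "Q = (\<Sum>i\<in>{i0..mu}. meval Const (q i) theta * p ^ (i - i0))"
  have "(\<Sum>i\<in>{..mu}. meval Const (q i) theta * p ^ i) =
      (\<Sum>i\<in>{i0..mu}. meval Const (q i) theta * p ^ i)"
    by (rule sum.mono_neutral_right) (auto simp: below)
  also have "\<dots> = p ^ i0 * Q"
    unfolding Q_def sum_distrib_left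
    by (rule sum.cong) (auto simp: mult_ac simp flip: power_add)
  finally have "arr.vanishes (p ^ i0 * Q)" using arr.J_vanishes[OF inJ] by simp
  then have "arr.vanishes Q"
  proof (induction i0)
    case (Suc i)
    then have "arr.vanishes (p * (p ^ i * Q))" by (simp add: mult.assoc)
    then show ?case using Suc.IH arr.vanishes_mult[OF _ nv] by blast
  qed simp
  moreover have "Q \<in> mpoly_carrier k"
    unfolding Q_def by (intro arr.carrier_sum arr.carrier_mult arr.carrier_substitute q(1) theta_carrier Pc)
  ultimately have "psi Q = 0" using arr.vanishes_imp_J psi_J by blast
  moreover have "psi Q = meval fps_const (q i0) tt"
  proof -
    have "psi Q = (\<Sum>i\<in>{i0..mu}. if i = i0 then meval fps_const (q i0) tt else 0)"
      unfolding Q_def psi_simps psi_substitute p(2)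
      by (rule sum.cong) (auto simp: power_0_left)
    then show ?thesis using i0 by simp
  qed
  ultimately show False using tt_indep[OF q(1)] i0(2) by simp
qed

section \<open>Enlarging the coefficient field\<close>

lemma common_denominator:
  assumes "finite I" "\<And>j. j \<in> I \<Longrightarrow> z j \<in> K"
  obtains D P where "D \<in> mpoly_carrier k" "meval (\<lambda>t. t) D b \<noteq> 0" "\<And>j. P j \<in> mpoly_carrier k"
    "\<And>j. j \<in> I \<Longrightarrow> meval (\<lambda>t. t) D b * z j = meval (\<lambda>t. t) (P j) b"
  by (rule arr.fractions_common_denominator[OF assms(1) K_fraction[OF assms(2)]]) (use that in blast)+

abbreviation "GI \<equiv> ideal_gen K (central_gens K A c b)"

lemma J_subset_GI: "arr.J \<subseteq> GI"
  using k_subset by (intro ideal_gen_mono) (auto simp: central_gens_def cpolys_def)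

lemma psi_GI:
  assumes "p \<in> GI" shows "psi p = 0"
  unfolding psi_def
proof (rule eval_fps.meval_ideal_gen[OF assms])
  fix g assume "g \<in> central_gens K A c b"
  then consider j where "g = linear_form (A j) - Const (b j)" | "g \<in> cpolys K R"
    unfolding central_gens_def by blast
  then show "meval fps_const g x = 0"
  proof cases
    case 1
    then show ?thesis by (simp add: eval_fps.meval_diff eval_fps.meval_linear_form Ax)
  next
    case 2
    interpret K: arrangement K R
      using arr.row_mem k_subset by unfold_locales auto
    from 2 have "(\<Prod>i\<in>UNIV. y i) * meval fps_const g x = 0"
      by (rule K.cpoly_vanishes[OF coeff_hom_fps_const _ xy y_rel])
    then show ?thesis using y_nonzero by simp
  qed
qed

text \<open>After denominators in \<open>b\<close> are cleared, every \<open>b j\<close> in a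
  coefficient is replaced by the linear form of constraint \<open>j\<close>. This changes the
  polynomial only modulo \<open>GI\<close> and keeps its image under \<open>psi\<close>, but brings
  the coefficients into \<open>k\<close>, where \<open>psi_zero_imp_J\<close> applies.\<close>

lemma psi_zero_imp_GI:
  assumes p: "p \<in> mpoly_carrier K" "psi p = 0"
  shows "p \<in> GI"
proof -
  obtain D P where D: "D \<in> mpoly_carrier k" "meval (\<lambda>t. t) D b \<noteq> 0"
    and P: "\<And>a. P a \<in> mpoly_carrier k"
    and DP: "\<And>a. a \<in> Poly_Mapping.keys p \<Longrightarrow>
      meval (\<lambda>t. t) D b * Poly_Mapping.lookup p a = meval (\<lambda>t. t) (P a) b"
    by (rule common_denominator[of "Poly_Mapping.keys p" "Poly_Mapping.lookup p"])
      (use p(1) in \<open>auto simp: mpoly_carrier_def\<close>)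
  define d where "d = meval (\<lambda>t. t) D b"
  have d: "d \<noteq> 0" "d \<in> K"
  proof -
    have "D \<in> mpoly_carrier K" using D(1) k_subset by (auto simp: mpoly_carrier_def)
    then show "d \<in> K" unfolding d_def by (rule K.meval_mem) (rule b_mem)
  qed (use D(2) in \<open>simp add: d_def\<close>)
  define th where "th j = theta (Some j)" for j
  define Q where "Q = (\<Sum>a\<in>Poly_Mapping.keys p. meval Const (P a) th * Poly_Mapping.single a 1)"
  have psi_th: "psi (meval Const q th) = fps_const (meval (\<lambda>t. t) q b)" for q
  proof -
    have "(\<lambda>j. meval fps_const (th j) x) = (\<lambda>j. fps_const (b j))"
      using psi_theta[of "Some j" for j] by (auto simp: th_def psi_def tt_def)
    then have "psi (meval Const q th) = meval fps_const q (\<lambda>j. fps_const (b j))"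
      by (simp add: psi_def eval_fps.meval_substitute)
    also have "\<dots> = fps_const (meval (\<lambda>t. t) q b)" by (rule eval_fps.meval_hom_point)
    finally show ?thesis .
  qed
  have eval_b: "Const (meval (\<lambda>t. t) q b) = (meval Const q (\<lambda>j. Const (b j)) :: ('n, 'a) mpoly)" for q
    by (rule eval_Const.meval_hom_point[symmetric])
  have dp: "Const d * p = (\<Sum>a\<in>Poly_Mapping.keys p. Const (meval (\<lambda>t. t) (P a) b) * Poly_Mapping.single a 1)"
  proof (rule poly_mapping_eqI)
    fix a
    have "Poly_Mapping.lookup (\<Sum>a\<in>Poly_Mapping.keys p. Const (meval (\<lambda>t. t) (P a) b) *
        Poly_Mapping.single a 1 :: ('n, 'a) mpoly) a =
      (\<Sum>a'\<in>Poly_Mapping.keys p. if a' = a then meval (\<lambda>t. t) (P a) b else 0)"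
      unfolding lookup_sum by (rule sum.cong) (auto simp: lookup_Const_mult lookup_single when_def)
    also have "\<dots> = d * Poly_Mapping.lookup p a"
      using DP[of a] by (auto simp: d_def in_keys_iff)
    finally show "Poly_Mapping.lookup (Const d * p) a = Poly_Mapping.lookup
      (\<Sum>a\<in>Poly_Mapping.keys p. Const (meval (\<lambda>t. t) (P a) b) * Poly_Mapping.single a 1) a"
      by (simp add: lookup_Const_mult)
  qed
  have "psi Q = psi (Const d * p)"
    unfolding dp Q_def psi_simps psi_th by simp
  then have "psi Q = 0" using p(2) by (simp add: psi_simps)
  moreover have "Q \<in> mpoly_carrier k"
    unfolding Q_def th_def
    by (intro arr.carrier_sum arr.carrier_mult arr.carrier_substitute P theta_carrier arr.carrier_single arr.one_mem)
  ultimately have Q: "Q \<in> GI" using psi_zero_imp_J J_subset_GI by blast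
  have PK: "P a \<in> mpoly_carrier K" for a using P[of a] k_subset by (auto simp: mpoly_carrier_def)
  have thK: "th j \<in> mpoly_carrier K" for j
    using theta_carrier[of "Some j"] k_subset by (auto simp: th_def mpoly_carrier_def)
  have gen: "Const (b j) - th j \<in> GI" for j
  proof -
    have "th j - Const (b j) \<in> central_gens K A c b"
      unfolding central_gens_def th_def theta_def by simp
    then have "(- 1) * (th j - Const (b j)) \<in> GI"
      by (intro ideal_gen_mult_gen K.carrier_uminus K.carrier_one)
    then show ?thesis by simp
  qed
  have "Const d * p - Q = (\<Sum>a\<in>Poly_Mapping.keys p. Poly_Mapping.single a 1 *
      (\<Sum>e\<in>Poly_Mapping.keys (P a). Const (Poly_Mapping.lookup (P a) e) *
        (mono_val (\<lambda>j. Const (b j)) e - mono_val th e)))"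
    unfolding dp Q_def eval_b meval_def[of Const]
    by (simp add: sum_subtractf right_diff_distrib sum_distrib_left sum_distrib_right mult_ac)
  also have "\<dots> \<in> GI"
    using PK
    by (intro ideal_gen_sum K.ideal_gen_mult K.carrier_single K.one_mem K.carrier_Const
        mono_val_substitution_diff[OF K.field_subset_axioms] b_mem thK gen)
      (auto simp: mpoly_carrier_def)
  finally have "Const d * p \<in> GI" using ideal_gen_add[OF _ Q] by fastforce
  then have "Const (inverse d) * (Const d * p) \<in> GI"
    by (rule K.ideal_gen_mult[OF _ K.carrier_Const[OF K.inverse_mem[OF d(2)]]])
  moreover have "Const (inverse d) * (Const d * p) = p"
    using d by (intro poly_mapping_eqI) (simp add: lookup_Const_mult)
  ultimately show ?thesis by (rule back_subst[of "\<lambda>q. q \<in> GI"])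
qed

text \<open>Since the series \<open>x i\<close> have coefficients in \<open>K\<close>, the kernel of
  \<open>psi\<close> over the whole type is spanned by its part over \<open>K\<close>. This covers
  arbitrary complex polynomials.\<close>

lemma psi_zero_decompose:
  assumes "psi p = 0"
  obtains Rs P where "finite Rs" "\<And>r. r \<in> Rs \<Longrightarrow> P r \<in> GI" "p = (\<Sum>r\<in>Rs. Const r * P r)"
proof -
  have xa: "mono_val x a \<in> fps_over K" for a by (intro K.fps_over_mono_val x_over)
  have "(\<Sum>a\<in>Poly_Mapping.keys p. fps_const (Poly_Mapping.lookup p a) * mono_val x a) = 0"
    using assms by (simp add: psi_def meval_def)
  then show thesis
  proof (rule K.fps_relation_coordinates[OF finite_keys xa])
  fix Rs u assume Rs: "finite Rs" and u: "\<And>a r. u a r \<in> K"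
    and pu: "\<And>a. a \<in> Poly_Mapping.keys p \<Longrightarrow> Poly_Mapping.lookup p a = (\<Sum>r\<in>Rs. u a r * r)"
    and rel: "\<And>r. r \<in> Rs \<Longrightarrow> (\<Sum>a\<in>Poly_Mapping.keys p. fps_const (u a r) * mono_val x a) = 0"
  define P where "P r = coeff_poly (Poly_Mapping.keys p) (\<lambda>a. u a r)" for r
  show thesis
  proof (rule that[OF Rs])
    fix r assume "r \<in> Rs"
    then show "P r \<in> GI"
      unfolding P_def by (intro psi_zero_imp_GI K.carrier_coeff_poly u) (simp add: psi_simps rel)
  next
    show "p = (\<Sum>r\<in>Rs. Const r * P r)"
    proof (rule poly_mapping_eqI)
      fix a
      show "Poly_Mapping.lookup p a = Poly_Mapping.lookup (\<Sum>r\<in>Rs. Const r * P r) a"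
        using pu[of a]
        by (cases "a \<in> Poly_Mapping.keys p")
          (simp_all add: lookup_sum lookup_Const_mult P_def lookup_coeff_poly mult.commute in_keys_iff)
    qed
  qed
  qed
qed

end

section \<open>The Hilbert function of the branch\<close>

lemma field_subset_UNIV: "field_subset UNIV"
  by unfold_locales auto

global_interpretation fps_vs: vector_space "\<lambda>(t::'a::field) (f::'a fps). fps_const t * f"
  defines fps_dim = fps_vs.dim
  by unfold_locales (simp_all add: algebra_simps flip: fps_const_mult fps_const_add)

text \<open>Independence is stated for an indexed family, so that possible coincidences among the
  \<open>f i\<close> are excluded by the hypothesis itself.\<close>

lemma (in vector_space) card_le_of_independent_family:
  assumes I: "finite I" and T: "finite T" and f: "\<And>i. i \<in> I \<Longrightarrow> f i \<in> span T"
    and indep: "\<And>w. (\<Sum>i\<in>I. scale (w i) (f i)) = 0 \<Longrightarrow> \<forall>i\<in>I. w i = 0"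
  shows "card I \<le> card T"
proof (rule ccontr)
  assume "\<not> card I \<le> card T"
  then have card: "card T < card I" by simp
  have "\<exists>u. i \<in> I \<longrightarrow> f i = (\<Sum>t\<in>T. scale (u t) t)" for i
    using f[of i] span_finite[OF T] by auto
  then obtain u where u: "\<And>i. i \<in> I \<Longrightarrow> f i = (\<Sum>t\<in>T. scale (u i t) t)" by metis
  interpret field_subset UNIV by (rule field_subset_UNIV)
  show False
  proof (rule homogeneous_system_solution[OF T I card, of u])
    fix w assume nz: "\<exists>i\<in>I. w i \<noteq> 0" and w: "\<And>t. t \<in> T \<Longrightarrow> (\<Sum>i\<in>I. w i * u i t) = 0"
    have "(\<Sum>i\<in>I. scale (w i) (f i)) = (\<Sum>i\<in>I. \<Sum>t\<in>T. scale (w i * u i t) t)"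
      using u by (intro sum.cong) (simp_all add: scale_sum_right)
    also have "\<dots> = (\<Sum>t\<in>T. scale (\<Sum>i\<in>I. w i * u i t) t)"
      by (subst sum.swap) (simp add: scale_sum_left)
    also have "\<dots> = 0" using w by simp
    finally show False using indep[of w] nz by blast
  qed simp
qed

lemma (in arrangement) nbc_combination_in_J:
  assumes "coeff_poly (nbc_exps (column_indep A) m) w \<in> J" "e \<in> nbc_exps (column_indep A) m"
  shows "w e = 0"
proof -
  let ?N = "nbc_exps (column_indep A)"
  have "\<forall>b\<in>?N m. w b = 0"
  proof (rule inverse_monomials_independent[OF linear_subspace_row_span[of A], where E = UNIV])
    fix s assume s: "s \<in> row_span A" "\<And>i. i \<in> UNIV \<Longrightarrow> s i \<noteq> 0"
    have "meval (\<lambda>x. x) (coeff_poly (?N m) w) (\<lambda>i. inverse (s i)) = 0"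
      using J_vanishes[OF assms(1)] s by (simp add: vanishes_def)
    then show "(\<Sum>a\<in>?N m. w a * mono_val (\<lambda>i. inverse (s i)) a) = 0"
      by (simp add: eval_id.meval_coeff_poly)
  next
    fix a assume "a \<in> ?N m"
    then show "Poly_Mapping.keys a \<subseteq> UNIV \<and> no_broken_relation (row_span A) UNIV (Poly_Mapping.keys a)"
      by (simp add: nbc_exps_def broken_circuit_complex_no_broken_relation)
  qed simp
  then show ?thesis using assms(2) by blast
qed

text \<open>Column by column, the Fredholm alternative either reduces to earlier columns or corrects
  the coefficients. The point is that \<open>g\<close> stays in the \<open>F\<close>-subspace
  \<open>M\<close>: with \<open>M\<close> the functions of bounded degree, the degree bound
  survives.\<close>

lemma (in field_subset) relation_killed_vector_in_row_space:
  fixes R :: "'l::finite \<Rightarrow> 'n \<Rightarrow> 'a" and z :: "'n \<Rightarrow> 'a fps"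
  assumes S: "finite S" and R: "\<And>l i. R l i \<in> F"
    and M: "0 \<in> M" "\<And>f g. f \<in> M \<Longrightarrow> g \<in> M \<Longrightarrow> f + g \<in> M"
      "\<And>t f. t \<in> F \<Longrightarrow> f \<in> M \<Longrightarrow> fps_const t * f \<in> M"
    and z: "\<And>i. i \<in> S \<Longrightarrow> z i \<in> M"
    and rel: "\<And>v. (\<And>i. v i \<in> F) \<Longrightarrow> (\<And>l. (\<Sum>i\<in>S. v i * R l i) = 0) \<Longrightarrow> (\<Sum>i\<in>S. fps_const (v i) * z i) = 0"
  shows "\<exists>g. (\<forall>l. g l \<in> M) \<and> (\<forall>i\<in>S. z i = (\<Sum>l\<in>UNIV. g l * fps_const (R l i)))"
  using S z rel
proof (induction S rule: finite_induct)
  case empty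
  show ?case using M(1) by (intro exI[of _ "\<lambda>_. 0"]) simp
next
  case (insert i S)
  have relS: "(\<Sum>j\<in>S. fps_const (v j) * z j) = 0"
    if v: "\<And>j. v j \<in> F" "\<And>l. (\<Sum>j\<in>S. v j * R l j) = 0" for v
  proof -
    have "(\<Sum>j\<in>insert i S. fps_const ((v(i := 0)) j) * z j) = 0"
    proof (rule insert.prems(2))
      show "(v(i := 0)) j \<in> F" for j using v(1) by simp
      have "(\<Sum>j\<in>S. (v(i := 0)) j * R l j) = (\<Sum>j\<in>S. v j * R l j)" for l
        using insert.hyps by (intro sum.cong) auto
      then show "(\<Sum>j\<in>insert i S. (v(i := 0)) j * R l j) = 0" for l
        using insert.hyps v(2) by simp
    qed
    moreover have "(\<Sum>j\<in>S. fps_const ((v(i := 0)) j) * z j) = (\<Sum>j\<in>S. fps_const (v j) * z j)"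
      using insert.hyps by (intro sum.cong) auto
    ultimately show ?thesis using insert.hyps by simp
  qed
  have zS: "\<And>j. j \<in> S \<Longrightarrow> z j \<in> M" using insert.prems(1) by blast
  have "\<exists>g. (\<forall>l. g l \<in> M) \<and> (\<forall>j\<in>S. z j = (\<Sum>l\<in>UNIV. g l * fps_const (R l j)))"
  proof (rule insert.IH)
    fix v assume "\<And>j. v j \<in> F" "\<And>l. (\<Sum>j\<in>S. v j * R l j) = 0"
    then show "(\<Sum>j\<in>S. fps_const (v j) * z j) = 0" by (rule relS)
  qed (rule zS)
  then obtain g where g: "\<forall>l. g l \<in> M" "\<forall>j\<in>S. z j = (\<Sum>l\<in>UNIV. g l * fps_const (R l j))"
    by (elim exE conjE)
  have Mneg: "- f \<in> M" if "f \<in> M" for f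
    using M(3)[OF uminus_mem[OF one_mem] that] by simp
  have Msum: "sum f I \<in> M" if "\<And>j. j \<in> I \<Longrightarrow> f j \<in> M" for f and I :: "'l set"
    using that by (induction I rule: infinite_finite_induct) (auto intro: M)
  have "(\<exists>\<beta>. (\<forall>j. \<beta> j \<in> F) \<and> (\<forall>l. R l i = (\<Sum>j\<in>S. \<beta> j * R l j))) \<or>
    (\<exists>\<eta>. (\<forall>l. \<eta> l \<in> F) \<and> (\<forall>j\<in>S. (\<Sum>l\<in>UNIV. \<eta> l * R l j) = 0) \<and> (\<Sum>l\<in>UNIV. \<eta> l * R l i) = 1)"
    using insert.hyps(1) R by (intro span_or_separating_functional) auto
  then show ?case
  proof (elim disjE exE conjE)
    fix \<beta> assume \<beta>: "\<forall>j. \<beta> j \<in> F" "\<forall>l. R l i = (\<Sum>j\<in>S. \<beta> j * R l j)"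
    define v where "v = (\<lambda>j. - \<beta> j)(i := 1)"
    have vS: "(\<Sum>j\<in>S. f j (v j)) = (\<Sum>j\<in>S. f j (- \<beta> j))" for f :: "'n \<Rightarrow> 'a \<Rightarrow> 'c::comm_monoid_add"
      using insert.hyps by (intro sum.cong) (auto simp: v_def)
    have "(\<Sum>j\<in>insert i S. fps_const (v j) * z j) = 0"
    proof (rule insert.prems(2))
      show "v j \<in> F" for j using \<beta>(1) by (auto simp: v_def)
      show "(\<Sum>j\<in>insert i S. v j * R l j) = 0" for l
        using insert.hyps \<beta>(2) vS[of "\<lambda>j t. t * R l j"] by (simp add: v_def sum_negf)
    qed
    then have "z i = (\<Sum>j\<in>S. fps_const (\<beta> j) * z j)"
      using insert.hyps vS[of "\<lambda>j t. fps_const t * z j"]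
      by (simp add: v_def sum_negf flip: fps_const_neg)
    also have "\<dots> = (\<Sum>j\<in>S. \<Sum>l\<in>UNIV. g l * (fps_const (\<beta> j) * fps_const (R l j)))"
      using g(2) by (intro sum.cong) (auto simp: sum_distrib_left mult_ac)
    also have "\<dots> = (\<Sum>l\<in>UNIV. g l * fps_const (\<Sum>j\<in>S. \<beta> j * R l j))"
      by (subst sum.swap) (simp add: sum_distrib_left eval_fps.hom_sum)
    also have "\<dots> = (\<Sum>l\<in>UNIV. g l * fps_const (R l i))" using \<beta>(2) by simp
    finally show ?thesis using g by (intro exI[of _ g]) auto
  next
    fix \<eta> assume \<eta>: "\<forall>l. \<eta> l \<in> F" "\<forall>j\<in>S. (\<Sum>l\<in>UNIV. \<eta> l * R l j) = 0" "(\<Sum>l\<in>UNIV. \<eta> l * R l i) = 1"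
    \<comment> \<open>The defect of the current combination at \<open>i\<close>; adding
      \<open>t\<close> times a functional that is 0 on the columns of \<open>S\<close> and 1 on
      column \<open>i\<close> removes it.\<close>
    define t where "t = z i - (\<Sum>l\<in>UNIV. g l * fps_const (R l i))"
    define g' where "g' l = g l + fps_const (\<eta> l) * t" for l
    have tM: "t \<in> M"
    proof -
      have "(\<Sum>l\<in>UNIV. fps_const (R l i) * g l) \<in> M" using g(1) R by (intro Msum M(3)) auto
      then have "z i + - (\<Sum>l\<in>UNIV. fps_const (R l i) * g l) \<in> M"
        using insert.prems(1) by (intro M(2) Mneg) auto
      then show ?thesis by (simp add: t_def mult.commute)
    qed
    have g'M: "g' l \<in> M" for l unfolding g'_def using g(1) tM \<eta>(1) by (intro M) auto
    have ev: "(\<Sum>l\<in>UNIV. g' l * fps_const (R l j)) =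
      (\<Sum>l\<in>UNIV. g l * fps_const (R l j)) + fps_const (\<Sum>l\<in>UNIV. \<eta> l * R l j) * t" for j
    proof -
      have "(\<Sum>l\<in>UNIV. g' l * fps_const (R l j)) =
          (\<Sum>l\<in>UNIV. g l * fps_const (R l j) + fps_const (\<eta> l * R l j) * t)"
        by (rule sum.cong) (simp_all only: g'_def distrib_right distrib_left fps_const_mult[symmetric] mult_ac)
      then show ?thesis by (simp add: sum.distrib sum_distrib_right eval_fps.hom_sum)
    qed
    have "\<forall>j\<in>insert i S. z j = (\<Sum>l\<in>UNIV. g' l * fps_const (R l j))"
      unfolding ev using g(2) \<eta>(2,3) by (auto simp: t_def)
    then show ?thesis using g'M by (intro exI[of _ g']) auto
  qed
qed

section \<open>The degree filtration and integrality over the cost\<close>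

context central_branch
begin

definition filt :: "nat \<Rightarrow> 'a fps set"
  where "filt m = {psi p |p. p \<in> mpoly_carrier k \<and> degree_le m p}"

lemma filt_zero: "0 \<in> filt m"
  and filt_const: "t \<in> k \<Longrightarrow> fps_const t \<in> filt m"
  and filt_add: "f \<in> filt m \<Longrightarrow> g \<in> filt m \<Longrightarrow> f + g \<in> filt m"
  and filt_mult: "f \<in> filt m \<Longrightarrow> g \<in> filt m' \<Longrightarrow> f * g \<in> filt (m + m')"
  and filt_mono: "f \<in> filt m \<Longrightarrow> m \<le> m' \<Longrightarrow> f \<in> filt m'"
  and filt_x: "x i \<in> filt 1"
proof -
  show "0 \<in> filt m" unfolding filt_def
    by (intro CollectI exI[of _ 0]) (simp add: psi_simps arr.carrier_zero)
  show "t \<in> k \<Longrightarrow> fps_const t \<in> filt m" unfolding filt_def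
    by (intro CollectI exI[of _ "Const t"]) (simp add: psi_simps arr.carrier_Const degree_le_Const)
  show "x i \<in> filt 1" unfolding filt_def
    by (intro CollectI exI[of _ "Var i"] conjI arr.carrier_Var degree_le_Var) (simp add: psi_simps)
  show "f \<in> filt m'" if f: "f \<in> filt m" and m: "m \<le> m'"
    using f degree_le_mono[OF _ m] unfolding filt_def by blast
  show "f + g \<in> filt m" if fg: "f \<in> filt m" "g \<in> filt m"
  proof -
    obtain p q where "f = psi p" "g = psi q" "p \<in> mpoly_carrier k" "q \<in> mpoly_carrier k"
      "degree_le m p" "degree_le m q" using fg unfolding filt_def by blast
    then show ?thesis unfolding filt_def
      by (intro CollectI exI[of _ "p + q"]) (simp add: psi_simps arr.carrier_add degree_le_add)
  qed
  show "f * g \<in> filt (m + m')" if fg: "f \<in> filt m" "g \<in> filt m'"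
  proof -
    obtain p q where "f = psi p" "g = psi q" "p \<in> mpoly_carrier k" "q \<in> mpoly_carrier k"
      "degree_le m p" "degree_le m' q" using fg unfolding filt_def by blast
    then show ?thesis unfolding filt_def
      by (intro CollectI exI[of _ "p * q"]) (simp add: psi_simps arr.carrier_mult degree_le_mult)
  qed
qed

lemma filt_scale: "t \<in> k \<Longrightarrow> f \<in> filt m \<Longrightarrow> fps_const t * f \<in> filt m"
  using filt_mult[OF filt_const[of t 0]] by simp

lemma filt_one: "1 \<in> filt m"
  using filt_const[of 1] by simp

lemma filt_sum: "(\<And>j. j \<in> I \<Longrightarrow> f j \<in> filt m) \<Longrightarrow> sum f I \<in> filt m"
  by (induction I rule: infinite_finite_induct) (auto intro: filt_zero filt_add)

lemma filt_power: "f \<in> filt m \<Longrightarrow> f ^ n \<in> filt (n * m)"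
  by (induction n) (auto intro: filt_one filt_mult)

lemma filt_mono_val: "mono_val x a \<in> filt (exp_degree a)"
  unfolding filt_def
  by (intro CollectI exI[of _ "Poly_Mapping.single a 1"])
    (simp add: psi_simps arr.carrier_single degree_le_single)

lemma filt_prod_x: "finite S \<Longrightarrow> (\<Prod>i\<in>S. x i) \<in> filt (card S)"
  by (induction S rule: finite_induct) (use filt_mult[OF filt_x] in \<open>auto intro: filt_one\<close>)

text \<open>The part of degree \<open>m + 1\<close> of the ideal generated by the linear forms \<open>theta l\<close>.\<close>

definition theta_part :: "nat \<Rightarrow> 'a fps set"
  where "theta_part m = {(\<Sum>l\<in>UNIV. tt l * g l) |g. \<forall>l. g l \<in> filt m}"

lemma theta_part_add:
  assumes "f \<in> theta_part m" "g \<in> theta_part m" shows "f + g \<in> theta_part m"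
proof -
  obtain u w where "f = (\<Sum>l\<in>UNIV. tt l * u l)" "g = (\<Sum>l\<in>UNIV. tt l * w l)"
    "\<forall>l. u l \<in> filt m" "\<forall>l. w l \<in> filt m"
    using assms unfolding theta_part_def by blast
  then show ?thesis unfolding theta_part_def
    by (intro CollectI exI[of _ "\<lambda>l. u l + w l"]) (simp add: distrib_left sum.distrib filt_add)
qed

lemma theta_part_zero: "0 \<in> theta_part m"
  unfolding theta_part_def by (intro CollectI exI[of _ "\<lambda>_. 0"]) (simp add: filt_zero)

lemma theta_part_sum: "(\<And>j. j \<in> I \<Longrightarrow> f j \<in> theta_part m) \<Longrightarrow> sum f I \<in> theta_part m"
  by (induction I rule: infinite_finite_induct) (auto intro: theta_part_zero theta_part_add)

lemma theta_part_mult: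
  assumes "f \<in> theta_part m" "g \<in> filt m'" shows "f * g \<in> theta_part (m + m')"
proof -
  obtain u where "f = (\<Sum>l\<in>UNIV. tt l * u l)" "\<forall>l. u l \<in> filt m"
    using assms(1) unfolding theta_part_def by blast
  then show ?thesis unfolding theta_part_def using assms(2)
    by (intro CollectI exI[of _ "\<lambda>l. u l * g"]) (simp add: sum_distrib_right mult.assoc filt_mult)
qed

text \<open>\<open>nilp n f\<close>: some power of \<open>f\<close>, regarded as an element of degree \<open>n\<close>, lies in the ideal
  generated by the linear forms \<open>theta l\<close>.\<close>

definition nilp :: "nat \<Rightarrow> 'a fps \<Rightarrow> bool"
  where "nilp n f \<longleftrightarrow> f \<in> filt n \<and> (\<exists>e m. Suc m = e * n \<and> f ^ e \<in> theta_part m)"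

lemma nilp_higher_power:
  assumes "f \<in> filt n" "Suc m = e * n" "f ^ e \<in> theta_part m" "e \<le> i"
  obtains m' where "Suc m' = i * n" "f ^ i \<in> theta_part m'"
proof (rule that)
  have "f ^ e * f ^ (i - e) \<in> theta_part (m + (i - e) * n)"
    by (intro theta_part_mult filt_power assms)
  then show "f ^ i \<in> theta_part (m + (i - e) * n)" using assms(4) by (simp flip: power_add)
  have "Suc (m + (i - e) * n) = e * n + (i - e) * n" using assms(2) by simp
  also have "\<dots> = i * n" using assms(4) by (simp flip: distrib_right)
  finally show "Suc (m + (i - e) * n) = i * n" .
qed

lemma nilp_mult:
  assumes "nilp n f" "g \<in> filt j" shows "nilp (n + j) (f * g)"
proof -
  obtain e m where e: "Suc m = e * n" "f ^ e \<in> theta_part m" using assms(1) unfolding nilp_def by blast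
  have "(f * g) ^ e \<in> theta_part (m + e * j)"
    unfolding power_mult_distrib by (intro theta_part_mult filt_power assms e)
  moreover have "Suc (m + e * j) = e * (n + j)" using e(1) by (simp add: distrib_left)
  ultimately show ?thesis using assms unfolding nilp_def by (auto intro: filt_mult)
qed

text \<open>Binomial expansion to the exponent \<open>e + e'\<close>: in every term one of the two
  factors has reached its own exponent.\<close>

lemma nilp_add:
  assumes "nilp n f" "nilp n g" shows "nilp n (f + g)"
proof -
  obtain e m where e: "Suc m = e * n" "f ^ e \<in> theta_part m" and f: "f \<in> filt n"
    using assms(1) unfolding nilp_def by blast
  obtain e' m' where e': "Suc m' = e' * n" "g ^ e' \<in> theta_part m'" and g: "g \<in> filt n"
    using assms(2) unfolding nilp_def by blast
  have n: "n > 0" and epos: "e > 0" using e(1) by (auto intro: gr0I)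
  define M where "M = (e + e') * n - 1"
  have M: "Suc M = (e + e') * n" using n epos by (simp add: M_def)
  have trm: "f ^ i * g ^ (e + e' - i) \<in> theta_part M" if i: "i \<le> e + e'" for i
  proof (cases "e \<le> i")
    case True
    obtain m1 where m1: "Suc m1 = i * n" "f ^ i \<in> theta_part m1"
      by (rule nilp_higher_power[OF f e True])
    have "f ^ i * g ^ (e + e' - i) \<in> theta_part (m1 + (e + e' - i) * n)"
      by (intro theta_part_mult filt_power m1 g)
    moreover have "Suc (m1 + (e + e' - i) * n) = Suc M"
      unfolding M add_Suc[symmetric] m1(1) distrib_right[symmetric] using i by simp
    ultimately show ?thesis by simp
  next
    case False
    then have "e' \<le> e + e' - i" by simp
    then obtain m1 where m1: "Suc m1 = (e + e' - i) * n" "g ^ (e + e' - i) \<in> theta_part m1"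
      by (rule nilp_higher_power[OF g e'])
    have "g ^ (e + e' - i) * f ^ i \<in> theta_part (m1 + i * n)"
      by (intro theta_part_mult filt_power m1 f)
    moreover have "Suc (m1 + i * n) = Suc M"
      unfolding M add_Suc[symmetric] m1(1) distrib_right[symmetric] using i by simp
    ultimately show ?thesis by (simp add: mult.commute)
  qed
  have "(f + g) ^ (e + e') = (\<Sum>i\<le>e + e'. fps_const (of_nat (e + e' choose i)) * (f ^ i * g ^ (e + e' - i)))"
    by (simp add: binomial_ring fps_of_nat mult.assoc)
  also have "\<dots> \<in> theta_part M"
  proof (rule theta_part_sum)
    fix i assume "i \<in> {..e + e'}"
    then have "f ^ i * g ^ (e + e' - i) * fps_const (of_nat (e + e' choose i)) \<in> theta_part (M + 0)"
      by (intro theta_part_mult trm filt_const) auto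
    then show "fps_const (of_nat (e + e' choose i)) * (f ^ i * g ^ (e + e' - i)) \<in> theta_part M"
      by (simp add: mult.commute)
  qed
  finally show ?thesis unfolding nilp_def using f g M by (auto intro: filt_add)
qed

lemma tt_sum: "tt l = (\<Sum>i\<in>UNIV. fps_const (R l i) * x i)"
  by (cases l) (simp_all add: tt_def tau_def Ax)

text \<open>Over the stratum where exactly the coordinates in \<open>S\<close> are non-zero, a point \<open>x\<close> of the
  reciprocal variety pairs with a vector of the row space to \<open>card S\<close>; hence no such point is
  killed by all \<open>theta l\<close> in characteristic \<open>0\<close>.\<close>

lemma support_monomial_relation:
  assumes S: "S \<noteq> {}"
  obtains w u where "w \<in> theta_part (card S - 1)" "\<And>i. u i \<in> filt (card S - 1)"
    "(\<Prod>i\<in>S. x i) = w + (\<Sum>i\<in>UNIV - S. x i * u i)"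
proof -
  \<comment> \<open>A polynomial substitute for the reciprocals: times the product of the
    \<open>y j\<close> over \<open>S\<close> it equals \<open>y i\<close> times a power of
    \<open>fps_X\<close>, so it is killed by every column relation supported in
    \<open>S\<close>.\<close>
  define z where "z i = (\<Prod>j\<in>S - {i}. x j)" for i
  have zmem: "z i \<in> filt (card S - 1)" if "i \<in> S" for i
    using filt_prod_x[of "S - {i}"] that by (simp add: z_def)
  have "(\<Sum>i\<in>S. fps_const (v i) * z i) = 0"
    if v: "\<And>i. v i \<in> k" "\<And>l. (\<Sum>i\<in>S. v i * R l i) = 0" for v
  proof -
    define v' where "v' i = (if i \<in> S then v i else 0)" for i
    have "(\<Sum>i\<in>UNIV. v' i * R l i) = (\<Sum>i\<in>S. v i * R l i)" for l
      by (rule sum.mono_neutral_cong_right) (auto simp: v'_def)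
    then have "column_relation R v'" using v(2) by (simp add: column_relation_def)
    then have "(\<Sum>i\<in>UNIV. fps_const (v' i) * y i) = 0" by (rule y_rel)
    moreover have "(\<Sum>i\<in>UNIV. fps_const (v' i) * y i) = (\<Sum>i\<in>S. fps_const (v i) * y i)"
      by (rule sum.mono_neutral_cong_right) (auto simp: v'_def)
    ultimately have yS: "(\<Sum>i\<in>S. fps_const (v i) * y i) = 0" by simp
    have zy: "(\<Prod>j\<in>S. y j) * z i = y i * fps_X ^ (card S - 1)" if i: "i \<in> S" for i
    proof -
      have "(\<Prod>j\<in>S. y j) * z i = y i * (\<Prod>j\<in>S - {i}. x j * y j)"
        using i by (simp add: z_def prod.remove[of S i] prod.distrib mult_ac)
      then show ?thesis using i by (simp add: xy)
    qed
    have "(\<Prod>j\<in>S. y j) * (\<Sum>i\<in>S. fps_const (v i) * z i) =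
        (\<Sum>i\<in>S. fps_const (v i) * ((\<Prod>j\<in>S. y j) * z i))"
      by (simp add: sum_distrib_left mult_ac)
    also have "\<dots> = (\<Sum>i\<in>S. fps_const (v i) * y i) * fps_X ^ (card S - 1)"
      unfolding sum_distrib_right by (rule sum.cong) (simp_all only: zy mult.assoc)
    finally have "(\<Prod>j\<in>S. y j) * (\<Sum>i\<in>S. fps_const (v i) * z i) = 0" using yS by simp
    then show ?thesis using y_nonzero by simp
  qed
  then have "\<exists>g. (\<forall>l. g l \<in> filt (card S - 1)) \<and> (\<forall>i\<in>S. z i = (\<Sum>l\<in>UNIV. g l * fps_const (R l i)))"
    by (intro arr.relation_killed_vector_in_row_space arr.row_mem zmem filt_zero filt_add filt_scale) auto
  then obtain g where g: "\<forall>l. g l \<in> filt (card S - 1)"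
    "\<forall>i\<in>S. z i = (\<Sum>l\<in>UNIV. g l * fps_const (R l i))" by (elim exE conjE)
  define h where "h i = (\<Sum>l\<in>UNIV. g l * fps_const (R l i))" for i
  have "(\<Sum>l\<in>UNIV. tt l * g l) = (\<Sum>l\<in>UNIV. \<Sum>i\<in>UNIV. x i * (g l * fps_const (R l i)))"
    by (simp add: tt_sum sum_distrib_left mult_ac)
  also have "\<dots> = (\<Sum>i\<in>UNIV. x i * h i)"
    unfolding h_def sum_distrib_left by (rule sum.swap)
  also have "\<dots> = (\<Sum>i\<in>S. x i * h i) + (\<Sum>i\<in>UNIV - S. x i * h i)"
    by (subst sum.subset_diff[of S]) (auto simp: add.commute)
  also have "(\<Sum>i\<in>S. x i * h i) = (\<Sum>i\<in>S. \<Prod>j\<in>S. x j)"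
  proof (rule sum.cong)
    fix i assume "i \<in> S"
    then show "x i * h i = (\<Prod>j\<in>S. x j)"
      using bspec[OF g(2)] by (simp add: h_def[symmetric] z_def prod.remove[of S i])
  qed simp
  \<comment> \<open>Every \<open>i\<close> in \<open>S\<close> contributes the same product, hence
    the factor \<open>card S\<close>, which is invertible in characteristic 0.\<close>
  finally have eq: "(\<Sum>l\<in>UNIV. tt l * g l) = of_nat (card S) * (\<Prod>j\<in>S. x j) + (\<Sum>i\<in>UNIV - S. x i * h i)"
    by simp
  define t where "t = fps_const (inverse (of_nat (card S) :: 'a))"
  have t: "t * of_nat (card S) = 1"
    using S by (simp add: t_def fps_of_nat[symmetric])
  have tm: "t \<in> filt 0" unfolding t_def by (intro filt_const arr.inverse_mem arr.of_nat_mem)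
  show thesis
  proof (rule that)
    have "(\<Sum>l\<in>UNIV. tt l * g l) * t \<in> theta_part (card S - 1 + 0)"
      using g(1) tm by (intro theta_part_mult) (auto simp: theta_part_def)
    then show "(\<Sum>l\<in>UNIV. tt l * g l) * t \<in> theta_part (card S - 1)" by simp
    have "h i \<in> filt (card S - 1)" for i
    proof -
      have "(\<Sum>l\<in>UNIV. fps_const (R l i) * g l) \<in> filt (card S - 1)"
        using g(1) by (intro filt_sum filt_scale arr.row_mem) auto
      then show ?thesis by (simp add: h_def mult.commute)
    qed
    then have "h i * - t \<in> filt (card S - 1 + 0)" for i
    proof (intro filt_mult)
      show "- t \<in> filt 0" unfolding t_def fps_const_neg[symmetric]
        using filt_const[of "- inverse (of_nat (card S))"] by (simp add: arr.uminus_mem arr.inverse_mem)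
    qed
    then show "h i * - t \<in> filt (card S - 1)" for i by simp
    have "(\<Prod>j\<in>S. x j) = t * of_nat (card S) * (\<Prod>j\<in>S. x j)" using t by simp
    also have "\<dots> = t * ((\<Sum>l\<in>UNIV. tt l * g l) - (\<Sum>i\<in>UNIV - S. x i * h i))"
      unfolding eq by (simp add: mult.assoc)
    also have "\<dots> = (\<Sum>l\<in>UNIV. tt l * g l) * t + (\<Sum>i\<in>UNIV - S. x i * (h i * - t))"
      by (simp add: right_diff_distrib sum_distrib_left sum_negf mult_ac)
    finally show "(\<Prod>j\<in>S. x j) = (\<Sum>l\<in>UNIV. tt l * g l) * t + (\<Sum>i\<in>UNIV - S. x i * (h i * - t))" .
  qed
qed

lemma nilp_theta_part: "f \<in> filt (Suc m) \<Longrightarrow> f \<in> theta_part m \<Longrightarrow> nilp (Suc m) f"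
  unfolding nilp_def by (intro conjI exI[of _ 1] exI[of _ m]) auto

text \<open>Induction on the number of coordinates outside \<open>S\<close>. The relation of
  \<open>support_monomial_relation\<close> is multiplied by the monomial itself: apart from the part
  in the ideal of the \<open>theta l\<close>, every term then contains the monomial of a larger
  support. So the square of the monomial is nilpotent.\<close>

lemma nilp_support_monomial:
  assumes "S \<noteq> {}" shows "nilp (card S) (\<Prod>i\<in>S. x i)"
  using assms
proof (induction "card (UNIV - S)" arbitrary: S rule: less_induct)
  case less
  let ?x = "\<lambda>S. \<Prod>i\<in>S. x i"
  obtain w u where w: "w \<in> theta_part (card S - 1)" and u: "\<And>i. u i \<in> filt (card S - 1)"
    and eq: "?x S = w + (\<Sum>i\<in>UNIV - S. x i * u i)"
    by (rule support_monomial_relation[OF less.prems]) blast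
  have cS: "card S > 0" using less.prems by (simp add: card_gt_0_iff)
  have xS: "?x S \<in> filt (card S)" by (rule filt_prod_x) simp
  \<comment> \<open>The larger monomial has degree \<open>card S + 1\<close> and \<open>u i\<close>
    has degree \<open>card S - 1\<close>; together they have the degree of the square.\<close>
  have ui: "nilp (card S + card S) (?x S * (x i * u i))" if i: "i \<in> UNIV - S" for i
  proof -
    have "card (UNIV - insert i S) < card (UNIV - S)"
      using i by (intro psubset_card_mono) auto
    then have "nilp (card (insert i S)) (?x (insert i S))" using less.hyps by blast
    then have "nilp (card (insert i S) + (card S - 1)) (?x (insert i S) * u i)"
      by (rule nilp_mult[OF _ u])
    moreover have "card (insert i S) + (card S - 1) = card S + card S" using i cS by simp
    moreover have "?x (insert i S) * u i = ?x S * (x i * u i)" using i by (simp add: mult_ac)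
    ultimately show ?thesis by simp
  qed
  have wS: "nilp (card S + card S) (w * ?x S)"
  proof -
    have m: "card S - 1 + card S = card S + card S - 1" "Suc (card S + card S - 1) = card S + card S"
      using cS by auto
    have "w * ?x S \<in> theta_part (card S + card S - 1)"
      using theta_part_mult[OF w xS] unfolding m .
    moreover have "w * ?x S \<in> filt (card S + card S)"
    proof -
      have "w = ?x S - (\<Sum>i\<in>UNIV - S. x i * u i)" using eq by simp
      also have "\<dots> = ?x S + fps_const (- 1) * (\<Sum>i\<in>UNIV - S. x i * u i)" by simp
      also have "\<dots> \<in> filt (card S)"
      proof (intro filt_add xS filt_scale filt_sum)
        fix i
        have "x i * u i \<in> filt (1 + (card S - 1))" by (rule filt_mult[OF filt_x u])
        then show "x i * u i \<in> filt (card S)" using cS by simp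
      qed (auto simp: arr.uminus_mem)
      finally show ?thesis by (rule filt_mult[OF _ xS])
    qed
    ultimately show ?thesis using nilp_theta_part[of "w * ?x S" "card S + card S - 1"] unfolding m by blast
  qed
  have sum: "nilp (card S + card S) (w * ?x S + (\<Sum>i\<in>I. ?x S * (x i * u i)))"
    if "finite I" "I \<subseteq> UNIV - S" for I
    using that
  proof (induction I rule: finite_induct)
    case empty
    then show ?case using wS by simp
  next
    case (insert i I)
    then have "nilp (card S + card S) ((w * ?x S + (\<Sum>i\<in>I. ?x S * (x i * u i))) + ?x S * (x i * u i))"
      by (intro nilp_add[OF insert.IH ui]) auto
    then show ?case using insert.hyps by (simp add: add_ac)
  qed
  have "?x S * ?x S = w * ?x S + (\<Sum>i\<in>UNIV - S. ?x S * (x i * u i))"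
  proof -
    have "?x S * ?x S = ?x S * (w + (\<Sum>i\<in>UNIV - S. x i * u i))" using eq by (rule arg_cong)
    then show ?thesis by (simp add: distrib_left sum_distrib_left mult.commute)
  qed
  then have "nilp (card S + card S) (?x S * ?x S)" using sum[of "UNIV - S"] by simp
  then obtain e m where e: "Suc m = e * (card S + card S)" "(?x S * ?x S) ^ e \<in> theta_part m"
    unfolding nilp_def by blast
  have "?x S ^ (2 * e) \<in> theta_part m" using e(2) by (simp add: power_mult power2_eq_square)
  moreover have "Suc m = (2 * e) * card S" using e(1) by (simp add: algebra_simps)
  ultimately show ?case unfolding nilp_def using xS by blast
qed

text \<open>For singletons, \<open>nilp_support_monomial\<close> puts a power of each
  \<open>x i\<close> into the ideal of the \<open>theta l\<close>; by pigeonhole a monomial of large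
  degree contains one of these powers. As the \<open>tt l\<close> are constants or
  \<open>tau\<close>, this is integrality over the cost.\<close>

lemma finite_over_theta:
  obtains m0 where "\<And>a. exp_degree a > m0 \<Longrightarrow> mono_val x a \<in> theta_part (exp_degree a - 1)"
proof -
  have "\<exists>m. x i ^ Suc m \<in> theta_part m" for i
    using nilp_support_monomial[of "{i}"] unfolding nilp_def by auto
  then obtain r where r: "\<And>i. x i ^ Suc (r i) \<in> theta_part (r i)" by metis
  define e where "e i = Suc (r i)" for i
  define m0 where "m0 = (\<Sum>i\<in>UNIV. e i)"
  show thesis
  proof (rule that)
    fix a :: "'n \<Rightarrow>\<^sub>0 nat" assume a: "exp_degree a > m0"
    have "\<exists>i. e i \<le> Poly_Mapping.lookup a i"
    proof (rule ccontr)
      assume "\<not> ?thesis"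
      then have "exp_degree a \<le> m0" unfolding exp_degree_def m0_def
        by (intro sum_mono) (simp add: not_le less_imp_le)
      then show False using a by simp
    qed
    then obtain i where i: "e i \<le> Poly_Mapping.lookup a i" by blast
    have m: "Suc (r i) = e i" "x i ^ e i \<in> theta_part (r i)" using r by (simp_all add: e_def)
    define a' where "a' = a - Poly_Mapping.single i (e i)"
    have eq: "a = Poly_Mapping.single i (e i) + a'"
      using i by (intro poly_mapping_eqI) (auto simp: a'_def lookup_add lookup_minus lookup_single when_def)
    have "x i ^ e i * mono_val x a' \<in> theta_part (r i + exp_degree a')"
      by (intro theta_part_mult m filt_mono_val)
    moreover have "mono_val x a = x i ^ e i * mono_val x a'" by (subst eq) (simp add: mono_val_add)
    moreover have "exp_degree a - 1 = r i + exp_degree a'" by (subst eq) (simp add: exp_degree_add flip: m(1))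
    ultimately show "mono_val x a \<in> theta_part (exp_degree a - 1)" by simp
  qed
qed

end

lemma eventually_constant_of_nonincreasing:
  fixes \<delta> :: "nat \<Rightarrow> int"
  assumes "\<And>m. m \<ge> M \<Longrightarrow> \<delta> (Suc m) \<le> \<delta> m" "\<And>m. 0 \<le> \<delta> m"
  obtains M' d where "\<And>m. m \<ge> M' \<Longrightarrow> \<delta> m = d"
proof -
  obtain m1 where m1: "m1 \<ge> M" and min: "\<And>m. m \<ge> M \<Longrightarrow> nat (\<delta> m1) \<le> nat (\<delta> m)"
    using ex_has_least_nat[of "\<lambda>m. m \<ge> M" M "\<lambda>m. nat (\<delta> m)"] by auto
  have "\<delta> m \<le> \<delta> m1" if "m \<ge> m1" for m
    using that
  proof (induction m rule: dec_induct)
    case (step n)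
    then show ?case using assms(1)[of n] m1 by linarith
  qed simp
  then have "\<delta> m = \<delta> m1" if "m \<ge> m1" for m
    using that min[of m] m1 assms(2)[of m] assms(2)[of m1] by (simp add: nat_le_eq_zle order_antisym)
  then show thesis by (rule that)
qed

definition total_degree :: "('i::finite, 'a::zero) mpoly \<Rightarrow> nat"
  where "total_degree p = (LEAST m. degree_le m p)"

lemma degree_le_total_degree: "degree_le (total_degree p) p"
  unfolding total_degree_def using degree_le_ex[of p] by (rule LeastI_ex)

section \<open>The slope of the affine Hilbert function\<close>

context central_branch
begin

definition mons :: "nat \<Rightarrow> 'a fps set"
  where "mons m = mono_val x ` exps_le UNIV m"

text \<open>The affine Hilbert function of the branch: the dimension of the polynomials of degree at
  most \<open>m\<close> modulo the kernel of \<open>psi\<close>.\<close>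

definition hf :: "nat \<Rightarrow> nat"
  where "hf m = fps_dim (mons m)"

lemma finite_mons: "finite (mons m)"
  by (simp add: mons_def)

lemma mons_mono: "m \<le> m' \<Longrightarrow> mons m \<subseteq> mons m'"
  by (auto simp: mons_def exps_le_def)

lemma mons_basis:
  obtains T where "T \<subseteq> mons m" "fps_vs.independent T" "mons m \<subseteq> fps_vs.span T" "card T = hf m" "finite T"
proof -
  obtain T where T: "T \<subseteq> mons m" "fps_vs.independent T" "mons m \<subseteq> fps_vs.span T"
    using fps_vs.maximal_independent_subset[of "mons m"] by blast
  moreover have "card T = hf m"
    unfolding hf_def using fps_vs.basis_card_eq_dim[OF T(1,3,2)] .
  moreover have "finite T" using T(1) finite_mons finite_subset by blast
  ultimately show thesis using that by blast
qed

lemma psi_in_span: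
  assumes "degree_le m p" shows "psi p \<in> fps_vs.span (mons m)"
  unfolding psi_def meval_def
proof (rule fps_vs.span_sum)
  fix a assume "a \<in> Poly_Mapping.keys p"
  then have "mono_val x a \<in> mons m" using keys_subset_exps_le[OF assms] by (auto simp: mons_def)
  then show "fps_const (Poly_Mapping.lookup p a) * mono_val x a \<in> fps_vs.span (mons m)"
    by (intro fps_vs.span_scale fps_vs.span_base)
qed

text \<open>Linear independence over the polynomial ring in \<open>tau\<close>, with the polynomials
  written out by their coefficients.\<close>

definition tau_indep :: "('n \<Rightarrow>\<^sub>0 nat) set \<Rightarrow> bool"
  where "tau_indep B \<longleftrightarrow> (\<forall>N w. (\<Sum>e\<in>B. \<Sum>i\<le>N. fps_const (w e i) * (tau ^ i * mono_val x e)) = 0 \<longrightarrow>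
    (\<forall>e\<in>B. \<forall>i\<le>N. w e i = 0))"

lemma tau_filt: "tau ^ i * mono_val x e = psi (linear_form c ^ i * Poly_Mapping.single e 1)"
  by (simp add: psi_simps tau_def psi_def eval_fps.meval_linear_form eval_fps.meval_simps)

lemma hf_ge:
  assumes B: "tau_indep B" "B \<subseteq> exps_le UNIV m0"
  shows "card B * Suc m \<le> hf (m + m0)"
proof -
  have finB: "finite B" using B(2) finite_subset by fastforce
  obtain T where T: "mons (m + m0) \<subseteq> fps_vs.span T" "card T = hf (m + m0)" "finite T"
    by (rule mons_basis[of "m + m0"])
  have "card (B \<times> {..m}) \<le> card T"
  proof (rule fps_vs.card_le_of_independent_family[of _ _ "\<lambda>(e, i). tau ^ i * mono_val x e"])
    fix ei assume "ei \<in> B \<times> {..m}"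
    then obtain e i where ei: "ei = (e, i)" "e \<in> B" "i \<le> m" by blast
    have "degree_le (1 * i + exp_degree e) (linear_form c ^ i * Poly_Mapping.single e 1)"
      by (intro degree_le_mult degree_le_power degree_le_linear_form degree_le_single) simp
    then have "degree_le (m + m0) (linear_form c ^ i * Poly_Mapping.single e 1)"
      using ei B(2) by (elim degree_le_mono) (auto simp: exps_le_def intro: add_mono)
    then have "tau ^ i * mono_val x e \<in> fps_vs.span (mons (m + m0))"
      unfolding tau_filt by (rule psi_in_span)
    then show "(case ei of (e, i) \<Rightarrow> tau ^ i * mono_val x e) \<in> fps_vs.span T"
      unfolding ei(1) using fps_vs.span_mono[OF T(1)] by (auto simp: fps_vs.span_span)
  next
    fix w :: "_ \<Rightarrow> 'a"
    assume "(\<Sum>ei\<in>B \<times> {..m}. fps_const (w ei) * (case ei of (e, i) \<Rightarrow> tau ^ i * mono_val x e)) = 0"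
    then have "(\<Sum>e\<in>B. \<Sum>i\<le>m. fps_const (w (e, i)) * (tau ^ i * mono_val x e)) = 0"
      by (simp add: sum.cartesian_product case_prod_unfold)
    then have "\<forall>e\<in>B. \<forall>i\<le>m. w (e, i) = 0"
      using B(1)[unfolded tau_indep_def, rule_format, of "\<lambda>e i. w (e, i)" m] by blast
    then show "\<forall>i\<in>B \<times> {..m}. w i = 0" by auto
  qed (use finB T(3) in auto)
  then show ?thesis using T(2) by (simp add: card_cartesian_product)
qed

text \<open>Otherwise the monomials of \<open>B\<close> carry more than \<open>mu\<close> copies of
  the polynomial ring in the \<open>theta l\<close>. Under \<open>psi\<close> the resulting relation
  modulo \<open>J\<close> becomes one over the polynomials in \<open>tau\<close>, which is trivial,
  and \<open>tt_indep\<close> makes its coefficients zero.\<close>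

lemma card_tau_indep_le_mu:
  assumes B: "tau_indep B" "B \<subseteq> exps_le UNIV m0"
  shows "card B \<le> mu"
proof (rule ccontr)
  assume "\<not> card B \<le> mu"
  then have card: "mu < card B" by simp
  have finB: "finite B" using B(2) finite_subset by fastforce
  have deg: "degree_le m0 (Poly_Mapping.single e 1 :: ('n, 'a) mpoly)" if "e \<in> B" for e
    using that B(2) by (intro degree_le_single) (auto simp: exps_le_def)
  show False
  proof (rule too_many_copies[OF finB card, of "\<lambda>e. Poly_Mapping.single e 1" m0])
    fix q assume q: "\<And>e. q e \<in> mpoly_carrier k" "\<exists>e\<in>B. q e \<noteq> 0"
      and J: "(\<Sum>e\<in>B. meval Const (q e) theta * Poly_Mapping.single e 1) \<in> arr.J"
    have "\<exists>M. \<forall>e. e \<in> B \<longrightarrow> degree_le M (q e)"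
    proof -
      have "degree_le (\<Sum>e\<in>B. total_degree (q e)) (q e)" if "e \<in> B" for e
        using that finB by (intro degree_le_mono[OF degree_le_total_degree] member_le_sum) auto
      then show ?thesis by (intro exI[of _ "\<Sum>e\<in>B. total_degree (q e)"]) simp
    qed
    then obtain M where M: "\<And>e. e \<in> B \<Longrightarrow> degree_le M (q e)" by blast
    have "0 = (\<Sum>e\<in>B. meval fps_const (q e) tt * mono_val x e)"
      using psi_J[OF J] by (simp add: psi_simps psi_substitute)
    also have "\<dots> = (\<Sum>e\<in>B. \<Sum>i\<le>M. fps_const (meval (\<lambda>t. t) (tcoeff (q e) i) b) * (tau ^ i * mono_val x e))"
      by (intro sum.cong) (simp_all add: meval_tt[OF M] sum_distrib_right mult.assoc)
    finally have "\<forall>e\<in>B. \<forall>i\<le>M. meval (\<lambda>t. t) (tcoeff (q e) i) b = 0"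
      using B(1)[unfolded tau_indep_def, rule_format, of "\<lambda>e i. meval (\<lambda>t. t) (tcoeff (q e) i) b" M] by simp
    then have "meval fps_const (q e) tt = 0" if "e \<in> B" for e
      using that by (simp add: meval_tt[OF M[OF that]])
    then have "q e = 0" if "e \<in> B" for e using tt_indep[OF q(1)] that by blast
    then show False using q(2) by blast
  qed (use deg in \<open>auto intro: arr.carrier_single\<close>)
qed

definition emb :: "('d, 'a) mpoly \<Rightarrow> ('d option, 'a) mpoly"
  where "emb p = meval Const p (\<lambda>j. Var (Some j))"

lemma emb_carrier: "p \<in> mpoly_carrier k \<Longrightarrow> emb p \<in> mpoly_carrier k"
  unfolding emb_def by (intro arr.carrier_substitute arr.carrier_Var)

lemma meval_emb: "meval fps_const (emb p) tt = fps_const (meval (\<lambda>t. t) p b)"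
proof -
  have "meval fps_const (emb p) tt = meval fps_const p (\<lambda>j. fps_const (b j))"
    by (simp add: emb_def eval_fps.meval_substitute tt_def)
  then show ?thesis by (simp only: eval_fps.meval_hom_point)
qed

text \<open>A dependence with scalars from the whole type is descended to \<open>K\<close>, freed
  from denominators in \<open>b\<close>, and then \<open>b\<close> is read as
  \<open>tt (Some j)\<close>. This brings the coefficients into the polynomials over
  \<open>k\<close> in the \<open>tt l\<close>, to which the count of standard monomials
  applies.\<close>

lemma tau_dependent_relation:
  assumes B: "tau_indep B" "finite B" and e: "e \<notin> B" "\<not> tau_indep (insert e B)"
  obtains g Q where "g \<in> mpoly_carrier k" "meval fps_const g tt \<noteq> 0" "\<And>e'. Q e' \<in> mpoly_carrier k"
    "meval fps_const g tt * mono_val x e = (\<Sum>e'\<in>B. meval fps_const (Q e') tt * mono_val x e')"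
proof -
  obtain N w e1 i1 where rel: "(\<Sum>e\<in>insert e B. \<Sum>i\<le>N. fps_const (w e i) * (tau ^ i * mono_val x e)) = 0"
    and w1: "e1 \<in> insert e B" "i1 \<le> N" "w e1 i1 \<noteq> 0"
    using e(2) unfolding tau_indep_def by blast
  let ?I = "insert e B \<times> {..N}" and ?f = "\<lambda>p. tau ^ snd p * mono_val x (fst p)"
  have finI: "finite ?I" using B(2) by simp
  have fK: "?f p \<in> fps_over K" for p
    by (intro K.fps_over_mult K.fps_over_power tau_over K.fps_over_mono_val x_over)
  have rel': "(\<Sum>p\<in>?I. fps_const (w (fst p) (snd p)) * ?f p) = 0"
    using rel by (simp only: sum.cartesian_product case_prod_unfold)
  show thesis
  proof (rule K.fps_relation_coordinates[OF finI fK rel'])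
    fix Rs u assume u: "\<And>p r. u p r \<in> K" and wu: "\<And>p. p \<in> ?I \<Longrightarrow> w (fst p) (snd p) = (\<Sum>r\<in>Rs. u p r * r)"
      and relu: "\<And>r. r \<in> Rs \<Longrightarrow> (\<Sum>p\<in>?I. fps_const (u p r) * ?f p) = 0"
    have "\<exists>r\<in>Rs. u (e1, i1) r \<noteq> 0"
    proof (rule ccontr)
      assume "\<not> ?thesis"
      then have "(\<Sum>r\<in>Rs. u (e1, i1) r * r) = 0" by (intro sum.neutral) auto
      then show False using wu[of "(e1, i1)"] w1 by auto
    qed
    then obtain r where r: "r \<in> Rs" "u (e1, i1) r \<noteq> 0" by blast
    show thesis
    proof (rule common_denominator[OF finI, of "\<lambda>p. u p r"])
      show "u p r \<in> K" for p by (rule u)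
      fix D P assume D: "meval (\<lambda>t. t) D b \<noteq> 0" and Pc: "\<And>p. P p \<in> mpoly_carrier k"
        and DP: "\<And>p. p \<in> ?I \<Longrightarrow> meval (\<lambda>t. t) D b * u p r = meval (\<lambda>t. t) (P p) b"
      define Q where "Q e' = (\<Sum>i\<le>N. emb (P (e', i)) * Var None ^ i)" for e'
      have Qc: "Q e' \<in> mpoly_carrier k" for e'
        unfolding Q_def by (intro arr.carrier_sum arr.carrier_mult arr.carrier_power arr.carrier_Var emb_carrier Pc)
      have Qtt: "meval fps_const (Q e') tt = (\<Sum>i\<le>N. fps_const (meval (\<lambda>t. t) (P (e', i)) b) * tau ^ i)" for e'
        by (simp add: Q_def eval_fps.meval_simps meval_emb tt_def)
      have QX: "meval fps_const (Q e') tt * mono_val x e' =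
          (\<Sum>i\<le>N. fps_const (meval (\<lambda>t. t) (P (e', i)) b) * (tau ^ i * mono_val x e'))" for e'
        unfolding Qtt by (simp add: sum_distrib_right mult.assoc)
      have "(\<Sum>e'\<in>insert e B. meval fps_const (Q e') tt * mono_val x e') =
          (\<Sum>p\<in>?I. fps_const (meval (\<lambda>t. t) (P p) b) * ?f p)"
        unfolding QX sum.cartesian_product case_prod_unfold by simp
      also have "\<dots> = (\<Sum>p\<in>?I. fps_const (meval (\<lambda>t. t) D b) * (fps_const (u p r) * ?f p))"
        by (rule sum.cong) (simp_all only: DP[symmetric] fps_const_mult[symmetric] mult.assoc)
      also have "\<dots> = 0" unfolding sum_distrib_left[symmetric] relu[OF r(1)] by simp
      finally have sum0: "meval fps_const (Q e) tt * mono_val x e +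
          (\<Sum>e'\<in>B. meval fps_const (Q e') tt * mono_val x e') = 0"
        using e(1) B(2) by simp
      \<comment> \<open>If this coefficient were zero, the rest would be a relation among
        \<open>B\<close> alone; then all coefficients would vanish, including the one at
        \<open>(e1, i1)\<close>.\<close>
      have nz: "meval fps_const (Q e) tt \<noteq> 0"
      proof
        assume z: "meval fps_const (Q e) tt = 0"
        then have 1: "\<forall>i\<le>N. meval (\<lambda>t. t) (P (e, i)) b = 0"
          unfolding Qtt by (rule tau_powers_independent)
        have "(\<Sum>e'\<in>B. \<Sum>i\<le>N. fps_const (meval (\<lambda>t. t) (P (e', i)) b) * (tau ^ i * mono_val x e')) = 0"
          using sum0 z unfolding QX[symmetric] by simp
        then have 2: "\<forall>e'\<in>B. \<forall>i\<le>N. meval (\<lambda>t. t) (P (e', i)) b = 0"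
          using B(1)[unfolded tau_indep_def, rule_format, of "\<lambda>e' i. meval (\<lambda>t. t) (P (e', i)) b" N] by blast
        have "meval (\<lambda>t. t) (P (e1, i1)) b = 0" using 1 2 w1 by blast
        then show False using DP[of "(e1, i1)"] D r(2) w1 by simp
      qed
      show thesis
      proof (rule that[OF Qc nz])
        show "- Q e' \<in> mpoly_carrier k" for e' by (intro arr.carrier_uminus Qc)
        show "meval fps_const (Q e) tt * mono_val x e =
            (\<Sum>e'\<in>B. meval fps_const (- Q e') tt * mono_val x e')"
          using sum0 by (simp add: eval_fps.meval_uminus sum_negf eq_neg_iff_add_eq_0)
      qed
    qed
  qed
qed

lemma maximal_tau_indep:
  obtains B where "tau_indep B" "B \<subseteq> exps_le UNIV m0"
    "\<And>e. e \<in> exps_le UNIV m0 \<Longrightarrow> e \<notin> B \<Longrightarrow> \<not> tau_indep (insert e B)"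
proof -
  let ?P = "\<lambda>B. tau_indep B \<and> B \<subseteq> exps_le UNIV m0"
  have "?P {}" by (simp add: tau_indep_def)
  moreover have "\<forall>B. ?P B \<longrightarrow> card B < Suc (card (exps_le (UNIV :: 'n set) m0))"
    by (auto intro!: card_mono le_imp_less_Suc)
  ultimately obtain B where B: "?P B" and max: "\<And>B'. ?P B' \<Longrightarrow> card B' \<le> card B"
    using ex_has_greatest_nat[of ?P "{}" card "Suc (card (exps_le (UNIV :: 'n set) m0))"] by blast
  show thesis
  proof (rule that)
    fix e assume e: "e \<in> exps_le UNIV m0" "e \<notin> B"
    have "finite B" using B finite_subset by fastforce
    then show "\<not> tau_indep (insert e B)" using max[of "insert e B"] B e by auto
  qed (use B in auto)
qed

text \<open>The product of the leading coefficients of the finitely many relations serves as a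
  common denominator \<open>\<Gamma>\<close>.\<close>

lemma common_relation:
  assumes B: "tau_indep B" "B \<subseteq> exps_le UNIV m0"
    and max: "\<And>e. e \<in> exps_le UNIV m0 \<Longrightarrow> e \<notin> B \<Longrightarrow> \<not> tau_indep (insert e B)"
  obtains \<Gamma> Q D where "\<Gamma> \<noteq> 0" "\<And>e e'. Q e e' \<in> mpoly_carrier k"
    "\<And>e e'. e \<in> exps_le UNIV m0 \<Longrightarrow> e' \<in> B \<Longrightarrow> degree_le D (Q e e')"
    "\<And>e. e \<in> exps_le UNIV m0 \<Longrightarrow> \<Gamma> * mono_val x e = (\<Sum>e'\<in>B. meval fps_const (Q e e') tt * mono_val x e')"
proof -
  let ?E = "exps_le (UNIV :: 'n set) m0"
  have finB: "finite B" using B(2) finite_subset by fastforce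
  define rl where "rl e g Q \<longleftrightarrow> g \<in> mpoly_carrier k \<and> meval fps_const g tt \<noteq> 0 \<and> (\<forall>e'. Q e' \<in> mpoly_carrier k) \<and>
    meval fps_const g tt * mono_val x e = (\<Sum>e'\<in>B. meval fps_const (Q e') tt * mono_val x e')" for e g Q
  have "\<exists>g Q. e \<in> ?E \<longrightarrow> rl e g Q" for e
  proof (cases "e \<in> ?E \<and> e \<notin> B")
    case True
    show ?thesis
    proof (rule tau_dependent_relation[OF B(1) finB _ max, of e])
      fix g Q assume "g \<in> mpoly_carrier k" "meval fps_const g tt \<noteq> 0" "\<And>e'. Q e' \<in> mpoly_carrier k"
        "meval fps_const g tt * mono_val x e = (\<Sum>e'\<in>B. meval fps_const (Q e') tt * mono_val x e')"
      then have "rl e g Q" unfolding rl_def by blast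
      then show ?thesis by blast
    qed (use True in auto)
  next
    case False
    show ?thesis
    proof (cases "e \<in> B")
      case True
      have "(\<Sum>e'\<in>B. meval fps_const (if e' = e then 1 else 0) tt * mono_val x e') =
        (\<Sum>e'\<in>B. if e' = e then mono_val x e else 0)"
        by (rule sum.cong) auto
      then have "rl e 1 (\<lambda>e'. if e' = e then 1 else 0)"
        using True finB by (simp add: rl_def arr.carrier_one arr.carrier_zero)
      then show ?thesis by blast
    qed (use False in blast)
  qed
  then obtain g Q where gQ: "\<And>e. e \<in> ?E \<Longrightarrow> rl e (g e) (Q e)" by metis
  define Q' where "Q' e e' = (if e \<in> ?E then (\<Prod>e''\<in>?E - {e}. g e'') * Q e e' else 0)" for e e'
  define \<Gamma> where "\<Gamma> = (\<Prod>e\<in>?E. meval fps_const (g e) tt)"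
  show thesis
  proof (rule that)
    show "\<Gamma> \<noteq> 0" unfolding \<Gamma>_def using gQ by (auto simp: rl_def)
    show "Q' e e' \<in> mpoly_carrier k" for e e'
      using gQ unfolding Q'_def rl_def
      by (auto intro!: arr.carrier_mult arr.carrier_prod arr.carrier_zero)
    fix e assume e: "e \<in> ?E"
    show "degree_le (\<Sum>p\<in>?E \<times> B. total_degree (Q' (fst p) (snd p))) (Q' e e')" if "e' \<in> B" for e'
      using member_le_sum[of "(e, e')" "?E \<times> B" "\<lambda>p. total_degree (Q' (fst p) (snd p))"] e that finB
      by (intro degree_le_mono[OF degree_le_total_degree]) auto
    have "\<Gamma> * mono_val x e = (\<Prod>e''\<in>?E - {e}. meval fps_const (g e'') tt) *
        (meval fps_const (g e) tt * mono_val x e)"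
      unfolding \<Gamma>_def using e by (simp add: prod.remove[of ?E e] mult_ac)
    also have "meval fps_const (g e) tt * mono_val x e = (\<Sum>e'\<in>B. meval fps_const (Q e e') tt * mono_val x e')"
      using gQ[OF e] by (simp add: rl_def)
    also have "(\<Prod>e''\<in>?E - {e}. meval fps_const (g e'') tt) * \<dots> =
        (\<Sum>e'\<in>B. meval fps_const (Q' e e') tt * mono_val x e')"
      using e by (simp add: Q'_def eval_fps.meval_mult eval_fps.meval_prod sum_distrib_left mult.assoc)
    finally show "\<Gamma> * mono_val x e = (\<Sum>e'\<in>B. meval fps_const (Q' e e') tt * mono_val x e')" .
  qed
qed

text \<open>A large monomial is a combination of the \<open>tt l\<close> with coefficients of lower
  degree, so the monomials of degree at most \<open>m0\<close> generate all others over the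
  polynomials in the \<open>tt l\<close>. The degree bound on \<open>q\<close> is what the counting
  uses.\<close>

lemma expand_over_small_monomials:
  assumes m0: "\<And>a. exp_degree a > m0 \<Longrightarrow> mono_val x a \<in> theta_part (exp_degree a - 1)"
  shows "\<exists>q. (\<forall>e. q e \<in> mpoly_carrier k \<and> degree_le (exp_degree a) (q e)) \<and>
    mono_val x a = (\<Sum>e\<in>exps_le UNIV m0. meval fps_const (q e) tt * mono_val x e)"
proof (induction "exp_degree a" arbitrary: a rule: less_induct)
  case less
  let ?E = "exps_le (UNIV :: 'n set) m0"
  show ?case
  proof (cases "exp_degree a \<le> m0")
    case True
    have "(\<Sum>e\<in>?E. meval fps_const (if e = a then 1 else 0) tt * mono_val x e) =
        (\<Sum>e\<in>?E. if e = a then mono_val x a else 0)"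
      by (rule sum.cong) auto
    also have "\<dots> = mono_val x a"
    proof -
      have "a \<in> ?E" using True by (simp add: exps_le_def)
      then show ?thesis by simp
    qed
    finally show ?thesis
      by (intro exI[of _ "\<lambda>e. if e = a then 1 else 0"]) (auto simp: arr.carrier_one arr.carrier_zero)
  next
    case False
    then have "mono_val x a \<in> theta_part (exp_degree a - 1)" using m0 by simp
    then obtain g where g: "mono_val x a = (\<Sum>l\<in>UNIV. tt l * g l)" "\<forall>l. g l \<in> filt (exp_degree a - 1)"
      unfolding theta_part_def by blast
    from g(2) have "\<forall>l. \<exists>p. g l = psi p \<and> p \<in> mpoly_carrier k \<and> degree_le (exp_degree a - 1) p"
      unfolding filt_def by blast
    from choice[OF this] obtain p where p: "\<And>l. g l = psi (p l)" "\<And>l. p l \<in> mpoly_carrier k"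
      "\<And>l. degree_le (exp_degree a - 1) (p l)" by blast
    define ok where "ok a' q \<longleftrightarrow> (\<forall>e. q e \<in> mpoly_carrier k \<and> degree_le (exp_degree a') (q e)) \<and>
      mono_val x a' = (\<Sum>e\<in>?E. meval fps_const (q e) tt * mono_val x e)" for a' q
    have "\<forall>a'. \<exists>q. exp_degree a' < exp_degree a \<longrightarrow> ok a' q"
      using less.hyps unfolding ok_def by simp
    from choice[OF this] obtain q where q: "\<And>a'. exp_degree a' < exp_degree a \<Longrightarrow> ok a' (q a')"
      by blast
    have small: "exp_degree a' \<le> exp_degree a - 1" if "a' \<in> Poly_Mapping.keys (p l)" for a' l
      using that p(3)[of l] by (auto simp: degree_le_def)
    then have less: "exp_degree a' < exp_degree a" if "a' \<in> Poly_Mapping.keys (p l)" for a' l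
      using small[OF that] False by linarith
    define Q where "Q e = (\<Sum>l\<in>UNIV. Var l * (\<Sum>a'\<in>Poly_Mapping.keys (p l).
      Const (Poly_Mapping.lookup (p l) a') * q a' e))" for e
    have "mono_val x a = (\<Sum>e\<in>?E. meval fps_const (Q e) tt * mono_val x e)"
    proof -
      have "psi (p l) = (\<Sum>e\<in>?E. (\<Sum>a'\<in>Poly_Mapping.keys (p l).
          fps_const (Poly_Mapping.lookup (p l) a') * meval fps_const (q a' e) tt) * mono_val x e)" for l
      proof -
        have "psi (p l) = (\<Sum>a'\<in>Poly_Mapping.keys (p l). fps_const (Poly_Mapping.lookup (p l) a') *
            (\<Sum>e\<in>?E. meval fps_const (q a' e) tt * mono_val x e))"
          unfolding psi_def meval_def[of _ "p l"] using q[OF less] by (intro sum.cong) (simp_all add: ok_def)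
        also have "\<dots> = (\<Sum>e\<in>?E. \<Sum>a'\<in>Poly_Mapping.keys (p l).
            fps_const (Poly_Mapping.lookup (p l) a') * (meval fps_const (q a' e) tt * mono_val x e))"
          unfolding sum_distrib_left by (rule sum.swap)
        finally show ?thesis by (simp add: sum_distrib_right mult.assoc)
      qed
      then have "mono_val x a = (\<Sum>l\<in>UNIV. tt l * (\<Sum>e\<in>?E. (\<Sum>a'\<in>Poly_Mapping.keys (p l).
          fps_const (Poly_Mapping.lookup (p l) a') * meval fps_const (q a' e) tt) * mono_val x e))"
        unfolding g(1) p(1) by simp
      also have "\<dots> = (\<Sum>e\<in>?E. \<Sum>l\<in>UNIV. tt l * ((\<Sum>a'\<in>Poly_Mapping.keys (p l).
          fps_const (Poly_Mapping.lookup (p l) a') * meval fps_const (q a' e) tt) * mono_val x e))"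
        unfolding sum_distrib_left by (rule sum.swap)
      also have "\<dots> = (\<Sum>e\<in>?E. meval fps_const (Q e) tt * mono_val x e)"
        by (simp add: Q_def eval_fps.meval_sum eval_fps.meval_mult sum_distrib_right mult.assoc)
      finally show ?thesis .
    qed
    moreover have "Q e \<in> mpoly_carrier k" for e
      unfolding Q_def
    proof (intro arr.carrier_sum arr.carrier_mult arr.carrier_Var arr.carrier_Const)
      show "Poly_Mapping.lookup (p l) a' \<in> k" for l a' using p(2) by (simp add: mpoly_carrier_def)
      show "q a' e \<in> mpoly_carrier k" if "a' \<in> Poly_Mapping.keys (p l)" for a' l
        using q[OF less[OF that]] by (simp add: ok_def)
    qed
    moreover have "degree_le (exp_degree a) (Q e)" for e
    proof -
      have "degree_le (1 + (exp_degree a - 1)) (Var l * (\<Sum>a'\<in>Poly_Mapping.keys (p l).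
          Const (Poly_Mapping.lookup (p l) a') * q a' e))" for l
      proof (intro degree_le_mult degree_le_Var degree_le_sum)
        fix a' assume a': "a' \<in> Poly_Mapping.keys (p l)"
        have "degree_le (0 + exp_degree a') (Const (Poly_Mapping.lookup (p l) a') * q a' e)"
          using q[OF less[OF a']] by (intro degree_le_mult degree_le_Const) (simp add: ok_def)
        then show "degree_le (exp_degree a - 1) (Const (Poly_Mapping.lookup (p l) a') * q a' e)"
          using small[OF a'] by (elim degree_le_mono) simp
      qed
      moreover have "1 + (exp_degree a - 1) = exp_degree a" using False by simp
      ultimately show ?thesis unfolding Q_def by (intro degree_le_sum) simp
    qed
    ultimately show ?thesis by (intro exI[of _ Q]) simp
  qed
qed

text \<open>Concavity in large degrees makes \<open>hf\<close> linear, bounds from both sides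
  identify the slope with \<open>card B\<close>, and the comparison with standard monomials
  identifies \<open>card B\<close> with \<open>mu\<close>.\<close>

lemma hilbert_function_eventually_linear:
  obtains M t where "\<And>m. m \<ge> M \<Longrightarrow> int (hf m) = int mu * int m + t" "mu > 0"
proof -
  obtain m0 where m0: "\<And>a. exp_degree a > m0 \<Longrightarrow> mono_val x a \<in> theta_part (exp_degree a - 1)"
    by (rule finite_over_theta) blast
  obtain B where B: "tau_indep B" "B \<subseteq> exps_le UNIV m0"
    and max: "\<And>e. e \<in> exps_le UNIV m0 \<Longrightarrow> e \<notin> B \<Longrightarrow> \<not> tau_indep (insert e B)"
    by (rule maximal_tau_indep[of m0]) blast
  let ?E = "exps_le (UNIV :: 'n set) m0" and ?N = "nbc_exps ind"
  have finB: "finite B" using B(2) finite_subset by fastforce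
  show thesis
  proof (rule common_relation[OF B max])
    fix \<Gamma> Q D assume \<Gamma>: "\<Gamma> \<noteq> 0" and Qc: "\<And>e e'. Q e e' \<in> mpoly_carrier k"
      and Qd: "\<And>e e'. e \<in> ?E \<Longrightarrow> e' \<in> B \<Longrightarrow> degree_le D (Q e e')"
      and \<Gamma>Q: "\<And>e. e \<in> ?E \<Longrightarrow> \<Gamma> * mono_val x e = (\<Sum>e'\<in>B. meval fps_const (Q e e') tt * mono_val x e')"
    define ok where "ok a q \<longleftrightarrow> (\<forall>e. q e \<in> mpoly_carrier k) \<and> (\<forall>e\<in>B. degree_le (exp_degree a + D) (q e)) \<and>
      \<Gamma> * mono_val x a = (\<Sum>e\<in>B. meval fps_const (q e) tt * mono_val x e)" for a q
    have "\<forall>a. \<exists>q. ok a q"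
    proof
      fix a
      obtain q where q: "\<And>e. q e \<in> mpoly_carrier k" "\<And>e. degree_le (exp_degree a) (q e)"
        "mono_val x a = (\<Sum>e\<in>?E. meval fps_const (q e) tt * mono_val x e)"
        using expand_over_small_monomials[where a = a, OF m0] by blast
      define q' where "q' e' = (\<Sum>e\<in>?E. q e * Q e e')" for e'
      have "\<Gamma> * mono_val x a = (\<Sum>e\<in>?E. meval fps_const (q e) tt * (\<Gamma> * mono_val x e))"
        unfolding q(3) by (simp add: sum_distrib_left mult_ac)
      also have "\<dots> = (\<Sum>e\<in>?E. \<Sum>e'\<in>B. meval fps_const (q e * Q e e') tt * mono_val x e')"
        by (intro sum.cong) (simp_all add: \<Gamma>Q sum_distrib_left eval_fps.meval_mult mult.assoc)
      also have "\<dots> = (\<Sum>e'\<in>B. meval fps_const (q' e') tt * mono_val x e')"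
        by (subst sum.swap) (simp add: q'_def eval_fps.meval_sum sum_distrib_right)
      finally have "\<Gamma> * mono_val x a = (\<Sum>e'\<in>B. meval fps_const (q' e') tt * mono_val x e')" .
      moreover have "q' e' \<in> mpoly_carrier k" for e'
        unfolding q'_def by (intro arr.carrier_sum arr.carrier_mult q Qc)
      moreover have "degree_le (exp_degree a + D) (q' e')" if "e' \<in> B" for e'
        unfolding q'_def by (intro degree_le_sum degree_le_mult q(2) Qd that)
      ultimately show "\<exists>q. ok a q" unfolding ok_def by (intro exI[of _ q']) simp
    qed
    from choice[OF this] obtain q where q: "\<And>a. ok a (q a)" by blast
    \<comment> \<open>Times \<open>\<Gamma>\<close>, each monomial of degree at most
      \<open>m\<close> is a combination of products of monomials of \<open>B\<close> with powers of
      \<open>tau\<close> up to \<open>m + D\<close>; multiplication by \<open>\<Gamma>\<close> is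
      injective.\<close>
    have hf_le: "hf m \<le> card B * Suc (m + D)" for m
    proof -
      obtain T where T: "T \<subseteq> mons m" "fps_vs.independent T" "card T = hf m" "finite T"
        by (rule mons_basis[of m])
      have "card T \<le> card ((\<lambda>(e, i). tau ^ i * mono_val x e) ` (B \<times> {..m + D}))"
      proof (rule fps_vs.card_le_of_independent_family[of _ _ "\<lambda>f. \<Gamma> * f"])
        fix f assume "f \<in> T"
        then obtain a where a: "f = mono_val x a" "exp_degree a \<le> m"
          using T(1) by (auto simp: mons_def exps_le_def)
        have deg: "degree_le (m + D) (q a e)" if "e \<in> B" for e
          by (rule degree_le_mono[of "exp_degree a + D"]) (use q[of a] that a(2) in \<open>auto simp: ok_def\<close>)
        have "\<Gamma> * f = (\<Sum>e\<in>B. \<Sum>i\<le>m + D. fps_const (meval (\<lambda>t. t) (tcoeff (q a e) i) b) * (tau ^ i * mono_val x e))"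
        proof -
          have "\<Gamma> * f = (\<Sum>e\<in>B. meval fps_const (q a e) tt * mono_val x e)"
            using q[of a] unfolding ok_def a(1) by blast
          also have "\<dots> = (\<Sum>e\<in>B. \<Sum>i\<le>m + D. fps_const (meval (\<lambda>t. t) (tcoeff (q a e) i) b) * (tau ^ i * mono_val x e))"
            by (intro sum.cong) (simp_all add: meval_tt[OF deg] sum_distrib_right mult.assoc)
          finally show ?thesis .
        qed
        also have "\<dots> \<in> fps_vs.span ((\<lambda>(e, i). tau ^ i * mono_val x e) ` (B \<times> {..m + D}))"
          by (intro fps_vs.span_sum fps_vs.span_scale fps_vs.span_base) auto
        finally show "\<Gamma> * f \<in> fps_vs.span ((\<lambda>(e, i). tau ^ i * mono_val x e) ` (B \<times> {..m + D}))" .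
      next
        fix w assume "(\<Sum>f\<in>T. fps_const (w f) * (\<Gamma> * f)) = 0"
        then have "\<Gamma> * (\<Sum>f\<in>T. fps_const (w f) * f) = 0" by (simp add: sum_distrib_left mult_ac)
        then have "(\<Sum>f\<in>T. fps_const (w f) * f) = 0" using \<Gamma> by simp
        then show "\<forall>f\<in>T. w f = 0" using fps_vs.independentD[OF T(2,4)] by blast
      qed (use T finB in auto)
      also have "\<dots> \<le> card (B \<times> {..m + D})" using finB by (intro card_image_le) simp
      finally show ?thesis using T(3) by (simp add: card_cartesian_product)
    qed
    \<comment> \<open>Otherwise some non-trivial combination over \<open>k\<close> of standard
      monomials is killed by \<open>psi\<close>, hence lies in \<open>J\<close>, against their
      independence modulo \<open>J\<close>.\<close>
    have "card (?N m) \<le> card (B \<times> exps_le (UNIV :: 'd option set) (m + D))" for m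
    proof (rule ccontr)
      assume "\<not> ?thesis"
      then have card: "card (B \<times> exps_le (UNIV :: 'd option set) (m + D)) < card (?N m)" by simp
      show False
      proof (rule arr.homogeneous_system_solution[OF _ _ card, of "\<lambda>a (e, \<alpha>). Poly_Mapping.lookup (q a e) \<alpha>"])
        fix w assume w: "\<And>a. w a \<in> k" "\<exists>a\<in>?N m. w a \<noteq> 0"
          and rel: "\<And>p. p \<in> B \<times> exps_le UNIV (m + D) \<Longrightarrow>
            (\<Sum>a\<in>?N m. w a * (case p of (e, \<alpha>) \<Rightarrow> Poly_Mapping.lookup (q a e) \<alpha>)) = 0"
        have zero: "(\<Sum>a\<in>?N m. Const (w a) * q a e) = 0" if e: "e \<in> B" for e
        proof (rule poly_mapping_eqI)
          fix \<alpha>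
          have "(\<Sum>a\<in>?N m. w a * Poly_Mapping.lookup (q a e) \<alpha>) = 0"
          proof (cases "\<alpha> \<in> exps_le UNIV (m + D)")
            case True
            then show ?thesis using rel[of "(e, \<alpha>)"] e by simp
          next
            case False
            have "Poly_Mapping.lookup (q a e) \<alpha> = 0" if a: "a \<in> ?N m" for a
            proof -
              have "degree_le (m + D) (q a e)"
                by (rule degree_le_mono[of "exp_degree a + D"])
                  (use q[of a] e a in \<open>auto simp: ok_def nbc_exps_def\<close>)
              then have "\<alpha> \<notin> Poly_Mapping.keys (q a e)" using False keys_subset_exps_le by blast
              then show ?thesis by (simp add: in_keys_iff)
            qed
            then show ?thesis by simp
          qed
          then show "Poly_Mapping.lookup (\<Sum>a\<in>?N m. Const (w a) * q a e) \<alpha> = Poly_Mapping.lookup 0 \<alpha>"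
            by (simp add: lookup_sum lookup_Const_mult)
        qed
        have "\<Gamma> * psi (coeff_poly (?N m) w) = (\<Sum>a\<in>?N m. fps_const (w a) * (\<Gamma> * mono_val x a))"
          by (simp add: psi_simps sum_distrib_left mult_ac)
        also have "\<dots> = (\<Sum>a\<in>?N m. \<Sum>e\<in>B. meval fps_const (Const (w a) * q a e) tt * mono_val x e)"
        proof (rule sum.cong)
          fix a
          have "\<Gamma> * mono_val x a = (\<Sum>e\<in>B. meval fps_const (q a e) tt * mono_val x e)"
            using q[of a] unfolding ok_def by blast
          then show "fps_const (w a) * (\<Gamma> * mono_val x a) =
              (\<Sum>e\<in>B. meval fps_const (Const (w a) * q a e) tt * mono_val x e)"
            by (simp add: sum_distrib_left eval_fps.meval_mult mult.assoc)
        qed simp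
        also have "\<dots> = (\<Sum>e\<in>B. meval fps_const (\<Sum>a\<in>?N m. Const (w a) * q a e) tt * mono_val x e)"
          by (subst sum.swap) (simp add: eval_fps.meval_sum sum_distrib_right)
        also have "\<dots> = 0" by (simp add: zero)
        finally have "psi (coeff_poly (?N m) w) = 0" using \<Gamma> by simp
        then have "coeff_poly (?N m) w \<in> arr.J"
          by (intro psi_zero_imp_J arr.carrier_coeff_poly w(1))
        then show False using arr.nbc_combination_in_J w(2) by blast
      qed (use q finB in \<open>auto simp: ok_def mpoly_carrier_def\<close>)
    qed
    then have N_le: "card (?N m) \<le> card B * ((m + D + Suc CARD('d)) choose Suc CARD('d))" for m
      by (simp only: card_cartesian_product card_exps_le card_option)
    have "mu \<le> card B"
    proof (rule binomial_growth[of 0 _ "CARD('d)" _ "Suc CARD('d) + D" 0])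
      fix m :: nat
      have "mu * ((m + Suc CARD('d)) choose Suc CARD('d)) \<le> card (?N (m + Suc CARD('d)))"
        unfolding mu_def card_option by (rule card_nbc_exps_ge)
      also note N_le
      finally show "mu * ((m + Suc CARD('d)) choose Suc CARD('d)) \<le>
          card B * ((m + (Suc CARD('d) + D) + Suc CARD('d)) choose Suc CARD('d)) +
          0 * ((m + (Suc CARD('d) + D) + Suc CARD('d)) choose CARD('d))"
        by (simp add: add_ac)
    qed
    then have mu: "card B = mu" using card_tau_indep_le_mu[OF B] by simp
    have mu_pos: "mu > 0"
    proof (rule ccontr)
      assume "\<not> mu > 0"
      then have "hf 0 = 0" using hf_le[of 0] mu by simp
      obtain T where T: "mons 0 \<subseteq> fps_vs.span T" "card T = hf 0" "finite T"
        by (rule mons_basis[of 0])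
      then have "T = {}" using \<open>hf 0 = 0\<close> by simp
      moreover have "1 \<in> mons 0" unfolding mons_def by (rule image_eqI[of _ _ 0]) (auto simp: exps_le_def)
      ultimately show False using T(1) by auto
    qed
    define \<delta> where "\<delta> m = int (hf (Suc m)) - int (hf m)" for m
    have hf_mono: "hf m \<le> hf (Suc m)" for m
    proof -
      obtain T where T: "T \<subseteq> mons m" "fps_vs.independent T" "card T = hf m" "finite T"
        by (rule mons_basis[of m])
      obtain T' where T': "mons (Suc m) \<subseteq> fps_vs.span T'" "card T' = hf (Suc m)" "finite T'"
        by (rule mons_basis[of "Suc m"])
      have "T \<subseteq> fps_vs.span T'" using T(1) T'(1) mons_mono[of m "Suc m"] by auto
      then show ?thesis using fps_vs.independent_span_bound[OF T'(3) T(2)] T(3) T'(2) by simp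
    qed
    \<comment> \<open>From degree \<open>Suc m\<close> to the next, only products with
      \<open>tau\<close> are new, since the constraint forms are constants on the branch. The
      products of \<open>tau\<close> with the span in degree \<open>m\<close> are already present,
      so the increments cannot grow.\<close>
    have concave: "hf (Suc (Suc m)) + hf m \<le> 2 * hf (Suc m)" if m: "m \<ge> m0" for m
    proof -
      obtain T where T: "T \<subseteq> mons m" "fps_vs.independent T" "card T = hf m" "finite T"
        by (rule mons_basis[of m])
      have "T \<subseteq> mons (Suc m)" using T(1) mons_mono[of m "Suc m"] by auto
      then obtain T1 where T1: "T \<subseteq> T1" "T1 \<subseteq> mons (Suc m)" "fps_vs.independent T1"
          "mons (Suc m) \<subseteq> fps_vs.span T1"
        using fps_vs.maximal_independent_subset_extend[OF _ T(2)] by blast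
      have finT1: "finite T1" using T1(2) finite_mons finite_subset by blast
      have cT1: "card T1 = hf (Suc m)"
        unfolding hf_def using fps_vs.basis_card_eq_dim[OF T1(2,4,3)] .
      let ?W = "T1 \<union> (\<lambda>f. tau * f) ` (T1 - T)"
      have span1: "psi p \<in> fps_vs.span T1" if "degree_le (Suc m) p" for p
        using psi_in_span[OF that] fps_vs.span_mono[OF T1(4)] by (auto simp: fps_vs.span_span)
      have spanW: "f \<in> fps_vs.span ?W" if "f \<in> fps_vs.span T1" for f
        using that fps_vs.span_mono[of T1 ?W] by auto
      have tauT1: "tau * t \<in> fps_vs.span ?W" if t: "t \<in> T1" for t
      proof (cases "t \<in> T")
        case True
        then obtain e where e: "t = mono_val x e" "exp_degree e \<le> m"
          using T(1) by (auto simp: mons_def exps_le_def)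
        have "degree_le (1 * 1 + exp_degree e) (linear_form c ^ 1 * Poly_Mapping.single e 1)"
          by (intro degree_le_mult degree_le_power degree_le_linear_form degree_le_single) simp
        then have "degree_le (Suc m) (linear_form c ^ 1 * Poly_Mapping.single e 1)"
          using e(2) by (elim degree_le_mono) simp
        then have "tau ^ 1 * t \<in> fps_vs.span T1" unfolding e(1) tau_filt by (rule span1)
        then show ?thesis using spanW by simp
      next
        case False
        then show ?thesis using t by (intro fps_vs.span_base) auto
      qed
      have tau_span: "tau * f \<in> fps_vs.span ?W" if "f \<in> fps_vs.span T1" for f
        using that
      proof (induction rule: fps_vs.span_induct_alt)
        case base
        then show ?case by (simp add: fps_vs.span_zero)
      next
        case (step t f g)
        have "tau * (fps_const t * f + g) = fps_const t * (tau * f) + tau * g"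
          by (simp add: algebra_simps)
        then show ?case using step tauT1 by (auto intro!: fps_vs.span_add fps_vs.span_scale)
      qed
      have "mons (Suc (Suc m)) \<subseteq> fps_vs.span ?W"
      proof
        fix f assume "f \<in> mons (Suc (Suc m))"
        then obtain a where a: "f = mono_val x a" "exp_degree a \<le> Suc (Suc m)"
          by (auto simp: mons_def exps_le_def)
        show "f \<in> fps_vs.span ?W"
        proof (cases "exp_degree a \<le> Suc m")
          case True
          then have "degree_le (Suc m) (Poly_Mapping.single a 1)" by (rule degree_le_single)
          from spanW[OF span1[OF this]] show ?thesis by (simp add: a(1) psi_simps)
        next
          case False
          then have da: "exp_degree a = Suc (Suc m)" using a(2) by simp
          then have "f \<in> theta_part (Suc m)" using m0[of a] m a(1) by simp
          then obtain g where g: "f = (\<Sum>l\<in>UNIV. tt l * g l)" "\<forall>l. g l \<in> filt (Suc m)"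
            unfolding theta_part_def by blast
          have gs: "g l \<in> fps_vs.span T1" for l
          proof -
            from g(2)[THEN spec, of l] obtain p where "g l = psi p" "degree_le (Suc m) p"
              unfolding filt_def by (elim CollectE exE conjE)
            then show ?thesis using span1 by simp
          qed
          have "tt l * g l \<in> fps_vs.span ?W" for l
          proof (cases l)
            case None
            then show ?thesis using tau_span[OF gs] by (simp add: tt_def)
          next
            case (Some j)
            then show ?thesis using spanW[OF gs[of l]] by (simp add: tt_def fps_vs.span_scale)
          qed
          then show ?thesis unfolding g(1) by (intro fps_vs.span_sum)
        qed
      qed
      moreover have "finite ?W" using finT1 by simp
      ultimately have "hf (Suc (Suc m)) \<le> card ?W"
        unfolding hf_def by (rule fps_vs.dim_le_card)
      also have "\<dots> \<le> card T1 + card (T1 - T)"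
        using finT1 by (intro order_trans[OF card_Un_le] add_left_mono card_image_le) simp
      also have "card (T1 - T) = hf (Suc m) - hf m"
        using card_Diff_subset[OF T(4) T1(1)] cT1 T(3) by simp
      finally show ?thesis using cT1 hf_mono[of m] by linarith
    qed
    have "\<delta> (Suc m) \<le> \<delta> m" if "m \<ge> m0" for m using concave[OF that] by (simp add: \<delta>_def)
    moreover have "0 \<le> \<delta> m" for m using hf_mono[of m] by (simp add: \<delta>_def)
    ultimately obtain M d where d: "\<And>m. m \<ge> M \<Longrightarrow> \<delta> m = d"
      by (rule eventually_constant_of_nonincreasing[of m0 \<delta>]) blast+
    have lin: "int (hf (M + n)) = int (hf M) + d * int n" for n
    proof (induction n)
      case (Suc n)
      have "int (hf (M + Suc n)) = int (hf (M + n)) + \<delta> (M + n)" by (simp add: \<delta>_def)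
      then show ?case using Suc d[of "M + n"] by (simp add: algebra_simps)
    qed simp
    have "d \<le> int mu"
    proof (rule ccontr)
      assume "\<not> d \<le> int mu"
      then have "int mu + 1 \<le> d" by simp
      \<comment> \<open>Equal to the slack in \<open>hf_le\<close>, so that a slope of at least
        \<open>mu + 1\<close> would force \<open>hf M = 0\<close>, although 1 is a non-zero
        function.\<close>
      define n where "n = mu * Suc (M + D)"
      have "int (hf M) + (int mu + 1) * int n \<le> int (hf M) + d * int n"
        using \<open>int mu + 1 \<le> d\<close> by (intro add_left_mono mult_right_mono) auto
      also have "\<dots> = int (hf (M + n))" using lin by simp
      also have "\<dots> \<le> int (mu * Suc (M + n + D))" using hf_le[of "M + n", unfolded mu] by (simp only: of_nat_le_iff)
      also have "\<dots> = int mu * int n + int n" by (simp add: n_def algebra_simps)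
      finally have "hf M = 0" by (simp add: algebra_simps)
      obtain T where T: "mons M \<subseteq> fps_vs.span T" "card T = hf M" "finite T"
        by (rule mons_basis[of M])
      then have "T = {}" using \<open>hf M = 0\<close> by simp
      moreover have "1 \<in> mons M" unfolding mons_def by (rule image_eqI[of _ _ 0]) (auto simp: exps_le_def)
      ultimately show False using T(1) by auto
    qed
    moreover have "int mu \<le> d"
    proof (rule ccontr)
      assume "\<not> int mu \<le> d"
      then have dm: "d + 1 \<le> int mu" by simp
      have d0: "0 \<le> d" using d[of M] hf_mono[of M] by (simp add: \<delta>_def)
      \<comment> \<open>The linear value at \<open>M + m0\<close>. After \<open>t\<close> further
        steps the linear value is \<open>t + d * t\<close>, below the lower bound
        \<open>(d + 1) * (t + 1)\<close> that \<open>hf_ge\<close> would give.\<close>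
      define t where "t = nat (int (hf M) + d * int m0)"
      have t: "int t = int (hf M) + d * int m0" using d0 by (simp add: t_def)
      have "(d + 1) * (int t + 1) \<le> int mu * int (Suc (M + t))"
        using dm d0 by (intro mult_mono) auto
      also have "\<dots> = int (mu * Suc (M + t))" by (simp only: of_nat_mult)
      also have "\<dots> \<le> int (hf (M + (m0 + t)))"
        using hf_ge[OF B, of "M + t", unfolded mu] by (simp only: of_nat_le_iff add_ac)
      also have "\<dots> = int (hf M) + d * int (m0 + t)" by (rule lin)
      also have "\<dots> = int t + d * int t" using t by (simp add: algebra_simps)
      finally show False using d0 by (simp add: algebra_simps)
    qed
    ultimately have "d = int mu" by simp
    show thesis
    proof (rule that[of M "int (hf M) - int mu * int M"])
      fix m assume "m \<ge> M"
      then obtain n where "m = M + n" using le_Suc_ex by blast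
      then show "int (hf m) = int mu * int m + (int (hf M) - int mu * int M)"
        using lin[of n] \<open>d = int mu\<close> by (simp add: algebra_simps)
    qed (rule mu_pos)
  qed
qed

end

section \<open>Points of the central path on the branch\<close>

context central_branch
begin

text \<open>The kernel of \<open>psi\<close> is spanned by elements of \<open>GI\<close>, which
  vanish on \<open>Z\<close>. Conversely, if \<open>p\<close> vanishes on \<open>Z\<close> but not
  on the branch, products of powers of \<open>p\<close> and of the cost outnumber \<open>hf\<close>;
  once the lowest power of \<open>p\<close> is cancelled, the relation restricts on \<open>Z\<close>
  to a non-zero polynomial in the cost with infinitely many roots.\<close>

lemma vanishes_on_path_iff:
  fixes Z :: "('n \<Rightarrow> 'a) set"
  assumes AZ: "\<And>z l. z \<in> Z \<Longrightarrow> (\<Sum>i\<in>UNIV. A l i * z i) = b l"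
    and LZ: "\<And>z. z \<in> Z \<Longrightarrow> \<exists>s\<in>row_span R. \<forall>i. z i * s i = 1"
    and inf: "infinite ((\<lambda>z. \<Sum>i\<in>UNIV. c i * z i) ` Z)"
  shows "(\<forall>z\<in>Z. meval (\<lambda>t. t) p z = 0) \<longleftrightarrow> psi p = 0"
proof -
  let ?ev = "meval (\<lambda>t. t)"
  interpret KR: arrangement K R
    using arr.row_mem k_subset by unfold_locales auto
  have GI_van: "?ev q z = 0" if q: "q \<in> GI" and z: "z \<in> Z" for q z
  proof (rule eval_id.meval_ideal_gen[OF q])
    fix g assume "g \<in> central_gens K A c b"
    then consider j where "g = linear_form (A j) - Const (b j)" | "g \<in> cpolys K R"
      unfolding central_gens_def by blast
    then show "?ev g z = 0"
    proof cases
      case 1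
      then show ?thesis using AZ[OF z] by (simp add: eval_id.meval_diff eval_id.meval_linear_form)
    next
      case 2
      obtain s where s: "s \<in> row_span R" "\<And>i. z i * s i = 1" using LZ[OF z] by blast
      have "(\<Prod>i\<in>UNIV. s i) * ?ev g z = 0"
        by (rule KR.cpoly_vanishes[OF coeff_hom_id 2 s(2)])
          (use column_relation_row_span[OF _ s(1)] in simp)
      moreover have "s i \<noteq> 0" for i using s(2)[of i] by auto
      ultimately show ?thesis by simp
    qed
  qed
  have van: "\<forall>z\<in>Z. ?ev p z = 0" if psi: "psi p = 0" for p
  proof
    fix z assume z: "z \<in> Z"
    show "?ev p z = 0"
    proof (rule psi_zero_decompose[OF psi])
      fix Rs P assume "\<And>r. r \<in> Rs \<Longrightarrow> P r \<in> GI" and p: "p = (\<Sum>r\<in>Rs. Const r * P r)"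
      then show ?thesis using GI_van[OF _ z] by (simp add: p eval_id.meval_sum eval_id.meval_mult)
    qed
  qed
  have "psi p = 0" if vp: "\<forall>z\<in>Z. ?ev p z = 0"
  proof (rule ccontr)
    assume np: "psi p \<noteq> 0"
    obtain D where D: "degree_le D p" using degree_le_ex by blast
    obtain M t where M: "\<And>m. m \<ge> M \<Longrightarrow> int (hf m) = int mu * int m + t"
      by (rule hilbert_function_eventually_linear) blast
    \<comment> \<open>Makes \<open>Suc mu * Suc m\<close>, the number of products with exponents up
      to \<open>mu\<close> and \<open>m\<close>, exceed the Hilbert function at their degree bound
      \<open>N\<close>.\<close>
    define m where "m = M + nat (int mu * int (D * mu) + t)"
    define N where "N = m + D * mu"
    have "int (hf N) = int mu * int m + (int mu * int (D * mu) + t)"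
      using M[of N] by (simp add: N_def m_def algebra_simps)
    also have "\<dots> < (int mu + 1) * (int m + 1)"
      by (simp add: m_def algebra_simps)
    finally have "int (hf N) < int (Suc mu * Suc m)" by (simp add: algebra_simps)
    then have lt: "hf N < card ({..mu} \<times> {..m})"
      by (simp only: of_nat_less_iff card_cartesian_product card_atMost)
    obtain T where T: "mons N \<subseteq> fps_vs.span T" "card T = hf N" "finite T"
      by (rule mons_basis[of N])
    let ?f = "\<lambda>(i, j). psi (p ^ i * linear_form c ^ j)"
    have "\<exists>w. (\<Sum>ij\<in>{..mu} \<times> {..m}. fps_const (w ij) * ?f ij) = 0 \<and> \<not> (\<forall>ij\<in>{..mu} \<times> {..m}. w ij = 0)"
    proof (rule ccontr)
      assume neg: "\<not> ?thesis"
      have "card ({..mu} \<times> {..m}) \<le> card T"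
      proof (rule fps_vs.card_le_of_independent_family[of _ _ ?f])
        fix ij assume "ij \<in> {..mu} \<times> {..m}"
        then obtain i j where ij: "ij = (i, j)" "i \<le> mu" "j \<le> m" by blast
        have "degree_le (D * i + 1 * j) (p ^ i * linear_form c ^ j)"
          by (intro degree_le_mult degree_le_power D degree_le_linear_form)
        moreover have "D * i \<le> D * mu" using ij(2) by simp
        then have "D * i + 1 * j \<le> N" using ij(3) unfolding N_def by linarith
        ultimately have "degree_le N (p ^ i * linear_form c ^ j)" by (rule degree_le_mono)
        then show "?f ij \<in> fps_vs.span T"
          unfolding ij(1) using psi_in_span fps_vs.span_mono[OF T(1)] by (auto simp: fps_vs.span_span)
      qed (use neg T(3) in auto)
      then show False using lt T(2) by simp
    qed
    then obtain w where w0: "(\<Sum>ij\<in>{..mu} \<times> {..m}. fps_const (w ij) * ?f ij) = 0"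
      and wnz: "\<not> (\<forall>ij\<in>{..mu} \<times> {..m}. w ij = 0)" by (elim exE conjE)
    define i0 where "i0 = (LEAST i. i \<le> mu \<and> (\<exists>j\<le>m. w (i, j) \<noteq> 0))"
    have "\<exists>i. i \<le> mu \<and> (\<exists>j\<le>m. w (i, j) \<noteq> 0)" using wnz by auto
    then have i0: "i0 \<le> mu" "\<exists>j\<le>m. w (i0, j) \<noteq> 0"
      using LeastI_ex[of "\<lambda>i. i \<le> mu \<and> (\<exists>j\<le>m. w (i, j) \<noteq> 0)"] unfolding i0_def by auto
    have below: "w (i, j) = 0" if "i < i0" "j \<le> m" for i j
      using not_less_Least[of i "\<lambda>i. i \<le> mu \<and> (\<exists>j\<le>m. w (i, j) \<noteq> 0)"] that i0(1) unfolding i0_def by auto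
    define q where "q i = (\<Sum>j\<le>m. Const (w (i, j)) * linear_form c ^ j)" for i
    have q0: "q i = 0" if "i < i0" for i
      unfolding q_def using below[OF that] by (simp add: Const_def)
    define Q where "Q = (\<Sum>i\<in>{i0..mu}. q i * p ^ (i - i0))"
    have "(\<Sum>ij\<in>{..mu} \<times> {..m}. fps_const (w ij) * ?f ij) = psi (\<Sum>i\<in>{..mu}. q i * p ^ i)"
    proof -
      have "psi (\<Sum>i\<in>{..mu}. q i * p ^ i) = (\<Sum>i\<in>{..mu}. \<Sum>j\<in>{..m}. fps_const (w (i, j)) * ?f (i, j))"
        unfolding q_def psi_simps sum_distrib_right by (intro sum.cong) (simp_all add: psi_simps mult_ac)
      then show ?thesis by (simp add: sum.cartesian_product case_prod_unfold)
    qed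
    also have "(\<Sum>i\<in>{..mu}. q i * p ^ i) = (\<Sum>i\<in>{i0..mu}. q i * p ^ i)"
      by (rule sum.mono_neutral_right) (auto simp: q0)
    also have "\<dots> = p ^ i0 * Q"
      unfolding Q_def sum_distrib_left
      by (rule sum.cong) (auto simp: mult_ac simp flip: power_add)
    finally have "psi Q = 0" using w0 np by (simp add: psi_simps)
    then have Qz: "?ev Q z = 0" if "z \<in> Z" for z using van that by blast
    define r where "r = (\<Sum>j\<le>m. Polynomial.monom (w (i0, j)) j)"
    have "Polynomial.poly r (\<Sum>i\<in>UNIV. c i * z i) = 0" if z: "z \<in> Z" for z
    proof -
      have "?ev Q z = (\<Sum>i\<in>{i0..mu}. if i = i0 then ?ev (q i0) z else 0)"
        unfolding Q_def eval_id.meval_sum eval_id.meval_mult eval_id.meval_power using vp z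
        by (intro sum.cong) (auto simp: power_0_left)
      also have "\<dots> = ?ev (q i0) z" using i0(1) by simp
      also have "\<dots> = Polynomial.poly r (\<Sum>i\<in>UNIV. c i * z i)"
        by (simp add: q_def r_def eval_id.meval_simps eval_id.meval_linear_form poly_sum poly_monom)
      finally show ?thesis using Qz[OF z] by simp
    qed
    then have "(\<lambda>z. \<Sum>i\<in>UNIV. c i * z i) ` Z \<subseteq> {u. Polynomial.poly r u = 0}" by auto
    then have "r = 0" using inf poly_roots_finite finite_subset by blast
    moreover have "Polynomial.coeff r j = w (i0, j)" if "j \<le> m" for j
    proof -
      have "Polynomial.coeff r j = (\<Sum>j'\<le>m. if j' = j then w (i0, j) else 0)"
        unfolding r_def Polynomial.coeff_sum by (rule sum.cong) auto
      then show ?thesis using that by simp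
    qed
    ultimately show False using i0(2) by auto
  qed
  with van show ?thesis by blast
qed

end

section \<open>Existence of the branch\<close>

lemma fps_mult_low_coeffs_zero:
  fixes d :: "'a::comm_ring_1 fps"
  assumes "\<And>k. k < m \<Longrightarrow> fps_nth d k = 0" "k < m"
  shows "fps_nth (h * d) k = 0"
  unfolding fps_mult_nth using assms by (intro sum.neutral) auto

lemma fps_inverse_low_coeffs:
  fixes f g :: "'a::field fps"
  assumes "\<And>k. k < m \<Longrightarrow> fps_nth f k = fps_nth g k" "fps_nth f 0 \<noteq> 0" "fps_nth g 0 \<noteq> 0" "k < m"
  shows "fps_nth (inverse f) k = fps_nth (inverse g) k"
proof -
  have "inverse f * inverse g * (g - f) = inverse f * (inverse g * g) - inverse g * (inverse f * f)"
    by (simp only: right_diff_distrib mult_ac)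
  then have "inverse f - inverse g = inverse f * inverse g * (g - f)"
    by (simp add: inverse_mult_eq_1 assms(2,3))
  moreover have "fps_nth (inverse f * inverse g * (g - f)) k = 0"
    by (rule fps_mult_low_coeffs_zero[of m]) (use assms in auto)
  ultimately show ?thesis by (metis eq_iff_diff_eq_0 fps_sub_nth)
qed

lemma (in field_subset) fps_over_inverse:
  assumes f: "f \<in> fps_over F" shows "inverse f \<in> fps_over F"
proof -
  have "natfun_inverse f n \<in> F" for n
  proof (induction n rule: less_induct)
    case (less n)
    show ?case
    proof (cases n)
      case 0
      then show ?thesis using f by (auto simp: fps_over_def)
    next
      case (Suc n')
      have "(\<Sum>i = 1..Suc n'. fps_nth f i * natfun_inverse f (Suc n' - i)) \<in> F"
        using f less Suc by (intro sum_mem mult_mem) (auto simp: fps_over_def)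
      then have "- inverse (fps_nth f 0) *
          (\<Sum>i = 1..Suc n'. fps_nth f i * natfun_inverse f (Suc n' - i)) \<in> F"
        using f by (intro mult_mem uminus_mem inverse_mem) (auto simp: fps_over_def)
      then show ?thesis unfolding Suc by (simp only: fps_right_inverse_constructor.simps)
    qed
  qed
  then show ?thesis by (simp add: fps_inverse_def fps_over_def)
qed

text \<open>The factor \<open>fps_X\<close> makes the right-hand side a contraction in the adic
  topology: agreement of coefficients below \<open>m\<close> improves to agreement below
  \<open>Suc m\<close>. The series can be inverted since their constant terms \<open>a i\<close> are
  non-zero, and all iterates stay over \<open>F\<close>.\<close>

lemma (in field_subset) fps_system_solution:
  fixes a :: "'n::finite \<Rightarrow> 'a" and \<rho> :: "'n \<Rightarrow> 'n \<Rightarrow> 'a"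
  assumes a: "\<And>i. a i \<in> F" "\<And>i. a i \<noteq> 0" and \<rho>: "\<And>i j. \<rho> i j \<in> F"
  shows "\<exists>z. (\<forall>i. z i \<in> fps_over F) \<and> (\<forall>i. fps_nth (z i) 0 = a i) \<and>
    (\<forall>i. z i = fps_const (a i) + fps_X * (\<Sum>j\<in>UNIV. fps_const (\<rho> i j) * inverse (z j)))"
proof -
  define \<Phi> where "\<Phi> z i = fps_const (a i) + fps_X * (\<Sum>j\<in>UNIV. fps_const (\<rho> i j) * inverse (z j))"
    for z :: "'n \<Rightarrow> 'a fps" and i
  define u where "u n = (\<Phi> ^^ n) (\<lambda>i. fps_const (a i))" for n
  have uSuc: "u (Suc n) = \<Phi> (u n)" for n by (simp add: u_def)
  have \<Phi>0: "fps_nth (\<Phi> z i) 0 = a i" for z i by (simp add: \<Phi>_def)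
  have u0: "fps_nth (u n i) 0 = a i" for n i
    by (cases n) (simp_all add: uSuc \<Phi>0, simp add: u_def)
  have uF: "u n i \<in> fps_over F" for n i
  proof (induction n arbitrary: i)
    case 0
    then show ?case using a by (simp add: u_def fps_over_const)
  next
    case (Suc n)
    have "fps_X \<in> fps_over F" by (auto simp: fps_over_def fps_X_def)
    then show ?case unfolding uSuc \<Phi>_def using Suc a \<rho>
      by (intro fps_over_add fps_over_mult fps_over_sum fps_over_const fps_over_inverse) auto
  qed
  have contract: "fps_nth (\<Phi> z i) k = fps_nth (\<Phi> z' i) k"
    if z: "\<And>j k. k < m \<Longrightarrow> fps_nth (z j) k = fps_nth (z' j) k"
      "\<And>j. fps_nth (z j) 0 = a j" "\<And>j. fps_nth (z' j) 0 = a j" and k: "k < Suc m" for z z' m i k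
  proof (cases k)
    case (Suc k')
    then have k': "k' < m" using k by simp
    have "fps_nth (inverse (z j)) k' = fps_nth (inverse (z' j)) k'" for j
      by (rule fps_inverse_low_coeffs[of m]) (use z a k' in auto)
    then show ?thesis by (simp add: \<Phi>_def Suc fps_sum_nth)
  qed (simp add: \<Phi>0)
  have step: "fps_nth (u (Suc n) i) k = fps_nth (u n i) k" if "k < Suc n" for n i k
    using that
  proof (induction n arbitrary: i k)
    case 0
    then show ?case by (simp add: u0)
  next
    case (Suc n)
    show ?case unfolding uSuc[of "Suc n"] uSuc[of n]
      by (rule contract[OF _ _ _ Suc.prems]) (use Suc.IH u0 in \<open>auto simp flip: uSuc\<close>)
  qed
  \<comment> \<open>The limit, read off diagonally: coefficient \<open>n\<close> no longer changes
    from iterate \<open>n\<close> on.\<close>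
  define z where "z i = Abs_fps (\<lambda>n. fps_nth (u n i) n)" for i
  have zu: "fps_nth (z i) k = fps_nth (u n i) k" if "k < Suc n" for n i k
    using that
  proof (induction n)
    case (Suc n)
    show ?case
    proof (cases "k < Suc n")
      case True
      then show ?thesis using Suc.IH step[OF True] by simp
    next
      case False
      then have "k = Suc n" using Suc.prems by simp
      then show ?thesis by (simp add: z_def)
    qed
  qed (simp add: z_def)
  have z0: "fps_nth (z i) 0 = a i" for i by (simp add: z_def u0)
  show ?thesis
  proof (intro exI[of _ z] conjI allI)
    show "z i \<in> fps_over F" for i using uF by (auto simp: fps_over_def z_def)
    show "fps_nth (z i) 0 = a i" for i by (rule z0)
    show "z i = fps_const (a i) + fps_X * (\<Sum>j\<in>UNIV. fps_const (\<rho> i j) * inverse (z j))" for i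
    proof -
      have "fps_nth (z i) n = fps_nth (\<Phi> z i) n" for n
      proof -
        have "fps_nth (z i) n = fps_nth (\<Phi> (u n) i) n" using zu[of n "Suc n" i] by (simp add: uSuc)
        also have "\<dots> = fps_nth (\<Phi> z i) n"
          by (rule contract[of "Suc n"]) (use zu[of _ n] u0 z0 in auto)
        finally show ?thesis .
      qed
      then show ?thesis unfolding \<Phi>_def by (intro fps_ext)
    qed
  qed
qed

text \<open>The branch passes through the vertex of the hyperplane arrangement at which the coordinates
  outside the column basis \<open>B\<close> vanish; there the curve is smooth and rational over \<open>K\<close>.\<close>

lemma central_branch_exists:
  fixes k K :: "'a::field_char_0 set"
    and A :: "'d::finite \<Rightarrow> 'n::{finite,linorder} \<Rightarrow> 'a" and c :: "'n \<Rightarrow> 'a" and b :: "'d \<Rightarrow> 'a"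
    and T :: "'n \<Rightarrow> 'd \<Rightarrow> 'a"
  defines "\<rho> i j \<equiv> (\<Sum>l\<in>UNIV. T i l * A l j)"
  assumes k: "field_subset k" and K: "field_subset K" and kK: "k \<subseteq> K"
    and mem: "\<And>l i. A l i \<in> k" "\<And>i. c i \<in> k" "\<And>l. b l \<in> K" "\<And>i l. T i l \<in> k"
    and b_indep: "\<And>q. q \<in> mpoly_carrier k \<Longrightarrow> meval (\<lambda>t. t) q b = 0 \<Longrightarrow> q = 0"
    and K_fraction: "\<And>z. z \<in> K \<Longrightarrow> \<exists>p q. p \<in> mpoly_carrier k \<and> q \<in> mpoly_carrier k \<and>
      meval (\<lambda>t. t) q b \<noteq> 0 \<and> z = meval (\<lambda>t. t) p b / meval (\<lambda>t. t) q b"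
    and dual: "\<And>i j. i \<in> B \<Longrightarrow> j \<in> B \<Longrightarrow> \<rho> i j = (if i = j then 1 else 0)"
    and basis: "\<And>l j. A l j = (\<Sum>i\<in>B. A l i * \<rho> i j)"
    and inv: "\<And>l l'. (\<Sum>i\<in>B. A l i * T i l') = (if l = l' then 1 else 0)"
    and b_vertex: "\<And>i. i \<in> B \<Longrightarrow> (\<Sum>l\<in>UNIV. T i l * b l) \<noteq> 0"
    and c_vertex: "\<And>j. j \<notin> B \<Longrightarrow> (\<Sum>i\<in>B. c i * \<rho> i j) \<noteq> c j"
    and B: "B \<noteq> UNIV"
  obtains x y where "central_branch k K A c b x y"
proof -
  interpret k: field_subset k by fact
  interpret K: field_subset K by fact
  have \<rho>k: "\<rho> i j \<in> k" for i j unfolding \<rho>_def by (intro k.sum_mem k.mult_mem mem)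
  \<comment> \<open>The unknown \<open>z i\<close> stands for the coordinate \<open>x i\<close> if
    \<open>i\<close> is in \<open>B\<close> and for the slack \<open>y i\<close> otherwise. Its
    constant term \<open>a i\<close> is the value at the vertex: the basic solution on
    \<open>B\<close>, the slack of the basic dual solution off \<open>B\<close>.\<close>
  define a where "a i = (if i \<in> B then \<Sum>l\<in>UNIV. T i l * b l else (\<Sum>i'\<in>B. c i' * \<rho> i' i) - c i)" for i
  define \<sigma> where "\<sigma> i j = (if i \<in> B \<and> j \<notin> B then - \<rho> i j else if i \<notin> B \<and> j \<in> B then \<rho> j i else 0)" for i j
  have aK: "a i \<in> K" for i
    unfolding a_def using mem \<rho>k kK by (auto intro!: K.sum_mem K.mult_mem K.diff_mem)
  have anz: "a i \<noteq> 0" for i using b_vertex c_vertex by (auto simp: a_def)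
  have \<sigma>K: "\<sigma> i j \<in> K" for i j unfolding \<sigma>_def using \<rho>k kK by (auto intro: K.uminus_mem)
  from K.fps_system_solution[of a \<sigma>, OF aK anz \<sigma>K] obtain z where
    zK: "\<forall>i. z i \<in> fps_over K" and z0': "\<forall>i. fps_nth (z i) 0 = a i"
    and zeq: "\<forall>i. z i = fps_const (a i) + fps_X * (\<Sum>j\<in>UNIV. fps_const (\<sigma> i j) * inverse (z j))"
    by (elim exE conjE)
  have z0: "fps_nth (z i) 0 = a i" for i using z0' by blast
  have zinv: "z i * inverse (z i) = 1" for i using inverse_mult_eq_1'[of "z i"] z0 anz by simp
  define x where "x i = (if i \<in> B then z i else fps_X * inverse (z i))" for i
  define y where "y i = (if i \<in> B then fps_X * inverse (z i) else z i)" for i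
  have z0nz: "z i \<noteq> 0" "inverse (z i) \<noteq> 0" for i using z0[of i] anz[of i] by auto
  have xB: "x i = fps_const (\<Sum>l\<in>UNIV. T i l * b l) - (\<Sum>j\<in>UNIV - B. fps_const (\<rho> i j) * x j)" if i: "i \<in> B" for i
  proof -
    have "x i = fps_const (a i) + fps_X * (\<Sum>j\<in>UNIV. fps_const (\<sigma> i j) * inverse (z j))"
      using i zeq[THEN spec, of i] unfolding x_def by argo
    also have "(\<Sum>j\<in>UNIV. fps_const (\<sigma> i j) * inverse (z j)) = (\<Sum>j\<in>UNIV - B. - (fps_const (\<rho> i j) * inverse (z j)))"
      using i by (intro sum.mono_neutral_cong_right) (auto simp: \<sigma>_def simp flip: fps_const_neg)
    also have "fps_X * \<dots> = - (\<Sum>j\<in>UNIV - B. fps_const (\<rho> i j) * x j)"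
      unfolding sum_distrib_left sum_negf[symmetric] by (rule sum.cong) (auto simp: x_def mult_ac)
    finally show ?thesis using i by (simp add: a_def)
  qed
  have yN: "y j = fps_const ((\<Sum>i\<in>B. c i * \<rho> i j) - c j) + (\<Sum>i\<in>B. fps_const (\<rho> i j) * y i)" if j: "j \<notin> B" for j
  proof -
    have "y j = fps_const (a j) + fps_X * (\<Sum>i\<in>UNIV. fps_const (\<sigma> j i) * inverse (z i))"
      using j zeq[THEN spec, of j] unfolding y_def by argo
    also have "(\<Sum>i\<in>UNIV. fps_const (\<sigma> j i) * inverse (z i)) = (\<Sum>i\<in>B. fps_const (\<rho> i j) * inverse (z i))"
      using j by (intro sum.mono_neutral_cong_right) (auto simp: \<sigma>_def)
    also have "fps_X * \<dots> = (\<Sum>i\<in>B. fps_const (\<rho> i j) * y i)"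
      unfolding sum_distrib_left by (rule sum.cong) (auto simp: y_def mult_ac)
    finally show ?thesis using j by (simp add: a_def)
  qed
  \<comment> \<open>On all coordinates \<open>y + c\<close> is a combination of the rows
    \<open>\<rho> i\<close>, hence of the rows of \<open>A\<close>; so \<open>y\<close> satisfies
    every relation between the columns of \<open>A\<close> and \<open>c\<close>.\<close>
  have yall: "y j = (\<Sum>i\<in>B. fps_const (\<rho> i j) * (y i + fps_const (c i))) - fps_const (c j)" for j
  proof (cases "j \<in> B")
    case False
    then show ?thesis
      by (simp add: yN[OF False] distrib_left sum.distrib eval_fps.hom_sum eval_fps.hom_diff mult_ac)
  next
    case True
    have "(\<Sum>i\<in>B. fps_const (\<rho> i j) * (y i + fps_const (c i))) = (\<Sum>i\<in>B. if i = j then y j + fps_const (c j) else 0)"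
      using True dual by (intro sum.cong) auto
    then show ?thesis using True by simp
  qed
  have "central_branch k K A c b x y"
  proof unfold_locales
    show "all_rows A c l i \<in> k" for l i using mem by (cases l) auto
    show "x i \<in> fps_over K" for i
    proof -
      have "fps_X \<in> fps_over K" by (auto simp: fps_over_def fps_X_def)
      then show ?thesis unfolding x_def using zK by (auto intro: K.fps_over_mult K.fps_over_inverse)
    qed
    show "y i \<noteq> 0" for i unfolding y_def using z0nz by auto
    show "x i * y i = fps_X" for i using zinv[of i] by (simp add: x_def y_def mult_ac)
    show "(\<Sum>i\<in>UNIV. fps_const (v i) * y i) = 0" if v: "column_relation (all_rows A c) v" for v
    proof -
      have va: "(\<Sum>j\<in>UNIV. v j * A l j) = 0" for l
        using v[unfolded column_relation_def, THEN spec, of "Some l"] by simp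
      have vc: "(\<Sum>j\<in>UNIV. v j * c j) = 0"
        using v[unfolded column_relation_def, THEN spec, of None] by simp
      have v\<rho>: "(\<Sum>j\<in>UNIV. v j * \<rho> i j) = 0" for i
      proof -
        have "(\<Sum>j\<in>UNIV. v j * \<rho> i j) = (\<Sum>l\<in>UNIV. T i l * (\<Sum>j\<in>UNIV. v j * A l j))"
          unfolding \<rho>_def sum_distrib_left by (subst sum.swap) (simp add: mult_ac)
        then show ?thesis using va by simp
      qed
      have "(\<Sum>j\<in>UNIV. fps_const (v j) * y j) =
          (\<Sum>j\<in>UNIV. (\<Sum>i\<in>B. (y i + fps_const (c i)) * fps_const (v j * \<rho> i j)) - fps_const (v j * c j))"
      proof (rule sum.cong)
        fix j
        show "fps_const (v j) * y j =
            (\<Sum>i\<in>B. (y i + fps_const (c i)) * fps_const (v j * \<rho> i j)) - fps_const (v j * c j)"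
          by (subst yall)
            (simp only: right_diff_distrib sum_distrib_left fps_const_mult[symmetric] mult_ac)
      qed simp
      also have "\<dots> = (\<Sum>i\<in>B. (y i + fps_const (c i)) * fps_const (\<Sum>j\<in>UNIV. v j * \<rho> i j)) -
          fps_const (\<Sum>j\<in>UNIV. v j * c j)"
        unfolding sum_subtractf eval_fps.hom_sum sum_distrib_left by (subst sum.swap) simp
      finally show ?thesis by (simp add: v\<rho> vc)
    qed
    show "(\<Sum>i\<in>UNIV. fps_const (A j i) * x i) = fps_const (b j)" for j
    proof -
      have "(\<Sum>i\<in>UNIV. fps_const (A j i) * x i) =
          (\<Sum>i\<in>B. fps_const (A j i) * x i) + (\<Sum>i\<in>UNIV - B. fps_const (A j i) * x i)"
        by (subst sum.subset_diff[of B]) (auto simp: add.commute)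
      also have "(\<Sum>i\<in>UNIV - B. fps_const (A j i) * x i) =
          (\<Sum>i'\<in>UNIV - B. \<Sum>i\<in>B. fps_const (A j i) * (fps_const (\<rho> i i') * x i'))"
      proof (rule sum.cong)
        fix i'
        have "fps_const (A j i') = (\<Sum>i\<in>B. fps_const (A j i) * fps_const (\<rho> i i'))"
          by (subst basis) (simp add: eval_fps.hom_sum)
        then show "fps_const (A j i') * x i' = (\<Sum>i\<in>B. fps_const (A j i) * (fps_const (\<rho> i i') * x i'))"
          by (simp only: sum_distrib_right mult.assoc)
      qed simp
      also have "\<dots> = (\<Sum>i\<in>B. fps_const (A j i) * (\<Sum>i'\<in>UNIV - B. fps_const (\<rho> i i') * x i'))"
        unfolding sum_distrib_left by (rule sum.swap)
      also have "(\<Sum>i\<in>B. fps_const (A j i) * x i) + \<dots> =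
          (\<Sum>i\<in>B. fps_const (A j i) * fps_const (\<Sum>l\<in>UNIV. T i l * b l))"
        unfolding sum.distrib[symmetric] distrib_left[symmetric]
        by (rule sum.cong) (simp_all add: xB)
      also have "\<dots> = fps_const (\<Sum>l\<in>UNIV. (\<Sum>i\<in>B. A j i * T i l) * b l)"
      proof -
        have "(\<Sum>l\<in>UNIV. (\<Sum>i\<in>B. A j i * T i l) * b l) = (\<Sum>i\<in>B. A j i * (\<Sum>l\<in>UNIV. T i l * b l))"
          unfolding sum_distrib_left sum_distrib_right by (subst sum.swap) (simp add: mult_ac)
        moreover have "(\<Sum>i\<in>B. fps_const (A j i) * fps_const (\<Sum>l\<in>UNIV. T i l * b l)) =
            fps_const (\<Sum>i\<in>B. A j i * (\<Sum>l\<in>UNIV. T i l * b l))"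
          by (simp only: eval_fps.hom_sum eval_fps.hom_mult)
        ultimately show ?thesis by simp
      qed
      also have "(\<Sum>l\<in>UNIV. (\<Sum>i\<in>B. A j i * T i l) * b l) = (\<Sum>l\<in>UNIV. if l = j then b j else 0)"
        unfolding inv by (rule sum.cong) auto
      finally show ?thesis by simp
    qed
    \<comment> \<open>To first order, each coordinate outside \<open>B\<close> changes the cost by
      \<open>- a j\<close> times \<open>inverse (a j)\<close>, that is by \<open>- 1\<close>; the
      total is minus the number of these coordinates.\<close>
    show "fps_deriv (\<Sum>i\<in>UNIV. fps_const (c i) * x i) \<noteq> 0"
    proof -
      have x1N: "fps_nth (x j) 1 = inverse (a j)" if "j \<notin> B" for j
        using that z0 by (simp add: x_def)
      have x1B: "fps_nth (x i) 1 = - (\<Sum>j\<in>UNIV - B. \<rho> i j * inverse (a j))" if "i \<in> B" for i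
        unfolding xB[OF that] using x1N by (simp add: fps_sum_nth)
      have "fps_nth (\<Sum>i\<in>UNIV. fps_const (c i) * x i) 1 = (\<Sum>i\<in>UNIV. c i * fps_nth (x i) 1)"
        by (simp add: fps_sum_nth)
      also have "\<dots> = (\<Sum>i\<in>B. c i * fps_nth (x i) 1) + (\<Sum>j\<in>UNIV - B. c j * fps_nth (x j) 1)"
        by (subst sum.subset_diff[of B]) (auto simp: add.commute)
      also have "(\<Sum>i\<in>B. c i * fps_nth (x i) 1) = - (\<Sum>j\<in>UNIV - B. (\<Sum>i\<in>B. c i * \<rho> i j) * inverse (a j))"
      proof -
        have "(\<Sum>i\<in>B. c i * fps_nth (x i) 1) = (\<Sum>i\<in>B. - (\<Sum>j\<in>UNIV - B. c i * \<rho> i j * inverse (a j)))"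
          by (rule sum.cong) (simp_all add: x1B[unfolded One_nat_def] sum_distrib_left mult.assoc)
        also have "\<dots> = - (\<Sum>j\<in>UNIV - B. \<Sum>i\<in>B. c i * \<rho> i j * inverse (a j))"
          unfolding sum_negf by (subst sum.swap) simp
        finally show ?thesis by (simp add: sum_distrib_right)
      qed
      also have "\<dots> + (\<Sum>j\<in>UNIV - B. c j * fps_nth (x j) 1) = (\<Sum>j\<in>UNIV - B. - 1)"
        unfolding sum_negf[symmetric] sum.distrib[symmetric]
      proof (rule sum.cong)
        fix j assume j: "j \<in> UNIV - B"
        have "- ((\<Sum>i\<in>B. c i * \<rho> i j) * inverse (a j)) + c j * fps_nth (x j) 1 = - (a j * inverse (a j))"
          using j x1N[of j] by (simp add: a_def algebra_simps)
        then show "- ((\<Sum>i\<in>B. c i * \<rho> i j) * inverse (a j)) + c j * fps_nth (x j) 1 = - 1"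
          using anz[of j] by simp
      qed simp
      also have "\<dots> = - of_nat (card (UNIV - B))" by simp
      finally have x1: "fps_nth (\<Sum>i\<in>UNIV. fps_const (c i) * x i) 1 = - of_nat (card (UNIV - B))" .
      have "card (UNIV - B) \<noteq> 0" using B by auto
      moreover have "fps_nth (fps_deriv (\<Sum>i\<in>UNIV. fps_const (c i) * x i)) 0 = - of_nat (card (UNIV - B))"
        unfolding fps_deriv_nth add_0 x1 by simp
      ultimately show ?thesis by (metis fps_zero_nth neg_equal_0_iff_equal of_nat_eq_0_iff)
    qed
  qed (use kK mem b_indep K_fraction in auto)
  then show thesis by (rule that)
qed

section \<open>The central path\<close>

text \<open>The inequality of arithmetic and geometric means, from the identity for the square of
  the midpoint: strict concavity of the logarithm at midpoints.\<close>

lemma ln_midpoint: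
  fixes u v :: real
  assumes "0 < u" "0 < v"
  shows "(ln u + ln v) / 2 \<le> ln ((u + v) / 2)" "u \<noteq> v \<Longrightarrow> (ln u + ln v) / 2 < ln ((u + v) / 2)"
proof -
  have sq: "((u + v) / 2)\<^sup>2 = u * v + ((u - v) / 2)\<^sup>2"
    by (simp add: power2_eq_square field_simps)
  have l2: "ln (((u + v) / 2)\<^sup>2) = 2 * ln ((u + v) / 2)" using assms by (simp add: ln_realpow)
  have lm: "ln (u * v) = ln u + ln v" using assms by (simp add: ln_mult)
  have "ln (u * v) \<le> ln (((u + v) / 2)\<^sup>2)"
    using assms sq by (subst ln_le_cancel_iff) (auto intro: add_pos_nonneg)
  then show "(ln u + ln v) / 2 \<le> ln ((u + v) / 2)" using l2 lm by simp
  assume "u \<noteq> v"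
  then have "0 < ((u - v) / 2)\<^sup>2" by simp
  then have "ln (u * v) < ln (((u + v) / 2)\<^sup>2)"
    using assms sq by (subst ln_less_cancel_iff) (auto intro: add_pos_nonneg)
  then show "(ln u + ln v) / 2 < ln ((u + v) / 2)" using l2 lm by simp
qed

lemma strictly_feasible_midpoint:
  assumes "x \<in> strictly_primal_feasible A b" "y \<in> strictly_primal_feasible A b"
  shows "(1/2) *\<^sub>R (x + y) \<in> strictly_primal_feasible A b"
  using assms unfolding strictly_primal_feasible_def
  by (simp add: matrix_vector_mult_scaleR matrix_vector_right_distrib add_pos_pos flip: scaleR_2)

text \<open>A second point attaining the maximum would be beaten by the midpoint, by strict
  concavity of the logarithm.\<close>

lemma barrier_maximizer_unique:
  assumes l: "l > 0" and x: "x \<in> strictly_primal_feasible A b"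
    and max: "\<And>y. y \<in> strictly_primal_feasible A b \<Longrightarrow> barrier c l y \<le> barrier c l x"
  shows "central_point A b c l x"
  unfolding central_point_def
proof (intro conjI ballI impI x)
  fix y assume y: "y \<in> strictly_primal_feasible A b" "y \<noteq> x"
  have pos: "0 < x $ i" "0 < y $ i" for i using x y by (auto simp: strictly_primal_feasible_def)
  let ?m = "(1/2) *\<^sub>R (x + y)"
  obtain i where i: "x $ i \<noteq> y $ i" using y(2) unfolding vec_eq_iff by metis
  have "(\<Sum>i\<in>UNIV. (ln (x $ i) + ln (y $ i)) / 2) < (\<Sum>i\<in>UNIV. ln ((x $ i + y $ i) / 2))"
  proof (rule sum_strict_mono_ex1)
    show "\<forall>i\<in>UNIV. (ln (x $ i) + ln (y $ i)) / 2 \<le> ln ((x $ i + y $ i) / 2)"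
      using ln_midpoint(1)[OF pos] by blast
    show "\<exists>i\<in>UNIV. (ln (x $ i) + ln (y $ i)) / 2 < ln ((x $ i + y $ i) / 2)"
      using ln_midpoint(2)[OF pos i] by blast
  qed simp
  then have "l * (\<Sum>i\<in>UNIV. (ln (x $ i) + ln (y $ i)) / 2) < l * (\<Sum>i\<in>UNIV. ln (?m $ i))"
    using l by simp
  then have "(barrier c l x + barrier c l y) / 2 < barrier c l ?m"
    by (simp add: barrier_def inner_add_right sum.distrib algebra_simps flip: sum_divide_distrib)
  also have "\<dots> \<le> barrier c l x" by (rule max[OF strictly_feasible_midpoint[OF x y(1)]])
  finally show "barrier c l y < barrier c l x" by simp
qed

text \<open>On \<open>A x = b\<close> the cost is the constant \<open>b \<bullet> y\<close> minus
  the pairing of \<open>x\<close> with the slacks. This splits the barrier into functions of one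
  coordinate each, bounded above when the slacks are positive.\<close>

lemma barrier_dual_form:
  fixes A :: "real^'n::finite^'d::finite"
  assumes "A *v x = b"
  shows "barrier c l x = b \<bullet> y + (\<Sum>i\<in>UNIV. l * ln (x $ i) - (transpose A *v y - c) $ i * x $ i)"
proof -
  have "(transpose A *v y) \<bullet> x = b \<bullet> y"
    unfolding transpose_matrix_vector dot_lmul_matrix assms by (rule inner_commute)
  then have "(transpose A *v y - c) \<bullet> x = b \<bullet> y - c \<bullet> x"
    by (simp only: inner_diff_left)
  then show ?thesis
    by (simp add: barrier_def sum_subtractf inner_vec_def sum_distrib_left)
qed

text \<open>Feasible points at least as good as \<open>x0\<close> lie in a compact box inside the
  positive orthant, since each one-variable summand tends to minus infinity at both ends of the
  half-line. A maximizer over that box is then a global one.\<close>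

lemma central_point_exists:
  fixes A :: "real^'n::finite^'d::finite"
  assumes l: "l > 0" and ne: "strictly_primal_feasible A b \<noteq> {}" and dual: "y \<in> strictly_dual_feasible A c"
  shows "\<exists>x. central_point A b c l x"
proof -
  obtain x0 where x0: "x0 \<in> strictly_primal_feasible A b" using ne by blast
  define s where "s = transpose A *v y - c"
  have s: "0 < s $ i" for i using dual by (simp add: s_def strictly_dual_feasible_def)
  \<comment> \<open>Comes from \<open>ln u \<le> u - 1\<close> at
    \<open>u = t * s $ i / (2 * l)\<close>; the factor 2 leaves half of the linear term to bound
    \<open>t\<close> from above.\<close>
  define H where "H i = l * ln (2 * l / s $ i) - l" for i
  \<comment> \<open>A lower bound for each single summand at a point no worse than
    \<open>x0\<close>, the other summands being bounded by the absolute values of the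
    \<open>H i\<close>.\<close>
  define \<gamma> where "\<gamma> = barrier c l x0 - b \<bullet> y - (\<Sum>i\<in>UNIV. \<bar>H i\<bar>)"
  have upper: "l * ln t - s $ i * t \<le> H i - s $ i * t / 2" if "t > 0" for t i
  proof -
    have u: "0 < 2 * l / s $ i" using l s by simp
    have "ln (t / (2 * l / s $ i)) \<le> t / (2 * l / s $ i) - 1"
      by (rule ln_le_minus_one[OF divide_pos_pos[OF that u]])
    then have "ln t \<le> ln (2 * l / s $ i) + (t / (2 * l / s $ i) - 1)"
      using that less_imp_neq[OF u] by (simp only: ln_div) auto
    then have "l * ln t \<le> l * (ln (2 * l / s $ i) + (t / (2 * l / s $ i) - 1))"
      using l by simp
    also have "\<dots> = H i + s $ i * t / 2" using l s[of i] by (simp add: H_def field_simps)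
    finally show ?thesis by simp
  qed
  define M where "M = (\<Sum>i\<in>UNIV. \<bar>2 * (H i - \<gamma>) / s $ i\<bar>)"
  define P where "P = {x. A *v x = b \<and> (\<forall>i. exp (\<gamma> / l) \<le> x $ i \<and> x $ i \<le> M)}"
  have inP: "x \<in> P" if x: "x \<in> strictly_primal_feasible A b" "barrier c l x0 \<le> barrier c l x" for x
  proof -
    have pos: "0 < x $ i" for i using x(1) by (simp add: strictly_primal_feasible_def)
    have Ax: "A *v x = b" using x(1) by (simp add: strictly_primal_feasible_def)
    define g where "g i = l * ln (x $ i) - s $ i * x $ i" for i
    have gH: "g i \<le> H i - s $ i * x $ i / 2" for i unfolding g_def by (rule upper[OF pos])
    have gH': "g i \<le> \<bar>H i\<bar>" for i using gH[of i] mult_pos_pos[OF s[of i] pos[of i]] by linarith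
    have sum: "barrier c l x0 \<le> b \<bullet> y + (\<Sum>i\<in>UNIV. g i)"
      using x(2) barrier_dual_form[OF Ax, of c l y] by (simp add: g_def s_def)
    have low: "\<gamma> \<le> g j" for j
    proof -
      have "(\<Sum>i\<in>UNIV. g i) = g j + (\<Sum>i\<in>UNIV - {j}. g i)" by (rule sum.remove) auto
      also have "(\<Sum>i\<in>UNIV - {j}. g i) \<le> (\<Sum>i\<in>UNIV - {j}. \<bar>H i\<bar>)" by (intro sum_mono gH')
      also have "\<dots> \<le> (\<Sum>i\<in>UNIV. \<bar>H i\<bar>)" by (intro sum_mono2) auto
      finally show ?thesis using sum unfolding \<gamma>_def by linarith
    qed
    have "exp (\<gamma> / l) \<le> x $ i \<and> x $ i \<le> M" for i
    proof
      have "\<gamma> \<le> l * ln (x $ i)"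
        using low[of i] mult_pos_pos[OF s[of i] pos[of i]] unfolding g_def by linarith
      then have "\<gamma> / l \<le> ln (x $ i)" using l by (simp add: divide_le_eq mult.commute)
      then show "exp (\<gamma> / l) \<le> x $ i" using pos[of i] by (simp add: ln_ge_iff)
      have "s $ i * x $ i / 2 \<le> H i - \<gamma>" using low[of i] gH[of i] by linarith
      then have "x $ i * s $ i \<le> 2 * (H i - \<gamma>)" by (simp add: mult.commute)
      then have "x $ i \<le> 2 * (H i - \<gamma>) / s $ i" by (simp only: pos_le_divide_eq[OF s])
      also have "\<dots> \<le> \<bar>2 * (H i - \<gamma>) / s $ i\<bar>" by (rule abs_ge_self)
      also have "\<dots> \<le> M" unfolding M_def by (rule member_le_sum[of i UNIV "\<lambda>i. \<bar>2 * (H i - \<gamma>) / s $ i\<bar>"]) auto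
      finally show "x $ i \<le> M" .
    qed
    then show ?thesis using Ax by (simp add: P_def)
  qed
  have "compact P"
  proof -
    have "P = {x. A *v x = b} \<inter> cbox (\<chi> i. exp (\<gamma> / l)) (\<chi> i. M)"
      by (auto simp: P_def mem_box_cart)
    moreover have "closed {x. A *v x = b}"
      by (intro closed_Collect_eq continuous_on_const matrix_vector_mult_linear_continuous_on)
    ultimately show ?thesis by (simp add: closed_Int_compact)
  qed
  moreover have "P \<noteq> {}" using inP[OF x0] by auto
  moreover have "continuous_on P (barrier c l)"
  proof -
    have "x $ i \<noteq> 0" if "x \<in> P" for x i
      using that exp_gt_zero[of "\<gamma> / l"] unfolding P_def by (metis (mono_tags, lifting) mem_Collect_eq not_le)
    then show ?thesis unfolding barrier_def by (intro continuous_intros) auto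
  qed
  ultimately obtain x where x: "x \<in> P" "\<forall>z\<in>P. barrier c l z \<le> barrier c l x"
    using continuous_attains_sup[of P "barrier c l"] by blast
  have xS: "x \<in> strictly_primal_feasible A b"
    using x(1) less_le_trans[OF exp_gt_zero[of "\<gamma> / l"]] unfolding P_def strictly_primal_feasible_def
    by blast
  have "central_point A b c l x"
  proof (rule barrier_maximizer_unique[OF l xS])
    fix z assume z: "z \<in> strictly_primal_feasible A b"
    show "barrier c l z \<le> barrier c l x"
    proof (cases "barrier c l x0 \<le> barrier c l z")
      case True
      then show ?thesis using inP[OF z] x(2) by blast
    next
      case False
      have "barrier c l x0 \<le> barrier c l x" using x(2) inP[OF x0] by blast
      then show ?thesis using False by linarith
    qed
  qed
  then show ?thesis by blast
qed

section \<open>Optimality conditions along the central path\<close>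

lemma central_point_stationary:
  fixes A :: "real^'n::finite^'d::finite"
  assumes cp: "central_point A b c l x" and v: "A *v v = 0"
  shows "c \<bullet> v + l * (\<Sum>i\<in>UNIV. v $ i / x $ i) = 0"
proof -
  have x: "A *v x = b" "\<And>i. 0 < x $ i"
    and max: "\<And>y. y \<in> strictly_primal_feasible A b \<Longrightarrow> barrier c l y \<le> barrier c l x"
    using cp unfolding central_point_def strictly_primal_feasible_def
    by (auto intro: less_imp_le)
  define \<phi> where "\<phi> t = barrier c l (x + t *\<^sub>R v)" for t
  \<comment> \<open>For \<open>t\<close> below this radius \<open>x + t *\<^sub>R v\<close> stays
    positive; the summand 1 in the denominator covers the coordinates with
    \<open>v $ i = 0\<close>.\<close>
  define e where "e = Min ((\<lambda>i. x $ i / (1 + \<bar>v $ i\<bar>)) ` UNIV)"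
  have e: "e > 0" unfolding e_def using x(2) by (subst Min_gr_iff) (auto intro!: divide_pos_pos add_pos_nonneg)
  have pos: "0 < (x + t *\<^sub>R v) $ i" if t: "\<bar>t\<bar> < e" for t i
  proof -
    have "\<bar>t\<bar> < x $ i / (1 + \<bar>v $ i\<bar>)" using t unfolding e_def by (subst (asm) Min_gr_iff) auto
    then have "\<bar>t\<bar> * (1 + \<bar>v $ i\<bar>) < x $ i" by (simp add: pos_less_divide_eq add_pos_nonneg)
    moreover have "\<bar>t * v $ i\<bar> \<le> \<bar>t\<bar> * (1 + \<bar>v $ i\<bar>)" by (simp add: abs_mult distrib_left)
    ultimately have "\<bar>t * v $ i\<bar> < x $ i" by linarith
    then show ?thesis by simp
  qed
  have "(\<phi> has_real_derivative c \<bullet> v + l * (\<Sum>i\<in>UNIV. v $ i / x $ i)) (at 0)"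
  proof -
    have "((\<lambda>t. ln (x $ i + t * v $ i)) has_real_derivative v $ i / x $ i) (at 0)" for i
      using x(2)[of i] by (auto intro!: derivative_eq_intros)
    then have "((\<lambda>t. (c \<bullet> x + t * (c \<bullet> v)) + l * (\<Sum>i\<in>UNIV. ln (x $ i + t * v $ i))) has_real_derivative
        (c \<bullet> v + l * (\<Sum>i\<in>UNIV. v $ i / x $ i))) (at 0)"
      by (intro DERIV_add DERIV_cmult DERIV_sum) (auto intro!: derivative_eq_intros)
    then show ?thesis by (simp add: \<phi>_def[abs_def] barrier_def inner_add_right)
  qed
  then show ?thesis
  proof (rule DERIV_local_max[OF _ e])
    show "\<forall>t. \<bar>0 - t\<bar> < e \<longrightarrow> \<phi> t \<le> \<phi> 0"
    proof (intro allI impI)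
      fix t :: real assume "\<bar>0 - t\<bar> < e"
      then have "x + t *\<^sub>R v \<in> strictly_primal_feasible A b"
        using pos[of t] x(1) v unfolding strictly_primal_feasible_def
        by (simp add: matrix_vector_right_distrib matrix_vector_mult_scaleR)
      then show "\<phi> t \<le> \<phi> 0" using max by (simp add: \<phi>_def)
    qed
  qed
qed

text \<open>Lagrange multipliers: a functional separating \<open>c + l / x\<close> from the rows of
  \<open>A\<close> would be a kernel direction violating stationarity. Solving for
  \<open>1 / x\<close> puts the reciprocal of \<open>x\<close> into the span of the rows and
  \<open>c\<close>.\<close>

lemma central_point_in_reciprocal:
  fixes A :: "real^'n::finite^'d::finite"
  assumes cp: "central_point A b c l x" and l: "l > 0"
  shows "\<exists>s\<in>row_span (all_rows (\<lambda>j i. A $ j $ i) (\<lambda>i. c $ i)). \<forall>i. x $ i * s i = 1"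
proof -
  interpret field_subset "UNIV :: real set" by (rule field_subset_UNIV)
  define w where "w i = c $ i + l / x $ i" for i
  have x: "0 < x $ i" for i using cp by (simp add: central_point_def strictly_primal_feasible_def)
  have "(\<exists>\<beta>. (\<forall>j. \<beta> j \<in> UNIV) \<and> (\<forall>i. w i = (\<Sum>j\<in>UNIV. \<beta> j * A $ j $ i))) \<or>
    (\<exists>\<eta>. (\<forall>i. \<eta> i \<in> UNIV) \<and> (\<forall>j\<in>UNIV. (\<Sum>i\<in>UNIV. \<eta> i * A $ j $ i) = 0) \<and> (\<Sum>i\<in>UNIV. \<eta> i * w i) = 1)"
    by (rule span_or_separating_functional) auto
  then show ?thesis
  proof (elim disjE exE conjE)
    fix \<eta> assume \<eta>: "\<forall>j\<in>UNIV. (\<Sum>i\<in>UNIV. \<eta> i * A $ j $ i) = 0" "(\<Sum>i\<in>UNIV. \<eta> i * w i) = 1"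
    have "A *v (\<chi> i. \<eta> i) = 0"
      using \<eta>(1) by (simp add: vec_eq_iff matrix_vector_mult_def mult.commute)
    from central_point_stationary[OF cp this]
    have "(\<Sum>i\<in>UNIV. \<eta> i * w i) = 0"
      by (simp add: w_def inner_vec_def distrib_left sum.distrib sum_distrib_left mult_ac)
    then show ?thesis using \<eta>(2) by simp
  next
    fix \<beta> assume \<beta>: "\<forall>i. w i = (\<Sum>j\<in>UNIV. \<beta> j * A $ j $ i)"
    define t where "t r = (case r of None \<Rightarrow> - 1 / l | Some j \<Rightarrow> \<beta> j / l)" for r
    define s where "s i = (\<Sum>r\<in>UNIV. t r * all_rows (\<lambda>j i. A $ j $ i) (\<lambda>i. c $ i) r i)" for i
    have s: "s i = 1 / x $ i" for i
    proof -
      have "s i = - c $ i / l + (\<Sum>j\<in>UNIV. \<beta> j / l * A $ j $ i)"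
        by (simp add: s_def t_def UNIV_option_conv sum.reindex)
      also have "(\<Sum>j\<in>UNIV. \<beta> j / l * A $ j $ i) = w i / l"
        using \<beta> by (simp add: sum_divide_distrib)
      finally show ?thesis using l by (simp add: w_def field_simps)
    qed
    have "x $ i * s i = 1" for i using s x[of i] by simp
    moreover have "s \<in> row_span (all_rows (\<lambda>j i. A $ j $ i) (\<lambda>i. c $ i))"
      unfolding row_span_def s_def by blast
    ultimately show ?thesis by blast
  qed
qed

text \<open>The cost is injective in the barrier parameter: distinct points of equal cost contradict
  the two strict maximalities, and a point serving two parameters would have
  \<open>c \<bullet> v = 0\<close> by stationarity.\<close>

lemma infinite_central_path_values:
  fixes A :: "real^'n::finite^'d::finite"
  assumes ne: "strictly_primal_feasible A b \<noteq> {}" and dual: "strictly_dual_feasible A c \<noteq> {}"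
    and v: "A *v v = 0" "c \<bullet> v \<noteq> 0"
  shows "infinite ((\<lambda>x. c \<bullet> x) ` primal_central_path A b c)"
proof -
  obtain y where y: "y \<in> strictly_dual_feasible A c" using dual by blast
  have "\<forall>l. \<exists>x. l > 0 \<longrightarrow> central_point A b c l x"
    using central_point_exists[OF _ ne y] by blast
  from choice[OF this] obtain X where X: "\<And>l. l > 0 \<Longrightarrow> central_point A b c l (X l)" by blast
  have "inj_on (\<lambda>l. c \<bullet> X l) {0<..}"
  proof (rule inj_onI, rule ccontr)
    fix l l' assume l: "l \<in> {0<..}" "l' \<in> {0<..}" "c \<bullet> X l = c \<bullet> X l'" "l \<noteq> l'"
    let ?S = "\<lambda>x :: real^'n. \<Sum>i\<in>UNIV. ln (x $ i)"
    have S: "X l \<in> strictly_primal_feasible A b" "X l' \<in> strictly_primal_feasible A b"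
      using X l by (auto simp: central_point_def)
    show False
    proof (cases "X l = X l'")
      case True
      let ?q = "\<Sum>i\<in>UNIV. v $ i / X l $ i"
      have "c \<bullet> v + l * ?q = 0" "c \<bullet> v + l' * ?q = 0"
        using central_point_stationary[OF X v(1), of l] central_point_stationary[OF X v(1), of l'] l True by auto
      then have "l * ?q = l' * ?q" by linarith
      then have "?q = 0" using l(4) by simp
      then show False using \<open>c \<bullet> v + l * ?q = 0\<close> v(2) by simp
    next
      case False
      have "barrier c l (X l') < barrier c l (X l)" "barrier c l' (X l) < barrier c l' (X l')"
        using X[of l] X[of l'] l S False unfolding central_point_def by auto
      then have "l * ?S (X l') < l * ?S (X l)" "l' * ?S (X l) < l' * ?S (X l')"
        using l(3) by (simp_all add: barrier_def)
      then have "?S (X l') < ?S (X l)" "?S (X l) < ?S (X l')" using l by auto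
      then show False by simp
    qed
  qed
  then have "infinite ((\<lambda>l. c \<bullet> X l) ` {0<..})"
    using infinite_Ioi[of "0::real"] by (simp add: finite_image_iff)
  moreover have "(\<lambda>l. c \<bullet> X l) ` {0<..} \<subseteq> (\<lambda>x. c \<bullet> x) ` primal_central_path A b c"
    using X unfolding primal_central_path_def by auto
  ultimately show ?thesis using finite_subset by blast
qed

section \<open>Fields of rational functions in independent parameters\<close>

lemma field_subset_generate_field:
  "field_subset (generate_field ring_of_type_algebra (H :: 'a::field set))"
proof -
  let ?R = "ring_of_type_algebra :: 'a ring"
  interpret R: field ?R by (rule field_from_type_algebra)
  have simps [simp]: "carrier ?R = UNIV" "x \<otimes>\<^bsub>?R\<^esub> y = x * y" "x \<oplus>\<^bsub>?R\<^esub> y = x + y"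
    "\<one>\<^bsub>?R\<^esub> = 1" "\<zero>\<^bsub>?R\<^esub> = 0" for x y
    by (simp_all add: ring_of_type_algebra_def)
  have neg: "\<ominus>\<^bsub>?R\<^esub> x = - x" for x by (rule R.minus_equality) auto
  have inv: "inv\<^bsub>?R\<^esub> x = inverse x" if "x \<noteq> 0" for x
    by (rule R.comm_inv_char) (use that in auto)
  show ?thesis
  proof
    show one: "1 \<in> generate_field ?R H" using generate_field.one[of ?R H] by simp
    show neg_mem: "- x \<in> generate_field ?R H" if "x \<in> generate_field ?R H" for x
      using generate_field.a_inv[OF that] by (simp add: neg)
    show add: "x + y \<in> generate_field ?R H" if "x \<in> generate_field ?R H" "y \<in> generate_field ?R H" for x y
      using generate_field.eng_add[OF that] by simp
    show "x * y \<in> generate_field ?R H" if "x \<in> generate_field ?R H" "y \<in> generate_field ?R H" for x y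
      using generate_field.eng_mult[OF that] by simp
    show zero: "0 \<in> generate_field ?R H" using add[OF one neg_mem[OF one]] by simp
    show "inverse x \<in> generate_field ?R H" if "x \<in> generate_field ?R H" for x
      using generate_field.m_inv[OF that] zero inv[of x] by (cases "x = 0") simp_all
  qed
qed

lemma (in field_subset) generate_field_subset:
  assumes "H \<subseteq> F" shows "generate_field ring_of_type_algebra H \<subseteq> F"
proof
  let ?R = "ring_of_type_algebra :: 'a ring"
  interpret R: field ?R by (rule field_from_type_algebra)
  have simps [simp]: "carrier ?R = UNIV" "x \<otimes>\<^bsub>?R\<^esub> y = x * y" "x \<oplus>\<^bsub>?R\<^esub> y = x + y"
    "\<one>\<^bsub>?R\<^esub> = 1" "\<zero>\<^bsub>?R\<^esub> = 0" for x y
    by (simp_all add: ring_of_type_algebra_def)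
  have neg: "\<ominus>\<^bsub>?R\<^esub> x = - x" for x by (rule R.minus_equality) auto
  have inv: "inv\<^bsub>?R\<^esub> x = inverse x" if "x \<noteq> 0" for x
    by (rule R.comm_inv_char) (use that in auto)
  fix x assume "x \<in> generate_field ?R H"
  then show "x \<in> F"
    by induction (use assms in \<open>auto simp: neg inv\<close>)
qed

definition fractions :: "'a::field set \<Rightarrow> ('d::finite \<Rightarrow> 'a) \<Rightarrow> 'a set"
  where "fractions F z = {meval (\<lambda>t. t) p z / meval (\<lambda>t. t) q z |p q.
    p \<in> mpoly_carrier F \<and> q \<in> mpoly_carrier F \<and> meval (\<lambda>t. t) q z \<noteq> 0}"

lemma (in field_subset) field_subset_fractions: "field_subset (fractions F z)"
proof
  let ?ev = "\<lambda>p. meval (\<lambda>t. t) p z"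
  have I: "?ev p / ?ev q \<in> fractions F z"
    if "p \<in> mpoly_carrier F" "q \<in> mpoly_carrier F" "?ev q \<noteq> 0" for p q
    using that unfolding fractions_def by blast
  have E: "\<exists>p q. p \<in> mpoly_carrier F \<and> q \<in> mpoly_carrier F \<and> ?ev q \<noteq> 0 \<and> x = ?ev p / ?ev q"
    if "x \<in> fractions F z" for x
    using that unfolding fractions_def by blast
  show "0 \<in> fractions F z" using I[OF carrier_zero carrier_one] by simp
  show "1 \<in> fractions F z" using I[OF carrier_one carrier_one] by simp
  fix x assume "x \<in> fractions F z"
  then obtain p q where x: "p \<in> mpoly_carrier F" "q \<in> mpoly_carrier F" "?ev q \<noteq> 0" "x = ?ev p / ?ev q"
    using E by blast
  show "- x \<in> fractions F z"
    using I[OF carrier_uminus[OF x(1)] x(2,3)] by (simp add: x(4) eval_id.meval_uminus)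
  show "inverse x \<in> fractions F z"
  proof (cases "?ev p = 0")
    case True
    then show ?thesis using \<open>0 \<in> fractions F z\<close> by (simp add: x(4))
  next
    case False
    then show ?thesis using I[OF x(2,1)] by (simp add: x(4))
  qed
  fix y assume "y \<in> fractions F z"
  then obtain p' q' where y: "p' \<in> mpoly_carrier F" "q' \<in> mpoly_carrier F" "?ev q' \<noteq> 0" "y = ?ev p' / ?ev q'"
    using E by blast
  have q: "q * q' \<in> mpoly_carrier F" "?ev (q * q') \<noteq> 0"
    using x y by (simp_all add: carrier_mult eval_id.meval_mult)
  have "p * q' + p' * q \<in> mpoly_carrier F" by (intro carrier_add carrier_mult x y)
  from I[OF this q] show "x + y \<in> fractions F z"
    using x(3) y(3) by (simp add: x(4) y(4) eval_id.meval_add eval_id.meval_mult add_frac_eq mult.commute)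
  have "p * p' \<in> mpoly_carrier F" by (intro carrier_mult x y)
  from I[OF this q] show "x * y \<in> fractions F z" by (simp add: x(4) y(4) eval_id.meval_mult)
qed

lemma (in field_subset) generate_field_fraction:
  assumes "H \<subseteq> F \<union> range z" "x \<in> generate_field ring_of_type_algebra H"
  shows "\<exists>p q. p \<in> mpoly_carrier F \<and> q \<in> mpoly_carrier F \<and> meval (\<lambda>t. t) q z \<noteq> 0 \<and>
    x = meval (\<lambda>t. t) p z / meval (\<lambda>t. t) q z"
proof -
  interpret fr: field_subset "fractions F z" by (rule field_subset_fractions)
  have "meval (\<lambda>t. t) p z / meval (\<lambda>t. t) 1 z \<in> fractions F z" if "p \<in> mpoly_carrier F" for p
    unfolding fractions_def using that carrier_one by (intro CollectI exI[of _ p] exI[of _ 1]) simp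
  then have ev: "meval (\<lambda>t. t) p z \<in> fractions F z" if "p \<in> mpoly_carrier F" for p
    using that by simp
  have "H \<subseteq> fractions F z"
  proof
    fix y assume "y \<in> H"
    then consider "y \<in> F" | j where "y = z j" using assms(1) by blast
    then show "y \<in> fractions F z"
      using ev[OF carrier_Const[of y]] ev[OF carrier_Var] by cases auto
  qed
  then show ?thesis using fr.generate_field_subset assms(2) unfolding fractions_def by blast
qed

lemma meval_Const_Var: "meval Const p Var = (p :: ('i::finite, 'a::comm_ring_1) mpoly)"
  unfolding meval_def mono_val_Var
  by (subst (3) poly_mapping_sum_single[of p]) (simp add: Const_def mult_single)

text \<open>With denominators in \<open>c\<close> cleared, the coefficients of \<open>q\<close> are
  polynomials in \<open>c\<close>. Fresh variables for \<open>c\<close> then give a polynomial over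
  \<open>F\<close> vanishing at the joint family \<open>b\<close>, \<open>c\<close>, to which the
  hypothesis applies.\<close>

lemma (in field_subset) algebraically_independent_tower:
  fixes b :: "'d::finite \<Rightarrow> 'a" and c :: "'n::finite \<Rightarrow> 'a"
  assumes ind: "algebraically_independent_over F (case_sum b c)"
    and q: "q \<in> mpoly_carrier (generate_field ring_of_type_algebra (F \<union> range c))" "meval (\<lambda>t. t) q b = 0"
  shows "q = 0"
proof -
  have "\<exists>p' q'. p' \<in> mpoly_carrier F \<and> q' \<in> mpoly_carrier F \<and> meval (\<lambda>t. t) q' c \<noteq> 0 \<and>
      Poly_Mapping.lookup q a = meval (\<lambda>t. t) p' c / meval (\<lambda>t. t) q' c" for a
    by (rule generate_field_fraction[of "F \<union> range c"]) (use q(1) in \<open>auto simp: mpoly_carrier_def\<close>)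
  then obtain D P where D: "D \<in> mpoly_carrier F" "meval (\<lambda>t. t) D c \<noteq> 0" and P: "\<And>a. P a \<in> mpoly_carrier F"
    and DP: "\<And>a. a \<in> Poly_Mapping.keys q \<Longrightarrow>
      meval (\<lambda>t. t) D c * Poly_Mapping.lookup q a = meval (\<lambda>t. t) (P a) c"
    by (rule fractions_common_denominator[OF finite_keys[of q], of c "Poly_Mapping.lookup q"]) blast+
  define Q :: "('d + 'n, 'a) mpoly" where "Q = (\<Sum>a\<in>Poly_Mapping.keys q.
    meval Const (P a) (\<lambda>i. Var (Inr i)) * mono_val (\<lambda>j. Var (Inl j)) a)"
  have Qc: "Q \<in> mpoly_carrier F"
    unfolding Q_def by (intro carrier_intros P)
  have ev: "meval (\<lambda>t. t) (meval Const p (\<lambda>i. Var (Inr i)) :: ('d + 'n, 'a) mpoly) (case_sum b c) =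
      meval (\<lambda>t. t) p c" for p
    by (simp add: eval_id.meval_substitute)
  have "meval (\<lambda>t. t) Q (case_sum b c) = (\<Sum>a\<in>Poly_Mapping.keys q. meval (\<lambda>t. t) (P a) c * mono_val b a)"
    by (simp add: Q_def eval_id.meval_sum eval_id.meval_mult ev eval_id.meval_mono_val)
  also have "\<dots> = meval (\<lambda>t. t) D c * meval (\<lambda>t. t) q b"
    unfolding meval_def[of _ q] sum_distrib_left by (intro sum.cong) (simp_all add: DP[symmetric])
  also have "\<dots> = 0" using q(2) by simp
  finally have "Q = 0"
    using ind Qc unfolding algebraically_independent_over_def mpoly_eval_eq_meval by blast
  \<comment> \<open>The passage to polynomials in one group of variables with polynomial
    coefficients in the other; it reads \<open>Q = 0\<close> as the vanishing of every
    \<open>P a\<close>.\<close>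
  define h where "h t = (Const (Const t) :: ('d, ('n, 'a) mpoly) mpoly)" for t
  interpret h: coeff_hom h
    unfolding h_def by unfold_locales
      (simp_all add: eval_Const.hom_1 eval_Const.hom_add eval_Const.hom_mult)
  define z where "z s = ((case s of Inl j \<Rightarrow> Var j | Inr i \<Rightarrow> Const (Var i)) :: ('d, ('n, 'a) mpoly) mpoly)" for s
  have hp: "meval h (meval Const p (\<lambda>i. Var (Inr i)) :: ('d + 'n, 'a) mpoly) z = Const p" for p
  proof -
    have "meval h (meval Const p (\<lambda>i. Var (Inr i)) :: ('d + 'n, 'a) mpoly) z = meval h p (\<lambda>i. Const (Var i))"
      by (simp add: h.meval_substitute z_def)
    also have "\<dots> = Const (meval Const p Var)"
      by (simp add: meval_def h_def eval_Const.hom_sum eval_Const.hom_mult eval_Const.mono_val_hom)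
    finally show ?thesis by (simp add: meval_Const_Var)
  qed
  have "0 = meval h Q z" by (simp add: \<open>Q = 0\<close>)
  also have "\<dots> = (\<Sum>a\<in>Poly_Mapping.keys q. Const (P a) * mono_val Var a)"
    by (simp add: Q_def h.meval_sum h.meval_mult hp h.meval_mono_val z_def)
  also have "\<dots> = coeff_poly (Poly_Mapping.keys q) P"
    unfolding coeff_poly_def single_eq_Const_mono_val ..
  finally have Pz: "P a = 0" if "a \<in> Poly_Mapping.keys q" for a
    using that lookup_coeff_poly[of "Poly_Mapping.keys q" P a] by simp
  show "q = 0"
  proof (rule ccontr)
    assume "q \<noteq> 0"
    then obtain a where a: "a \<in> Poly_Mapping.keys q" by (metis keys_eq_empty ex_in_conv)
    then have "meval (\<lambda>t. t) D c * Poly_Mapping.lookup q a = 0" using DP Pz by simp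
    then show False using D(2) a by (simp add: in_keys_iff)
  qed
qed

lemma (in field_subset) independent_linear_form_nonzero:
  fixes z :: "'i::finite \<Rightarrow> 'a"
  assumes ind: "algebraically_independent_over F z" and w: "\<And>i. w i \<in> F" "w i0 \<noteq> 0"
  shows "(\<Sum>i\<in>UNIV. w i * z i) \<noteq> 0"
proof
  assume "(\<Sum>i\<in>UNIV. w i * z i) = 0"
  then have "mpoly_eval (linear_form w) z = 0"
    by (simp add: mpoly_eval_eq_meval eval_id.meval_linear_form)
  then have "linear_form w = 0"
    using ind carrier_linear_form[of w] w(1) unfolding algebraically_independent_over_def by blast
  then have "meval (\<lambda>t. t) (linear_form w) (\<lambda>i. if i = i0 then 1 else 0) = 0" by simp
  moreover have "(\<Sum>i\<in>UNIV. w i * (if i = i0 then 1 else 0)) = (\<Sum>i\<in>UNIV. if i = i0 then w i0 else 0)"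
    by (rule sum.cong) auto
  ultimately show False using w(2) by (simp add: eval_id.meval_linear_form)
qed

section \<open>A column basis\<close>

text \<open>\<open>B\<close> is maximal among the sets of columns admitting dual functionals over
  \<open>F\<close>; a column outside its span could be separated and added. \<open>T\<close> is
  inverse to the submatrix of \<open>A\<close> on \<open>B\<close>, on the other side because the
  rows are independent.\<close>

lemma (in field_subset) column_basis_exists:
  fixes A :: "'d::finite \<Rightarrow> 'n::finite \<Rightarrow> 'a"
  assumes A: "\<And>l i. A l i \<in> F"
    and rows: "\<And>\<eta>. (\<And>l. \<eta> l \<in> F) \<Longrightarrow> (\<And>i. (\<Sum>l\<in>UNIV. \<eta> l * A l i) = 0) \<Longrightarrow> \<forall>l. \<eta> l = 0"
  obtains B T where "\<And>i l. T i l \<in> F"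
    "\<And>i j. i \<in> B \<Longrightarrow> j \<in> B \<Longrightarrow> (\<Sum>l\<in>UNIV. T i l * A l j) = (if i = j then 1 else 0)"
    "\<And>l j. A l j = (\<Sum>i\<in>B. A l i * (\<Sum>l'\<in>UNIV. T i l' * A l' j))"
    "\<And>l l'. (\<Sum>i\<in>B. A l i * T i l') = (if l = l' then 1 else 0)"
proof -
  define P where "P B T \<longleftrightarrow> (\<forall>i l. T i l \<in> F) \<and>
    (\<forall>i\<in>B. \<forall>j\<in>B. (\<Sum>l\<in>UNIV. T i l * A l j) = (if i = j then 1 else 0))" for B :: "'n set" and T
  have "P {} (\<lambda>_ _. 0)" by (simp add: P_def)
  then have "\<exists>T. P {} T" by blast
  moreover have "\<forall>B. (\<exists>T. P B T) \<longrightarrow> card B < Suc CARD('n)"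
    by (auto intro!: card_mono le_imp_less_Suc)
  ultimately obtain B where ex: "\<exists>T. P B T" and max: "\<And>B'. \<exists>T. P B' T \<Longrightarrow> card B' \<le> card B"
    using ex_has_greatest_nat[of "\<lambda>B. \<exists>T. P B T" "{}" card "Suc CARD('n)"] by blast
  from ex obtain T where T: "P B T" by blast
  have TF: "T i l \<in> F" for i l using T by (simp add: P_def)
  have dual: "(\<Sum>l\<in>UNIV. T i l * A l j) = (if i = j then 1 else 0)" if "i \<in> B" "j \<in> B" for i j
    using T that by (simp add: P_def)
  have basis: "A l m = (\<Sum>i\<in>B. A l i * (\<Sum>l'\<in>UNIV. T i l' * A l' m))" for l m
  proof -
    have "(\<exists>\<beta>. (\<forall>j. \<beta> j \<in> F) \<and> (\<forall>l. A l m = (\<Sum>j\<in>B. \<beta> j * A l j))) \<or>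
      (\<exists>\<eta>. (\<forall>l. \<eta> l \<in> F) \<and> (\<forall>j\<in>B. (\<Sum>l\<in>UNIV. \<eta> l * A l j) = 0) \<and> (\<Sum>l\<in>UNIV. \<eta> l * A l m) = 1)"
      by (rule span_or_separating_functional) (auto simp: A)
    then show ?thesis
    proof (elim disjE exE conjE)
      fix \<beta> assume \<beta>: "\<forall>l. A l m = (\<Sum>j\<in>B. \<beta> j * A l j)"
      have "(\<Sum>l'\<in>UNIV. T i l' * A l' m) = \<beta> i" if i: "i \<in> B" for i
      proof -
        have "(\<Sum>l'\<in>UNIV. T i l' * A l' m) = (\<Sum>l'\<in>UNIV. \<Sum>j\<in>B. \<beta> j * (T i l' * A l' j))"
          by (rule sum.cong[OF refl]) (subst \<beta>[THEN spec], simp add: sum_distrib_left mult_ac)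
        also have "\<dots> = (\<Sum>j\<in>B. \<beta> j * (\<Sum>l'\<in>UNIV. T i l' * A l' j))"
          unfolding sum_distrib_left by (rule sum.swap)
        also have "\<dots> = (\<Sum>j\<in>B. if j = i then \<beta> i else 0)"
          by (rule sum.cong) (auto simp: dual[OF i])
        finally show ?thesis using i by simp
      qed
      then show ?thesis by (subst \<beta>[THEN spec]) (simp add: mult.commute)
    next
      fix \<eta> assume \<eta>: "\<forall>l. \<eta> l \<in> F" "\<forall>j\<in>B. (\<Sum>l\<in>UNIV. \<eta> l * A l j) = 0" "(\<Sum>l\<in>UNIV. \<eta> l * A l m) = 1"
      have mB: "m \<notin> B" using \<eta>(2,3) by auto
      define t where "t i = (\<Sum>l\<in>UNIV. T i l * A l m)" for i
      \<comment> \<open>The old functionals are corrected by a multiple of \<open>\<eta>\<close> so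
        that they vanish on the new column \<open>m\<close>.\<close>
      define T' where "T' i l = (if i = m then \<eta> l else T i l - t i * \<eta> l)" for i l
      have ev: "(\<Sum>l\<in>UNIV. (T i l - t i * \<eta> l) * A l j) =
          (\<Sum>l\<in>UNIV. T i l * A l j) - t i * (\<Sum>l\<in>UNIV. \<eta> l * A l j)" for i j
        by (simp add: left_diff_distrib sum_subtractf sum_distrib_left mult.assoc)
      have "P (insert m B) T'"
        unfolding P_def
      proof (intro conjI allI ballI)
        show "T' i l \<in> F" for i l
          unfolding T'_def t_def using \<eta>(1) TF A by (auto intro!: diff_mem mult_mem sum_mem)
        fix i j assume "i \<in> insert m B" "j \<in> insert m B"
        then have j: "j = m \<or> j \<in> B" and i: "i = m \<or> i \<in> B" by auto
        show "(\<Sum>l\<in>UNIV. T' i l * A l j) = (if i = j then 1 else 0)"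
        proof (cases "i = m")
          case True
          then show ?thesis using j \<eta>(2,3) mB by (auto simp: T'_def)
        next
          case False
          then have "(\<Sum>l\<in>UNIV. T' i l * A l j) =
              (\<Sum>l\<in>UNIV. T i l * A l j) - t i * (\<Sum>l\<in>UNIV. \<eta> l * A l j)"
            by (simp only: T'_def if_False ev)
          moreover have "(\<Sum>l\<in>UNIV. T i l * A l m) = t i" by (simp only: t_def)
          ultimately show ?thesis using False i j \<eta>(2,3) dual[of i j] by (cases "j = m") simp_all
        qed
      qed
      then have "card (insert m B) \<le> card B" using max by blast
      then show ?thesis using mB by simp
    qed
  qed
  have inv: "(\<Sum>i\<in>B. A l i * T i l') = (if l = l' then 1 else 0)" for l l'
  proof -
    define E where "E l' = (\<Sum>i\<in>B. A l i * T i l') - (if l = l' then 1 else 0)" for l'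
    have "\<forall>l'. E l' = 0"
    proof (rule rows)
      show "E l' \<in> F" for l' unfolding E_def using A TF by (intro diff_mem sum_mem mult_mem) auto
      fix j
      have "(\<Sum>l'\<in>UNIV. E l' * A l' j) = (\<Sum>l'\<in>UNIV. \<Sum>i\<in>B. A l i * (T i l' * A l' j)) -
          (\<Sum>l'\<in>UNIV. if l' = l then A l j else 0)"
        unfolding E_def left_diff_distrib sum_subtractf sum_distrib_right mult.assoc
        by (intro arg_cong2[where f = "(-)"] sum.cong) auto
      also have "(\<Sum>l'\<in>UNIV. \<Sum>i\<in>B. A l i * (T i l' * A l' j)) = A l j"
        by (subst basis) (subst sum.swap, simp add: sum_distrib_left)
      finally show "(\<Sum>l'\<in>UNIV. E l' * A l' j) = 0" by simp
    qed
    then show ?thesis by (simp add: E_def)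
  qed
  show thesis by (rule that[OF TF dual basis inv])
qed

section \<open>Transfer along field embeddings\<close>

text \<open>Used with the identity of the reals for the ideal and with
  \<open>complex_of_real\<close> for the degree.\<close>

locale field_embedding = coeff_hom h for h :: "'a::field_char_0 \<Rightarrow> 'b::field_char_0"
begin

lemma hom_eq_0_iff: "h t = 0 \<longleftrightarrow> t = 0"
proof
  assume "h t = 0"
  show "t = 0"
  proof (rule ccontr)
    assume "t \<noteq> 0"
    then have "h t * h (inverse t) = 1" by (simp add: hom_1 flip: hom_mult)
    then show False using \<open>h t = 0\<close> by simp
  qed
qed (simp add: hom_0)

lemma hom_inverse: "h (inverse t) = inverse (h t)"
proof (cases "t = 0")
  case False
  then have "h t * h (inverse t) = 1" by (simp add: hom_1 flip: hom_mult)
  then show ?thesis by (simp add: inverse_unique)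
qed (simp add: hom_0)

lemma hom_divide: "h (s / t) = h s / h t"
  by (simp add: divide_inverse hom_mult hom_inverse)

lemma inj_hom: "inj h"
  by (rule injI) (metis eq_iff_diff_eq_0 hom_diff hom_eq_0_iff)

lemma field_subset_image:
  assumes "field_subset F" shows "field_subset (h ` F)"
proof -
  interpret field_subset F by fact
  show ?thesis
    by unfold_locales
      (auto simp: image_iff simp flip: hom_add hom_mult hom_uminus hom_inverse
        intro: bexI[of _ 0] bexI[of _ 1] simp: hom_0 hom_1)
qed

definition hom_poly :: "('i, 'a) mpoly \<Rightarrow> ('i, 'b) mpoly"
  where "hom_poly p = coeff_poly (Poly_Mapping.keys p) (\<lambda>a. h (Poly_Mapping.lookup p a))"

lemma lookup_hom_poly: "Poly_Mapping.lookup (hom_poly p) a = h (Poly_Mapping.lookup p a)"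
  by (auto simp: hom_poly_def lookup_coeff_poly in_keys_iff hom_0)

lemma meval_hom_poly: "meval (\<lambda>t. t) (hom_poly p) (\<lambda>i. h (z i)) = h (meval (\<lambda>t. t) p z)"
  unfolding hom_poly_def eval_id.meval_coeff_poly meval_hom_point[symmetric]
  by (simp add: meval_def)

lemma hom_poly_carrier: "p \<in> mpoly_carrier F \<Longrightarrow> hom_poly p \<in> mpoly_carrier (h ` F)"
  by (simp add: mpoly_carrier_def lookup_hom_poly)

lemma hom_poly_surj:
  assumes "q \<in> mpoly_carrier (h ` F)"
  obtains p where "p \<in> mpoly_carrier F" "q = hom_poly p"
proof -
  have "\<forall>a. \<exists>t. t \<in> F \<and> Poly_Mapping.lookup q a = h t" using assms by (auto simp: mpoly_carrier_def)
  from choice[OF this] obtain t where t: "\<And>a. t a \<in> F" "\<And>a. Poly_Mapping.lookup q a = h (t a)" by blast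
  have t0: "t a = 0" if "a \<notin> Poly_Mapping.keys q" for a
    using that t(2)[of a] by (simp add: in_keys_iff hom_eq_0_iff)
  define p where "p = coeff_poly (Poly_Mapping.keys q) t"
  have lp: "Poly_Mapping.lookup p a = t a" for a using t0 by (simp add: p_def lookup_coeff_poly)
  show thesis
  proof (rule that)
    show "p \<in> mpoly_carrier F" using t(1) by (simp add: mpoly_carrier_def lp)
    show "q = hom_poly p" by (rule poly_mapping_eqI) (simp add: lookup_hom_poly lp t(2))
  qed
qed

end

section \<open>The degree of the projective closure\<close>

text \<open>Rank-nullity relative to a subspace inside a finitely generated span, since the ambient
  space of polynomials is infinite-dimensional. A basis of the kernel is extended, and the added
  vectors map to a basis of the image.\<close>

lemma (in vector_space_pair) dim_kernel_add_dim_image: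
  assumes f: "Vector_Spaces.linear s1 s2 f" and V: "vs1.subspace V"
    and fin: "finite T" "V \<subseteq> vs1.span T"
  shows "vs1.dim V = vs1.dim {v \<in> V. f v = 0} + vs2.dim (f ` V)"
proof -
  interpret f: Vector_Spaces.linear s1 s2 f by fact
  let ?W = "{v \<in> V. f v = 0}"
  have W: "vs1.subspace ?W"
    using V by (auto simp: vs1.subspace_def f.add f.scale f.zero)
  obtain B where B: "B \<subseteq> ?W" "vs1.independent B" "?W \<subseteq> vs1.span B" "card B = vs1.dim ?W"
    by (rule vs1.basis_exists)
  obtain C where C: "B \<subseteq> C" "C \<subseteq> V" "vs1.independent C" "V \<subseteq> vs1.span C"
    by (rule vs1.maximal_independent_subset_extend[of B V]) (use B in auto)
  define D where "D = C - B"
  have finC: "finite C" using vs1.independent_span_bound[OF fin(1) C(3)] C(2) fin(2) by blast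
  have D: "finite D" "finite B" "B \<inter> D = {}" "C = B \<union> D" "vs1.independent D" "D \<subseteq> V"
    using finC C vs1.independent_mono[OF C(3), of "C - B"] unfolding D_def
    by (auto intro: finite_subset)
  have spanB: "vs1.span B \<subseteq> ?W" by (rule vs1.span_minimal[OF B(1) W])
  have spanD: "vs1.span D \<subseteq> V" by (rule vs1.span_minimal[OF D(6) V])
  have zero: "v = 0" if v: "v \<in> vs1.span B" "v \<in> vs1.span D" for v
  proof -
    obtain u where u: "v = (\<Sum>x\<in>B. s1 (u x) x)" using v(1) vs1.span_finite[OF D(2)] by auto
    obtain w where w: "v = (\<Sum>x\<in>D. s1 (w x) x)" using v(2) vs1.span_finite[OF D(1)] by auto
    define g where "g x = (if x \<in> B then u x else - w x)" for x
    have "(\<Sum>x\<in>C. s1 (g x) x) = (\<Sum>x\<in>B. s1 (g x) x) + (\<Sum>x\<in>D. s1 (g x) x)"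
      unfolding D(4) by (rule sum.union_disjoint[OF D(2,1,3)])
    also have "(\<Sum>x\<in>B. s1 (g x) x) = v" unfolding u by (rule sum.cong) (auto simp: g_def)
    also have "(\<Sum>x\<in>D. s1 (g x) x) = - v" unfolding w sum_negf[symmetric]
      by (rule sum.cong) (use D(3) in \<open>auto simp: g_def\<close>)
    finally have "(\<Sum>x\<in>C. s1 (g x) x) = 0" by simp
    from vs1.independentD[OF C(3) finC order_refl this] have g0: "g x = 0" if "x \<in> C" for x
      using that by blast
    have "s1 (u x) x = 0" if "x \<in> B" for x
      using g0[of x] that C(1) by (auto simp: g_def)
    then show "v = 0" unfolding u by (rule sum.neutral[OF ballI])
  qed
  have inj: "inj_on f (vs1.span D)"
  proof (rule inj_onI)
    fix v w assume vw: "v \<in> vs1.span D" "w \<in> vs1.span D" "f v = f w"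
    have d: "v - w \<in> vs1.span D" using vw(1,2) by (rule vs1.span_diff)
    then have "v - w \<in> ?W" using spanD vw(3) by (auto simp: f.diff)
    then have "v - w = 0" using zero d B(3) by blast
    then show "v = w" by simp
  qed
  have ind: "vs2.independent (f ` D)"
    by (rule linear_independent_injective_image[OF f D(5) inj])
  have "f ` V \<subseteq> vs2.span (f ` D)"
  proof
    fix y assume "y \<in> f ` V"
    then obtain v where v: "v \<in> V" "y = f v" by blast
    then obtain p q where pq: "v = p + q" "p \<in> vs1.span B" "q \<in> vs1.span D"
      using C(4) unfolding D(4) vs1.span_Un by blast
    then have "y = f q" using spanB v(2) by (auto simp: f.add)
    then show "y \<in> vs2.span (f ` D)" using pq(3) by (auto simp: f.span_image)
  qed
  then have "card (f ` D) = vs2.dim (f ` V)"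
    using D(6) ind by (intro vs2.basis_card_eq_dim) auto
  moreover have "card (f ` D) = card D"
    by (rule card_image) (rule inj_on_subset[OF inj], rule vs1.span_superset)
  moreover have "card C = vs1.dim V" by (rule vs1.basis_card_eq_dim[OF C(2,4,3)])
  moreover have "card C = card B + card D" unfolding D(4) by (rule card_Un_disjoint[OF D(2,1,3)])
  ultimately show ?thesis using B(4) by simp
qed

lemma homogeneous_iff: "homogeneous m p \<longleftrightarrow> (\<forall>a\<in>Poly_Mapping.keys p. exp_degree a = m)"
proof -
  have "exp_degree a = (\<Sum>i\<in>Poly_Mapping.keys a. Poly_Mapping.lookup a i)" for a :: "'a::finite \<Rightarrow>\<^sub>0 nat"
    unfolding exp_degree_def by (rule sum.mono_neutral_right) (auto simp: in_keys_iff)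
  then show ?thesis by (simp add: homogeneous_def)
qed

lemma subspace_homogeneous:
  "mpoly_vs.subspace {F :: ('i::finite, 'a::field) mpoly. homogeneous m F}"
proof -
  have "homogeneous m (p + q)" if "homogeneous m p" "homogeneous m q" for p q :: "('i, 'a) mpoly"
    using that Poly_Mapping.keys_add[of p q] unfolding homogeneous_iff by blast
  moreover have "homogeneous m (Const t * p)" if "homogeneous m p" for t and p :: "('i, 'a) mpoly"
    using that by (auto simp: homogeneous_iff in_keys_iff lookup_Const_mult)
  moreover have "homogeneous m (0 :: ('i, 'a) mpoly)" by (simp add: homogeneous_def)
  ultimately show ?thesis by (simp add: mpoly_vs.subspace_def)
qed

lemma homogeneous_finite_dim:
  "{F :: ('i::finite, 'a::field) mpoly. homogeneous m F} \<subseteq>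
    mpoly_vs.span ((\<lambda>a. Poly_Mapping.single a 1) ` exps_le UNIV m)"
proof
  fix F :: "('i, 'a) mpoly" assume "F \<in> {F. homogeneous m F}"
  then have F: "homogeneous m F" by simp
  have "(\<Sum>a\<in>Poly_Mapping.keys F. Const (Poly_Mapping.lookup F a) * Poly_Mapping.single a 1)
      \<in> mpoly_vs.span ((\<lambda>a. Poly_Mapping.single a 1) ` exps_le UNIV m)"
    by (intro mpoly_vs.span_sum mpoly_vs.span_scale mpoly_vs.span_base)
      (use F in \<open>auto simp: homogeneous_iff exps_le_def\<close>)
  also have "(\<Sum>a\<in>Poly_Mapping.keys F. Const (Poly_Mapping.lookup F a) * Poly_Mapping.single a 1) =
      (\<Sum>a\<in>Poly_Mapping.keys F. Poly_Mapping.single a (Poly_Mapping.lookup F a))"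
    by (rule sum.cong) (simp_all add: Const_def mult_single)
  also have "\<dots> = F" by (rule poly_mapping_sum_single[symmetric])
  finally show "F \<in> mpoly_vs.span ((\<lambda>a. Poly_Mapping.single a 1) ` exps_le UNIV m)" .
qed

text \<open>Two polynomials agreeing at all large integers coincide, which settles the definite
  description. As \<open>r > 0\<close> the degree is 1, so the factorial is 1.\<close>

lemma projective_degree_of_linear_hilbert_function:
  assumes H: "\<And>m. m \<ge> M \<Longrightarrow> int (hilbert_function Z m) = int r * int m + t" and r: "r > 0"
  shows "projective_degree Z = of_nat r"
proof -
  let ?P = "[:of_int t, of_nat r:] :: rat poly"
  have val: "of_nat (hilbert_function Z m) = poly ?P (of_nat m)" if "m \<ge> M" for m
  proof -
    have "(of_nat (hilbert_function Z m) :: rat) = of_int (int (hilbert_function Z m))" by simp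
    also have "\<dots> = of_int (int r * int m + t)" using H[OF that] by simp
    finally show ?thesis by (simp add: algebra_simps)
  qed
  have "hilbert_polynomial Z = ?P"
    unfolding hilbert_polynomial_def
  proof (rule the_equality)
    show "\<forall>\<^sub>F m in sequentially. of_nat (hilbert_function Z m) = poly ?P (of_nat m)"
      unfolding eventually_sequentially using val by blast
    fix Q :: "rat poly"
    assume "\<forall>\<^sub>F m in sequentially. of_nat (hilbert_function Z m) = poly Q (of_nat m)"
    then obtain N where N: "\<And>m. m \<ge> N \<Longrightarrow> of_nat (hilbert_function Z m) = poly Q (of_nat m)"
      unfolding eventually_sequentially by blast
    have "of_nat ` {max M N..} \<subseteq> {s. poly (Q - ?P) s = 0}"
    proof
      fix s :: rat assume "s \<in> of_nat ` {max M N..}"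
      then obtain m where "s = of_nat m" "m \<ge> M" "m \<ge> N" by auto
      then show "s \<in> {s. poly (Q - ?P) s = 0}" using N[of m] val[of m] by simp
    qed
    moreover have "infinite ((of_nat :: nat \<Rightarrow> rat) ` {max M N..})"
      using infinite_Ici by (simp add: finite_image_iff inj_on_def)
    ultimately have "infinite {s. poly (Q - ?P) s = 0}" using finite_subset by blast
    then show "Q = ?P" using poly_roots_finite[of "Q - ?P"] by auto
  qed
  then show ?thesis using r by (simp add: projective_degree_def)
qed

text \<open>Setting the homogenizing coordinate to 1 matches forms of degree \<open>m\<close> with
  polynomials of degree at most \<open>m\<close>; the exponent at \<open>None\<close> makes up the
  missing degree.\<close>

lemma (in central_branch) hf_eq_dim_homogeneous:
  "hf m = fps_dim ((\<lambda>F. meval fps_const F (case_option 1 x)) ` {F. homogeneous m F})"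
  (is "_ = fps_dim (?f ` ?V)")
proof -
  have "mons m \<subseteq> ?f ` ?V"
  proof
    fix z assume "z \<in> mons m"
    then obtain a where a: "exp_degree a \<le> m" "z = mono_val x a" by (auto simp: mons_def exps_le_def)
    define e :: "'n option \<Rightarrow>\<^sub>0 nat" where "e = Poly_Mapping.single None (m - exp_degree a) +
      (\<Sum>i\<in>UNIV. Poly_Mapping.single (Some i) (Poly_Mapping.lookup a i))"
    have eN: "Poly_Mapping.lookup e None = m - exp_degree a"
      and eS: "Poly_Mapping.lookup e (Some i) = Poly_Mapping.lookup a i" for i
      by (simp_all add: e_def lookup_add lookup_sum lookup_single when_def)
    have "exp_degree e = m"
      using a(1) by (simp add: exp_degree_def UNIV_option_conv sum.reindex eN eS)
    moreover have "mono_val (case_option 1 x) e = z"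
      by (simp add: a(2) mono_val_def UNIV_option_conv prod.reindex eN eS)
    ultimately show "z \<in> ?f ` ?V"
      by (intro image_eqI[of _ _ "Poly_Mapping.single e 1"]) (simp_all add: homogeneous_iff)
  qed
  moreover have "?f ` ?V \<subseteq> fps_vs.span (mons m)"
  proof
    fix z assume "z \<in> ?f ` ?V"
    then obtain F where F: "homogeneous m F" "z = ?f F" by blast
    show "z \<in> fps_vs.span (mons m)"
      unfolding F(2) meval_def
    proof (rule fps_vs.span_sum, rule fps_vs.span_scale, rule fps_vs.span_base)
      fix a assume a: "a \<in> Poly_Mapping.keys F"
      define a' where "a' = (\<Sum>i\<in>UNIV. Poly_Mapping.single i (Poly_Mapping.lookup a (Some i)))"
      have a': "Poly_Mapping.lookup a' i = Poly_Mapping.lookup a (Some i)" for i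
        by (simp add: a'_def lookup_sum lookup_single when_def)
      have "exp_degree a = m" using F(1) a by (simp add: homogeneous_iff)
      then have "exp_degree a' \<le> m"
        by (simp add: exp_degree_def UNIV_option_conv sum.reindex a')
      moreover have "mono_val (case_option 1 x) a = mono_val x a'"
        by (simp add: mono_val_def UNIV_option_conv prod.reindex a')
      ultimately show "mono_val (case_option 1 x) a \<in> mons m"
        by (auto simp: mons_def exps_le_def)
    qed
  qed
  ultimately have "fps_vs.span (?f ` ?V) = fps_vs.span (mons m)"
    by (intro equalityI fps_vs.span_minimal[OF _ fps_vs.subspace_span] fps_vs.span_mono)
  then show ?thesis unfolding hf_def by (rule fps_vs.span_eq_dim[symmetric])
qed

text \<open>A form vanishes on the projective closure exactly when its dehomogenization vanishes on
  \<open>Z\<close>, that is, on the branch. By rank-nullity the projective Hilbert function equals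
  \<open>hf\<close>.\<close>

lemma affine_degree_branch:
  fixes Z :: "(complex^'n::{finite,linorder}) set"
  assumes "central_branch k K A c b x y"
    and van: "\<And>p. (\<forall>z\<in>Z. mpoly_eval p (($) z) = 0) \<longleftrightarrow> meval fps_const p x = 0"
  shows "affine_degree (zariski_closure Z) = of_nat (central_branch.mu A c)"
proof -
  interpret central_branch k K A c b x y by fact
  interpret pair: vector_space_pair "\<lambda>t (p :: ('n option, complex) mpoly). Const t * p"
    "\<lambda>t (f :: complex fps). fps_const t * f"
    by unfold_locales
  let ?P = "projective_closure (zariski_closure Z)"
  let ?f = "\<lambda>F :: ('n option, complex) mpoly. meval fps_const F (case_option 1 x)"
  define D :: "('n option, complex) mpoly \<Rightarrow> ('n, complex) mpoly"
    where "D F = meval Const F (case_option 1 Var)" for F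
  have D_eval: "mpoly_eval (D F) (($) z) = mpoly_eval F (($) (homogenize z))" for F z
    unfolding mpoly_eval_eq_meval D_def eval_id.meval_substitute
    by (rule arg_cong[where f = "meval (\<lambda>x. x) F"]) (auto simp: fun_eq_iff homogenize_def split: option.split)
  have D_psi: "meval fps_const (D F) x = ?f F" for F
    unfolding D_def eval_fps.meval_substitute
    by (rule arg_cong[where f = "meval fps_const F"]) (auto simp: fun_eq_iff split: option.split)
  have closure: "Z \<subseteq> zariski_closure Z" by (auto simp: zariski_closure_def)
  have vanP: "(\<forall>z\<in>?P. mpoly_eval F (($) z) = 0) \<longleftrightarrow> ?f F = 0" if F: "homogeneous m F" for F m
  proof
    assume L: "\<forall>z\<in>?P. mpoly_eval F (($) z) = 0"
    have "mpoly_eval (D F) (($) z) = 0" if z: "z \<in> Z" for z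
    proof -
      have "homogenize z $ None = 1" by (simp add: homogenize_def)
      then have "homogenize z \<noteq> 0" by (metis zero_index zero_neq_one)
      then have "homogenize z \<in> ?P" using z closure unfolding projective_closure_def by blast
      then show ?thesis using L D_eval by simp
    qed
    then show "?f F = 0" using van[of "D F"] D_psi by simp
  next
    assume "?f F = 0"
    then have DZ: "\<forall>z\<in>Z. mpoly_eval (D F) (($) z) = 0" using van[of "D F"] D_psi by simp
    then have "mpoly_eval (D F) (($) z) = 0" if "z \<in> zariski_closure Z" for z
      using that unfolding zariski_closure_def by blast
    then show "\<forall>z\<in>?P. mpoly_eval F (($) z) = 0"
      using F unfolding projective_closure_def D_eval by blast
  qed
  have lin: "Vector_Spaces.linear (\<lambda>t (p :: ('n option, complex) mpoly). Const t * p) (\<lambda>t f. fps_const t * f) ?f"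
    by unfold_locales (simp_all add: eval_fps.meval_add eval_fps.meval_mult)
  have "hilbert_function ?P m = hf m" for m
  proof -
    have "{F. homogeneous m F \<and> (\<forall>z\<in>?P. mpoly_eval F (($) z) = 0)} =
        {F \<in> {F. homogeneous m F}. ?f F = 0}"
      using vanP by blast
    then show ?thesis
      unfolding hilbert_function_def
      using pair.dim_kernel_add_dim_image[OF lin subspace_homogeneous _ homogeneous_finite_dim, of m]
        hf_eq_dim_homogeneous[of m] by (simp add: mpoly_dim_def fps_dim_def)
  qed
  then have "projective_degree ?P = of_nat mu"
    using hilbert_function_eventually_linear projective_degree_of_linear_hilbert_function[of _ ?P mu]
    by metis
  then show ?thesis by (simp add: affine_degree_def)
qed

section \<open>The Moebius number\<close>

lemma column_indep_mono: "column_indep A S \<Longrightarrow> C \<subseteq> S \<Longrightarrow> column_indep A C"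
  unfolding column_indep_def by (meson subset_trans)

text \<open>If a face of full size missed the smallest element \<open>m\<close>, adding
  \<open>m\<close> would create a circuit with minimum \<open>m\<close>, whose broken circuit lies
  in the face. So each such face is determined by its other elements.\<close>

lemma (in arrangement) moebius_number_le_binomial:
  "card {S \<in> Br. card S = CARD('l)} \<le> (CARD('n) - 1) choose (CARD('l) - 1)"
proof -
  define m :: 'n where "m = Min UNIV"
  have m_le: "m \<le> i" for i by (simp add: m_def)
  have mS: "m \<in> S" if S: "S \<in> Br" "card S = CARD('l)" for S
  proof (rule ccontr)
    assume "m \<notin> S"
    then have "card (insert m S) = Suc CARD('l)" using S(2) by simp
    then have "\<not> column_indep A (insert m S)" using column_indep_card[of "insert m S"] by auto
    then obtain C where C: "matroid_circuit (column_indep A) C" "C \<subseteq> insert m S"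
      by (rule dependent_imp_circuit)
    have "\<not> C \<subseteq> S"
      using C(1) column_indep_mono[OF broken_circuit_complex_indep[OF S(1)]] by (auto simp: matroid_circuit_def)
    then have "m \<in> C" using C(2) by auto
    then have "Min C = m" using m_le by (intro Min_eqI) auto
    then have "C - {m} \<in> broken_circuits (column_indep A)" using C(1) by (auto simp: broken_circuits_def)
    moreover have "C - {m} \<subseteq> S" using C(2) by auto
    ultimately show False using S(1) unfolding broken_circuit_complex_def by blast
  qed
  let ?X = "{S \<in> Br. card S = CARD('l)}"
  have "card ?X = card ((\<lambda>S. S - {m}) ` ?X)"
  proof (rule card_image[symmetric], rule inj_onI)
    fix S S' assume S: "S \<in> ?X" "S' \<in> ?X" "S - {m} = S' - {m}"
    then have "m \<in> S" "m \<in> S'" using mS by simp_all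
    then show "S = S'" using S(3) by blast
  qed
  also have "\<dots> \<le> card {T. T \<subseteq> UNIV - {m} \<and> card T = CARD('l) - 1}"
    by (rule card_mono) (use mS in auto)
  also have "\<dots> = card (UNIV - {m}) choose (CARD('l) - 1)"
    by (rule n_subsets) simp
  finally show ?thesis by (simp add: card_Diff_singleton)
qed

text \<open>A face with as many elements as there are rows is independent, so the rank of the
  matroid equals the number of rows.\<close>

lemma (in arrangement) moebius_number_eq:
  assumes "{S \<in> Br. card S = CARD('l)} \<noteq> {}"
  shows "moebius_number (column_indep A) = card {S \<in> Br. card S = CARD('l)}"
proof -
  obtain S where S: "S \<in> Br" "card S = CARD('l)" using assms by blast
  have "matroid_rank (column_indep A) = CARD('l)"
    unfolding matroid_rank_def
  proof (rule Max_eqI)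
    show "finite {card I |I. column_indep A I}" by simp
    show "y \<le> CARD('l)" if "y \<in> {card I |I. column_indep A I}" for y
      using that column_indep_card by blast
    show "CARD('l) \<in> {card I |I. column_indep A I}"
      using S broken_circuit_complex_indep[OF S(1)] by force
  qed
  then show ?thesis by (simp add: moebius_number_def)
qed

text \<open>Circuits refer to coefficients from the whole type, minimal supports to vectors over
  \<open>F\<close>; \<open>circuit_vector\<close> reconciles the two.\<close>

lemma (in arrangement) circuit_iff_minimal_support:
  assumes v: "\<And>i. v i \<in> F" "column_relation A v"
  shows "matroid_circuit (column_indep A) (form_support v) \<longleftrightarrow>
    form_support v \<noteq> {} \<and> \<not> (\<exists>w. (\<forall>i. w i \<in> F) \<and> column_relation A w \<and> form_support w \<noteq> {} \<and>
      form_support w \<subset> form_support v)" (is "?l \<longleftrightarrow> ?r")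
proof
  assume l: ?l
  have "form_support v \<noteq> {}" using l unfolding matroid_circuit_def column_indep_def by auto
  moreover have False if "column_relation A w" "form_support w \<noteq> {}" "form_support w \<subset> form_support v" for w
    using l that unfolding matroid_circuit_def column_indep_def by blast
  ultimately show ?r by blast
next
  assume r: ?r
  then obtain m where "m \<in> form_support v" by blast
  then obtain C where C: "matroid_circuit (column_indep A) C" "m \<in> C" "C \<subseteq> form_support v"
    using circuit_through[OF v(2)] by blast
  obtain w where w: "\<And>i. w i \<in> F" "column_relation A w" "form_support w = C"
    by (rule circuit_vector[OF C(1)]) blast
  have "\<not> form_support w \<subset> form_support v" using r w C(2) by blast
  then have "C = form_support v" using C(3) w(3) by blast
  then show ?l using C(1) by simp
qed

lemma all_rows_image: "all_rows (\<lambda>j i. h (A j i)) (\<lambda>i. h (c i)) = (\<lambda>l i. h (all_rows A c l i))"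
  proof (intro ext)
  show "all_rows (\<lambda>j i. h (A j i)) (\<lambda>i. h (c i)) l i = h (all_rows A c l i)" for l i by (cases l) simp_all
qed

text \<open>Enlarging the field creates no new dependence, because every circuit carries a vector
  over the image of the smaller field.\<close>

lemma (in field_embedding) column_indep_image:
  assumes R: "arrangement F R"
  shows "column_indep (\<lambda>l i. h (R l i)) = column_indep R"
proof
  fix I
  interpret F: arrangement F R by fact
  interpret hF: arrangement "h ` F" "\<lambda>l i. h (R l i)"
    by (intro arrangement.intro arrangement_axioms.intro field_subset_image F.field_subset_axioms)
      (use F.row_mem in auto)
  have rel: "column_relation (\<lambda>l i. h (R l i)) (\<lambda>i. h (v i)) \<longleftrightarrow> column_relation R v" for v
    unfolding column_relation_def by (simp add: hom_eq_0_iff flip: hom_mult hom_sum)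
  have supp: "form_support (\<lambda>i. h (v i)) = form_support v" for v
    by (auto simp: form_support_def hom_eq_0_iff)
  show "column_indep (\<lambda>l i. h (R l i)) I = column_indep R I"
  proof
    assume "column_indep (\<lambda>l i. h (R l i)) I"
    then show "column_indep R I" unfolding column_indep_def using rel supp by metis
  next
    assume ind: "column_indep R I"
    show "column_indep (\<lambda>l i. h (R l i)) I"
    proof (rule ccontr)
      assume "\<not> column_indep (\<lambda>l i. h (R l i)) I"
      then obtain C where C: "matroid_circuit (column_indep (\<lambda>l i. h (R l i))) C" "C \<subseteq> I"
        by (rule dependent_imp_circuit)
      obtain v where v: "\<And>i. v i \<in> h ` F" "column_relation (\<lambda>l i. h (R l i)) v" "form_support v = C"
        by (rule hF.circuit_vector[OF C(1)]) blast
      define w where "w i = inv_into UNIV h (v i)" for i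
      have "h (w i) = v i" for i unfolding w_def by (rule f_inv_into_f) (use v(1)[of i] in blast)
      then have "v = (\<lambda>i. h (w i))" by simp
      then have "column_relation R w" "form_support w = C" using v(2,3) rel[of w] supp[of w] by simp_all
      then have "C = {}" using ind C(2) unfolding column_indep_def by blast
      then show False using C(1) unfolding matroid_circuit_def column_indep_def by simp
    qed
  qed
qed

section \<open>The ideal of a branch\<close>

lemma (in field_subset) mpoly_ring_simps:
  "carrier (mpoly_ring F) = mpoly_carrier F" "x \<otimes>\<^bsub>mpoly_ring F\<^esub> y = x * y"
  "x \<oplus>\<^bsub>mpoly_ring F\<^esub> y = x + y" "\<one>\<^bsub>mpoly_ring F\<^esub> = 1" "\<zero>\<^bsub>mpoly_ring F\<^esub> = 0"
  by (simp_all add: mpoly_ring_def ring_of_type_algebra_def)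

lemma (in field_subset) cring_mpoly_ring: "cring (mpoly_ring F :: ('i::finite, 'a) mpoly ring)"
proof (intro cringI abelian_groupI comm_monoidI)
  show "\<exists>q\<in>carrier (mpoly_ring F). q \<oplus>\<^bsub>mpoly_ring F\<^esub> p = \<zero>\<^bsub>mpoly_ring F\<^esub>"
    if "p \<in> carrier (mpoly_ring F)" for p :: "('i, 'a) mpoly"
    using that by (intro bexI[of _ "- p"]) (simp_all add: mpoly_ring_simps carrier_uminus)
qed (simp_all add: mpoly_ring_simps carrier_intros algebra_simps)

context central_branch
begin

abbreviation "branch_ideal \<equiv> {p \<in> mpoly_carrier K. psi p = 0}"

lemma branch_ideal_eq: "branch_ideal = GI"
proof
  show "branch_ideal \<subseteq> GI" using psi_zero_imp_GI by blast
  have "central_gens K A c b \<subseteq> mpoly_carrier K"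
  proof -
    have "cpolys K R \<subseteq> mpoly_carrier K"
    proof -
      interpret RK: arrangement K R
        by unfold_locales (use arr.row_mem k_subset in auto)
      show ?thesis by (rule RK.cpolys_carrier)
    qed
    moreover have "linear_form (A j) - Const (b j) \<in> mpoly_carrier K" for j
      using arr.row_mem[of "Some j"] k_subset b_mem
      by (intro K.carrier_intros K.carrier_linear_form) auto
    ultimately show ?thesis by (auto simp: central_gens_def)
  qed
  then show "GI \<subseteq> branch_ideal" using psi_GI K.ideal_gen_carrier by blast
qed

lemma ideal_branch_ideal: "ideal branch_ideal (mpoly_ring K)"
proof (rule idealI)
  interpret P: cring "mpoly_ring K :: ('n, 'a) mpoly ring" by (rule K.cring_mpoly_ring)
  show "ring (mpoly_ring K :: ('n, 'a) mpoly ring)" by unfold_locales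
  have minus: "\<ominus>\<^bsub>mpoly_ring K\<^esub> p = - p" if "p \<in> mpoly_carrier K" for p :: "('n, 'a) mpoly"
    by (rule P.minus_equality) (use that in \<open>simp_all add: K.mpoly_ring_simps K.carrier_uminus\<close>)
  show "subgroup branch_ideal (add_monoid (mpoly_ring K))"
  proof (rule P.add.subgroupI)
    show "branch_ideal \<subseteq> carrier (mpoly_ring K)" by (auto simp: K.mpoly_ring_simps)
    show "branch_ideal \<noteq> {}" using K.carrier_zero by (auto simp: psi_simps)
    show "\<ominus>\<^bsub>mpoly_ring K\<^esub> p \<in> branch_ideal" if "p \<in> branch_ideal" for p
      using that minus[of p] K.carrier_uminus[of p] psi_simps(3)[of 0 p] by (simp add: psi_simps)
    show "p \<oplus>\<^bsub>mpoly_ring K\<^esub> q \<in> branch_ideal" if "p \<in> branch_ideal" "q \<in> branch_ideal" for p q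
      using that by (simp add: K.mpoly_ring_simps K.carrier_add psi_simps)
  qed
qed (simp_all add: K.mpoly_ring_simps K.carrier_mult psi_simps)

text \<open>\<open>psi\<close> takes values in power series over a field, which have no zero
  divisors.\<close>

lemma primeideal_branch_ideal: "primeideal branch_ideal (mpoly_ring K)"
proof (rule primeidealI[OF ideal_branch_ideal K.cring_mpoly_ring])
  show "carrier (mpoly_ring K) \<noteq> branch_ideal"
  proof
    assume "carrier (mpoly_ring K) = branch_ideal"
    then have "(1 :: ('n, 'a) mpoly) \<in> branch_ideal" using K.carrier_one by (simp add: K.mpoly_ring_simps)
    then show False by (simp add: psi_simps)
  qed
qed (auto simp: K.mpoly_ring_simps psi_simps)

lemma genideal_branch_ideal: "genideal (mpoly_ring K) (central_gens K A c b) = branch_ideal"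
proof
  have "g \<in> GI" if "g \<in> central_gens K A c b" for g
    using ideal_gen_mult_gen[OF K.carrier_one that] by simp
  then show "genideal (mpoly_ring K) (central_gens K A c b) \<subseteq> branch_ideal"
    unfolding genideal_def using ideal_branch_ideal branch_ideal_eq by blast
  show "branch_ideal \<subseteq> genideal (mpoly_ring K) (central_gens K A c b)"
    unfolding branch_ideal_eq genideal_def
  proof (rule subsetI, rule InterI)
    fix p I
    assume p: "p \<in> GI" and I: "I \<in> {I. ideal I (mpoly_ring K) \<and> central_gens K A c b \<subseteq> I}"
    then interpret I: ideal I "mpoly_ring K" by blast
    from p show "p \<in> I"
    proof induction
      case ideal_gen_zero
      then show ?case using additive_subgroup.zero_closed[OF I.is_additive_subgroup] by (simp add: K.mpoly_ring_simps)
    next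
      case (ideal_gen_step q p g)
      then have "p * g \<in> I" using I I.I_l_closed[of g p] by (auto simp: K.mpoly_ring_simps)
      then show ?case using additive_subgroup.a_closed[OF I.is_additive_subgroup, of q "p * g"] ideal_gen_step by (simp add: K.mpoly_ring_simps)
    qed
  qed
qed

end

section \<open>The branch of a linear program\<close>

lemma sum_UNIV_sum:
  "(\<Sum>s\<in>(UNIV :: ('d::finite + 'n::finite) set). f s) = (\<Sum>j\<in>UNIV. f (Inl j)) + (\<Sum>i\<in>UNIV. f (Inr i))"
  by (subst UNIV_Plus_UNIV[symmetric], subst sum.Plus) simp_all

locale generic_lp =
  fixes A :: "real^'n::{finite,linorder}^'d::finite" and b :: "real^'d" and c :: "real^'n::{finite,linorder}"
  assumes card_less: "CARD('d) < CARD('n)" and rank: "rank A = CARD('d)" and generic: "lp_generic A b c"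
begin

abbreviation "F0 \<equiv> entry_field A"
abbreviation "K \<equiv> lp_field A b c"
abbreviation "k \<equiv> generate_field ring_of_type_algebra (F0 \<union> range (($) c)) :: real set"
abbreviation "Am \<equiv> \<lambda>j i. A $ j $ i"
abbreviation "bm \<equiv> \<lambda>j. b $ j"
abbreviation "cm \<equiv> \<lambda>i. c $ i"

sublocale F0: field_subset F0 unfolding entry_field_def by (rule field_subset_generate_field)
sublocale k: field_subset k by (rule field_subset_generate_field)
sublocale K: field_subset K unfolding lp_field_def by (rule field_subset_generate_field)

lemma A_F0: "A $ j $ i \<in> F0"
  unfolding entry_field_def by (rule generate_field.incl) force

lemma F0_k: "F0 \<subseteq> k" and c_k: "c $ i \<in> k"
  by (auto intro: generate_field.incl)

lemma F0_K: "F0 \<subseteq> K" and c_K: "c $ i \<in> K" and b_K: "b $ j \<in> K"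
  unfolding lp_field_def by (auto intro: generate_field.incl)

lemma k_K: "k \<subseteq> K"
  by (rule K.generate_field_subset) (use F0_K c_K in auto)

lemma b_indep:
  assumes "q \<in> mpoly_carrier k" "meval (\<lambda>t. t) q bm = 0" shows "q = 0"
  using F0.algebraically_independent_tower[of bm cm q] assms generic unfolding lp_generic_def by simp

lemma K_fraction:
  assumes "z \<in> K"
  shows "\<exists>p q. p \<in> mpoly_carrier k \<and> q \<in> mpoly_carrier k \<and>
      meval (\<lambda>t. t) q bm \<noteq> 0 \<and> z = meval (\<lambda>t. t) p bm / meval (\<lambda>t. t) q bm"
proof (rule k.generate_field_fraction)
  show "z \<in> generate_field ring_of_type_algebra (F0 \<union> range bm \<union> range cm)"
    using assms by (simp add: lp_field_def)
  show "F0 \<union> range bm \<union> range cm \<subseteq> k \<union> range bm" using F0_k c_k by auto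
qed

lemma linear_form_nonzero:
  assumes "\<And>j. u j \<in> F0" "\<And>i. w i \<in> F0" "(\<exists>j. u j \<noteq> 0) \<or> (\<exists>i. w i \<noteq> 0)"
  shows "(\<Sum>j\<in>UNIV. u j * b $ j) + (\<Sum>i\<in>UNIV. w i * c $ i) \<noteq> 0"
proof -
  have "\<exists>s. case_sum u w s \<noteq> 0"
    using assms(3) by (metis sum.case)
  then obtain s where s: "case_sum u w s \<noteq> 0" by blast
  have "case_sum u w s \<in> F0" for s using assms(1,2) by (cases s) simp_all
  from F0.independent_linear_form_nonzero[of "case_sum bm cm" "case_sum u w", OF _ this s]
  show ?thesis using generic by (simp add: lp_generic_def sum_UNIV_sum)
qed

lemma c_form_nonzero:
  assumes "\<And>i. w i \<in> F0" "w i0 \<noteq> 0"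
  shows "(\<Sum>i\<in>UNIV. w i * c $ i) \<noteq> 0"
  using linear_form_nonzero[of "\<lambda>_. 0" w] assms by auto

lemma b_form_nonzero:
  assumes "\<And>j. u j \<in> F0" "u j0 \<noteq> 0"
  shows "(\<Sum>j\<in>UNIV. u j * b $ j) \<noteq> 0"
  using linear_form_nonzero[of u "\<lambda>_. 0"] assms by auto

text \<open>The kernel vector is chosen over the field of the entries of \<open>A\<close>, so
  genericity of \<open>c\<close> makes the cost non-constant along it.\<close>

lemma kernel_vector:
  obtains v where "A *v v = 0" "c \<bullet> v \<noteq> 0"
proof -
  obtain w where w: "\<And>i. w i \<in> F0" "\<exists>i\<in>UNIV. w i \<noteq> 0" "\<And>j. (\<Sum>i\<in>UNIV. w i * A $ j $ i) = 0"
  proof (rule F0.homogeneous_system_solution[of "UNIV :: 'd set" "UNIV :: 'n set" "\<lambda>i j. A $ j $ i"])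
    show "card (UNIV :: 'd set) < card (UNIV :: 'n set)" by (rule card_less)
  qed (use A_F0 in auto)
  show thesis
  proof (rule that[of "\<chi> i. w i"])
    show "A *v (\<chi> i. w i) = 0"
      using w(3) by (simp add: vec_eq_iff matrix_vector_mult_def mult.commute)
    have "(\<Sum>i\<in>UNIV. w i * c $ i) \<noteq> 0" using c_form_nonzero w(1,2) by blast
    then show "c \<bullet> (\<chi> i. w i) \<noteq> 0" by (simp add: inner_vec_def mult.commute)
  qed
qed

lemma rows_independent:
  assumes "\<And>i. (\<Sum>l\<in>UNIV. \<eta> l * A $ l $ i) = 0"
  shows "\<forall>l. \<eta> l = (0 :: real)"
proof -
  have "rank (transpose A) = CARD('d)" using rank by (simp add: rank_transpose)
  then have inj: "inj ((*v) (transpose A))" by (simp add: full_rank_injective)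
  have "transpose A *v (\<chi> l. \<eta> l) = transpose A *v 0"
    using assms by (simp add: vec_eq_iff matrix_vector_mult_def transpose_def mult.commute)
  from injD[OF inj this] have "(\<chi> l. \<eta> l) = 0" .
  then show ?thesis by (simp add: vec_eq_iff)
qed

text \<open>Genericity supplies the conditions at the vertex: the basic coordinates and the slacks
  are non-trivial linear forms over \<open>F0\<close> in \<open>b\<close> and in \<open>c\<close>.
  All data are then carried along \<open>h\<close>.\<close>

lemma embedded_branch:
  fixes h :: "real \<Rightarrow> 'b::field_char_0"
  assumes "field_embedding h"
  obtains x y where "central_branch (h ` k) (h ` K) (\<lambda>j i. h (A $ j $ i)) (\<lambda>i. h (c $ i)) (\<lambda>j. h (b $ j)) x y"
proof -
  interpret h: field_embedding h by fact
  obtain B T where T: "\<And>i l. T i l \<in> F0"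
    and dual: "\<And>i j. i \<in> B \<Longrightarrow> j \<in> B \<Longrightarrow> (\<Sum>l\<in>UNIV. T i l * A $ l $ j) = (if i = j then 1 else 0)"
    and basis: "\<And>l j. A $ l $ j = (\<Sum>i\<in>B. A $ l $ i * (\<Sum>l'\<in>UNIV. T i l' * A $ l' $ j))"
    and inv: "\<And>l l'. (\<Sum>i\<in>B. A $ l $ i * T i l') = (if l = l' then 1 else 0)"
    by (rule F0.column_basis_exists[of Am]) (use A_F0 rows_independent in blast)+
  define \<rho> where "\<rho> i j = (\<Sum>l\<in>UNIV. T i l * A $ l $ j)" for i j
  have \<rho>: "\<rho> i j \<in> F0" for i j unfolding \<rho>_def using T A_F0 by blast
  \<comment> \<open>The columns in \<open>B\<close> are independent by \<open>dual\<close>, whereas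
    all columns together are dependent because \<open>d < n\<close>.\<close>
  have B: "B \<noteq> UNIV"
  proof
    assume U: "B = UNIV"
    obtain w where w: "\<And>i. w i \<in> F0" "\<exists>i\<in>UNIV. w i \<noteq> 0" "\<And>j. (\<Sum>i\<in>UNIV. w i * A $ j $ i) = 0"
    proof (rule F0.homogeneous_system_solution[of "UNIV :: 'd set" "UNIV :: 'n set" "\<lambda>i j. A $ j $ i"])
      show "card (UNIV :: 'd set) < card (UNIV :: 'n set)" by (rule card_less)
    qed (use A_F0 in auto)
    have "w i = 0" for i
    proof -
      have "w i = (\<Sum>j\<in>UNIV. if i = j then w j else 0)" by simp
      also have "\<dots> = (\<Sum>j\<in>UNIV. w j * (\<Sum>l\<in>UNIV. T i l * A $ l $ j))"
        by (rule sum.cong) (auto simp: dual U)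
      also have "\<dots> = (\<Sum>j\<in>UNIV. \<Sum>l\<in>UNIV. T i l * (w j * A $ l $ j))"
        by (simp add: sum_distrib_left mult_ac)
      also have "\<dots> = (\<Sum>l\<in>UNIV. T i l * (\<Sum>j\<in>UNIV. w j * A $ l $ j))"
        unfolding sum_distrib_left by (rule sum.swap)
      finally show "w i = 0" by (simp add: w(3))
    qed
    then show False using w(2) by blast
  qed
  have bv: "(\<Sum>l\<in>UNIV. T i l * b $ l) \<noteq> 0" if "i \<in> B" for i
  proof -
    have "\<exists>l. T i l \<noteq> 0"
    proof (rule ccontr)
      assume "\<not> (\<exists>l. T i l \<noteq> 0)"
      then show False using dual[OF that that] by simp
    qed
    then show ?thesis using b_form_nonzero T by blast
  qed
  have cv: "(\<Sum>i\<in>B. c $ i * \<rho> i j) \<noteq> c $ j" if "j \<notin> B" for j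
  proof -
    \<comment> \<open>The coefficients of the slack at \<open>j\<close> as a linear form in
      \<open>c\<close>; the entry at \<open>j\<close> is \<open>- 1\<close>, so the form is not
      zero.\<close>
    define w where "w i = (if i \<in> B then \<rho> i j else if i = j then - 1 else 0)" for i
    have "w i \<in> F0" for i using \<rho> by (auto simp: w_def)
    moreover have "w j \<noteq> 0" using that by (simp add: w_def)
    ultimately have "(\<Sum>i\<in>UNIV. w i * c $ i) \<noteq> 0" by (rule c_form_nonzero)
    also have "(\<Sum>i\<in>UNIV. w i * c $ i) = (\<Sum>i\<in>UNIV. (if i \<in> B then c $ i * \<rho> i j else 0) - (if i = j then c $ i else 0))"
      by (rule sum.cong) (use that in \<open>auto simp: w_def\<close>)
    also have "\<dots> = (\<Sum>i\<in>B. c $ i * \<rho> i j) - c $ j"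
      by (simp add: sum_subtractf sum.If_cases)
    finally show ?thesis by simp
  qed
  have hval: "h (meval (\<lambda>t. t) p bm) = meval (\<lambda>t. t) (h.hom_poly p) (\<lambda>j. h (b $ j))" for p
    by (rule h.meval_hom_poly[symmetric])
  have h\<rho>: "(\<Sum>l\<in>UNIV. h (T i l) * h (A $ l $ j)) = h (\<rho> i j)" for i j
    by (simp add: \<rho>_def h.hom_sum h.hom_mult)
  have h_if: "h (if P then 1 else 0) = (if P then 1 else 0)" for P by (simp add: h.hom_0 h.hom_1)
  have frac: "\<exists>p q. p \<in> mpoly_carrier (h ` k) \<and> q \<in> mpoly_carrier (h ` k) \<and>
      meval (\<lambda>t. t) q (\<lambda>j. h (b $ j)) \<noteq> 0 \<and>
      z = meval (\<lambda>t. t) p (\<lambda>j. h (b $ j)) / meval (\<lambda>t. t) q (\<lambda>j. h (b $ j))" if z: "z \<in> h ` K" for z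
  proof -
    from z obtain z' where z': "z' \<in> K" "z = h z'" by (rule imageE)
    from K_fraction[OF z'(1)] show ?thesis
    proof (elim exE conjE)
      fix p q assume pq: "p \<in> mpoly_carrier k" "q \<in> mpoly_carrier k"
        "meval (\<lambda>t. t) q bm \<noteq> 0" "z' = meval (\<lambda>t. t) p bm / meval (\<lambda>t. t) q bm"
      have "meval (\<lambda>t. t) (h.hom_poly q) (\<lambda>j. h (b $ j)) \<noteq> 0"
        using pq(3) by (simp add: h.hom_eq_0_iff flip: hval)
      moreover have "z = meval (\<lambda>t. t) (h.hom_poly p) (\<lambda>j. h (b $ j)) / meval (\<lambda>t. t) (h.hom_poly q) (\<lambda>j. h (b $ j))"
        by (simp only: z'(2) pq(4) h.hom_divide hval)
      ultimately show ?thesis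
        using h.hom_poly_carrier[OF pq(1)] h.hom_poly_carrier[OF pq(2)]
        by (intro exI[of _ "h.hom_poly p"] exI[of _ "h.hom_poly q"] conjI)
    qed
  qed
  show thesis
  proof (rule central_branch_exists[of "h ` k" "h ` K" "\<lambda>j i. h (A $ j $ i)" "\<lambda>i. h (c $ i)" "\<lambda>j. h (b $ j)"
        "\<lambda>i l. h (T i l)" B])
    show "field_subset (h ` k)" "field_subset (h ` K)"
      by (rule h.field_subset_image k.field_subset_axioms K.field_subset_axioms)+
    show "h ` k \<subseteq> h ` K" using k_K by blast
    show "h (A $ l $ i) \<in> h ` k" for l i using A_F0 F0_k by blast
    show "h (c $ i) \<in> h ` k" for i using c_k by blast
    show "h (b $ l) \<in> h ` K" for l using b_K by blast
    show "h (T i l) \<in> h ` k" for i l using T F0_k by blast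
    show "q = 0" if q: "q \<in> mpoly_carrier (h ` k)" "meval (\<lambda>t. t) q (\<lambda>j. h (b $ j)) = 0" for q
    proof -
      obtain p where p: "p \<in> mpoly_carrier k" "q = h.hom_poly p" by (rule h.hom_poly_surj[OF q(1)])
      then have "h (meval (\<lambda>t. t) p bm) = 0" using q(2) hval by simp
      then have "p = 0" using b_indep p(1) by (simp add: h.hom_eq_0_iff)
      then show ?thesis by (intro poly_mapping_eqI) (simp add: p(2) h.lookup_hom_poly h.hom_0)
    qed
    show "\<exists>p q. p \<in> mpoly_carrier (h ` k) \<and> q \<in> mpoly_carrier (h ` k) \<and>
        meval (\<lambda>t. t) q (\<lambda>j. h (b $ j)) \<noteq> 0 \<and>
        z = meval (\<lambda>t. t) p (\<lambda>j. h (b $ j)) / meval (\<lambda>t. t) q (\<lambda>j. h (b $ j))" if "z \<in> h ` K" for z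
      by (rule frac[OF that])
    show "(\<Sum>l\<in>UNIV. h (T i l) * h (A $ l $ j)) = (if i = j then 1 else 0)" if "i \<in> B" "j \<in> B" for i j
      unfolding h\<rho> using dual[OF that] by (simp only: \<rho>_def h_if)
    show "h (A $ l $ j) = (\<Sum>i\<in>B. h (A $ l $ i) * (\<Sum>l'\<in>UNIV. h (T i l') * h (A $ l' $ j)))" for l j
      unfolding h\<rho> h.hom_mult[symmetric] h.hom_sum[symmetric] \<rho>_def
      by (rule arg_cong[where f = h], rule basis)
    show "(\<Sum>i\<in>B. h (A $ l $ i) * h (T i l')) = (if l = l' then 1 else 0)" for l l'
      unfolding h.hom_mult[symmetric] h.hom_sum[symmetric] inv by (rule h_if)
    show "(\<Sum>l\<in>UNIV. h (T i l) * h (b $ l)) \<noteq> 0" if "i \<in> B" for i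
      unfolding h.hom_mult[symmetric] h.hom_sum[symmetric] h.hom_eq_0_iff by (rule bv[OF that])
    show "(\<Sum>i\<in>B. h (c $ i) * (\<Sum>l\<in>UNIV. h (T i l) * h (A $ l $ j))) \<noteq> h (c $ j)" if "j \<notin> B" for j
      unfolding h\<rho> h.hom_mult[symmetric] h.hom_sum[symmetric] inj_eq[OF h.inj_hom] by (rule cv[OF that, unfolded \<rho>_def])
    show "B \<noteq> UNIV" by (rule B)
  qed (rule that)
qed

end

context generic_lp
begin

abbreviation "R \<equiv> all_rows Am cm"

lemma row_in_row_space: "row j A \<in> row_space K A c" and cost_in_row_space: "c \<in> row_space K A c"
proof -
  have "row j A = (\<Sum>l\<in>UNIV. (if l = j then 1 else 0) *\<^sub>R row l A) + 0 *\<^sub>R c"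
    by (simp add: if_distrib[of "\<lambda>t. t *\<^sub>R _"] cong: if_cong)
  then show "row j A \<in> row_space K A c"
    unfolding row_space_def by (intro CollectI exI[of _ "\<lambda>l. if l = j then 1 else 0"] exI[of _ 0] conjI) auto
  have "c = (\<Sum>l\<in>UNIV. 0 *\<^sub>R row l A) + 1 *\<^sub>R c" by simp
  then show "c \<in> row_space K A c"
    unfolding row_space_def by (intro CollectI exI[of _ "\<lambda>l. 0"] exI[of _ 1] conjI) auto
qed

lemma vanishes_on_row_space_iff:
  "(\<forall>x\<in>row_space K A c. (\<Sum>i\<in>UNIV. v i * x $ i) = 0) \<longleftrightarrow> column_relation R v"
proof
  assume L: "\<forall>x\<in>row_space K A c. (\<Sum>i\<in>UNIV. v i * x $ i) = 0"
  show "column_relation R v"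
    unfolding column_relation_def
  proof
    fix l show "(\<Sum>i\<in>UNIV. v i * R l i) = 0"
      by (cases l) (use L row_in_row_space cost_in_row_space in \<open>auto simp: row_def\<close>)
  qed
next
  assume rel: "column_relation R v"
  show "\<forall>x\<in>row_space K A c. (\<Sum>i\<in>UNIV. v i * x $ i) = 0"
  proof
    fix x assume "x \<in> row_space K A c"
    then obtain y t where x: "x = (\<Sum>l\<in>UNIV. y l *\<^sub>R row l A) + t *\<^sub>R c"
      unfolding row_space_def by blast
    have "(\<lambda>i. x $ i) \<in> row_span R"
      unfolding row_span_def
    proof (intro CollectI exI[of _ "case_option t y"] ext)
      show "x $ i = (\<Sum>l\<in>UNIV. case_option t y l * R l i)" for i
        by (simp add: x row_def UNIV_option_conv sum.reindex)
    qed
    then show "(\<Sum>i\<in>UNIV. v i * x $ i) = 0" using column_relation_row_span[OF rel] by blast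
  qed
qed

lemma arrangement_K:
  assumes "arrangement k R" shows "arrangement K R"
proof -
  interpret arrangement k R by fact
  show ?thesis by unfold_locales (use row_mem k_K in auto)
qed

text \<open>The two notions differ in the range of the coefficients, \<open>K\<close> against all
  reals; circuit vectors over \<open>K\<close> close the gap.\<close>

lemma coord_indep_eq:
  assumes "arrangement k R"
  shows "coord_indep K (row_space K A c) = column_indep R"
proof
  fix I
  interpret RK: arrangement K R by (rule arrangement_K[OF assms])
  have ext: "(\<Sum>i\<in>I. w i * x $ i) = (\<Sum>i\<in>UNIV. (if i \<in> I then w i else 0) * x $ i)"
    for w :: "'n \<Rightarrow> real" and x :: "(real, 'n) vec"
  proof -
    have "(\<Sum>i\<in>I. w i * x $ i) = (\<Sum>i\<in>UNIV. if i \<in> I then w i * x $ i else 0)"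
      by (simp add: sum.If_cases)
    also have "\<dots> = (\<Sum>i\<in>UNIV. (if i \<in> I then w i else 0) * x $ i)"
      by (rule sum.cong) auto
    finally show ?thesis .
  qed
  show "coord_indep K (row_space K A c) I = column_indep R I"
  proof
    assume ci: "coord_indep K (row_space K A c) I"
    show "column_indep R I"
    proof (rule ccontr)
      assume "\<not> column_indep R I"
      then obtain C where C: "matroid_circuit (column_indep R) C" "C \<subseteq> I" by (rule dependent_imp_circuit)
      obtain v where v: "\<And>i. v i \<in> K" "column_relation R v" "form_support v = C"
        by (rule RK.circuit_vector[OF C(1)]) blast
      have supp: "(if i \<in> I then v i else 0) = v i" for i
        using v(3) C(2) by (auto simp: form_support_def)
      have "\<forall>x\<in>row_space K A c. (\<Sum>i\<in>I. v i * x $ i) = 0"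
        unfolding ext supp vanishes_on_row_space_iff by (rule v(2))
      then have "\<forall>i\<in>I. v i = 0" using ci v(1) unfolding coord_indep_def by blast
      then have "C = {}" using v(3) C(2) by (auto simp: form_support_def)
      then show False using C(1) by (auto simp: matroid_circuit_def column_indep_def)
    qed
  next
    assume ind: "column_indep R I"
    show "coord_indep K (row_space K A c) I"
      unfolding coord_indep_def
    proof (intro allI impI, elim conjE)
      fix w assume "\<forall>x\<in>row_space K A c. (\<Sum>i\<in>I. w i * x $ i) = 0"
      then have "column_relation R (\<lambda>i. if i \<in> I then w i else 0)"
        unfolding ext vanishes_on_row_space_iff .
      moreover have "form_support (\<lambda>i. if i \<in> I then w i else 0) \<subseteq> I"
        by (auto simp: form_support_def)
      ultimately have "form_support (\<lambda>i. if i \<in> I then w i else 0) = {}"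
        using ind unfolding column_indep_def by blast
      then show "\<forall>i\<in>I. w i = 0" unfolding form_support_empty_iff by metis
    qed
  qed
qed

lemma vanishing_forms_iff:
  "v \<in> vanishing_forms K (row_space K A c) \<longleftrightarrow> (\<forall>i. v $ i \<in> K) \<and> column_relation R (($) v)"
  by (simp add: vanishing_forms_def vanishes_on_row_space_iff)

lemma support_eq: "support v = form_support (($) v)"
  by (simp add: support_def form_support_def)

lemma circuit_polynomials_eq:
  assumes "arrangement k R"
  shows "circuit_polynomial ` circuit_vectors K (row_space K A c) = cpolys K R"
proof -
  interpret RK: arrangement K R by (rule arrangement_K[OF assms])
  let ?V = "vanishing_forms K (row_space K A c)"
  have cp: "circuit_polynomial v = cpoly (($) v)" for v :: "(real, 'n) vec"
    by (simp add: circuit_polynomial_def cpoly_def support_eq)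
  have nz: "v \<noteq> 0 \<longleftrightarrow> form_support (($) v) \<noteq> {}" for v :: "(real, 'n) vec"
    by (simp add: form_support_empty_iff vec_eq_iff)
  have ex: "(\<exists>w\<in>?V. w \<noteq> 0 \<and> support w \<subset> S) \<longleftrightarrow>
      (\<exists>w. (\<forall>i. w i \<in> K) \<and> column_relation R w \<and> form_support w \<noteq> {} \<and> form_support w \<subset> S)" for S
  proof
    assume "\<exists>w\<in>?V. w \<noteq> 0 \<and> support w \<subset> S"
    then obtain w where "w \<in> ?V" "w \<noteq> 0" "support w \<subset> S" by blast
    then show "\<exists>w. (\<forall>i. w i \<in> K) \<and> column_relation R w \<and> form_support w \<noteq> {} \<and> form_support w \<subset> S"
      by (intro exI[of _ "($) w"]) (simp add: vanishing_forms_iff nz support_eq)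
  next
    assume "\<exists>w. (\<forall>i. w i \<in> K) \<and> column_relation R w \<and> form_support w \<noteq> {} \<and> form_support w \<subset> S"
    then show "\<exists>w\<in>?V. w \<noteq> 0 \<and> support w \<subset> S"
    proof (elim exE conjE)
      fix w assume w: "\<forall>i. w i \<in> K" "column_relation R w" "form_support w \<noteq> {}" "form_support w \<subset> S"
      have "($) (\<chi> i. w i) = w" by (simp add: fun_eq_iff)
      then show ?thesis using w
        by (intro bexI[of _ "\<chi> i. w i"]) (simp_all add: vanishing_forms_iff nz support_eq)
    qed
  qed
  have iff: "v \<in> circuit_vectors K (row_space K A c) \<longleftrightarrow>
      (\<forall>i. v $ i \<in> K) \<and> column_relation R (($) v) \<and> matroid_circuit (column_indep R) (form_support (($) v))" for v
  proof (cases "(\<forall>i. v $ i \<in> K) \<and> column_relation R (($) v)")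
    case True
    then have "matroid_circuit (column_indep R) (form_support (($) v)) \<longleftrightarrow>
        v \<noteq> 0 \<and> \<not> (\<exists>w\<in>?V. w \<noteq> 0 \<and> support w \<subset> support v)"
      unfolding ex by (subst RK.circuit_iff_minimal_support) (simp_all add: nz support_eq)
    then show ?thesis using True by (simp add: circuit_vectors_def vanishing_forms_iff)
  next
    case False
    then have "v \<notin> ?V" by (simp only: vanishing_forms_iff not_False_eq_True)
    then have "v \<notin> circuit_vectors K (row_space K A c)" by (simp add: circuit_vectors_def)
    with False show ?thesis by blast
  qed
  show ?thesis
  proof
    show "circuit_polynomial ` circuit_vectors K (row_space K A c) \<subseteq> cpolys K R"
    proof (rule image_subsetI)
      fix v assume "v \<in> circuit_vectors K (row_space K A c)"
      then show "circuit_polynomial v \<in> cpolys K R"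
        unfolding cpolys_def cp iff by (intro CollectI exI[of _ "($) v"] conjI) simp_all
    qed
    show "cpolys K R \<subseteq> circuit_polynomial ` circuit_vectors K (row_space K A c)"
    proof
      fix p assume "p \<in> cpolys K R"
      then obtain v where v: "p = cpoly v" "\<forall>i. v i \<in> K" "column_relation R v"
        "matroid_circuit (column_indep R) (form_support v)"
        unfolding cpolys_def by (elim CollectE exE conjE) (rule that)
      have "($) (\<chi> i. v i) = v" by (simp add: fun_eq_iff)
      then show "p \<in> circuit_polynomial ` circuit_vectors K (row_space K A c)"
        using v by (intro image_eqI[of _ _ "\<chi> i. v i"]) (simp_all add: cp iff)
    qed
  qed
qed

lemma central_generators_eq:
  assumes "arrangement k R"
  shows "central_generators A b c = central_gens K Am cm bm"
proof -
  have "constraint_polynomial A b = (\<lambda>j. linear_form (Am j) - Const (bm j))"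
    by (rule ext) (simp add: constraint_polynomial_def linear_form_def)
  then show ?thesis
    by (simp add: central_generators_def central_gens_def Let_def circuit_polynomials_eq[OF assms])
qed

lemma real_branch: obtains x y where "central_branch k K Am cm bm x y"
proof -
  have "field_embedding (\<lambda>t :: real. t)" by unfold_locales auto
  then show thesis by (rule embedded_branch) (simp add: that)
qed

lemma path_solves: "x \<in> primal_central_path A b c \<Longrightarrow> (\<Sum>i\<in>UNIV. A $ l $ i * x $ i) = b $ l"
  by (auto simp: primal_central_path_def central_point_def strictly_primal_feasible_def matrix_vector_mult_def)

lemma path_reciprocal:
  "x \<in> primal_central_path A b c \<Longrightarrow> \<exists>s\<in>row_span R. \<forall>i. x $ i * s i = 1"
  unfolding primal_central_path_def using central_point_in_reciprocal by blast

lemma path_infinite: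
  assumes "strictly_primal_feasible A b \<noteq> {}" "strictly_dual_feasible A c \<noteq> {}"
  shows "infinite ((\<lambda>x. \<Sum>i\<in>UNIV. c $ i * x $ i) ` primal_central_path A b c)"
proof -
  obtain v where "A *v v = 0" "c \<bullet> v \<noteq> 0" by (rule kernel_vector)
  from infinite_central_path_values[OF assms this] show ?thesis by (simp add: inner_vec_def)
qed

lemma central_ideal_branch:
  assumes "strictly_primal_feasible A b \<noteq> {}" "strictly_dual_feasible A c \<noteq> {}"
    and "central_branch k K Am cm bm x y"
  shows "central_ideal A b c = {p \<in> mpoly_carrier K. central_branch.psi x p = 0}"
proof -
  interpret br: central_branch k K Am cm bm x y by fact
  have "(\<forall>z\<in>(($) ` primal_central_path A b c). meval (\<lambda>t. t) p z = 0) \<longleftrightarrow> br.psi p = 0" for p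
    by (rule br.vanishes_on_path_iff)
      (use path_solves path_reciprocal path_infinite[OF assms(1,2)] in \<open>auto simp: image_image\<close>)
  then show ?thesis unfolding central_ideal_def mpoly_eval_eq_meval by auto
qed

text \<open>The degree comes from the branch over the complex numbers; its matroid is identified
  with that of the real matrix because independence does not change under the embedding.\<close>

lemma primal_central_curve_degree:
  assumes "strictly_primal_feasible A b \<noteq> {}" "strictly_dual_feasible A c \<noteq> {}"
  shows "affine_degree (primal_central_curve A b c) = of_nat (lp_moebius A b c)"
    and "lp_moebius A b c \<le> ((CARD('n) - 1) choose CARD('d))"
proof -
  let ?h = complex_of_real
  let ?Ac = "\<lambda>j i. ?h (A $ j $ i)" and ?cc = "\<lambda>i. ?h (c $ i)" and ?bc = "\<lambda>j. ?h (b $ j)"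
  let ?P = "(\<lambda>x. \<chi> i. ?h (x $ i)) ` primal_central_path A b c"
  obtain x y where real: "central_branch k K Am cm bm x y" by (rule real_branch)
  then have arr: "arrangement k R" by (rule central_branch.axioms)
  interpret h: field_embedding ?h by unfold_locales auto
  obtain x y where cplx: "central_branch (?h ` k) (?h ` K) ?Ac ?cc ?bc x y"
    by (rule embedded_branch[OF h.field_embedding_axioms])
  interpret br: central_branch "?h ` k" "?h ` K" ?Ac ?cc ?bc x y by (rule cplx)
  have rows: "all_rows ?Ac ?cc = (\<lambda>l i. ?h (R l i))" by (rule all_rows_image)
  have "(\<forall>z\<in>(($) ` ?P). meval (\<lambda>t. t) p z = 0) \<longleftrightarrow> br.psi p = 0" for p
  proof (rule br.vanishes_on_path_iff)
    show "(\<Sum>i\<in>UNIV. ?Ac l i * z i) = ?bc l" if z: "z \<in> ($) ` ?P" for z l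
    proof -
      obtain w where w: "w \<in> primal_central_path A b c" "z = (\<lambda>i. ?h (w $ i))"
        using z by (elim imageE) (rule that, assumption, simp add: fun_eq_iff)
      show ?thesis unfolding w(2) using path_solves[OF w(1), of l, symmetric] by simp
    qed
    show "\<exists>s\<in>row_span (all_rows ?Ac ?cc). \<forall>i. z i * s i = 1" if z: "z \<in> ($) ` ?P" for z
    proof -
      obtain w where w: "w \<in> primal_central_path A b c" "z = (\<lambda>i. ?h (w $ i))"
        using z by (elim imageE) (rule that, assumption, simp add: fun_eq_iff)
      from path_reciprocal[OF w(1)] obtain s where s: "s \<in> row_span R" "\<And>i. w $ i * s i = 1" by blast
      from s(1) obtain u where u: "s = (\<lambda>i. \<Sum>l\<in>UNIV. u l * R l i)" unfolding row_span_def by blast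
      have "(\<lambda>i. ?h (s i)) \<in> row_span (all_rows ?Ac ?cc)"
        unfolding row_span_def
      proof (intro CollectI exI[of _ "\<lambda>l. ?h (u l)"] ext)
        show "?h (s i) = (\<Sum>l\<in>UNIV. ?h (u l) * all_rows ?Ac ?cc l i)" for i
          unfolding rows u by simp
      qed
      moreover have "z i * ?h (s i) = 1" for i
        unfolding w(2) by (simp add: s(2) flip: of_real_mult)
      ultimately show ?thesis by (intro bexI[of _ "\<lambda>i. ?h (s i)"] allI)
    qed
    have "(\<lambda>z. \<Sum>i\<in>UNIV. ?cc i * z i) ` ($) ` ?P =
        ?h ` ((\<lambda>x. \<Sum>i\<in>UNIV. c $ i * x $ i) ` primal_central_path A b c)"
      by (simp add: image_image)
    moreover have "infinite \<dots>"
      using path_infinite[OF assms] finite_imageD[OF _ inj_on_subset[OF h.inj_hom subset_UNIV]] by blast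
    ultimately show "infinite ((\<lambda>z. \<Sum>i\<in>UNIV. ?cc i * z i) ` ($) ` ?P)" by simp
  qed
  then have van: "(\<forall>z\<in>?P. mpoly_eval p (($) z) = 0) \<longleftrightarrow> meval fps_const p x = 0" for p
    unfolding br.psi_def mpoly_eval_eq_meval by blast
  have ind: "column_indep (all_rows ?Ac ?cc) = column_indep R"
    unfolding rows by (rule h.column_indep_image[OF arr])
  \<comment> \<open>Positivity provides a face with \<open>d + 1\<close> elements, so that
    \<open>mu\<close> is the Moebius number.\<close>
  have "br.mu > 0" by (rule br.hilbert_function_eventually_linear)
  then have "{S \<in> br.arr.Br. card S = CARD('d option)} \<noteq> {}" unfolding br.mu_def card_gt_0_iff by (rule conjunct1)
  then have "br.mu = moebius_number (column_indep (all_rows ?Ac ?cc))"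
    unfolding br.mu_def by (rule br.arr.moebius_number_eq[symmetric])
  then have mu: "br.mu = lp_moebius A b c"
    by (simp add: lp_moebius_def Let_def coord_indep_eq[OF arr] ind)
  show "affine_degree (primal_central_curve A b c) = of_nat (lp_moebius A b c)"
    unfolding primal_central_curve_def mu[symmetric] by (rule affine_degree_branch[OF cplx van])
  show "lp_moebius A b c \<le> ((CARD('n) - 1) choose CARD('d))"
    unfolding mu[symmetric] br.mu_def using br.arr.moebius_number_le_binomial by (simp add: card_option)
qed

end

theorem theorem13:
  fixes A :: "real^'n::{finite,linorder}^'d::finite"
    and b :: "real^'d"
    and c :: "real^'n::{finite,linorder}"
  assumes "CARD('d) < CARD('n)"
    and "rank A = CARD('d)"
    and "lp_generic A b c"
    and "lp_bounded A b c"
    and "strictly_primal_feasible A b \<noteq> {}"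
    and "strictly_dual_feasible A c \<noteq> {}"
  shows "affine_degree (primal_central_curve A b c) = of_nat (lp_moebius A b c) \<and>
    affine_degree (primal_central_curve A b c) \<le> of_nat ((CARD('n) - 1) choose CARD('d)) \<and>
    primeideal (central_ideal A b c) (mpoly_ring (lp_field A b c)) \<and>
    central_ideal A b c = genideal (mpoly_ring (lp_field A b c)) (central_generators A b c)"
proof -
  interpret generic_lp A b c by unfold_locales (rule assms)+
  obtain x y where br: "central_branch k K Am cm bm x y" by (rule real_branch)
  interpret br: central_branch k K Am cm bm x y by (rule br)
  have arr: "arrangement k R" by (rule br.arr.arrangement_axioms)
  note deg = primal_central_curve_degree[OF assms(5,6)]
  have "primeideal (central_ideal A b c) (mpoly_ring K)"
    unfolding central_ideal_branch[OF assms(5,6) br] by (rule br.primeideal_branch_ideal)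
  moreover have "central_ideal A b c = genideal (mpoly_ring K) (central_generators A b c)"
    unfolding central_ideal_branch[OF assms(5,6) br] central_generators_eq[OF arr]
    by (rule br.genideal_branch_ideal[symmetric])
  ultimately show ?thesis using deg by simp
qed

end
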